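(* Let $1\le p\le\infty$ and $r\in\mathbb{N}^d$. Then there is a constant $C$ depending on $r,p,d$ only such that for every $d$-parallelepiped $Q=[a_1,b_1]\times\cdots\times[a_d,b_d]$ and any $f\in L_p(Q)$ the inequalities $$\Big(\sum_{e \subset [d]}\prod_{i \in e} 2^{r_i}\Big)^{-1}\Omega_r(f,t)_{p,Q} \ \le \ K_r(f,t^r)_{p,Q} \ \le \ C\,\Omega_r(f,t)_{p,Q},\qquad t\in\mathbb{R}_+^d,$$ hold true.
   Context: $\mathbb{N}$ denotes the positive integers, $\mathbb{Z}_+$ and $\mathbb{R}_+$ the non-negative integers and non-negative reals, and $[d]=\{1,\dots,d\}$. $Q = [a_1,b_1]\times\cdots\times[a_d,b_d]\subset\mathbb{R}^d$ with $a_i<b_i$. $L_p(Q)$ is the usual space of Lebesgue measurable functions on $Q$ with norm $\|\cdot\|_{p,Q}$ (the ess sup norm if $p=\infty$); more generally $\|\cdot\|_{p,D}$ is the $L_p$ norm over a measurable set $D$. For $x\in\mathbb{R}^d$ and $r\in\mathbb{Z}_+^d$, $x^r := (x_1^{r_1},\dots,x_d^{r_d})$ (a vector). Sums over $e\subset[d]$ include $e=\emptyset$ unless excluded, and empty products equal $1$. For $m\in\mathbb{Z}_+$, $h\in\mathbb{R}$ and a univariate function $f$, $\Delta_h^m(f,x) := \sum_{j=0}^m(-1)^{m-j}\binom{m}{j}f(x+jh)$ (with $\Delta_h^0 f=f$). For $r\in\mathbb{Z}_+^d$ and $h\in\mathbb{R}^d$, the mixed difference operator is $\Delta_h^r :=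 \prod_{i=1}^d\Delta_{h_i,i}^{r_i}$, where $\Delta_{h_i,i}^{r_i}$ is the univariate operator $\Delta_{h_i}^{r_i}$ applied to $f$ as a function of $x_i$ with the other variables fixed. For $y,h\in\mathbb{R}^d$ put $yh:=(y_1h_1,\dots,y_dh_d)$ and $Q_y := \{x\in Q : x_i,\ x_i+y_i\in[a_i,b_i],\ i\in[d]\}$. The mixed $r$th modulus of smoothness is $$\omega_r(f,t)_{p,Q} := \sup_{|h_i|\le t_i,\ i\in[d]}\|\Delta_h^r(f)\|_{p,Q_{rh}},\qquad t\in\mathbb{R}_+^d.$$ For $r\in\mathbb{Z}_+^d$ and $e\subset[d]$, $r(e)\in\mathbb{Z}_+^d$ is the vector with $r(e)_i=r_i$ for $i\in e$ and $r(e)_i=0$ for $i\notin e$. The total mixed modulus of smoothness of order $r$ is $$\Omega_r(f,t)_{p,Q} := \sum_{e\subset[d],\ e\ne\emptyset}\omega_{r(e)}(f,t)_{p,Q},\qquad t\in\mathbb{R}_+^d.$$ For $k\in\mathbb{Z}_+^d$, $f^{(k)} = \partial^{k_1+\cdots+k_d}f/\partial x_1^{k_1}\cdots\partial x_d^{k_d}$ is the mixed weak derivative ($f^{(0)}=f$). For $r\in\mathbb{N}^d$, the Sobolev type space $W^r_p(Q)$ of mixed smoothness $r$ is the set of $f\in L_p(Q)$ for which $\|f\|_{W^r_p(Q)} := \sum_{e\subset[d]}\|f^{(r(e))}\|_{p,Q}$ is finite. The mixed K-functional is, for $f\in L_p(Q)$ and $t\in\mathbb{R}_+^d$, $$K_r(f,t)_{p,Q}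 := \inf_{g\in W^r_p(Q)}\Big\{\|f-g\|_{p,Q} + \sum_{e\subset[d],\ e\ne\emptyset}\Big(\prod_{i\in e}t_i\Big)\|g^{(r(e))}\|_{p,Q}\Big\}.$$
   Formalization: For p = ∞ the upper inequality is stated only when all t_i > 0; with some t_i = 0 it is false (d = r = 1, Q = [0,1], f the indicator of [1/2,1], t = 0 gives Ω = 0 but K = 1/2). The lower inequality is kept for all p and t. *)

theory Defs
  imports "HOL-Analysis.Analysis" "HOL-Probability.Essential_Supremum"
begin

text \<open>
  The dimension \<open>d\<close> is \<open>CARD('d)\<close>; the index set \<open>[d]\<close> is the finite type \<open>'d\<close>, so that
  subsets \<open>e\<close> of \<open>[d]\<close> are the elements of \<open>'d set\<close>.  Functions on \<open>Q\<close> are represented by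
  functions on the whole space whose values off \<open>Q\<close> are never used, and elements of
  \<open>L_p\<close> by representatives.  Norms take values in \<open>ennreal\<close>.
\<close>

definition Lp_norm :: "ennreal \<Rightarrow> (real^'d) set \<Rightarrow> (real^'d \<Rightarrow> real) \<Rightarrow> ennreal" where
  "Lp_norm p D f =
    (if p = \<infinity> then esssup (lebesgue_on D) (\<lambda>x. ennreal \<bar>f x\<bar>)
     else let I = (\<integral>\<^sup>+x. ennreal (\<bar>f x\<bar> powr enn2real p) \<partial>lebesgue_on D)
          in if I = \<infinity> then \<infinity> else ennreal (enn2real I powr (1 / enn2real p)))"

definition Lp_space :: "ennreal \<Rightarrow> (real^'d) set \<Rightarrow> (real^'d \<Rightarrow> real) set" where
  "Lp_space p D = {f \<in> borel_measurable (lebesgue_on D). Lp_norm p D f < \<infinity>}"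

definition fdiff :: "nat \<Rightarrow> real \<Rightarrow> (real \<Rightarrow> real) \<Rightarrow> real \<Rightarrow> real" where
  "fdiff m h f x = (\<Sum>j\<le>m. (-1) ^ (m - j) * real (m choose j) * f (x + real j * h))"

definition set_coord :: "'d \<Rightarrow> real \<Rightarrow> real^'d \<Rightarrow> real^'d" where
  "set_coord i s x = (\<chi> j. if j = i then s else x $ j)"

definition coord_diff :: "'d \<Rightarrow> nat \<Rightarrow> real \<Rightarrow> (real^'d \<Rightarrow> real) \<Rightarrow> (real^'d \<Rightarrow> real)" where
  "coord_diff i m h f = (\<lambda>x. fdiff m h (\<lambda>s. f (set_coord i s x)) (x $ i))"

text \<open>
  The product over \<open>i\<close> is the composition of the coordinate operators; their order is
  irrelevant, as the lemma \<open>coord_diff_comp_fun_commute\<close> below shows.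
\<close>

definition mixed_diff :: "nat^'d \<Rightarrow> real^'d \<Rightarrow> (real^'d \<Rightarrow> real) \<Rightarrow> (real^'d \<Rightarrow> real)" where
  "mixed_diff r h f = Finite_Set.fold (\<lambda>i. coord_diff i (r $ i) (h $ i)) f UNIV"

lemma coord_diff_commute:
  assumes "i \<noteq> j"
  shows "coord_diff i m h (coord_diff j n k f) = coord_diff j n k (coord_diff i m h f)"
proof
  fix x :: "real^'a"
  have upd: "set_coord j s (set_coord i u x) = set_coord i u (set_coord j s x)" for s u
    using assms by (auto simp: set_coord_def vec_eq_iff)
  have nth: "set_coord i u x $ j = x $ j" "set_coord j u x $ i = x $ i" for u
    using assms by (auto simp: set_coord_def)
  show "coord_diff i m h (coord_diff j n k f) x = coord_diff j n k (coord_diff i m h f) x"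
    unfolding coord_diff_def fdiff_def nth upd sum_distrib_left
    by (subst sum.swap) (simp add: mult_ac)
qed

lemma coord_diff_comp_fun_commute:
  "comp_fun_commute (\<lambda>i. coord_diff i (r $ i) (h $ i))"
proof
  fix i j :: 'a
  show "coord_diff j (r $ j) (h $ j) \<circ> coord_diff i (r $ i) (h $ i) =
        coord_diff i (r $ i) (h $ i) \<circ> coord_diff j (r $ j) (h $ j)"
    by (cases "i = j") (auto simp: fun_eq_iff coord_diff_commute)
qed

definition shift_domain :: "(real^'d) set \<Rightarrow> real^'d \<Rightarrow> (real^'d) set" where
  "shift_domain Q y = {x \<in> Q. x + y \<in> Q}"

definition mixed_modulus ::
    "nat^'d \<Rightarrow> ennreal \<Rightarrow> (real^'d) set \<Rightarrow> (real^'d \<Rightarrow> real) \<Rightarrow> real^'d \<Rightarrow> ennreal" where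
  "mixed_modulus r p Q f t =
    (SUP h \<in> {h. \<forall>i. \<bar>h $ i\<bar> \<le> t $ i}.
       Lp_norm p (shift_domain Q (\<chi> i. real (r $ i) * h $ i)) (mixed_diff r h f))"

text \<open>The vector \<open>r(e)\<close>.\<close>

definition restrict_index :: "nat^'d \<Rightarrow> 'd set \<Rightarrow> nat^'d" where
  "restrict_index r e = (\<chi> i. if i \<in> e then r $ i else 0)"

definition total_modulus ::
    "nat^'d \<Rightarrow> ennreal \<Rightarrow> (real^'d) set \<Rightarrow> (real^'d \<Rightarrow> real) \<Rightarrow> real^'d \<Rightarrow> ennreal" where
  "total_modulus r p Q f t =
    (\<Sum>e \<in> {e. e \<noteq> {}}. mixed_modulus (restrict_index r e) p Q f t)"

definition partial :: "'d \<Rightarrow> (real^'d \<Rightarrow> real) \<Rightarrow> (real^'d \<Rightarrow> real)" where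
  "partial i \<phi> = (\<lambda>x. deriv (\<lambda>s. \<phi> (x + s *\<^sub>R axis i 1)) 0)"

definition iter_partial :: "'d list \<Rightarrow> (real^'d \<Rightarrow> real) \<Rightarrow> (real^'d \<Rightarrow> real)" where
  "iter_partial is \<phi> = foldr partial is \<phi>"

definition test_function :: "(real^'d) set \<Rightarrow> (real^'d \<Rightarrow> real) \<Rightarrow> bool" where
  "test_function U \<phi> \<longleftrightarrow>
    (\<forall>is. iter_partial is \<phi> differentiable_on UNIV) \<and>
    (\<exists>K. compact K \<and> K \<subseteq> U \<and> (\<forall>x. x \<notin> K \<longrightarrow> \<phi> x = 0))"

definition locally_integrable :: "(real^'d) set \<Rightarrow> (real^'d \<Rightarrow> real) \<Rightarrow> bool" where
  "locally_integrable U f \<longleftrightarrow>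
    (\<forall>K. compact K \<and> K \<subseteq> U \<longrightarrow> set_integrable lebesgue K f)"

text \<open>
  A mixed derivative of order \<open>k\<close> is taken along a list in which each \<open>i\<close> occurs \<open>k $ i\<close>
  times.  For smooth functions all such lists give the same result, so quantifying over
  them all imposes nothing more than a fixed choice would.
\<close>

definition has_weak_deriv ::
    "(real^'d) set \<Rightarrow> nat^'d \<Rightarrow> (real^'d \<Rightarrow> real) \<Rightarrow> (real^'d \<Rightarrow> real) \<Rightarrow> bool" where
  "has_weak_deriv U k f g \<longleftrightarrow>
    locally_integrable U f \<and> locally_integrable U g \<and>
    (\<forall>\<phi> is. test_function U \<phi> \<longrightarrow> (\<forall>i. count_list is i = k $ i) \<longrightarrow>
      (LINT x:U|lebesgue. f x * iter_partial is \<phi> x) =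
      (-1) ^ (\<Sum>i\<in>UNIV. k $ i) * (LINT x:U|lebesgue. g x * \<phi> x))"

text \<open>
  A representative of the weak derivative, which is unique up to null sets.  For
  \<open>U = interior Q\<close>, its values on the boundary of \<open>Q\<close> are arbitrary, but this boundary is a
  null set when \<open>Q\<close> is a box.
\<close>

definition weak_deriv ::
    "(real^'d) set \<Rightarrow> nat^'d \<Rightarrow> (real^'d \<Rightarrow> real) \<Rightarrow> (real^'d \<Rightarrow> real)" where
  "weak_deriv U k f = (SOME g. has_weak_deriv U k f g)"

definition Sobolev_norm ::
    "nat^'d \<Rightarrow> ennreal \<Rightarrow> (real^'d) set \<Rightarrow> (real^'d \<Rightarrow> real) \<Rightarrow> ennreal" where
  "Sobolev_norm r p Q f =
    (\<Sum>e\<in>UNIV. Lp_norm p Q (weak_deriv (interior Q) (restrict_index r e) f))"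

definition Sobolev_space ::
    "nat^'d \<Rightarrow> ennreal \<Rightarrow> (real^'d) set \<Rightarrow> (real^'d \<Rightarrow> real) set" where
  "Sobolev_space r p Q =
    {f \<in> Lp_space p Q.
      (\<forall>e. \<exists>g. has_weak_deriv (interior Q) (restrict_index r e) f g) \<and>
      Sobolev_norm r p Q f < \<infinity>}"

definition K_functional ::
    "nat^'d \<Rightarrow> ennreal \<Rightarrow> (real^'d) set \<Rightarrow> (real^'d \<Rightarrow> real) \<Rightarrow> real^'d \<Rightarrow> ennreal" where
  "K_functional r p Q f t =
    (INF g \<in> Sobolev_space r p Q.
       Lp_norm p Q (\<lambda>x. f x - g x) +
       (\<Sum>e \<in> {e. e \<noteq> {}}. ennreal (\<Prod>i\<in>e. t $ i) *
          Lp_norm p Q (weak_deriv (interior Q) (restrict_index r e) g)))"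

text \<open>The vector \<open>t\<^sup>r\<close>.\<close>

definition vec_pow :: "real^'d \<Rightarrow> nat^'d \<Rightarrow> real^'d" where
  "vec_pow t r = (\<chi> i. t $ i ^ r $ i)"

end

theory Submission
  imports Defs "HOL-Probability.Probability"
begin

text \<open>
  Both estimates rest on one fact about averages: if
  \<open>G\<close> is dominated pointwise by an average of functions of norm at most \<open>m\<close> over a probability
  space, then \<open>G\<close> has norm at most \<open>m\<close> (\<open>Lp_bounded_average\<close>).  Norms over \<open>Q\<close> and over the domains
  of the differences become norms over the whole space of Borel functions multiplied by indicators.

  For the lower estimate, let \<open>g\<close> be a competitor in the K-functional and \<open>e\<close> a set of coordinates.  The
  difference of order \<open>r(e)\<close> of \<open>f - g\<close> has norm at most \<open>\<Prod>i\<in>e. 2 ^ r\<^sub>i\<close> times that of \<open>f - g\<close>.  The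
  difference of \<open>g\<close> equals \<open>\<Prod>i\<in>e. h\<^sub>i ^ r\<^sub>i\<close> times an average of translates of its weak derivative
  (\<open>mixed_diff_eq_average_of_weak_deriv\<close>): for test functions this is the fundamental theorem of
  calculus applied once per derivative, and it is carried over to \<open>g\<close> by duality.  Summation over
  \<open>e\<close> gives \<open>total_modulus_le_K_functional\<close>.

  For the upper estimate with positive \<open>t\<close>, a competitor is built from products of univariate kernels,
  \<open>g(x) = c \<integral> F(y) \<Prod>i. k\<^sub>i(x\<^sub>i, y\<^sub>i) dy\<close>.  The model is the Steklov mean
  \<open>\<integral> W(x, h) \<Sum>j. \<plusminus> (r choose j) F(x + j h) dh\<close>, where the weight \<open>W(x, \<cdot>)\<close> lives on steps of size at
  most \<open>\<delta> \<le> t\<close> that point into \<open>Q\<close>, so that no extension of \<open>f\<close> beyond \<open>Q\<close> is needed.  Its error is an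
  average of differences of \<open>F\<close> (\<open>Lp_bounded_steklov_error\<close>).  Because \<open>w\<close> is an iterated moving average,
  its \<open>r\<close>-th derivative is an \<open>r\<close>-th difference of a bounded function; summation by parts moves this
  difference onto \<open>F\<close>, and so \<open>t ^ r\<close> times the derivative is controlled by the modulus of smoothness
  (\<open>Lp_bounded_difference_kernel\<close>).  The step \<open>\<delta>\<close> cannot exceed a fixed fraction of the side length of
  \<open>Q\<close>.  In coordinates where \<open>t\<^sub>i\<close> is larger, the kernel is replaced by its Taylor polynomial of degree
  less than \<open>r\<^sub>i\<close> in \<open>x\<^sub>i\<close>: its \<open>r\<^sub>i\<close>-th derivative vanishes, so that the size of \<open>t\<^sub>i\<close> does no harm, and the
  Taylor remainder is again an \<open>r\<^sub>i\<close>-th difference.  Expanding the product of the kernels over subsets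
  \<open>e\<close> of the coordinates bounds every term by the modulus of order \<open>r(e)\<close>
  (\<open>K_functional_le_smoothing\<close>).

  For \<open>p < \<infinity>\<close>, zero entries of \<open>t\<close> are replaced by a small \<open>\<epsilon>\<close>.  This does not decrease the
  K-functional, and by the continuity of translation in \<open>L\<^sub>p\<close> it changes the total modulus arbitrarily
  little (\<open>total_modulus_perturb\<close>).
\<close>

section \<open>Bounds for averages in the L_p norm\<close>

text \<open>
  For \<open>m \<ge> 0\<close> this says that the \<open>L\<^sub>p\<close> norm of \<open>u\<close> over the whole space is at most \<open>m\<close>.  Comparing
  the integral of the \<open>p\<close>-th power with \<open>m\<^sup>p\<close> avoids roots and infinite values, so that Tonelli
  and Jensen apply directly.
\<close>

definition Lp_bounded :: "ennreal \<Rightarrow> real \<Rightarrow> ('a::euclidean_space \<Rightarrow> real) \<Rightarrow> bool" where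
  "Lp_bounded p m u \<longleftrightarrow>
    (if p = \<infinity> then AE x in lborel. \<bar>u x\<bar> \<le> m
     else (\<integral>\<^sup>+x. ennreal (\<bar>u x\<bar> powr enn2real p) \<partial>lborel) \<le> ennreal (m powr enn2real p))"

lemma enn2real_ge_1:
  assumes "1 \<le> p" "p \<noteq> \<infinity>" shows "1 \<le> enn2real p"
  using enn2real_mono[of 1 p] assms by (auto simp: less_top)

lemma borel_measurable_lebesgue_AE_eq:
  fixes f u :: "'a::euclidean_space \<Rightarrow> real"
  assumes u: "u \<in> borel_measurable borel" and ae: "AE x in lborel. f x = u x"
  shows "f \<in> borel_measurable lebesgue"
proof (rule measurableI)
  fix A :: "real set" assume A: "A \<in> sets borel"
  have A1: "u -` A \<inter> space lebesgue \<in> sets lebesgue"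
    using A u by (intro measurable_sets[OF measurable_completion]) auto
  have A2: "AE x in lebesgue. x \<in> u -` A \<inter> space lebesgue \<longleftrightarrow> x \<in> f -` A \<inter> space lebesgue"
    using ae by (simp add: AE_completion_iff) (auto elim!: eventually_mono)
  show "f -` A \<inter> space lebesgue \<in> sets lebesgue"
    by (rule completion.in_sets_AE[OF A2 A1]) auto
qed auto

text \<open>
  The Borel function \<open>u\<close>, extended by zero, replaces the Lebesgue measurable \<open>f\<close> on \<open>D\<close>: on
  product spaces only Borel measurability is convenient.
\<close>

lemma Lp_norm_le_iff:
  fixes f u :: "real^'d \<Rightarrow> real"
  assumes p: "1 \<le> p" and D: "D \<in> sets borel" and u: "u \<in> borel_measurable borel"
    and ae: "AE x in lborel. u x = indicator D x * f x" and m: "0 \<le> m"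
  shows "Lp_norm p D f \<le> ennreal m \<longleftrightarrow> Lp_bounded p m u"
proof (cases "p = \<infinity>")
  case True
  have Dl: "D \<inter> space lebesgue \<in> sets lebesgue" using D by auto
  have "(\<lambda>x. indicator D x * f x) \<in> borel_measurable lebesgue"
    by (rule borel_measurable_lebesgue_AE_eq[OF u]) (use ae in \<open>auto elim!: eventually_mono\<close>)
  also have "(\<lambda>x. indicator D x * f x) = (\<lambda>x. if x \<in> D then f x else 0)"
    by (auto simp: fun_eq_iff)
  finally have f: "f \<in> borel_measurable (lebesgue_on D)"
    using D by (subst (asm) borel_measurable_if) auto
  have "(\<lambda>x. ennreal \<bar>f x\<bar>) \<in> borel_measurable (lebesgue_on D)" using f by measurable
  note esm = this
  have "Lp_norm p D f \<le> ennreal m \<longleftrightarrow> (AE x in lebesgue_on D. ennreal \<bar>f x\<bar> \<le> ennreal m)"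
    unfolding Lp_norm_def using True
    using esssup_AE[of "\<lambda>x. ennreal \<bar>f x\<bar>" "lebesgue_on D"]
    by (auto intro: esssup_I[OF esm] elim!: eventually_mono dest: order_trans)
  also have "\<dots> \<longleftrightarrow> (AE x in lborel. x \<in> D \<longrightarrow> \<bar>f x\<bar> \<le> m)"
    using D m by (subst AE_restrict_space_iff) (auto simp: AE_completion_iff ennreal_le_iff)
  also have "\<dots> \<longleftrightarrow> (AE x in lborel. \<bar>u x\<bar> \<le> m)"
  proof (rule eventually_subst)
    show "\<forall>\<^sub>F x in ae_filter lborel. (x \<in> D \<longrightarrow> \<bar>f x\<bar> \<le> m) = (\<bar>u x\<bar> \<le> m)"
      using ae by eventually_elim (use m in \<open>simp add: indicator_def\<close>)
  qed
  also have "\<dots> \<longleftrightarrow> Lp_bounded p m u"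
    unfolding Lp_bounded_def using True by simp
  finally show ?thesis .
next
  case False
  define q where "q = enn2real p"
  have q: "1 \<le> q" using enn2real_ge_1[OF p False] by (simp add: q_def)
  define I where "I = (\<integral>\<^sup>+x. ennreal (\<bar>u x\<bar> powr q) \<partial>lborel)"
  have I: "(\<integral>\<^sup>+x. ennreal (\<bar>f x\<bar> powr q) \<partial>lebesgue_on D) = I"
  proof -
    have "(\<integral>\<^sup>+x. ennreal (\<bar>f x\<bar> powr q) \<partial>lebesgue_on D)
       = (\<integral>\<^sup>+x. ennreal (\<bar>f x\<bar> powr q) * indicator D x \<partial>lebesgue)"
      using D by (subst nn_integral_restrict_space) auto
    also have "\<dots> = I"
      unfolding nn_integral_completion I_def
      by (rule nn_integral_cong_AE) (use ae q in \<open>auto elim!: eventually_mono simp: indicator_def\<close>)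
    finally show ?thesis .
  qed
  have "Lp_norm p D f \<le> ennreal m \<longleftrightarrow> I \<noteq> \<infinity> \<and> ennreal (enn2real I powr (1/q)) \<le> ennreal m"
    unfolding Lp_norm_def using False q I by (auto simp: q_def Let_def top_unique)
  also have "\<dots> \<longleftrightarrow> I \<le> ennreal (m powr q)"
  proof (cases I)
    case (real i)
    have "i powr (1/q) \<le> m \<longleftrightarrow> i \<le> m powr q"
    proof
      assume "i powr (1/q) \<le> m"
      then have "(i powr (1/q)) powr q \<le> m powr q" using q by (intro powr_mono2) auto
      then show "i \<le> m powr q" using q real by (simp add: powr_powr)
    next
      assume "i \<le> m powr q"
      then have "i powr (1/q) \<le> (m powr q) powr (1/q)" using q real by (intro powr_mono2) auto
      then show "i powr (1/q) \<le> m" using q m by (simp add: powr_powr)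
    qed
    then show ?thesis using real m by (simp add: ennreal_le_iff)
  qed (simp add: top_unique)
  also have "\<dots> \<longleftrightarrow> Lp_bounded p m u"
    using False by (simp add: Lp_bounded_def I_def q_def)
  finally show ?thesis .
qed

lemma Lp_bounded_mono_AE:
  assumes "1 \<le> p" and "AE x in lborel. \<bar>u x\<bar> \<le> \<bar>v x\<bar>" and "Lp_bounded p m v"
  shows "Lp_bounded p m u"
proof (cases "p = \<infinity>")
  case True
  then show ?thesis using assms unfolding Lp_bounded_def by (auto elim!: AE_mp)
next
  case False
  have "(\<integral>\<^sup>+x. ennreal (\<bar>u x\<bar> powr enn2real p) \<partial>lborel) \<le> (\<integral>\<^sup>+x. ennreal (\<bar>v x\<bar> powr enn2real p) \<partial>lborel)"
    by (rule nn_integral_mono_AE, use assms(2) in eventually_elim)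
       (use enn2real_ge_1[OF assms(1) False] in \<open>auto intro!: ennreal_leI powr_mono2\<close>)
  then show ?thesis using False assms(3) by (auto simp: Lp_bounded_def)
qed

lemma Lp_bounded_le:
  assumes "1 \<le> p" "0 \<le> m" "m \<le> n" "Lp_bounded p m u"
  shows "Lp_bounded p n u"
proof (cases "p = \<infinity>")
  case True
  then show ?thesis using assms unfolding Lp_bounded_def by (auto elim!: eventually_mono)
next
  case False
  have "m powr enn2real p \<le> n powr enn2real p"
    using assms enn2real_ge_1[OF assms(1) False] by (intro powr_mono2) auto
  then show ?thesis using assms False unfolding Lp_bounded_def
    by (auto intro: order_trans ennreal_leI)
qed

lemma Lp_bounded_cmult:
  fixes u :: "'a::euclidean_space \<Rightarrow> real"
  assumes "1 \<le> p" "0 \<le> m" "Lp_bounded p m u" and [measurable]: "u \<in> borel_measurable borel"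
  shows "Lp_bounded p (\<bar>c\<bar> * m) (\<lambda>x. c * u x)"
proof (cases "p = \<infinity>")
  case True
  then show ?thesis using assms unfolding Lp_bounded_def
    by (auto elim!: eventually_mono simp: abs_mult mult_left_mono)
next
  case False
  have "(\<integral>\<^sup>+x. ennreal (\<bar>c * u x\<bar> powr enn2real p) \<partial>lborel)
     = ennreal (\<bar>c\<bar> powr enn2real p) * (\<integral>\<^sup>+x. ennreal (\<bar>u x\<bar> powr enn2real p) \<partial>lborel)"
    by (subst nn_integral_cmult[symmetric])
       (auto simp: abs_mult powr_mult ennreal_mult' intro!: nn_integral_cong)
  also have "\<dots> \<le> ennreal (\<bar>c\<bar> powr enn2real p) * ennreal (m powr enn2real p)"
    using False assms by (intro mult_left_mono) (auto simp: Lp_bounded_def)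
  also have "\<dots> = ennreal ((\<bar>c\<bar> * m) powr enn2real p)"
    using assms by (simp add: powr_mult ennreal_mult)
  finally show ?thesis using False by (simp add: Lp_bounded_def)
qed

lemma Lp_bounded_translate:
  fixes u :: "'a::euclidean_space \<Rightarrow> real"
  assumes "Lp_bounded p m u" and [measurable]: "u \<in> borel_measurable borel"
  shows "Lp_bounded p m (\<lambda>x. u (x + s))"
proof -
  have *: "distr lborel borel ((+) s) = (lborel :: 'a measure)" by (rule lborel_distr_plus)
  show ?thesis
  proof (cases "p = \<infinity>")
    case True
    then have "AE x in distr lborel borel ((+) s). \<bar>u x\<bar> \<le> m"
      using assms by (subst *) (simp add: Lp_bounded_def)
    then show ?thesis using True
      by (subst (asm) AE_distr_iff) (auto simp: Lp_bounded_def add.commute)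
  next
    case False
    have "(\<integral>\<^sup>+x. ennreal (\<bar>u x\<bar> powr enn2real p) \<partial>distr lborel borel ((+) s))
       = (\<integral>\<^sup>+x. ennreal (\<bar>u (s + x)\<bar> powr enn2real p) \<partial>lborel)"
      by (subst nn_integral_distr) auto
    then show ?thesis using False assms(1) unfolding * by (simp add: Lp_bounded_def add.commute)
  qed
qed

lemma convex_on_abs_powr:
  assumes "1 \<le> (q::real)"
  shows "convex_on UNIV (\<lambda>x::real. \<bar>x\<bar> powr q)"
proof (rule convex_onI)
  fix t x y :: real assume t: "0 < t" "t < 1"
  have conv: "convex_on {0<..} (\<lambda>x. x powr q)"
  proof (rule f''_ge0_imp_convex)
    show "((\<lambda>x. x powr q) has_real_derivative q * x powr (q - 1)) (at x)" if "x \<in> {0<..}" for x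
      using that by (auto intro!: derivative_eq_intros)
    show "((\<lambda>x. q * x powr (q - 1)) has_real_derivative q * ((q-1) * x powr (q - 1 - 1))) (at x)"
      if "x \<in> {0<..}" for x
      using that by (auto intro!: derivative_eq_intros)
    show "0 \<le> q * ((q-1) * x powr (q - 1 - 1))" for x using assms by auto
  qed auto
  have pos: "((1-t)*a + t*b) powr q \<le> (1-t) * a powr q + t * b powr q" if "a \<ge> 0" "b \<ge> 0" for a b
  proof (cases "a = 0 \<or> b = 0")
    case True
    have "t powr q \<le> t" "(1-t) powr q \<le> 1-t" using t assms powr_mono'[of 1 q t] powr_mono'[of 1 q "1-t"] by auto
    then show ?thesis using True that t assms
      by (auto simp: powr_mult intro!: mult_right_mono)
  next
    case False
    then show ?thesis using convex_onD[OF conv, of t a b] t that by auto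
  qed
  have "\<bar>(1-t)*x + t*y\<bar> \<le> (1-t)*\<bar>x\<bar> + t*\<bar>y\<bar>"
    using t by (intro order_trans[OF abs_triangle_ineq]) (auto simp: abs_mult)
  then have "\<bar>(1-t)*x + t*y\<bar> powr q \<le> ((1-t)*\<bar>x\<bar> + t*\<bar>y\<bar>) powr q"
    using assms by (intro powr_mono2) auto
  also have "\<dots> \<le> (1-t) * \<bar>x\<bar> powr q + t * \<bar>y\<bar> powr q" by (rule pos) auto
  finally show "\<bar>(1 - t) *\<^sub>R x + t *\<^sub>R y\<bar> powr q \<le> (1 - t) * \<bar>x\<bar> powr q + t * \<bar>y\<bar> powr q" by simp
qed auto

text \<open>
  Jensen's inequality for \<open>y \<mapsto> \<bar>y\<bar> powr q\<close>, in a form that remains meaningful when \<open>\<Phi>\<close> is not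
  integrable.
\<close>

lemma (in prob_space) powr_expectation_le:
  fixes \<Phi> :: "'a \<Rightarrow> real"
  assumes [measurable]: "\<Phi> \<in> borel_measurable M" and pos: "\<And>\<theta>. 0 \<le> \<Phi> \<theta>" and q: "1 \<le> q"
    and c: "0 \<le> c" "ennreal \<bar>y\<bar> \<le> ennreal c * (\<integral>\<^sup>+\<theta>. ennreal (\<Phi> \<theta>) \<partial>M)"
  shows "ennreal (\<bar>y\<bar> powr q) \<le> ennreal (c powr q) * (\<integral>\<^sup>+\<theta>. ennreal (\<Phi> \<theta> powr q) \<partial>M)"
proof (cases "integrable M (\<lambda>\<theta>. \<Phi> \<theta> powr q)")
  case False
  then have "(\<integral>\<^sup>+\<theta>. ennreal (\<Phi> \<theta> powr q) \<partial>M) = \<infinity>"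
    by (subst (asm) integrable_iff_bounded) (auto simp flip: less_top)
  then show ?thesis using c q by (cases "c = 0") (auto simp: ennreal_mult_top)
next
  case True
  have le: "x \<le> 1 + x powr q" if "0 \<le> x" for x :: real
  proof (cases "x \<le> 1")
    case False then have "x powr 1 \<le> x powr q" using q by (intro powr_mono) auto
    then show ?thesis using False by auto
  qed (auto intro: order_trans add_increasing2)
  have int: "integrable M \<Phi>"
    by (rule Bochner_Integration.integrable_bound[where f="\<lambda>\<theta>. 1 + \<Phi> \<theta> powr q"])
       (use True le pos in \<open>auto intro!: AE_I2 simp: abs_of_nonneg add_nonneg_nonneg\<close>)
  have "\<bar>expectation \<Phi>\<bar> powr q \<le> expectation (\<lambda>\<theta>. \<bar>\<Phi> \<theta>\<bar> powr q)"
    using True pos by (intro jensens_inequality[OF int, of UNIV, OF _ _ _ convex_on_abs_powr[OF q]]) auto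
  then have J: "expectation \<Phi> powr q \<le> expectation (\<lambda>\<theta>. \<Phi> \<theta> powr q)"
    using pos by (simp add: integral_nonneg_AE abs_of_nonneg)
  have e0: "0 \<le> expectation \<Phi>" using pos by simp
  have "(\<integral>\<^sup>+\<theta>. ennreal (\<Phi> \<theta>) \<partial>M) = ennreal (expectation \<Phi>)"
    by (rule nn_integral_eq_integral[OF int]) (use pos in auto)
  then have "ennreal \<bar>y\<bar> \<le> ennreal (c * expectation \<Phi>)"
    using c pos by (simp add: ennreal_mult'')
  then have "\<bar>y\<bar> \<le> c * expectation \<Phi>" using c e0 by (subst (asm) ennreal_le_iff) auto
  then have "\<bar>y\<bar> powr q \<le> (c * expectation \<Phi>) powr q" using q by (intro powr_mono2) auto
  also have "\<dots> = c powr q * expectation \<Phi> powr q" using c e0 by (simp add: powr_mult)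
  also have "\<dots> \<le> c powr q * expectation (\<lambda>\<theta>. \<Phi> \<theta> powr q)" using J by (intro mult_left_mono) auto
  finally have "ennreal (\<bar>y\<bar> powr q) \<le> ennreal (c powr q) * ennreal (expectation (\<lambda>\<theta>. \<Phi> \<theta> powr q))"
    by (simp add: ennreal_mult'' [symmetric] ennreal_leI)
  also have "ennreal (expectation (\<lambda>\<theta>. \<Phi> \<theta> powr q)) = (\<integral>\<^sup>+\<theta>. ennreal (\<Phi> \<theta> powr q) \<partial>M)"
    by (rule nn_integral_eq_integral[OF True, symmetric]) auto
  finally show ?thesis .
qed

text \<open>
  Minkowski's inequality for averages: for \<open>p < \<infinity>\<close> Jensen's inequality at each point followed by
  Tonelli, for \<open>p = \<infinity>\<close> an exchange of null sets.
\<close>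

lemma Lp_bounded_average:
  fixes G :: "'a::euclidean_space \<Rightarrow> real" and \<Phi> :: "'a \<Rightarrow> 'b \<Rightarrow> real"
  assumes p: "1 \<le> p" and \<mu>: "prob_space \<mu>"
    and [measurable]: "(\<lambda>(x, \<theta>). \<Phi> x \<theta>) \<in> borel_measurable (lborel \<Otimes>\<^sub>M \<mu>)"
    and pos: "\<And>x \<theta>. 0 \<le> \<Phi> x \<theta>" and c: "0 \<le> c" and m: "0 \<le> m"
    and G: "AE x in lborel. ennreal \<bar>G x\<bar> \<le> ennreal c * (\<integral>\<^sup>+\<theta>. ennreal (\<Phi> x \<theta>) \<partial>\<mu>)"
    and le: "AE \<theta> in \<mu>. Lp_bounded p m (\<lambda>x. \<Phi> x \<theta>)"
  shows "Lp_bounded p (c * m) G"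
proof -
  interpret \<mu>: prob_space \<mu> by fact
  interpret pair: pair_sigma_finite "lborel :: 'a measure" \<mu> ..
  show ?thesis
  proof (cases "p = \<infinity>")
    case True
    have "AE \<theta> in \<mu>. AE x in lborel. \<Phi> x \<theta> \<le> m"
      using le True pos by (simp add: Lp_bounded_def)
    then have "AE x in lborel. AE \<theta> in \<mu>. \<Phi> x \<theta> \<le> m"
      by (subst pair.AE_commute) measurable
    then have "AE x in lborel. \<bar>G x\<bar> \<le> c * m"
      using G
    proof eventually_elim
      case (elim x)
      have "(\<integral>\<^sup>+\<theta>. ennreal (\<Phi> x \<theta>) \<partial>\<mu>) \<le> (\<integral>\<^sup>+\<theta>. ennreal m \<partial>\<mu>)"
        by (rule nn_integral_mono_AE) (use elim(1) in \<open>auto elim!: eventually_mono intro: ennreal_leI\<close>)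
      also have "\<dots> = ennreal m" by (simp add: \<mu>.emeasure_space_1)
      finally have "ennreal \<bar>G x\<bar> \<le> ennreal c * ennreal m"
        using elim(2) by (meson mult_left_mono order_trans zero_le)
      then show ?case using c m by (simp add: ennreal_mult[symmetric] ennreal_le_iff)
    qed
    then show ?thesis using True by (simp add: Lp_bounded_def)
  next
    case False
    define q where "q = enn2real p"
    have q: "1 \<le> q" using enn2real_ge_1[OF p False] by (simp add: q_def)
    have "(\<integral>\<^sup>+x. ennreal (\<bar>G x\<bar> powr q) \<partial>lborel)
       \<le> (\<integral>\<^sup>+x. ennreal (c powr q) * (\<integral>\<^sup>+\<theta>. ennreal (\<Phi> x \<theta> powr q) \<partial>\<mu>) \<partial>lborel)"
    proof (rule nn_integral_mono_AE, use G in eventually_elim)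
      case (elim x)
      show ?case by (rule \<mu>.powr_expectation_le[OF _ pos q c elim]) measurable
    qed
    also have "\<dots> = ennreal (c powr q) * (\<integral>\<^sup>+x. (\<integral>\<^sup>+\<theta>. ennreal (\<Phi> x \<theta> powr q) \<partial>\<mu>) \<partial>lborel)"
      by (rule nn_integral_cmult) measurable
    also have "(\<integral>\<^sup>+x. (\<integral>\<^sup>+\<theta>. ennreal (\<Phi> x \<theta> powr q) \<partial>\<mu>) \<partial>lborel)
        = (\<integral>\<^sup>+\<theta>. (\<integral>\<^sup>+x. ennreal (\<Phi> x \<theta> powr q) \<partial>lborel) \<partial>\<mu>)"
      by (rule pair.Fubini'[symmetric]) measurable
    also have "\<dots> \<le> (\<integral>\<^sup>+\<theta>. ennreal (m powr q) \<partial>\<mu>)"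
      by (rule nn_integral_mono_AE, use le in eventually_elim) (use False pos in \<open>simp add: Lp_bounded_def q_def\<close>)
    also have "\<dots> = ennreal (m powr q)" by (simp add: \<mu>.emeasure_space_1)
    finally have "(\<integral>\<^sup>+x. ennreal (\<bar>G x\<bar> powr q) \<partial>lborel) \<le> ennreal (c powr q) * ennreal (m powr q)"
      by (simp add: mult_left_mono)
    then show ?thesis using False c m by (simp add: Lp_bounded_def q_def powr_mult ennreal_mult)
  qed
qed

text \<open>
  This removes the strict positivity of the bounds by which the next proof divides.
\<close>

lemma Lp_bounded_limit:
  assumes p: "1 \<le> p" and m: "0 \<le> m" and "\<And>\<epsilon>. 0 < \<epsilon> \<Longrightarrow> Lp_bounded p (m + \<epsilon>) u"
  shows "Lp_bounded p m u"
proof (cases "p = \<infinity>")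
  case True
  have "AE x in lborel. \<forall>n. \<bar>u x\<bar> \<le> m + 1 / real (Suc n)"
    using assms(3) True by (auto simp: AE_all_countable Lp_bounded_def)
  then have "AE x in lborel. \<bar>u x\<bar> \<le> m"
  proof eventually_elim
    case (elim x)
    show ?case
    proof (rule field_le_epsilon)
      fix e :: real assume "0 < e"
      then obtain n where "1 / real (Suc n) < e" by (metis nat_approx_posE)
      then show "\<bar>u x\<bar> \<le> m + e" using elim[rule_format, of n] by linarith
    qed
  qed
  then show ?thesis using True by (simp add: Lp_bounded_def)
next
  case False
  define q where "q = enn2real p"
  have q: "1 \<le> q" using enn2real_ge_1[OF p False] by (simp add: q_def)
  have "((\<lambda>\<epsilon>. ennreal ((m + \<epsilon>) powr q)) \<longlongrightarrow> ennreal ((m + 0) powr q)) (at_right 0)"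
    using q m by (intro tendsto_intros tendsto_ennrealI tendsto_powr' ) (auto simp: eventually_at_filter)
  moreover have "\<forall>\<^sub>F \<epsilon> in at_right 0. (\<integral>\<^sup>+x. ennreal (\<bar>u x\<bar> powr q) \<partial>lborel) \<le> ennreal ((m + \<epsilon>) powr q)"
    using assms(3) False by (auto simp: Lp_bounded_def q_def eventually_at_filter)
  ultimately have "(\<integral>\<^sup>+x. ennreal (\<bar>u x\<bar> powr q) \<partial>lborel) \<le> ennreal ((m + 0) powr q)"
    by (intro tendsto_lowerbound[where F="at_right (0::real)"]) auto
  then show ?thesis using False by (simp add: Lp_bounded_def q_def)
qed

text \<open>
  With \<open>\<lambda> = m / (m + n)\<close>, the sum \<open>u + v\<close> is the average of \<open>u / \<lambda>\<close> and \<open>v / (1 - \<lambda>)\<close> for a coin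
  that shows heads with probability \<open>\<lambda>\<close>, and both of these have norm at most \<open>m + n\<close>.
\<close>

lemma Lp_bounded_add:
  fixes u v :: "'a::euclidean_space \<Rightarrow> real"
  assumes p: "1 \<le> p" and [measurable]: "u \<in> borel_measurable borel" "v \<in> borel_measurable borel"
    and m: "0 \<le> m" "0 \<le> n" and u: "Lp_bounded p m u" and v: "Lp_bounded p n v"
  shows "Lp_bounded p (m + n) (\<lambda>x. u x + v x)"
proof (rule Lp_bounded_limit[OF p])
  show "0 \<le> m + n" using m by simp
  fix \<epsilon> :: real assume e: "0 < \<epsilon>"
  define a b where "a = m + \<epsilon>/2" and "b = n + \<epsilon>/2"
  have ab: "0 < a" "0 < b" "a + b = m + n + \<epsilon>" using m e by (auto simp: a_def b_def)
  define \<mu> where "\<mu> = measure_pmf (bernoulli_pmf (a / (a + b)))"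
  have l: "0 \<le> a / (a+b)" "a / (a+b) \<le> 1" using ab by auto
  have "Lp_bounded p ((a + b) * 1) (\<lambda>x. u x + v x)"
  proof (rule Lp_bounded_average[where \<mu>=\<mu> and \<Phi>="\<lambda>x \<theta>. if \<theta> then \<bar>u x\<bar> / a else \<bar>v x\<bar> / b", OF p])
    show "prob_space \<mu>" unfolding \<mu>_def by unfold_locales
    have [measurable]: "(\<lambda>x. x) \<in> measurable \<mu> (count_space UNIV)" unfolding \<mu>_def by simp
    show "(\<lambda>(x, \<theta>). if \<theta> then \<bar>u x\<bar> / a else \<bar>v x\<bar> / b) \<in> borel_measurable (lborel \<Otimes>\<^sub>M \<mu>)"
      by measurable
    show "AE x in lborel. ennreal \<bar>u x + v x\<bar> \<le> ennreal (a + b) * (\<integral>\<^sup>+ \<theta>. ennreal (if \<theta> then \<bar>u x\<bar> / a else \<bar>v x\<bar> / b) \<partial>\<mu>)"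
    proof (rule AE_I2)
      fix x
      have "(\<integral>\<^sup>+ \<theta>. ennreal (if \<theta> then \<bar>u x\<bar> / a else \<bar>v x\<bar> / b) \<partial>\<mu>)
         = ennreal (a/(a+b) * (\<bar>u x\<bar> / a) + (1 - a/(a+b)) * (\<bar>v x\<bar> / b))"
        unfolding \<mu>_def using l ab
        by (subst nn_integral_measure_pmf_support[of UNIV])
           (auto simp: UNIV_bool ennreal_mult[symmetric] ennreal_plus[symmetric] mult.commute simp del: ennreal_plus)
      also have "a/(a+b) * (\<bar>u x\<bar> / a) + (1 - a/(a+b)) * (\<bar>v x\<bar> / b) = (\<bar>u x\<bar> + \<bar>v x\<bar>) / (a + b)"
      proof -
        have "1 - a/(a+b) = b/(a+b)" using ab(1,2) by (simp add: field_simps)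
        then show ?thesis using ab(1,2) by (simp add: add_divide_distrib)
      qed
      finally show "ennreal \<bar>u x + v x\<bar> \<le> ennreal (a + b) * (\<integral>\<^sup>+ \<theta>. ennreal (if \<theta> then \<bar>u x\<bar> / a else \<bar>v x\<bar> / b) \<partial>\<mu>)"
        using ab by (simp add: ennreal_mult[symmetric] ennreal_le_iff del: ennreal_plus)
    qed
    have "Lp_bounded p (\<bar>1/a\<bar> * a) (\<lambda>x. 1/a * u x)"
      using Lp_bounded_le[OF p m(1) _ u, of a] ab e by (intro Lp_bounded_cmult p) (auto simp: a_def)
    moreover have "Lp_bounded p (\<bar>1/b\<bar> * b) (\<lambda>x. 1/b * v x)"
      using Lp_bounded_le[OF p m(2) _ v, of b] ab e by (intro Lp_bounded_cmult p) (auto simp: b_def)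
    ultimately have "Lp_bounded p 1 (\<lambda>x. if \<theta> then \<bar>u x\<bar> / a else \<bar>v x\<bar> / b)" for \<theta>
      using ab by (cases \<theta>) (auto simp: Lp_bounded_def)
    then show "AE \<theta> in \<mu>. Lp_bounded p 1 (\<lambda>x. if \<theta> then \<bar>u x\<bar> / a else \<bar>v x\<bar> / b)" by auto
  qed (use ab in auto)
  then show "Lp_bounded p (m + n + \<epsilon>) (\<lambda>x. u x + v x)" using ab by simp
qed

lemma Lp_bounded_zero:
  assumes "1 \<le> p" shows "Lp_bounded p 0 (\<lambda>x. 0)"
  using enn2real_ge_1[OF assms] by (auto simp: Lp_bounded_def)

lemma Lp_bounded_sum:
  fixes u :: "'i \<Rightarrow> 'a::euclidean_space \<Rightarrow> real"
  assumes p: "1 \<le> p" and "finite J"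
    and "\<And>j. j \<in> J \<Longrightarrow> u j \<in> borel_measurable borel \<and> 0 \<le> m j \<and> Lp_bounded p (m j) (u j)"
  shows "Lp_bounded p (\<Sum>j\<in>J. m j) (\<lambda>x. \<Sum>j\<in>J. u j x)"
  using assms(2,3)
proof (induction J rule: finite_induct)
  case (insert j J)
  then show ?case
    by (auto intro!: Lp_bounded_add[OF p] borel_measurable_sum sum_nonneg)
qed (simp add: Lp_bounded_zero[OF p])

section \<open>Mixed differences and their moduli\<close>

abbreviation multi_indices :: "nat^'d \<Rightarrow> ('d \<Rightarrow> nat) set" where
  "multi_indices r \<equiv> PiE UNIV (\<lambda>i. {..r $ i})"

definition index_scale :: "('d \<Rightarrow> nat) \<Rightarrow> real^'d \<Rightarrow> real^'d" where
  "index_scale j h = (\<chi> i. real (j i) * h $ i)"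

definition diff_coeff :: "nat^'d \<Rightarrow> ('d \<Rightarrow> nat) \<Rightarrow> real" where
  "diff_coeff r j = (\<Prod>i\<in>UNIV. (-1) ^ (r $ i - j i) * real (r $ i choose j i))"

lemma finite_multi_indices [simp]: "finite (multi_indices (r :: nat^'d::finite))"
  by (rule finite_PiE) auto

lemma set_coord_eq: "set_coord i (x $ i + s) x = x + axis i s"
  by (auto simp: set_coord_def vec_eq_iff axis_def)

lemma fold_coord_diff_expand:
  fixes f :: "real^'d::finite \<Rightarrow> real"
  assumes "finite S"
  shows "Finite_Set.fold (\<lambda>i. coord_diff i (r $ i) (h $ i)) f S x =
    (\<Sum>j\<in>PiE S (\<lambda>i. {..r $ i}). (\<Prod>i\<in>S. (-1) ^ (r $ i - j i) * real (r $ i choose j i)) *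
       f (x + (\<chi> i. if i \<in> S then real (j i) * h $ i else 0)))"
  using assms
proof (induction S arbitrary: x rule: finite_induct)
  case empty
  have "x + (\<chi> i. 0) = x" by (simp add: vec_eq_iff)
  then show ?case by simp
next
  case (insert k S)
  interpret comp_fun_commute "\<lambda>i. coord_diff i (r $ i) (h $ i)"
    by (rule coord_diff_comp_fun_commute)
  let ?c = "\<lambda>i l. (-1) ^ (r $ i - l) * real (r $ i choose l)"
  let ?v = "\<lambda>S j. \<chi> i. if i \<in> S then real (j i) * h $ i else 0"
  have "Finite_Set.fold (\<lambda>i. coord_diff i (r $ i) (h $ i)) f (insert k S) x =
    (\<Sum>l\<le>r $ k. ?c k l * Finite_Set.fold (\<lambda>i. coord_diff i (r $ i) (h $ i)) f S (x + axis k (real l * h $ k)))"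
    using insert.hyps by (simp add: coord_diff_def fdiff_def set_coord_eq)
  also have "\<dots> = (\<Sum>l\<le>r $ k. \<Sum>j\<in>PiE S (\<lambda>i. {..r $ i}). ?c k l * ((\<Prod>i\<in>S. ?c i (j i)) *
       f (x + axis k (real l * h $ k) + ?v S j)))"
    by (simp only: insert.IH sum_distrib_left)
  also have "\<dots> = (\<Sum>(l, j)\<in>{..r $ k} \<times> PiE S (\<lambda>i. {..r $ i}). ?c k l * ((\<Prod>i\<in>S. ?c i (j i)) *
       f (x + axis k (real l * h $ k) + ?v S j)))"
    using insert.hyps by (subst sum.cartesian_product) auto
  also have "\<dots> = (\<Sum>j\<in>PiE (insert k S) (\<lambda>i. {..r $ i}). (\<Prod>i\<in>insert k S. ?c i (j i)) * f (x + ?v (insert k S) j))"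
    unfolding PiE_insert_eq
  proof (subst sum.reindex)
    show "inj_on (\<lambda>(y, g). g(k := y)) ({..r $ k} \<times> PiE S (\<lambda>i. {..r $ i}))"
      using insert.hyps by (intro inj_combinator) auto
    show "(\<Sum>(l, j)\<in>{..r $ k} \<times> PiE S (\<lambda>i. {..r $ i}). ?c k l * ((\<Prod>i\<in>S. ?c i (j i)) *
       f (x + axis k (real l * h $ k) + ?v S j))) =
      sum ((\<lambda>j. (\<Prod>i\<in>insert k S. ?c i (j i)) * f (x + ?v (insert k S) j)) \<circ> (\<lambda>(y, g). g(k := y)))
       ({..r $ k} \<times> PiE S (\<lambda>i. {..r $ i}))"
    proof (rule sum.cong, simp, clarify)
      fix l j assume "j \<in> PiE S (\<lambda>i. {..r $ i})"
      have "x + axis k (real l * h $ k) + ?v S j = x + ?v (insert k S) (j(k := l))"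
        using insert.hyps by (auto simp: vec_eq_iff axis_def)
      moreover have "(\<Prod>i\<in>S. ?c i ((j(k := l)) i)) = (\<Prod>i\<in>S. ?c i (j i))"
        using insert.hyps by (intro prod.cong) auto
      moreover have "((\<lambda>j. (\<Prod>i\<in>insert k S. ?c i (j i)) * f (x + ?v (insert k S) j)) \<circ> (\<lambda>(y, g). g(k := y))) (l, j)
          = ?c k l * (\<Prod>i\<in>S. ?c i ((j(k := l)) i)) * f (x + ?v (insert k S) (j(k := l)))"
        by (simp only: o_def prod.case prod.insert[OF insert.hyps] fun_upd_same)
      ultimately show "?c k l * ((\<Prod>i\<in>S. ?c i (j i)) * f (x + axis k (real l * h $ k) + ?v S j)) =
        ((\<lambda>j. (\<Prod>i\<in>insert k S. ?c i (j i)) * f (x + ?v (insert k S) j)) \<circ> (\<lambda>(y, g). g(k := y))) (l, j)"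
        by (simp only: mult.assoc)
    qed
  qed
  finally show ?case .
qed

text \<open>
  A finite sum of translates: measurability, norm bounds and integrals of mixed differences are
  read off from it.
\<close>

lemma mixed_diff_expand:
  fixes f :: "real^'d::finite \<Rightarrow> real"
  shows "mixed_diff r h f x = (\<Sum>j\<in>multi_indices r. diff_coeff r j * f (x + index_scale j h))"
  unfolding mixed_diff_def diff_coeff_def index_scale_def
  by (subst fold_coord_diff_expand) auto

lemma sum_abs_diff_coeff:
  "(\<Sum>j\<in>multi_indices (r :: nat^'d::finite). \<bar>diff_coeff r j\<bar>) = (\<Prod>i\<in>UNIV. 2 ^ (r $ i))"
proof -
  have "(\<Sum>j\<in>multi_indices r. \<bar>diff_coeff r j\<bar>) = (\<Sum>j\<in>multi_indices r. \<Prod>i\<in>UNIV. real (r $ i choose j i))"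
    by (simp add: diff_coeff_def abs_prod abs_mult power_abs)
  also have "\<dots> = (\<Prod>i\<in>UNIV. \<Sum>l\<le>r $ i. real (r $ i choose l))"
    by (rule prod_sum_PiE[symmetric]) auto
  also have "\<dots> = (\<Prod>i\<in>UNIV. 2 ^ (r $ i))"
    by (simp flip: of_nat_sum add: choose_row_sum)
  finally show ?thesis .
qed

lemma continuous_on_index_scale [continuous_intros]:
  "continuous_on S f \<Longrightarrow> continuous_on S (\<lambda>x. index_scale j (f x))"
  unfolding index_scale_def by (intro continuous_intros)

lemma borel_measurable_index_scale [measurable]:
  "index_scale (j :: 'd::finite \<Rightarrow> nat) \<in> borel_measurable borel"
  by (intro borel_measurable_continuous_onI continuous_intros)

lemma borel_measurable_mixed_diff [measurable]:
  fixes f :: "real^'d::finite \<Rightarrow> real"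
  assumes [measurable]: "f \<in> borel_measurable borel" "g \<in> borel_measurable M" "k \<in> borel_measurable M"
  shows "(\<lambda>z. mixed_diff r (k z) f (g z)) \<in> borel_measurable M"
  unfolding mixed_diff_expand by measurable

lemma mixed_diff_diff:
  "mixed_diff r h (\<lambda>x. f x - g x) x = mixed_diff r h f x - mixed_diff r h g (x :: real^'d::finite)"
  by (simp add: mixed_diff_expand right_diff_distrib sum_subtractf)

lemma Lp_bounded_mixed_diff:
  fixes f :: "real^'d::finite \<Rightarrow> real"
  assumes p: "1 \<le> p" and m: "0 \<le> m" and f: "Lp_bounded p m f" and [measurable]: "f \<in> borel_measurable borel"
  shows "Lp_bounded p ((\<Prod>i\<in>UNIV. 2 ^ (r $ i)) * m) (mixed_diff r h f)"
proof -
  have "Lp_bounded p (\<Sum>j\<in>multi_indices r. \<bar>diff_coeff r j\<bar> * m)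
     (\<lambda>x. \<Sum>j\<in>multi_indices r. diff_coeff r j * f (x + index_scale j h))"
    by (intro Lp_bounded_sum p) (auto intro!: Lp_bounded_cmult Lp_bounded_translate mult_nonneg_nonneg p m f)
  moreover have "(\<lambda>x. \<Sum>j\<in>multi_indices r. diff_coeff r j * f (x + index_scale j h)) = mixed_diff r h f"
    by (rule ext) (rule mixed_diff_expand[symmetric])
  ultimately show ?thesis
    by (simp add: sum_distrib_right[symmetric] sum_abs_diff_coeff)
qed

text \<open>
  The nodes are \<open>x + (j\<^sub>i h\<^sub>i)\<^sub>i\<close> with \<open>j\<^sub>i \<le> r\<^sub>i\<close>, so steps in coordinates of order zero never
  enter.
\<close>

lemma mixed_diff_cong_step:
  fixes f :: "real^'d::finite \<Rightarrow> real"
  assumes "\<And>i. r $ i \<noteq> 0 \<Longrightarrow> h $ i = k $ i"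
  shows "mixed_diff r h f = mixed_diff r k f"
proof
  fix x
  have "index_scale j h = index_scale j k" if "j \<in> multi_indices r" for j
    using that assms by (auto simp: index_scale_def vec_eq_iff PiE_iff) (metis gr_zeroI le_zero_eq)
  then show "mixed_diff r h f x = mixed_diff r k f x"
    unfolding mixed_diff_expand by (intro sum.cong) auto
qed

abbreviation step_vec :: "nat^'d \<Rightarrow> real^'d \<Rightarrow> real^'d" where
  "step_vec r h \<equiv> (\<chi> i. real (r $ i) * h $ i)"

text \<open>
  Each coordinate of a node lies between those of \<open>x\<close> and \<open>x + r h\<close>.  Hence a difference at a
  point of its domain uses values of the function in the box only.
\<close>

lemma add_index_scale_mem_cbox:
  fixes a b x h :: "real^'d::finite"
  assumes x: "x \<in> shift_domain (cbox a b) (step_vec r h)" and j: "\<And>i. j i \<le> r $ i"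
  shows "x + index_scale j h \<in> cbox a b"
proof -
  have "a $ i \<le> x $ i + real (j i) * h $ i \<and> x $ i + real (j i) * h $ i \<le> b $ i" for i
  proof -
    have 1: "a $ i \<le> x $ i" "x $ i \<le> b $ i" "a $ i \<le> x $ i + real (r $ i) * h $ i" "x $ i + real (r $ i) * h $ i \<le> b $ i"
      using x by (auto simp: shift_domain_def mem_box_cart)
    have 2: "0 \<le> real (j i)" "real (j i) \<le> real (r $ i)" using j[of i] by auto
    show ?thesis
    proof (cases "0 \<le> h $ i")
      case True
      then have "0 \<le> real (j i) * h $ i" "real (j i) * h $ i \<le> real (r $ i) * h $ i"
        using 2 by (auto intro: mult_right_mono)
      then show ?thesis using 1 by auto
    next
      case False
      then have "real (j i) * h $ i \<le> 0" "real (r $ i) * h $ i \<le> real (j i) * h $ i"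
        using 2 by (auto intro: mult_right_mono_neg simp: mult_nonneg_nonpos)
      then show ?thesis using 1 by auto
    qed
  qed
  then show ?thesis by (auto simp: mem_box_cart index_scale_def)
qed

lemma shift_domain_borel [measurable]:
  fixes a b y :: "real^'d::finite"
  shows "shift_domain (cbox a b) y \<in> sets borel"
proof -
  have "shift_domain (cbox a b) y = cbox a b \<inter> (\<lambda>x. x + y) -` cbox a b"
    by (auto simp: shift_domain_def)
  also have "closed \<dots>" by (intro closed_Int closed_cbox continuous_closed_vimage) auto
  ultimately show ?thesis by simp
qed

lemma AE_lborel_translate:
  fixes P :: "'a::euclidean_space \<Rightarrow> bool"
  assumes "AE x in lborel. P x"
  shows "AE x in lborel. P (x + s)"
proof -
  from assms obtain N where N: "{x. \<not> P x} \<subseteq> N" "N \<in> null_sets lborel"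
    by (auto elim!: AE_E simp: null_sets_def)
  have "AE x in distr lborel borel ((+) s). x \<notin> N"
    unfolding lborel_distr_plus by (rule AE_not_in[OF N(2)])
  then have "AE x in lborel. s + x \<notin> N"
    using N(2) by (subst (asm) AE_distr_iff) auto
  then show ?thesis
    by eventually_elim (use N(1) in \<open>auto simp: add.commute\<close>)
qed

text \<open>
  Finitely many translates of a null set form a null set.
\<close>

lemma AE_mixed_diff_eq:
  fixes f F :: "real^'d::finite \<Rightarrow> real"
  assumes "AE x in lborel. x \<in> cbox a b \<longrightarrow> f x = F x"
  shows "AE x in lborel. x \<in> shift_domain (cbox a b) (step_vec r h) \<longrightarrow> mixed_diff r h f x = mixed_diff r h F x"
proof -
  have "AE x in lborel. \<forall>j\<in>multi_indices r. x + index_scale j h \<in> cbox a b \<longrightarrow> f (x + index_scale j h) = F (x + index_scale j h)"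
    by (intro AE_finite_allI finite_multi_indices AE_lborel_translate[OF assms])
  then show ?thesis
  proof eventually_elim
    case (elim x)
    show ?case unfolding mixed_diff_expand
      using elim add_index_scale_mem_cbox[of x a b r h] by (auto intro!: sum.cong simp: PiE_iff)
  qed
qed

lemma Lp_space_ex_borel:
  fixes f :: "real^'d::finite \<Rightarrow> real"
  assumes "f \<in> borel_measurable (lebesgue_on (cbox a b))"
  obtains F where "F \<in> borel_measurable borel" "\<And>x. x \<notin> cbox a b \<Longrightarrow> F x = 0"
    "AE x in lborel. x \<in> cbox a b \<longrightarrow> f x = F x"
proof -
  have "(\<lambda>x. if x \<in> cbox a b then f x else 0) \<in> borel_measurable lebesgue"
    using assms by (subst borel_measurable_if) auto
  from completion_ex_borel_measurable_real[OF this] obtain F where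
    F: "F \<in> borel_measurable borel" "AE x in lborel. (if x \<in> cbox a b then f x else 0) = F x" by auto
  show ?thesis
  proof (rule that[of "\<lambda>x. indicator (cbox a b) x * F x"])
    show "(\<lambda>x. indicator (cbox a b) x * F x) \<in> borel_measurable borel" using F by measurable
    show "AE x in lborel. x \<in> cbox a b \<longrightarrow> f x = indicat_real (cbox a b) x * F x"
      using F(2) by eventually_elim (auto split: if_splits)
  qed auto
qed

lemma mixed_modulus_le_iff:
  fixes f F :: "real^'d::finite \<Rightarrow> real"
  assumes p: "1 \<le> p" and F[measurable]: "F \<in> borel_measurable borel"
    and ae: "AE x in lborel. x \<in> cbox a b \<longrightarrow> f x = F x" and m: "0 \<le> m"
  shows "mixed_modulus r p (cbox a b) f t \<le> ennreal m \<longleftrightarrow>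
    (\<forall>h. (\<forall>i. \<bar>h $ i\<bar> \<le> t $ i) \<longrightarrow>
      Lp_bounded p m (\<lambda>x. indicator (shift_domain (cbox a b) (step_vec r h)) x * mixed_diff r h F x))"
proof -
  have "Lp_norm p (shift_domain (cbox a b) (step_vec r h)) (mixed_diff r h f) \<le> ennreal m \<longleftrightarrow>
      Lp_bounded p m (\<lambda>x. indicator (shift_domain (cbox a b) (step_vec r h)) x * mixed_diff r h F x)" for h
  proof (rule Lp_norm_le_iff[OF p])
    show "AE x in lborel. indicat_real (shift_domain (cbox a b) (step_vec r h)) x * mixed_diff r h F x =
         indicat_real (shift_domain (cbox a b) (step_vec r h)) x * mixed_diff r h f x"
      using AE_mixed_diff_eq[OF ae, of r h] by eventually_elim (auto simp: indicator_def)
  qed (use m in measurable)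
  then show ?thesis unfolding mixed_modulus_def SUP_le_iff by auto
qed

section \<open>Test functions determine a function\<close>

text \<open>
  The smooth functions \<open>x\<^sup>-\<^sup>n exp (-1/x)\<close> on the positive half line; the derivative of one is a
  combination of the next two.
\<close>

definition exp_inv :: "nat \<Rightarrow> real \<Rightarrow> real" where
  "exp_inv n x = (if 0 < x then inverse x ^ n * exp (- inverse x) else 0)"

lemma exp_inv_tendsto_0: "((exp_inv n) \<longlongrightarrow> 0) (at_right 0)"
proof -
  have "((\<lambda>x. (inverse x) ^ n / exp (inverse x)) \<longlongrightarrow> 0) (at_right (0::real))"
    by (rule filterlim_compose[OF tendsto_power_div_exp_0 filterlim_inverse_at_top_right])
  then show ?thesis
    by (rule Lim_transform_eventually)
       (auto simp: eventually_at_filter exp_inv_def exp_minus divide_inverse)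
qed

lemma exp_inv_has_derivative:
  "(exp_inv n has_real_derivative - real n * exp_inv (Suc n) x + exp_inv (Suc (Suc n)) x) (at x)"
proof -
  consider "0 < x" | "x < 0" | "x = 0" by linarith
  then show ?thesis
  proof cases
    case 1
    have "((\<lambda>x. inverse x ^ n * exp (- inverse x)) has_real_derivative
        - real n * exp_inv (Suc n) x + exp_inv (Suc (Suc n)) x) (at x)"
      using 1 by (cases n) (auto intro!: derivative_eq_intros simp: exp_inv_def algebra_simps power2_eq_square,
          metis Suc_pred gr0I power_Suc)
    moreover have "\<forall>\<^sub>F y in nhds x. exp_inv n y = inverse y ^ n * exp (- inverse y)"
      using eventually_nhds_in_open[of "{0<..}" x] 1
      by (auto elim!: eventually_mono simp: exp_inv_def)
    ultimately show ?thesis by (subst DERIV_cong_ev[OF refl _ refl])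
  next
    case 2
    have "\<forall>\<^sub>F y in nhds x. exp_inv n y = 0"
      using eventually_nhds_in_open[of "{..<0}" x] 2
      by (auto elim!: eventually_mono simp: exp_inv_def)
    then have "(exp_inv n has_real_derivative 0) (at x)"
      by (subst DERIV_cong_ev[OF refl _ refl]) auto
    then show ?thesis using 2 by (simp add: exp_inv_def)
  next
    case 3
    have "((\<lambda>h. (exp_inv n (0 + h) - exp_inv n 0) / h) \<longlongrightarrow> 0) (at_right 0)"
      by (rule Lim_transform_eventually[OF exp_inv_tendsto_0[of "Suc n"]])
         (auto simp: eventually_at_filter exp_inv_def divide_inverse)
    moreover have "((\<lambda>h. (exp_inv n (0 + h) - exp_inv n 0) / h) \<longlongrightarrow> 0) (at_left 0)"
      by (rule Lim_transform_eventually[OF tendsto_const])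
         (auto simp: eventually_at_filter exp_inv_def)
    ultimately have "(exp_inv n has_real_derivative 0) (at 0)"
      unfolding DERIV_def by (rule filterlim_split_at_real[rotated])
    then show ?thesis using 3 by (simp add: exp_inv_def)
  qed
qed

text \<open>
  Closed under differentiation by the product rule, hence consisting of infinitely differentiable
  functions.
\<close>

inductive exp_inv_algebra :: "(real \<Rightarrow> real) \<Rightarrow> bool" where
  base: "exp_inv_algebra (\<lambda>x. exp_inv n (\<alpha> * x + \<beta>))"
| cmult: "exp_inv_algebra u \<Longrightarrow> exp_inv_algebra (\<lambda>x. c * u x)"
| add: "exp_inv_algebra u \<Longrightarrow> exp_inv_algebra v \<Longrightarrow> exp_inv_algebra (\<lambda>x. u x + v x)"
| mult: "exp_inv_algebra u \<Longrightarrow> exp_inv_algebra v \<Longrightarrow> exp_inv_algebra (\<lambda>x. u x * v x)"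

lemma exp_inv_algebra_deriv:
  assumes "exp_inv_algebra u"
  shows "exp_inv_algebra (deriv u) \<and> (\<forall>x. (u has_real_derivative deriv u x) (at x))"
proof -
  have "\<exists>u'. exp_inv_algebra u' \<and> (\<forall>x. (u has_real_derivative u' x) (at x))"
    using assms
  proof induction
    case (base n \<alpha> \<beta>)
    have "((\<lambda>x. exp_inv n (\<alpha> * x + \<beta>)) has_real_derivative
      (- real n * \<alpha>) * exp_inv (Suc n) (\<alpha> * x + \<beta>) + \<alpha> * exp_inv (Suc (Suc n)) (\<alpha> * x + \<beta>)) (at x)" for x
      by (rule DERIV_cong[OF DERIV_chain2[OF exp_inv_has_derivative]])
         (auto intro!: derivative_eq_intros simp: algebra_simps)
    moreover have "exp_inv_algebra (\<lambda>x. (- real n * \<alpha>) * exp_inv (Suc n) (\<alpha> * x + \<beta>) + \<alpha> * exp_inv (Suc (Suc n)) (\<alpha> * x + \<beta>))"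
      by (intro exp_inv_algebra.intros)
    ultimately show ?case by blast
  next
    case (cmult u c)
    then obtain u' where "exp_inv_algebra u'" "\<forall>x. (u has_real_derivative u' x) (at x)" by auto
    then show ?case
      by (intro exI[of _ "\<lambda>x. c * u' x"]) (auto intro!: exp_inv_algebra.intros derivative_eq_intros)
  next
    case (add u v)
    then obtain u' v' where "exp_inv_algebra u'" "\<forall>x. (u has_real_derivative u' x) (at x)"
      "exp_inv_algebra v'" "\<forall>x. (v has_real_derivative v' x) (at x)" by auto
    then show ?case
      by (intro exI[of _ "\<lambda>x. u' x + v' x"]) (auto intro!: exp_inv_algebra.intros derivative_eq_intros)
  next
    case (mult u v)
    then obtain u' v' where "exp_inv_algebra u'" "\<forall>x. (u has_real_derivative u' x) (at x)"
      "exp_inv_algebra v'" "\<forall>x. (v has_real_derivative v' x) (at x)" by auto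
    then show ?case using mult.hyps
      by (intro exI[of _ "\<lambda>x. u' x * v x + v' x * u x"])
         (auto intro!: exp_inv_algebra.intros derivative_eq_intros)
  qed
  then obtain u' where u': "exp_inv_algebra u'" "\<forall>x. (u has_real_derivative u' x) (at x)" by auto
  then have "deriv u = u'" by (auto simp: fun_eq_iff intro: DERIV_imp_deriv)
  then show ?thesis using u' by simp
qed

lemma partial_prod:
  fixes u :: "'d::finite \<Rightarrow> real \<Rightarrow> real"
  assumes "(u k has_real_derivative u' (x $ k)) (at (x $ k))"
  shows "((\<lambda>s. \<Prod>i\<in>UNIV. u i ((x + s *\<^sub>R axis k 1) $ i)) has_real_derivative
     (\<Prod>i\<in>UNIV. (u(k := u')) i (x $ i))) (at 0)"
proof -
  have UN: "UNIV = insert k (- {k})" by auto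
  have eq: "(\<lambda>s. \<Prod>i\<in>UNIV. u i ((x + s *\<^sub>R axis k 1) $ i)) = (\<lambda>s. u k (x $ k + s) * (\<Prod>i\<in>-{k}. u i (x $ i)))"
  proof
    fix s
    have "(\<Prod>i\<in>- {k}. u i ((x + s *\<^sub>R axis k 1) $ i)) = (\<Prod>i\<in>-{k}. u i (x $ i))"
      by (rule prod.cong) (auto simp: axis_def)
    then show "(\<Prod>i\<in>UNIV. u i ((x + s *\<^sub>R axis k 1) $ i)) = u k (x $ k + s) * (\<Prod>i\<in>-{k}. u i (x $ i))"
      by (subst UN, subst prod.insert) (auto simp: axis_def)
  qed
  have eq2: "(\<Prod>i\<in>UNIV. (u(k := u')) i (x $ i)) = u' (x $ k) * (\<Prod>i\<in>-{k}. u i (x $ i))"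
  proof -
    have "(\<Prod>i\<in>- {k}. (u(k := u')) i (x $ i)) = (\<Prod>i\<in>-{k}. u i (x $ i))"
      by (rule prod.cong) auto
    then show ?thesis by (subst UN, subst prod.insert) auto
  qed
  have "((\<lambda>s. u k (x $ k + s)) has_real_derivative u' (x $ k)) (at 0)"
    by (rule DERIV_cong[OF DERIV_chain2[where Db=1]]) (use assms in \<open>auto intro!: derivative_eq_intros\<close>)
  then show ?thesis unfolding eq eq2 by (rule DERIV_cmult_right)
qed

text \<open>
  Products of such functions over the coordinates are stable under all partial derivatives, so
  they are test functions as soon as their support is compact.
\<close>

lemma iter_partial_prod:
  fixes u :: "'d::finite \<Rightarrow> real \<Rightarrow> real"
  assumes "\<And>i. exp_inv_algebra (u i)"
  shows "\<exists>v. (\<forall>i. exp_inv_algebra (v i)) \<and> iter_partial is (\<lambda>x. \<Prod>i\<in>UNIV. u i (x $ i)) = (\<lambda>x. \<Prod>i\<in>UNIV. v i (x $ i))"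
proof (induction "is")
  case Nil
  then show ?case using assms by (intro exI[of _ u]) (simp add: iter_partial_def)
next
  case (Cons k "is")
  then obtain v where v: "\<And>i. exp_inv_algebra (v i)"
    "iter_partial is (\<lambda>x. \<Prod>i\<in>UNIV. u i (x $ i)) = (\<lambda>x. \<Prod>i\<in>UNIV. v i (x $ i))" by auto
  have "iter_partial (k # is) (\<lambda>x. \<Prod>i\<in>UNIV. u i (x $ i)) = partial k (\<lambda>x. \<Prod>i\<in>UNIV. v i (x $ i))"
    using v(2) by (simp add: iter_partial_def)
  also have "\<dots> = (\<lambda>x. \<Prod>i\<in>UNIV. (v(k := deriv (v k))) i (x $ i))"
    unfolding partial_def using exp_inv_algebra_deriv[OF v(1)[of k]]
    by (intro ext DERIV_imp_deriv partial_prod) auto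
  finally show ?case using v(1) exp_inv_algebra_deriv[OF v(1)[of k]]
    by (intro exI[of _ "v(k := deriv (v k))"]) auto
qed

lemma differentiable_on_prod_component:
  fixes v :: "'d::finite \<Rightarrow> real \<Rightarrow> real"
  assumes "\<And>i x. v i differentiable at x"
  shows "(\<lambda>x. \<Prod>i\<in>UNIV. v i (x $ i)) differentiable_on UNIV"
proof -
  have 1: "(\<lambda>x. v i (x $ i)) differentiable at x" for i and x :: "real^'d"
    using differentiable_chain_at[OF bounded_linear_imp_differentiable[OF bounded_linear_vec_nth[of i]] assms[where i=i]]
    by (simp add: o_def)
  have "(\<lambda>x. \<Prod>i\<in>S. v i (x $ i)) differentiable at x" if "finite S" for S and x :: "real^'d"
    using that by (induction rule: finite_induct) (auto intro!: differentiable_mult 1)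
  then show ?thesis by (simp add: differentiable_on_def)
qed

text \<open>
  The measures with densities \<open>max 0 g\<close> and \<open>max 0 (- g)\<close> are finite and agree on boxes, which
  generate the Borel sets and are stable under intersection.
\<close>

lemma AE_zero_if_box_integrals_zero:
  fixes g :: "'a::euclidean_space \<Rightarrow> real"
  assumes g: "integrable lborel g" and z: "\<And>c d. (\<integral>x. indicator (box c d) x * g x \<partial>lborel) = 0"
  shows "AE x in lborel. g x = 0"
proof -
  have [measurable]: "g \<in> borel_measurable borel" using borel_measurable_integrable[OF g] by simp
  define M1 where "M1 = density lborel (\<lambda>x. ennreal (g x))"
  define M2 where "M2 = density lborel (\<lambda>x. ennreal (- g x))"
  have i1: "integrable lborel (\<lambda>x. indicator B x * max 0 (g x))"
    and i2: "integrable lborel (\<lambda>x. indicator B x * max 0 (- g x))" if "B \<in> sets borel" for B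
    using that by (auto intro!: Bochner_Integration.integrable_bound[OF g] AE_I2 simp: indicator_def)
  have e1: "emeasure M1 B = ennreal (\<integral>x. indicator B x * max 0 (g x) \<partial>lborel)"
    if B: "B \<in> sets borel" for B
  proof -
    have "emeasure M1 B = (\<integral>\<^sup>+x. ennreal (indicator B x * max 0 (g x)) \<partial>lborel)"
      unfolding M1_def using B by (subst emeasure_density)
        (auto intro!: nn_integral_cong simp: indicator_def max_def ennreal_neg)
    also have "\<dots> = ennreal (\<integral>x. indicator B x * max 0 (g x) \<partial>lborel)"
      by (rule nn_integral_eq_integral[OF i1[OF B]]) auto
    finally show ?thesis .
  qed
  have e2: "emeasure M2 B = ennreal (\<integral>x. indicator B x * max 0 (- g x) \<partial>lborel)"
    if B: "B \<in> sets borel" for B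
  proof -
    have "emeasure M2 B = (\<integral>\<^sup>+x. ennreal (indicator B x * max 0 (- g x)) \<partial>lborel)"
      unfolding M2_def using B by (subst emeasure_density)
        (auto intro!: nn_integral_cong simp: indicator_def max_def ennreal_neg)
    also have "\<dots> = ennreal (\<integral>x. indicator B x * max 0 (- g x) \<partial>lborel)"
      by (rule nn_integral_eq_integral[OF i2[OF B]]) auto
    finally show ?thesis .
  qed
  have eqb: "emeasure M1 (box c d) = emeasure M2 (box c d)" for c d
  proof -
    have "(\<integral>x. indicator (box c d) x * max 0 (g x) \<partial>lborel) - (\<integral>x. indicator (box c d) x * max 0 (- g x) \<partial>lborel)
      = (\<integral>x. indicator (box c d) x * max 0 (g x) - indicator (box c d) x * max 0 (- g x) \<partial>lborel)"
      by (rule Bochner_Integration.integral_diff[symmetric]) (auto intro!: i1 i2)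
    also have "\<dots> = (\<integral>x. indicator (box c d) x * g x \<partial>lborel)"
      by (rule Bochner_Integration.integral_cong) (auto simp: indicator_def)
    finally show ?thesis using z by (simp add: e1 e2)
  qed
  have "M1 = M2"
  proof (rule measure_eqI_generator_eq)
    let ?E = "range (\<lambda>(a, b). box a b::'a set)"
    show "Int_stable ?E" by (auto simp: Int_stable_def box_Int_box)
    show "?E \<subseteq> Pow UNIV" "sets M1 = sigma_sets UNIV ?E" "sets M2 = sigma_sets UNIV ?E"
      by (simp_all add: M1_def M2_def borel_eq_box)
    let ?A = "\<lambda>n::nat. box (- (real n *\<^sub>R One)) (real n *\<^sub>R One) :: 'a set"
    show "range ?A \<subseteq> ?E" "(\<Union>i. ?A i) = UNIV" unfolding UN_box_eq_UNIV by auto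
    show "emeasure M1 (?A i) \<noteq> \<infinity>" for i by (simp add: e1)
    show "emeasure M1 X = emeasure M2 X" if "X \<in> ?E" for X
      using that eqb by auto
  qed
  moreover have "integral\<^sup>N lborel (\<lambda>x. ennreal (g x)) \<noteq> \<infinity>"
    using e1[of UNIV] by (simp add: M1_def emeasure_density)
  ultimately have "AE x in lborel. ennreal (g x) = ennreal (- g x)"
    unfolding M1_def M2_def by (subst (asm) finite_density_unique) auto
  then show ?thesis
  proof eventually_elim
    case (elim x)
    then show "g x = 0"
      by (cases "0 \<le> g x") (auto simp: ennreal_neg)
  qed
qed

lemma test_function_continuous:
  assumes "test_function U \<phi>" shows "continuous_on UNIV (iter_partial ks \<phi>)"
  using assms unfolding test_function_def by (auto intro: differentiable_imp_continuous_on)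

lemma iter_partial_Nil [simp]: "iter_partial [] \<phi> = \<phi>"
  by (simp add: iter_partial_def)

text \<open>
  Every box whose closure lies in \<open>U\<close> is the limit of test functions with values in \<open>[0, 1]\<close>, so
  by dominated convergence the integrals of \<open>q\<close> over such boxes vanish.
\<close>

lemma AE_zero_if_orthogonal_to_test_functions:
  fixes q :: "real^'d::finite \<Rightarrow> real"
  assumes U: "open U" and [measurable]: "q \<in> borel_measurable borel"
    and int: "\<And>K. compact K \<Longrightarrow> K \<subseteq> U \<Longrightarrow> integrable lborel (\<lambda>x. indicator K x * q x)"
    and z: "\<And>\<phi>. test_function U \<phi> \<Longrightarrow> (\<integral>x. q x * \<phi> x \<partial>lborel) = 0"
  shows "AE x in lborel. x \<in> U \<longrightarrow> q x = 0"
proof -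
  have box: "(\<integral>x. indicator (box c d) x * q x \<partial>lborel) = 0" if sub: "cbox c d \<subseteq> U" for c d
  proof -
    \<comment> \<open>As \<open>n\<close> grows, both factors tend to \<open>1\<close> inside the interval \<open>]c\<^sub>i, d\<^sub>i[\<close>; outside it one of
      them is zero.\<close>
    define u where "u n i x = exp_inv 0 (real (Suc n) * x + - (real (Suc n) * c $ i)) * exp_inv 0 (- real (Suc n) * x + real (Suc n) * d $ i)"
      for n i x
    define \<phi> where "\<phi> n x = (\<Prod>i\<in>UNIV. u n i (x $ i))" for n and x :: "real^'d"
    have u_eq: "u n i x = exp_inv 0 (real (Suc n) * (x - c $ i)) * exp_inv 0 (real (Suc n) * (d $ i - x))" for n i x
      unfolding u_def by (simp add: algebra_simps)
    have u: "exp_inv_algebra (u n i)" for n i unfolding u_def[abs_def] by (intro exp_inv_algebra.mult exp_inv_algebra.base)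
    have u_le: "0 \<le> u n i x \<and> u n i x \<le> 1" for n i x
    proof -
      have "0 \<le> exp_inv 0 y \<and> exp_inv 0 y \<le> 1" for y by (simp add: exp_inv_def)
      then show ?thesis unfolding u_eq by (intro conjI mult_nonneg_nonneg mult_le_one) blast+
    qed
    have u0: "u n i (x $ i) = 0" if "\<not> (c $ i < x $ i \<and> x $ i < d $ i)" for n i and x :: "real^'d"
    proof -
      have "\<not> 0 < real (Suc n) * (x $ i - c $ i) \<or> \<not> 0 < real (Suc n) * (d $ i - x $ i)"
        using that by (simp only: zero_less_mult_iff of_nat_0_less_iff) linarith
      then have "exp_inv 0 (real (Suc n) * (x $ i - c $ i)) = 0 \<or> exp_inv 0 (real (Suc n) * (d $ i - x $ i)) = 0"
        unfolding exp_inv_def by presburger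
      then show ?thesis unfolding u_eq mult_eq_0_iff .
    qed
    have sb: "box c d \<subseteq> cbox c d" by (rule box_subset_cbox)
    have \<phi>0: "\<phi> n x = 0" if "x \<notin> box c d" for n x
    proof -
      obtain i where "\<not> (c $ i < x $ i \<and> x $ i < d $ i)" using \<open>x \<notin> box c d\<close> unfolding mem_box_cart by blast
      then have "u n i (x $ i) = 0" by (rule u0)
      then show ?thesis unfolding \<phi>_def by (intro prod_zero) auto
    qed
    have test: "test_function U (\<phi> n)" for n
      unfolding test_function_def
    proof (intro conjI allI)
      fix "is"
      have \<phi>n: "\<phi> n = (\<lambda>x. \<Prod>i\<in>UNIV. u n i (x $ i))" by (rule ext) (rule \<phi>_def)
      obtain v where v: "\<forall>i. exp_inv_algebra (v i)" "iter_partial is (\<phi> n) = (\<lambda>x. \<Prod>i\<in>UNIV. v i (x $ i))"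
        unfolding \<phi>n using iter_partial_prod[of "u n" "is", OF u] by (elim exE conjE)
      show "iter_partial is (\<phi> n) differentiable_on UNIV"
        unfolding v(2) using exp_inv_algebra_deriv[OF v(1)[rule_format]]
        by (intro differentiable_on_prod_component) (metis real_differentiable_def)
      show "\<exists>K. compact K \<and> K \<subseteq> U \<and> (\<forall>x. x \<notin> K \<longrightarrow> \<phi> n x = 0)"
      proof (intro exI[of _ "cbox c d"] conjI allI impI compact_cbox sub)
        fix x assume "x \<notin> cbox c d"
        then have "x \<notin> box c d" using sb by (rule contra_subsetD[rotated])
        then show "\<phi> n x = 0" by (rule \<phi>0)
      qed
    qed
    have cont: "continuous_on UNIV (\<phi> n)" for n using test_function_continuous[OF test, where ks="[]"] by simp
    have [measurable]: "\<phi> n \<in> borel_measurable borel" for n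
      by (rule borel_measurable_continuous_onI[OF cont])
    have "(\<lambda>n. \<integral>x. q x * \<phi> n x \<partial>lborel) \<longlonglongrightarrow> (\<integral>x. indicator (box c d) x * q x \<partial>lborel)"
    proof (rule integral_dominated_convergence[where w="\<lambda>x. \<bar>indicator (cbox c d) x * q x\<bar>"])
      show "integrable lborel (\<lambda>x. \<bar>indicator (cbox c d) x * q x\<bar>)"
        using int[OF compact_cbox sub] by auto
      show "AE x in lborel. norm (q x * \<phi> n x) \<le> \<bar>indicator (cbox c d) x * q x\<bar>" for n
      proof (rule AE_I2)
        fix x
        have "\<bar>\<phi> n x\<bar> \<le> 1" unfolding \<phi>_def abs_prod using u_le by (intro prod_le_1) auto
        then show "norm (q x * \<phi> n x) \<le> \<bar>indicator (cbox c d) x * q x\<bar>"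
          using \<phi>0[of x n] sb
          by (cases "x \<in> box c d") (auto simp: abs_mult mult_left_le)
      qed
      show "AE x in lborel. (\<lambda>n. q x * \<phi> n x) \<longlonglongrightarrow> indicator (box c d) x * q x"
      proof (rule AE_I2)
        fix x
        show "(\<lambda>n. q x * \<phi> n x) \<longlonglongrightarrow> indicator (box c d) x * q x"
        proof (cases "x \<in> box c d")
          case True
          have lim: "(\<lambda>n. exp (- inverse (real (Suc n) * s))) \<longlonglongrightarrow> 1" for s :: real
          proof -
            have "(\<lambda>n. exp (- (inverse (real (Suc n)) * inverse s))) \<longlonglongrightarrow> exp (- (0 * inverse s))"
              by (intro tendsto_intros LIMSEQ_inverse_real_of_nat)
            then show ?thesis by (simp add: inverse_mult_distrib)
          qed
          have "(\<lambda>n. u n i (x $ i)) \<longlonglongrightarrow> 1" for i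
          proof -
            have xi: "c $ i < x $ i" "x $ i < d $ i" using True by (auto simp: mem_box_cart)
            have "u n i (x $ i) = exp (- inverse (real (Suc n) * (x $ i - c $ i))) * exp (- inverse (real (Suc n) * (d $ i - x $ i)))" for n
              using xi by (simp add: u_eq exp_inv_def del: of_nat_Suc)
            then show ?thesis using tendsto_mult[OF lim[of "x $ i - c $ i"] lim[of "d $ i - x $ i"]] by simp
          qed
          then have "(\<lambda>n. \<phi> n x) \<longlonglongrightarrow> (\<Prod>i\<in>(UNIV::'d set). 1)"
            unfolding \<phi>_def by (intro tendsto_prod)
          then have "(\<lambda>n. q x * \<phi> n x) \<longlonglongrightarrow> q x * 1" by (intro tendsto_mult tendsto_const) simp
          then show ?thesis using True by simp
        qed (simp add: \<phi>0)
      qed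
    qed measurable
    then show ?thesis using z[OF test] by (simp add: LIMSEQ_const_iff)
  qed
  have cb: "AE x in lborel. x \<in> cbox c d \<longrightarrow> q x = 0" if sub: "cbox c d \<subseteq> U" for c d
  proof -
    have "AE x in lborel. indicator (cbox c d) x * q x = 0"
    proof (rule AE_zero_if_box_integrals_zero)
      show "integrable lborel (\<lambda>x. indicator (cbox c d) x * q x)" by (rule int[OF compact_cbox sub])
      fix c' d'
      have bd: "AE x in lborel. x \<notin> cbox c d - box c d"
      proof -
        have "cbox c d - box c d \<in> null_sets lborel"
        proof (rule null_setsI)
          show "cbox c d - box c d \<in> sets lborel" by auto
          show "emeasure lborel (cbox c d - box c d) = 0"
            by (subst emeasure_Diff) (auto simp: emeasure_lborel_cbox_eq emeasure_lborel_box_eq box_subset_cbox)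
        qed
        then show ?thesis by (rule AE_not_in)
      qed
      obtain e f where ef: "box c' d' \<inter> box c d = box e f" by (auto simp: box_Int_box)
      have "(\<integral>x. indicator (box c' d') x * (indicator (cbox c d) x * q x) \<partial>lborel)
        = (\<integral>x. indicator (box e f) x * q x \<partial>lborel)"
      proof (rule integral_cong_AE)
        show "AE x in lborel. indicator (box c' d') x * (indicator (cbox c d) x * q x) = indicator (box e f) x * q x"
          using bd by eventually_elim (use box_subset_cbox[of c d] in \<open>auto simp: indicator_def simp flip: ef\<close>)
      qed auto
      also have "\<dots> = 0"
      proof (cases "box e f = {}")
        case False
        then have "closure (box e f) \<subseteq> closure (box c d)" by (auto intro!: closure_mono simp flip: ef)
        moreover have "box c d \<noteq> {}" using False ef by auto
        ultimately have "cbox e f \<subseteq> cbox c d" using False by (simp add: closure_box)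
        then show ?thesis using sub by (intro box) auto
      qed simp
      finally show "(\<integral>x. indicator (box c' d') x * (indicator (cbox c d) x * q x) \<partial>lborel) = 0" .
    qed
    then show ?thesis by eventually_elim (auto simp: indicator_def split: if_splits)
  qed
  obtain D where D: "countable D" "\<And>X. X \<in> D \<Longrightarrow> X \<subseteq> U" "\<And>X. X \<in> D \<Longrightarrow> \<exists>a b. X = cbox a b" "\<Union>D = U"
    using open_countable_Union_open_cbox[OF U] by (metis Pow_iff subset_eq)
  have "AE x in lborel. \<forall>X\<in>D. x \<in> X \<longrightarrow> q x = 0"
    using D(2,3) cb by (subst AE_ball_countable[OF D(1)]) metis
  then show ?thesis by eventually_elim (use D(4) in auto)
qed

section \<open>Differences of test functions as averages of derivatives\<close>

lemma fdiff_Suc: "fdiff (Suc m) h f x = fdiff m h f (x + h) - fdiff m h f x"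
proof -
  define a where "a j = f (x + real j * h)" for j
  have 1: "fdiff (Suc m) h f x = (-1) ^ Suc m * a 0 +
     (\<Sum>j\<le>m. (-1) ^ (m - j) * real (m choose j) * a (Suc j)) + (\<Sum>j\<le>m. (-1) ^ (m - j) * real (m choose Suc j) * a (Suc j))"
    unfolding fdiff_def a_def[symmetric]
    by (subst sum.atMost_Suc_shift) (simp add: sum.distrib[symmetric] algebra_simps)
  have 2: "fdiff m h f (x + h) = (\<Sum>j\<le>m. (-1) ^ (m - j) * real (m choose j) * a (Suc j))"
    unfolding fdiff_def a_def by (intro sum.cong) (auto simp: algebra_simps)
  have "fdiff m h f x = (\<Sum>j\<le>Suc m. (-1) ^ (m - j) * real (m choose j) * a j)"
    unfolding fdiff_def a_def by simp
  also have "\<dots> = (-1)^m * a 0 + (\<Sum>j\<le>m. (-1) ^ (m - Suc j) * real (m choose Suc j) * a (Suc j))"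
    by (subst sum.atMost_Suc_shift) simp
  also have "(\<Sum>j\<le>m. (-1) ^ (m - Suc j) * real (m choose Suc j) * a (Suc j))
     = - (\<Sum>j\<le>m. (-1) ^ (m - j) * real (m choose Suc j) * a (Suc j))"
    unfolding sum_negf[symmetric]
  proof (rule sum.cong)
    fix j assume "j \<in> {..m}"
    then consider "j < m" | "j = m" by fastforce
    then show "(-1) ^ (m - Suc j) * real (m choose Suc j) * a (Suc j) = - ((-1) ^ (m - j) * real (m choose Suc j) * a (Suc j))"
    proof cases
      case 1
      then have "m - j = Suc (m - Suc j)" by simp
      then show ?thesis by simp
    qed simp
  qed simp
  finally have 3: "fdiff m h f x = (-1)^m * a 0 - (\<Sum>j\<le>m. (-1) ^ (m - j) * real (m choose Suc j) * a (Suc j))" by simp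
  show ?thesis unfolding 1 2 3 by simp
qed

definition line_diff :: "'d \<Rightarrow> real \<Rightarrow> (real^'d \<Rightarrow> real) \<Rightarrow> real^'d \<Rightarrow> real" where
  "line_diff i s \<psi> x = \<psi> (x + s *\<^sub>R axis i 1) - \<psi> x"

lemma coord_diff_eq_funpow:
  fixes \<psi> :: "real^'d \<Rightarrow> real"
  shows "coord_diff i m s \<psi> = (line_diff i s ^^ m) \<psi>"
proof (induction m)
  case 0
  have "set_coord i (x $ i) x = x" for x :: "real^'d" by (simp add: set_coord_def vec_eq_iff)
  then show ?case by (simp add: fun_eq_iff coord_diff_def fdiff_def)
next
  case (Suc m)
  have shift: "fdiff m s (\<lambda>u. \<psi> (set_coord i u x)) (x $ i + s) = coord_diff i m s \<psi> (x + s *\<^sub>R axis i 1)" for x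
  proof -
    have "set_coord i u (x + s *\<^sub>R axis i 1) = set_coord i u x" for u
      by (auto simp: set_coord_def vec_eq_iff axis_def)
    then show ?thesis by (simp add: coord_diff_def axis_def)
  qed
  have "coord_diff i (Suc m) s \<psi> = line_diff i s (coord_diff i m s \<psi>)"
    unfolding line_diff_def shift[symmetric] by (rule ext) (simp add: coord_diff_def fdiff_Suc)
  then show ?case using Suc by simp
qed

text \<open>
  Differences along a list of coordinates run parallel to iterated partial derivatives along the
  same list, and one induction over the list can treat both.
\<close>

lemma mixed_diff_eq_foldr:
  fixes r :: "nat^'d::finite"
  shows "\<exists>ks. (\<forall>i. count_list ks i = r $ i) \<and>
    (\<forall>h \<phi>. mixed_diff r h \<phi> = foldr (\<lambda>i. line_diff i (h $ i)) ks \<phi>)"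
proof -
  have "\<exists>ks. (\<forall>i. count_list ks i = (if i \<in> S then r $ i else 0)) \<and>
    (\<forall>h \<phi>. Finite_Set.fold (\<lambda>i. coord_diff i (r $ i) (h $ i)) \<phi> S = foldr (\<lambda>i. line_diff i (h $ i)) ks \<phi>)"
    if "finite S" for S
    using that
  proof (induction S rule: finite_induct)
    case empty
    show ?case by (intro exI[of _ "[]"]) auto
  next
    case (insert k S)
    obtain ks where ks: "\<And>i. count_list ks i = (if i \<in> S then r $ i else 0)"
      "\<And>h \<phi>. Finite_Set.fold (\<lambda>i. coord_diff i (r $ i) (h $ i)) \<phi> S = foldr (\<lambda>i. line_diff i (h $ i)) ks \<phi>"
      using insert.IH by blast
    have cr: "count_list (replicate n k) i = (if i = k then n else 0)" for n i
      by (induction n) auto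
    have fr: "foldr f (replicate n k) z = (f k ^^ n) z" for f :: "'d \<Rightarrow> (real^'d \<Rightarrow> real) \<Rightarrow> (real^'d \<Rightarrow> real)" and n z
      by (induction n) auto
    have "Finite_Set.fold (\<lambda>i. coord_diff i (r $ i) (h $ i)) \<phi> (insert k S)
       = foldr (\<lambda>i. line_diff i (h $ i)) (replicate (r $ k) k @ ks) \<phi>" for h \<phi>
    proof -
      interpret comp_fun_commute "\<lambda>i. coord_diff i (r $ i) (h $ i)"
        by (rule coord_diff_comp_fun_commute)
      show ?thesis using insert.hyps by (simp add: ks(2) coord_diff_eq_funpow fr)
    qed
    then show ?case using insert.hyps
      by (intro exI[of _ "replicate (r $ k) k @ ks"]) (auto simp: count_list_append cr ks(1))
  qed
  from this[of UNIV] show ?thesis by (simp add: mixed_diff_def)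
qed

lemma iter_partial_zero_outside:
  fixes \<phi> :: "real^'d::finite \<Rightarrow> real"
  assumes K: "closed K" and z: "\<And>x. x \<notin> K \<Longrightarrow> \<phi> x = 0"
  shows "x \<notin> K \<Longrightarrow> iter_partial ks \<phi> x = 0"
proof (induction ks arbitrary: x)
  case (Cons k ks)
  have "open ((\<lambda>s. x + s *\<^sub>R axis k 1) -` (- K))"
    using K by (intro continuous_open_vimage) (auto intro!: continuous_intros)
  moreover have "0 \<in> (\<lambda>s. x + s *\<^sub>R axis k 1) -` (- K)" using Cons.prems by simp
  ultimately have "\<forall>\<^sub>F s in nhds 0. s \<in> (\<lambda>s. x + s *\<^sub>R axis k 1) -` (- K)"
    by (rule eventually_nhds_in_open)
  then have "\<forall>\<^sub>F s in nhds 0. iter_partial ks \<phi> (x + s *\<^sub>R axis k 1) = 0"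
    by (rule eventually_mono) (auto intro!: Cons.IH)
  then have "((\<lambda>s. iter_partial ks \<phi> (x + s *\<^sub>R axis k 1)) has_real_derivative 0) (at 0)"
    by (subst DERIV_cong_ev[OF refl _ refl]) auto
  then show ?case by (simp add: iter_partial_def partial_def DERIV_imp_deriv)
qed (use z in simp)

lemma iter_partial_Cons: "iter_partial (k # ks) \<phi> = partial k (iter_partial ks \<phi>)"
  by (simp add: iter_partial_def)

lemma has_derivative_along_axis:
  fixes \<psi> :: "real^'d::finite \<Rightarrow> real"
  assumes "\<psi> differentiable_on UNIV"
  shows "((\<lambda>s. \<psi> (y + (s * c) *\<^sub>R axis k 1)) has_real_derivative c * partial k \<psi> (y + (s * c) *\<^sub>R axis k 1)) (at s)"
proof -
  have d: "((\<lambda>s. \<psi> (z + s *\<^sub>R axis k 1)) has_real_derivative partial k \<psi> z) (at 0)" for z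
  proof -
    have "\<psi> differentiable at (z + 0 *\<^sub>R axis k 1)" using assms by (simp add: differentiable_on_def)
    moreover have "(\<lambda>s. z + s *\<^sub>R axis k 1) differentiable at 0" by (intro derivative_intros)
    ultimately have "(\<psi> \<circ> (\<lambda>s. z + s *\<^sub>R axis k 1)) differentiable at 0" by (intro differentiable_chain_at)
    then have "(\<lambda>s. \<psi> (z + s *\<^sub>R axis k 1)) field_differentiable at 0"
      by (simp add: o_def real_differentiable_def field_differentiable_def)
    then show ?thesis unfolding partial_def by (simp add: field_differentiable_derivI)
  qed
  have "((\<lambda>u. (u - s) * c) has_real_derivative c) (at s)" by (auto intro!: derivative_eq_intros)
  from DERIV_chain2[OF _ this, of "\<lambda>v. \<psi> (y + (s * c) *\<^sub>R axis k 1 + v *\<^sub>R axis k 1)"] d[of "y + (s * c) *\<^sub>R axis k 1"]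
  have "((\<lambda>u. \<psi> (y + (s * c) *\<^sub>R axis k 1 + ((u - s) * c) *\<^sub>R axis k 1)) has_real_derivative
      partial k \<psi> (y + (s * c) *\<^sub>R axis k 1) * c) (at s)" by simp
  moreover have "y + (s * c) *\<^sub>R axis k 1 + ((u - s) * c) *\<^sub>R axis k 1 = y + (u * c) *\<^sub>R axis k 1" for u
    by (simp add: algebra_simps)
  ultimately show ?thesis by (simp only: mult.commute[of "partial k _ _"])
qed

lemma test_function_bounded:
  fixes \<phi> :: "real^'d::finite \<Rightarrow> real"
  assumes "test_function U \<phi>"
  obtains B where "0 \<le> B" "\<And>x. \<bar>iter_partial ks \<phi> x\<bar> \<le> B"
proof -
  obtain K where K: "compact K" "\<And>x. x \<notin> K \<Longrightarrow> \<phi> x = 0"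
    using assms unfolding test_function_def by blast
  have "bounded (iter_partial ks \<phi> ` K)"
    by (intro compact_imp_bounded compact_continuous_image K continuous_on_subset[OF test_function_continuous[OF assms]]) auto
  then obtain B where B: "\<And>x. x \<in> K \<Longrightarrow> \<bar>iter_partial ks \<phi> x\<bar> \<le> B"
    by (auto simp: bounded_iff)
  have "\<bar>iter_partial ks \<phi> x\<bar> \<le> max B 0" for x
    using B[of x] iter_partial_zero_outside[OF compact_imp_closed[OF K(1)] K(2), where x=x and ks=ks]
    by (cases "x \<in> K") auto
  then show ?thesis by (intro that[of "max B 0"]) auto
qed

definition uniform01 :: "real measure" where
  "uniform01 = density lborel (\<lambda>x. ennreal (indicator {0..1} x))"

lemma sets_uniform01 [measurable_cong, simp]: "sets uniform01 = sets borel"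
  by (simp add: uniform01_def)

lemma prob_space_uniform01: "prob_space uniform01"
  by standard (simp add: uniform01_def emeasure_density ennreal_indicator)

text \<open>
  A first difference with step \<open>h\<^sub>k\<close> is \<open>h\<^sub>k\<close> times the average of the partial derivative over the
  segment.  Iterating this gives an average over a sum of independent vectors, each uniformly
  distributed on one segment; \<open>\<mu>\<close> is the law of this sum.  That \<open>\<mu>\<close> does not depend on the test
  function makes the argument by duality possible.
\<close>

lemma test_function_line_diffs:
  fixes h :: "real^'d::finite"
  shows "\<exists>\<mu>. prob_space \<mu> \<and> sets \<mu> = sets borel \<and>
    (AE s in \<mu>. s \<in> cbox (\<chi> i. min 0 (real (count_list ks i) * h $ i)) (\<chi> i. max 0 (real (count_list ks i) * h $ i))) \<and>
    (\<forall>U \<phi> x. test_function U \<phi> \<longrightarrow> foldr (\<lambda>i. line_diff i (h $ i)) ks \<phi> x =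
      (\<Prod>i\<leftarrow>ks. h $ i) * (\<integral>s. iter_partial ks \<phi> (x + s) \<partial>\<mu>))"
proof (induction ks)
  case Nil
  have "(AE s in return borel 0. s \<in> cbox (\<chi> i. min 0 (real (count_list [] i) * h $ i)) (\<chi> i. max 0 (real (count_list [] i) * h $ i)))"
    by (subst AE_return) (auto simp: mem_box_cart zero_vec_def)
  moreover have "(\<integral>s. \<phi> (x + s) \<partial>return borel 0) = \<phi> x" if "test_function U \<phi>" for U \<phi> and x :: "real^'d"
  proof -
    have [measurable]: "\<phi> \<in> borel_measurable borel"
      using borel_measurable_continuous_onI[OF test_function_continuous[OF that, where ks="[]"]] by simp
    show ?thesis by (subst integral_return) auto
  qed
  ultimately show ?case by (intro exI[of _ "return borel 0"]) (auto simp: prob_space_return)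
next
  case (Cons k ks)
  then obtain \<mu> where \<mu>: "prob_space \<mu>" and s\<mu>[measurable_cong]: "sets \<mu> = sets borel"
    and supp: "AE s in \<mu>. s \<in> cbox (\<chi> i. min 0 (real (count_list ks i) * h $ i)) (\<chi> i. max 0 (real (count_list ks i) * h $ i))"
    and rep: "\<And>U \<phi> x. test_function U \<phi> \<Longrightarrow> foldr (\<lambda>i. line_diff i (h $ i)) ks \<phi> x =
      (\<Prod>i\<leftarrow>ks. h $ i) * (\<integral>s. iter_partial ks \<phi> (x + s) \<partial>\<mu>)"
    by blast
  interpret \<mu>: prob_space \<mu> by fact
  interpret u: prob_space uniform01 by (rule prob_space_uniform01)
  interpret pair: pair_prob_space \<mu> uniform01 ..
  \<comment> \<open>Adding one more uniformly distributed segment vector to the random shift.\<close>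
  define T where "T = (\<lambda>(s :: real^'d, \<theta>). s + (\<theta> * h $ k) *\<^sub>R axis k 1)"
  have [measurable]: "T \<in> measurable (\<mu> \<Otimes>\<^sub>M uniform01) borel"
    unfolding T_def by measurable
  define \<nu> where "\<nu> = distr (\<mu> \<Otimes>\<^sub>M uniform01) borel T"
  have "prob_space \<nu>" unfolding \<nu>_def by (rule pair.prob_space_distr) measurable
  moreover have "sets \<nu> = sets borel" by (simp add: \<nu>_def)
  moreover have "AE s in \<nu>. s \<in> cbox (\<chi> i. min 0 (real (count_list (k # ks) i) * h $ i)) (\<chi> i. max 0 (real (count_list (k # ks) i) * h $ i))"
  proof -
    have "AE \<theta> in uniform01. \<theta> \<in> {0..1}"
      unfolding uniform01_def by (subst AE_density) (auto simp: indicator_def)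
    note u_ae = this
    have "AE z in \<mu> \<Otimes>\<^sub>M uniform01. snd z \<in> {0..1}"
    proof (rule pair.AE_pair_measure)
      show "AE x in \<mu>. AE y in uniform01. snd (x, y) \<in> {0..1}" using u_ae by simp
    qed measurable
    moreover have "AE z in \<mu> \<Otimes>\<^sub>M uniform01. fst z \<in> cbox (\<chi> i. min 0 (real (count_list ks i) * h $ i)) (\<chi> i. max 0 (real (count_list ks i) * h $ i))"
    proof (rule pair.AE_pair_measure)
      show "AE x in \<mu>. AE y in uniform01. fst (x, y) \<in> cbox (\<chi> i. min 0 (real (count_list ks i) * h $ i)) (\<chi> i. max 0 (real (count_list ks i) * h $ i))"
        using supp by simp
    qed measurable
    ultimately have "AE z in \<mu> \<Otimes>\<^sub>M uniform01. T z \<in> cbox (\<chi> i. min 0 (real (count_list (k # ks) i) * h $ i)) (\<chi> i. max 0 (real (count_list (k # ks) i) * h $ i))"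
    proof eventually_elim
      case (elim z)
      obtain s \<theta> where z: "z = (s, \<theta>)" by force
      have s: "min 0 (real (count_list ks i) * h $ i) \<le> s $ i" "s $ i \<le> max 0 (real (count_list ks i) * h $ i)" for i
        using elim z by (auto simp: mem_box_cart)
      have t: "0 \<le> \<theta>" "\<theta> \<le> 1" using elim z by auto
      have mn: "min 0 (c * x) = c * min 0 x" and mx: "max 0 (c * x) = c * max 0 x" if "0 \<le> c" for c x :: real
        using that by (simp_all add: min_mult_distrib_left max_mult_distrib_left)
      have "\<theta> * min 0 (h $ k) \<le> \<theta> * h $ k" "\<theta> * h $ k \<le> \<theta> * max 0 (h $ k)"
        using t by (intro mult_left_mono; simp)+
      moreover have "1 * min 0 (h $ k) \<le> \<theta> * min 0 (h $ k)" "\<theta> * max 0 (h $ k) \<le> 1 * max 0 (h $ k)"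
        using t by (intro mult_right_mono_neg mult_right_mono; simp)+
      ultimately have "min 0 (h $ k) \<le> \<theta> * h $ k" "\<theta> * h $ k \<le> max 0 (h $ k)" by linarith+
      moreover have "min 0 (real (Suc (count_list ks k)) * h $ k) = min 0 (real (count_list ks k) * h $ k) + min 0 (h $ k)"
        "max 0 (real (Suc (count_list ks k)) * h $ k) = max 0 (real (count_list ks k) * h $ k) + max 0 (h $ k)"
        using mn[of "real (Suc (count_list ks k))" "h $ k"] mn[of "real (count_list ks k)" "h $ k"]
          mx[of "real (Suc (count_list ks k))" "h $ k"] mx[of "real (count_list ks k)" "h $ k"]
        by (simp_all add: distrib_right)
      ultimately have "min 0 (real (Suc (count_list ks k)) * h $ k) \<le> s $ k + \<theta> * h $ k"
        "s $ k + \<theta> * h $ k \<le> max 0 (real (Suc (count_list ks k)) * h $ k)"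
        using s[of k] by linarith+
      then show ?case using s by (auto simp: T_def z mem_box_cart axis_def)
    qed
    then show ?thesis unfolding \<nu>_def by (subst AE_distr_iff) auto
  qed
  moreover have "foldr (\<lambda>i. line_diff i (h $ i)) (k # ks) \<phi> x =
      (\<Prod>i\<leftarrow>(k # ks). h $ i) * (\<integral>s. iter_partial (k # ks) \<phi> (x + s) \<partial>\<nu>)" if \<phi>: "test_function U \<phi>" for U \<phi> x
  proof -
    let ?\<psi> = "iter_partial ks \<phi>" and ?\<psi>' = "iter_partial (k # ks) \<phi>" and ?e = "axis k 1 :: real^'d"
    have [measurable]: "?\<psi> \<in> borel_measurable borel" "?\<psi>' \<in> borel_measurable borel"
      by (intro borel_measurable_continuous_onI test_function_continuous[OF \<phi>])+
    obtain B where B: "0 \<le> B" "\<And>x. \<bar>?\<psi> x\<bar> \<le> B" using test_function_bounded[OF \<phi>, of ks] by blast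
    obtain B' where B': "0 \<le> B'" "\<And>x. \<bar>?\<psi>' x\<bar> \<le> B'" using test_function_bounded[OF \<phi>, of "k # ks"] by blast
    have int: "integrable \<mu> (\<lambda>s. ?\<psi> (y + s))" for y
      using B by (intro \<mu>.integrable_const_bound[where B=B]) auto
    have ftc: "?\<psi> (y + h $ k *\<^sub>R ?e) - ?\<psi> y = h $ k * (\<integral>\<theta>. ?\<psi>' (y + (\<theta> * h $ k) *\<^sub>R ?e) \<partial>uniform01)" for y
    proof -
      have "(\<integral>\<theta>. (h $ k * ?\<psi>' (y + (\<theta> * h $ k) *\<^sub>R ?e)) * indicator {0..1} \<theta> \<partial>lborel)
         = ?\<psi> (y + (1 * h $ k) *\<^sub>R ?e) - ?\<psi> (y + (0 * h $ k) *\<^sub>R ?e)"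
      proof (rule integral_FTC_Icc_real)
        fix s :: real
        show "((\<lambda>s. ?\<psi> (y + (s * h $ k) *\<^sub>R ?e)) has_real_derivative h $ k * ?\<psi>' (y + (s * h $ k) *\<^sub>R ?e)) (at s)"
          unfolding iter_partial_Cons using \<phi> by (intro has_derivative_along_axis) (auto simp: test_function_def)
        have "continuous_on UNIV (\<lambda>s. h $ k * ?\<psi>' (y + (s * h $ k) *\<^sub>R ?e))"
          by (intro continuous_intros continuous_on_compose2[OF test_function_continuous[OF \<phi>]]) auto
        then show "isCont (\<lambda>s. h $ k * ?\<psi>' (y + (s * h $ k) *\<^sub>R ?e)) s"
          by (simp add: continuous_on_eq_continuous_at)
      qed simp
      moreover have "(\<integral>\<theta>. ?\<psi>' (y + (\<theta> * h $ k) *\<^sub>R ?e) \<partial>uniform01)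
          = (\<integral>\<theta>. indicator {0..1} \<theta> *\<^sub>R ?\<psi>' (y + (\<theta> * h $ k) *\<^sub>R ?e) \<partial>lborel)"
        unfolding uniform01_def by (subst integral_density) auto
      ultimately show ?thesis by (simp add: mult_ac)
    qed
    have "foldr (\<lambda>i. line_diff i (h $ i)) (k # ks) \<phi> x =
       foldr (\<lambda>i. line_diff i (h $ i)) ks \<phi> (x + h $ k *\<^sub>R ?e) - foldr (\<lambda>i. line_diff i (h $ i)) ks \<phi> x"
      by (simp add: line_diff_def)
    also have "\<dots> = (\<Prod>i\<leftarrow>ks. h $ i) * ((\<integral>s. ?\<psi> (x + h $ k *\<^sub>R ?e + s) \<partial>\<mu>) - (\<integral>s. ?\<psi> (x + s) \<partial>\<mu>))"
      unfolding rep[OF \<phi>] by (simp add: right_diff_distrib)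
    also have "(\<integral>s. ?\<psi> (x + h $ k *\<^sub>R ?e + s) \<partial>\<mu>) - (\<integral>s. ?\<psi> (x + s) \<partial>\<mu>)
        = (\<integral>s. ?\<psi> (x + h $ k *\<^sub>R ?e + s) - ?\<psi> (x + s) \<partial>\<mu>)"
      by (rule Bochner_Integration.integral_diff[symmetric]) (rule int)+
    also have "\<dots> = (\<integral>s. ?\<psi> ((x + s) + h $ k *\<^sub>R ?e) - ?\<psi> (x + s) \<partial>\<mu>)"
      by (simp add: add_ac)
    also have "\<dots> = h $ k * (\<integral>s. (\<integral>\<theta>. ?\<psi>' (x + s + (\<theta> * h $ k) *\<^sub>R ?e) \<partial>uniform01) \<partial>\<mu>)"
      unfolding ftc by simp
    also have "(\<integral>s. (\<integral>\<theta>. ?\<psi>' (x + s + (\<theta> * h $ k) *\<^sub>R ?e) \<partial>uniform01) \<partial>\<mu>)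
       = (\<integral>z. ?\<psi>' (x + fst z + (snd z * h $ k) *\<^sub>R ?e) \<partial>(\<mu> \<Otimes>\<^sub>M uniform01))"
    proof -
      have "integrable (\<mu> \<Otimes>\<^sub>M uniform01) (\<lambda>z. ?\<psi>' (x + fst z + (snd z * h $ k) *\<^sub>R ?e))"
        using B' by (intro pair.integrable_const_bound[where B=B']) auto
      from pair.integral_fst'[OF this] show ?thesis by simp
    qed
    also have "\<dots> = (\<integral>s. ?\<psi>' (x + s) \<partial>\<nu>)"
      unfolding \<nu>_def by (subst integral_distr) (auto simp: T_def split_beta add.assoc)
    finally show ?thesis by (simp add: mult_ac)
  qed
  ultimately show ?case by blast
qed

section \<open>Differences of weakly differentiable functions\<close>

lemma integrable_lborel_translate:
  fixes f :: "'a::euclidean_space \<Rightarrow> real"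
  assumes [measurable]: "f \<in> borel_measurable borel"
  shows "integrable lborel (\<lambda>x. f (x + s)) \<longleftrightarrow> integrable lborel f"
proof -
  have "integrable (distr lborel borel ((+) s)) f \<longleftrightarrow> integrable lborel (\<lambda>x. f (s + x))"
    by (rule integrable_distr_eq) auto
  then show ?thesis unfolding lborel_distr_plus by (simp add: add.commute)
qed

lemma integral_lborel_translate:
  fixes f :: "'a::euclidean_space \<Rightarrow> real"
  assumes [measurable]: "f \<in> borel_measurable borel"
  shows "(\<integral>x. f (x + s) \<partial>lborel) = (\<integral>x. f x \<partial>lborel)"
proof -
  have "(\<integral>x. f x \<partial>distr lborel borel ((+) s)) = (\<integral>x. f (s + x) \<partial>lborel)"
    by (rule integral_distr) auto
  then show ?thesis unfolding lborel_distr_plus by (simp add: add.commute)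
qed

lemma nn_integral_lborel_translate:
  fixes f :: "'a::euclidean_space \<Rightarrow> ennreal"
  assumes [measurable]: "f \<in> borel_measurable borel"
  shows "(\<integral>\<^sup>+x. f (x + s) \<partial>lborel) = (\<integral>\<^sup>+x. f x \<partial>lborel)"
proof -
  have "(\<integral>\<^sup>+x. f x \<partial>distr lborel borel ((+) s)) = (\<integral>\<^sup>+x. f (s + x) \<partial>lborel)"
    by (rule nn_integral_distr) auto
  then show ?thesis unfolding lborel_distr_plus by (simp add: add.commute)
qed

lemma integral_lebesgue_AE_eq:
  fixes f u :: "'a::euclidean_space \<Rightarrow> real"
  assumes u: "u \<in> borel_measurable borel" and ae: "AE x in lborel. f x = u x"
  shows "(\<integral>x. f x \<partial>lebesgue) = (\<integral>x. u x \<partial>lborel)"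
    and "integrable lebesgue f \<longleftrightarrow> integrable lborel u"
proof -
  have f: "f \<in> borel_measurable lebesgue" by (rule borel_measurable_lebesgue_AE_eq[OF u ae])
  have ul: "u \<in> borel_measurable lebesgue" using u by (intro measurable_completion) simp
  have ae': "AE x in lebesgue. f x = u x" using ae by (simp add: AE_completion_iff)
  show "(\<integral>x. f x \<partial>lebesgue) = (\<integral>x. u x \<partial>lborel)"
    using integral_cong_AE[OF f ul ae'] u by (simp add: integral_completion)
  show "integrable lebesgue f \<longleftrightarrow> integrable lborel u"
    using integrable_cong_AE[OF f ul ae'] u by (simp add: integrable_completion)
qed

lemma iter_partial_translate:
  "iter_partial ks (\<lambda>x. \<phi> (x + s)) = (\<lambda>x. iter_partial ks \<phi> (x + s))"
proof (induction ks)
  case (Cons k ks)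
  then show ?case by (simp add: iter_partial_Cons partial_def fun_eq_iff add_ac)
qed simp

lemma test_function_translate:
  fixes \<phi> :: "real^'d::finite \<Rightarrow> real"
  assumes \<phi>: "test_function U \<phi>" and V: "\<And>z. z \<in> U \<Longrightarrow> z - s \<in> V"
  shows "test_function V (\<lambda>x. \<phi> (x + s))"
  unfolding test_function_def
proof (intro conjI allI)
  fix ks
  have "iter_partial ks \<phi> differentiable_on UNIV" using \<phi> by (simp add: test_function_def)
  then show "iter_partial ks (\<lambda>x. \<phi> (x + s)) differentiable_on UNIV"
    unfolding iter_partial_translate differentiable_on_def
    using differentiable_chain_at[of "\<lambda>x. x + s" _ "iter_partial ks \<phi>"] by (simp add: o_def)
  obtain K where K: "compact K" "K \<subseteq> U" "\<forall>x. x \<notin> K \<longrightarrow> \<phi> x = 0"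
    using \<phi> unfolding test_function_def by blast
  show "\<exists>K. compact K \<and> K \<subseteq> V \<and> (\<forall>x. x \<notin> K \<longrightarrow> \<phi> (x + s) = 0)"
  proof (intro exI[of _ "(\<lambda>z. z - s) ` K"] conjI allI impI)
    show "compact ((\<lambda>z. z - s) ` K)" using K(1) by (rule compact_translation_subtract)
    show "(\<lambda>z. z - s) ` K \<subseteq> V" using K(2) V by auto
    fix x assume "x \<notin> (\<lambda>z. z - s) ` K"
    then have "x + s \<notin> K" by (metis add_diff_cancel_right' image_eqI)
    then show "\<phi> (x + s) = 0" using K(3) by blast
  qed
qed

lemma Lp_bounded_integrable:
  fixes F :: "real^'d::finite \<Rightarrow> real"
  assumes p: "1 \<le> p" and [measurable]: "F \<in> borel_measurable borel"
    and F0: "\<And>x. x \<notin> cbox a b \<Longrightarrow> F x = 0" and F: "Lp_bounded p m F"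
  shows "integrable lborel F"
proof (cases "p = \<infinity>")
  case True
  have ind: "integrable lborel (indicator (cbox a b) :: real^'d \<Rightarrow> real)"
    by (rule integrable_real_indicator) (auto intro: emeasure_bounded_finite[unfolded infinity_ennreal_def])
  show ?thesis
  proof (rule Bochner_Integration.integrable_bound)
    show "integrable lborel (\<lambda>x. m * indicator (cbox a b) x :: real)" using ind by simp
    show "AE x in lborel. norm (F x) \<le> norm (m * indicator (cbox a b) x :: real)"
      using F unfolding Lp_bounded_def if_P[OF True]
      by eventually_elim (use F0 in \<open>auto simp: indicator_def\<close>)
  qed simp
next
  case False
  define q where "q = enn2real p"
  have q: "1 \<le> q" using enn2real_ge_1[OF p False] by (simp add: q_def)
  have "(\<integral>\<^sup>+x. ennreal (\<bar>F x\<bar> powr q) \<partial>lborel) \<le> ennreal (m powr q)"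
    using F False by (simp add: Lp_bounded_def q_def)
  then have Fq: "integrable lborel (\<lambda>x. \<bar>F x\<bar> powr q)"
    by (subst integrable_iff_bounded) (auto simp: le_less_trans)
  show ?thesis
  proof (rule Bochner_Integration.integrable_bound)
    have "integrable lborel (indicator (cbox a b) :: real^'d \<Rightarrow> real)"
      by (rule integrable_real_indicator) (auto intro: emeasure_bounded_finite[unfolded infinity_ennreal_def])
    then show "integrable lborel (\<lambda>x. indicator (cbox a b) x + \<bar>F x\<bar> powr q)"
      using Fq by (rule Bochner_Integration.integrable_add)
    have "\<bar>y\<bar> \<le> 1 + \<bar>y\<bar> powr q" for y
    proof (cases "\<bar>y\<bar> \<le> 1")
      case False then have "\<bar>y\<bar> powr 1 \<le> \<bar>y\<bar> powr q" using q by (intro powr_mono) auto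
      then show ?thesis using False by auto
    next
      case True
      moreover have "0 \<le> \<bar>y\<bar> powr q" by simp
      ultimately show ?thesis by linarith
    qed
    then have "\<bar>F x\<bar> \<le> indicator (cbox a b) x + \<bar>F x\<bar> powr q" for x
      using F0[of x] by (cases "x \<in> cbox a b") simp_all
    then show "AE x in lborel. norm (F x) \<le> norm (indicator (cbox a b) x + \<bar>F x\<bar> powr q)"
      by (auto intro!: AE_I2 order_trans[OF _ abs_ge_self])
  qed measurable
qed

text \<open>
  Summation by parts: a translation of the variable in every term of the expansion.
\<close>

lemma integral_mixed_diff_mult:
  fixes F \<phi> :: "real^'d::finite \<Rightarrow> real"
  assumes [measurable]: "\<phi> \<in> borel_measurable borel" and F: "integrable lborel F"
    and B: "\<And>x. \<bar>\<phi> x\<bar> \<le> B"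
  shows "integrable lborel (\<lambda>x. mixed_diff r h F x * \<phi> x)"
    and "(\<integral>x. mixed_diff r h F x * \<phi> x \<partial>lborel) = (\<integral>x. F x * mixed_diff r (- h) \<phi> x \<partial>lborel)"
proof -
  have [measurable]: "F \<in> borel_measurable borel" using F by auto
  have int: "integrable lborel (\<lambda>x. F x * \<phi> (x - s))" for s
    by (rule Bochner_Integration.integrable_bound[OF integrable_mult_left[OF integrable_abs[OF F], of B]])
       (auto simp: abs_mult intro!: AE_I2 mult_left_mono order_trans[OF B] abs_ge_self)
  have int2: "integrable lborel (\<lambda>x. F (x + s) * \<phi> x)" for s
    using integrable_lborel_translate[of "\<lambda>x. F x * \<phi> (x - s)" s] int[of s] by simp
  have eq: "(\<integral>x. F (x + s) * \<phi> x \<partial>lborel) = (\<integral>x. F x * \<phi> (x - s) \<partial>lborel)" for s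
    using integral_lborel_translate[of "\<lambda>x. F x * \<phi> (x - s)" s] by simp
  have neg: "index_scale j (- h) = - index_scale j h" for j
    by (simp add: index_scale_def vec_eq_iff)
  have i2: "integrable lborel (\<lambda>x. diff_coeff r j * (F (x + index_scale j h) * \<phi> x))" for j
    using int2 by simp
  show "integrable lborel (\<lambda>x. mixed_diff r h F x * \<phi> x)"
    unfolding mixed_diff_expand sum_distrib_right mult.assoc using i2 by auto
  have "(\<integral>x. mixed_diff r h F x * \<phi> x \<partial>lborel) = (\<Sum>j\<in>multi_indices r. diff_coeff r j * (\<integral>x. F (x + index_scale j h) * \<phi> x \<partial>lborel))"
    unfolding mixed_diff_expand sum_distrib_right mult.assoc using i2
    by (subst Bochner_Integration.integral_sum) auto
  also have "\<dots> = (\<Sum>j\<in>multi_indices r. diff_coeff r j * (\<integral>x. F x * \<phi> (x - index_scale j h) \<partial>lborel))"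
    unfolding eq ..
  also have "\<dots> = (\<integral>x. (\<Sum>j\<in>multi_indices r. diff_coeff r j * (F x * \<phi> (x - index_scale j h))) \<partial>lborel)"
    using int by (subst Bochner_Integration.integral_sum) auto
  also have "\<dots> = (\<integral>x. F x * mixed_diff r (- h) \<phi> x \<partial>lborel)"
    unfolding mixed_diff_expand neg sum_distrib_left
    by (intro Bochner_Integration.integral_cong sum.cong) (auto simp: mult_ac)
  finally show "(\<integral>x. mixed_diff r h F x * \<phi> x \<partial>lborel) = (\<integral>x. F x * mixed_diff r (- h) \<phi> x \<partial>lborel)" .
qed

lemma integrable_mixed_diff:
  fixes F :: "real^'d::finite \<Rightarrow> real"
  assumes "integrable lborel F" shows "integrable lborel (mixed_diff r h F)"
  using integral_mixed_diff_mult(1)[OF _ assms, of "\<lambda>x. 1" 1 r h] by simp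

lemma prod_list_count:
  fixes f :: "'d::finite \<Rightarrow> real"
  shows "(\<Prod>i\<leftarrow>ks. f i) = (\<Prod>i\<in>UNIV. f i ^ count_list ks i)"
proof (induction ks)
  case (Cons k ks)
  have "(\<Prod>i\<in>UNIV. f i ^ count_list (k # ks) i) = (\<Prod>i\<in>UNIV. (if i = k then f i else 1) * f i ^ count_list ks i)"
    by (intro prod.cong) auto
  also have "\<dots> = f k * (\<Prod>i\<in>UNIV. f i ^ count_list ks i)"
    by (simp add: prod.distrib)
  finally show ?case using Cons by simp
qed simp

lemma interior_shift_domain:
  fixes a b y z :: "real^'d::finite"
  assumes "z \<in> interior (shift_domain (cbox a b) y)"
  shows "z \<in> box a b" "z + y \<in> box a b"
proof -
  have "interior (shift_domain (cbox a b) y) \<subseteq> interior (cbox a b)"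
    by (rule interior_mono) (auto simp: shift_domain_def)
  then show "z \<in> box a b" using assms by auto
  have "(+) y ` interior (shift_domain (cbox a b) y) \<subseteq> interior (cbox a b)"
    using interior_subset[of "shift_domain (cbox a b) y"]
    by (intro interior_maximal open_translation open_interior) (auto simp: shift_domain_def add.commute)
  then show "z + y \<in> box a b" using assms by (auto simp: add.commute)
qed

text \<open>
  Both sides have the same integral against every test function \<open>\<phi>\<close> supported inside the domain of
  the difference: the difference is moved onto \<open>\<phi>\<close> and written as an average of derivatives of
  translates of \<open>\<phi>\<close>.  The translates are supported in the box, so the hypothesis on \<open>F\<close> and \<open>G\<close>
  applies to each of them.
\<close>

lemma mixed_diff_eq_average_of_weak_deriv:
  fixes F G :: "real^'d::finite \<Rightarrow> real"
  assumes F: "integrable lborel F" and G: "integrable lborel G"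
    and weak: "\<And>\<phi> ks. test_function (box a b) \<phi> \<Longrightarrow> (\<And>i. count_list ks i = k $ i) \<Longrightarrow>
      (\<integral>x. F x * iter_partial ks \<phi> x \<partial>lborel) = (-1) ^ (\<Sum>i\<in>UNIV. k $ i) * (\<integral>x. G x * \<phi> x \<partial>lborel)"
  shows "\<exists>\<mu>. prob_space \<mu> \<and> sets \<mu> = sets borel \<and>
    (AE x in lborel. x \<in> interior (shift_domain (cbox a b) (step_vec k h)) \<longrightarrow>
      mixed_diff k h F x = (\<Prod>i\<in>UNIV. h $ i ^ k $ i) * (\<integral>s. G (x - s) \<partial>\<mu>))"
proof -
  have [measurable]: "F \<in> borel_measurable borel" "G \<in> borel_measurable borel" using F G by auto
  obtain ks where ks: "\<And>i. count_list ks i = k $ i"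
    "\<And>h \<phi>. mixed_diff k h \<phi> = foldr (\<lambda>i. line_diff i (h $ i)) ks \<phi>"
    using mixed_diff_eq_foldr[of k] by blast
  obtain \<mu> where \<mu>: "prob_space \<mu>" and s\<mu>[measurable_cong]: "sets \<mu> = sets borel"
    and supp: "AE s in \<mu>. s \<in> cbox (\<chi> i. min 0 (real (count_list ks i) * (- h) $ i)) (\<chi> i. max 0 (real (count_list ks i) * (- h) $ i))"
    and rep0: "\<forall>U \<phi> x. test_function U \<phi> \<longrightarrow> foldr (\<lambda>i. line_diff i ((- h) $ i)) ks \<phi> x =
      (\<Prod>i\<leftarrow>ks. (- h) $ i) * (\<integral>s. iter_partial ks \<phi> (x + s) \<partial>\<mu>)"
    using test_function_line_diffs[of ks "- h"] by (elim exE conjE)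
  note rep = rep0[rule_format]
  interpret \<mu>: prob_space \<mu> by fact
  interpret pair: pair_sigma_finite "lborel :: (real^'d) measure" \<mu> ..
  define H where "H = (\<Prod>i\<in>UNIV. h $ i ^ k $ i)"
  define N where "N = (\<Sum>i\<in>UNIV. k $ i)"
  have H': "(\<Prod>i\<leftarrow>ks. (- h) $ i) = (-1) ^ N * H"
  proof -
    have "(\<Prod>i\<leftarrow>ks. (- h) $ i) = (\<Prod>i\<in>UNIV. ((-1) * h $ i) ^ k $ i)"
      by (simp add: prod_list_count ks(1))
    also have "\<dots> = (-1) ^ N * H"
      unfolding power_mult_distrib prod.distrib H_def N_def power_sum ..
    finally show ?thesis .
  qed
  define U' where "U' = interior (shift_domain (cbox a b) (step_vec k h))"
  define A where "A x = (\<integral>s. G (x - s) \<partial>\<mu>)" for x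
  have [measurable]: "A \<in> borel_measurable borel"
  proof -
    have "(\<lambda>x. \<integral>s. G (x - s) \<partial>\<mu>) \<in> borel_measurable lborel" by measurable
    then show ?thesis unfolding A_def by simp
  qed
  have conv: "integrable (lborel \<Otimes>\<^sub>M \<mu>) (\<lambda>(x, s). G (x - s) * \<phi> x)"
    if [measurable]: "\<phi> \<in> borel_measurable borel" and B: "\<And>x. \<bar>\<phi> x\<bar> \<le> B" "0 \<le> B" for \<phi> B
  proof (rule integrableI_bounded)
    have "(\<integral>\<^sup>+ z. ennreal (norm (case z of (x, s) \<Rightarrow> G (x - s) * \<phi> x)) \<partial>(lborel \<Otimes>\<^sub>M \<mu>))
      = (\<integral>\<^sup>+ s. \<integral>\<^sup>+ x. ennreal (norm (G (x - s) * \<phi> x)) \<partial>lborel \<partial>\<mu>)"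
      by (subst pair.nn_integral_snd[symmetric]) auto
    also have "\<dots> \<le> (\<integral>\<^sup>+ s. \<integral>\<^sup>+ x. ennreal (B * \<bar>G (x + (- s))\<bar>) \<partial>lborel \<partial>\<mu>)"
      using B by (intro nn_integral_mono ennreal_leI) (auto simp: abs_mult mult.commute intro!: mult_left_mono mult_right_mono)
    also have "\<dots> = (\<integral>\<^sup>+ s. \<integral>\<^sup>+ x. ennreal (B * \<bar>G x\<bar>) \<partial>lborel \<partial>\<mu>)"
      by (intro nn_integral_cong nn_integral_lborel_translate) auto
    also have "\<dots> = (\<integral>\<^sup>+ x. ennreal (B * \<bar>G x\<bar>) \<partial>lborel)" by (simp add: \<mu>.emeasure_space_1)
    also have "\<dots> < \<infinity>"
      using integrable_mult_right[OF integrable_abs[OF G], of B] B(2)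
      by (subst (asm) integrable_iff_bounded) (auto simp: abs_mult)
    finally show "(\<integral>\<^sup>+ z. ennreal (norm (case z of (x, s) \<Rightarrow> G (x - s) * \<phi> x)) \<partial>(lborel \<Otimes>\<^sub>M \<mu>)) < \<infinity>" .
  qed measurable
  have A_int: "integrable lborel (\<lambda>x. A x * \<phi> x)"
    and A_eq: "(\<integral>x. A x * \<phi> x \<partial>lborel) = (\<integral>s. \<integral>x. G (x - s) * \<phi> x \<partial>lborel \<partial>\<mu>)"
    if [measurable]: "\<phi> \<in> borel_measurable borel" and B: "\<And>x. \<bar>\<phi> x\<bar> \<le> B" "0 \<le> B" for \<phi> B
  proof -
    show "integrable lborel (\<lambda>x. A x * \<phi> x)" using pair.integrable_fst[OF conv[OF that]] by (simp add: A_def)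
    show "(\<integral>x. A x * \<phi> x \<partial>lborel) = (\<integral>s. \<integral>x. G (x - s) * \<phi> x \<partial>lborel \<partial>\<mu>)"
      using pair.Fubini_integral[OF conv[OF that]] by (simp add: A_def)
  qed
  have dF: "integrable lborel (mixed_diff k h F)" by (rule integrable_mixed_diff[OF F])
  have A_int1: "integrable lborel A" using A_int[of "\<lambda>x. 1" 1] by simp
  have "AE x in lborel. x \<in> U' \<longrightarrow> mixed_diff k h F x - H * A x = 0"
  proof (rule AE_zero_if_orthogonal_to_test_functions)
    show "open U'" by (simp add: U'_def)
    show "(\<lambda>x. mixed_diff k h F x - H * A x) \<in> borel_measurable borel" by measurable
    have "integrable lborel (\<lambda>x. mixed_diff k h F x - H * A x)" using dF A_int1 by simp
    then show "integrable lborel (\<lambda>x. indicat_real K x * (mixed_diff k h F x - H * A x))" if "compact K" for K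
      using integrable_real_mult_indicator[of K lborel "\<lambda>x. mixed_diff k h F x - H * A x"] compact_imp_closed[OF that]
      by (simp add: mult.commute)
    fix \<phi> assume \<phi>: "test_function U' \<phi>"
    let ?\<psi> = "iter_partial ks \<phi>"
    have [measurable]: "?\<psi> \<in> borel_measurable borel"
      by (intro borel_measurable_continuous_onI test_function_continuous[OF \<phi>])
    have [measurable]: "\<phi> \<in> borel_measurable borel"
      using borel_measurable_continuous_onI[OF test_function_continuous[OF \<phi>, where ks="[]"]] by simp
    obtain B where B: "0 \<le> B" "\<And>x. \<bar>\<phi> x\<bar> \<le> B" using test_function_bounded[OF \<phi>, of "[]"] by auto
    obtain B' where B': "0 \<le> B'" "\<And>x. \<bar>?\<psi> x\<bar> \<le> B'" using test_function_bounded[OF \<phi>, of ks] by blast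
    have int: "integrable (lborel \<Otimes>\<^sub>M \<mu>) (\<lambda>(x, s). F x * ?\<psi> (x + s))"
    proof (rule integrableI_bounded)
      have "(\<integral>\<^sup>+ z. ennreal (norm (case z of (x, s) \<Rightarrow> F x * ?\<psi> (x + s))) \<partial>(lborel \<Otimes>\<^sub>M \<mu>))
        = (\<integral>\<^sup>+ s. \<integral>\<^sup>+ x. ennreal (norm (F x * ?\<psi> (x + s))) \<partial>lborel \<partial>\<mu>)"
        by (subst pair.nn_integral_snd[symmetric]) auto
      also have "\<dots> \<le> (\<integral>\<^sup>+ s. \<integral>\<^sup>+ x. ennreal (B' * \<bar>F x\<bar>) \<partial>lborel \<partial>\<mu>)"
        using B' by (intro nn_integral_mono ennreal_leI) (simp add: abs_mult mult.commute[of B'] mult_left_mono)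
      also have "\<dots> = (\<integral>\<^sup>+ x. ennreal (B' * \<bar>F x\<bar>) \<partial>lborel)" by (simp add: \<mu>.emeasure_space_1)
      also have "\<dots> < \<infinity>"
        using integrable_mult_right[OF integrable_abs[OF F], of B'] B'(1)
        by (subst (asm) integrable_iff_bounded) (auto simp: abs_mult)
      finally show "(\<integral>\<^sup>+ z. ennreal (norm (case z of (x, s) \<Rightarrow> F x * ?\<psi> (x + s))) \<partial>(lborel \<Otimes>\<^sub>M \<mu>)) < \<infinity>" .
    qed measurable
    have swap: "(\<integral>x. F x * ?\<psi> (x + s) \<partial>lborel) = (-1) ^ N * (\<integral>x. G (x - s) * \<phi> x \<partial>lborel)"
      if s: "s \<in> cbox (\<chi> i. min 0 (real (count_list ks i) * (- h) $ i)) (\<chi> i. max 0 (real (count_list ks i) * (- h) $ i))" for s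
    proof -
      have "test_function (box a b) (\<lambda>x. \<phi> (x + s))"
      proof (rule test_function_translate[OF \<phi>])
        fix z assume "z \<in> U'"
        then have z: "z \<in> box a b" "z + step_vec k h \<in> box a b"
          unfolding U'_def by (rule interior_shift_domain)+
        have "a $ i < (z - s) $ i \<and> (z - s) $ i < b $ i" for i
        proof -
          have "a $ i < z $ i" "z $ i < b $ i" "a $ i < z $ i + real (k $ i) * h $ i" "z $ i + real (k $ i) * h $ i < b $ i"
            using z by (auto simp: mem_box_cart)
          moreover have "min 0 (- (real (k $ i) * h $ i)) \<le> s $ i" "s $ i \<le> max 0 (- (real (k $ i) * h $ i))"
            using s by (auto simp: mem_box_cart ks(1))
          ultimately show ?thesis by (simp add: min_def max_def split: if_splits)
        qed
        then show "z - s \<in> box a b" by (simp add: mem_box_cart)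
      qed
      from weak[OF this ks(1)] have "(\<integral>x. F x * ?\<psi> (x + s) \<partial>lborel) = (-1) ^ N * (\<integral>x. G x * \<phi> (x + s) \<partial>lborel)"
        by (simp add: N_def iter_partial_translate)
      also have "(\<integral>x. G x * \<phi> (x + s) \<partial>lborel) = (\<integral>x. G (x - s) * \<phi> x \<partial>lborel)"
        using integral_lborel_translate[of "\<lambda>x. G (x - s) * \<phi> x" s] by simp
      finally show ?thesis .
    qed
    have "(\<integral>x. mixed_diff k h F x * \<phi> x \<partial>lborel) = (\<integral>x. F x * mixed_diff k (- h) \<phi> x \<partial>lborel)"
      by (rule integral_mixed_diff_mult(2)[OF _ F B(2)]) simp
    also have "\<dots> = (-1) ^ N * H * (\<integral>x. F x * (\<integral>s. ?\<psi> (x + s) \<partial>\<mu>) \<partial>lborel)"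
      unfolding ks(2) rep[OF \<phi>] H' by (subst integral_mult_right_zero[symmetric]) (simp add: mult_ac)
    also have "(\<integral>x. F x * (\<integral>s. ?\<psi> (x + s) \<partial>\<mu>) \<partial>lborel) = (\<integral>s. \<integral>x. F x * ?\<psi> (x + s) \<partial>lborel \<partial>\<mu>)"
      using pair.Fubini_integral[OF int] by simp
    also have "\<dots> = (\<integral>s. (-1) ^ N * (\<integral>x. G (x - s) * \<phi> x \<partial>lborel) \<partial>\<mu>)"
      by (rule integral_cong_AE) (measurable, use supp in \<open>auto elim!: eventually_mono intro!: swap\<close>)
    also have "\<dots> = (-1) ^ N * (\<integral>x. A x * \<phi> x \<partial>lborel)"
      unfolding A_eq[of \<phi> B, OF _ B(2,1), simplified] by simp
    finally have "(\<integral>x. mixed_diff k h F x * \<phi> x \<partial>lborel) = H * (\<integral>x. A x * \<phi> x \<partial>lborel)"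
      by (simp add: power_mult_distrib[symmetric])
    moreover have "(\<integral>x. (mixed_diff k h F x - H * A x) * \<phi> x \<partial>lborel) =
       (\<integral>x. mixed_diff k h F x * \<phi> x \<partial>lborel) - H * (\<integral>x. A x * \<phi> x \<partial>lborel)"
      unfolding left_diff_distrib mult.assoc
      using integral_mixed_diff_mult(1)[OF _ F B(2), where r=k and h=h] A_int[of \<phi> B, OF _ B(2,1)]
      by (subst Bochner_Integration.integral_diff) auto
    ultimately show "(\<integral>x. (mixed_diff k h F x - H * A x) * \<phi> x \<partial>lborel) = 0" by simp
  qed
  then have "AE x in lborel. x \<in> U' \<longrightarrow> mixed_diff k h F x = H * (\<integral>s. G (x - s) \<partial>\<mu>)"
    by eventually_elim (simp add: A_def)
  then show ?thesis using \<mu> s\<mu> unfolding U'_def H_def by blast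
qed

section \<open>The lower estimate\<close>

lemma AE_cbox_imp_box:
  "AE x in lborel. x \<in> cbox a b \<longrightarrow> x \<in> box a (b :: 'a::euclidean_space)"
proof -
  have "cbox a b - box a b \<in> null_sets lborel"
  proof (rule null_setsI)
    show "emeasure lborel (cbox a b - box a b) = 0"
      by (subst emeasure_Diff) (auto simp: emeasure_lborel_cbox_eq emeasure_lborel_box_eq box_subset_cbox)
  qed auto
  from AE_not_in[OF this] show ?thesis by eventually_elim auto
qed

lemma borel_measurable_lebesgue_AE_cong:
  fixes f g :: "'a::euclidean_space \<Rightarrow> real"
  assumes "g \<in> borel_measurable lebesgue" and "AE x in lborel. f x = g x"
  shows "f \<in> borel_measurable lebesgue"
proof -
  obtain u where u: "u \<in> borel_measurable lborel" "AE x in lborel. g x = u x"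
    using completion_ex_borel_measurable_real[OF assms(1)] by blast
  have "AE x in lborel. f x = u x" using assms(2) u(2) by eventually_elim simp
  then show ?thesis using u(1) by (intro borel_measurable_lebesgue_AE_eq[of u]) simp
qed

text \<open>
  The open box is exhausted by compact boxes, and its boundary is a null set.
\<close>

lemma locally_integrable_imp_measurable:
  fixes G :: "real^'d::finite \<Rightarrow> real"
  assumes "locally_integrable (box a b) G"
  shows "G \<in> borel_measurable (lebesgue_on (cbox a b))"
proof -
  define K where "K n = cbox (a + inverse (real (Suc n)) *\<^sub>R 1) (b - inverse (real (Suc n)) *\<^sub>R 1)" for n
  have K: "K n \<subseteq> box a b" for n
  proof
    fix x assume "x \<in> K n"
    then have "a $ i < x $ i \<and> x $ i < b $ i" for i
    proof -
      have "a $ i + inverse (real (Suc n)) \<le> x $ i" "x $ i \<le> b $ i - inverse (real (Suc n))"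
        using \<open>x \<in> K n\<close> by (auto simp: K_def mem_box_cart)
      moreover have "0 < inverse (real (Suc n))" by simp
      ultimately show ?thesis by linarith
    qed
    then show "x \<in> box a b" by (simp add: mem_box_cart)
  qed
  have "(\<lambda>x. indicator (box a b) x * G x) \<in> borel_measurable lebesgue"
  proof (rule borel_measurable_LIMSEQ_real)
    show "(\<lambda>x. indicator (K n) x * G x) \<in> borel_measurable lebesgue" for n
    proof -
      have "set_integrable lebesgue (K n) G"
        using assms K[of n] by (auto simp: locally_integrable_def K_def)
      then have "(\<lambda>x. indicator (K n) x *\<^sub>R G x) \<in> borel_measurable lebesgue"
        unfolding set_integrable_def by (rule borel_measurable_integrable)
      then show ?thesis by simp
    qed
    fix x
    show "(\<lambda>n. indicator (K n) x * G x) \<longlonglongrightarrow> indicator (box a b) x * G x"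
    proof (cases "x \<in> box a b")
      case True
      have "\<forall>\<^sub>F n in sequentially. \<forall>i. inverse (real (Suc n)) < x $ i - a $ i \<and> inverse (real (Suc n)) < b $ i - x $ i"
      proof (rule eventually_all_finite)
        fix i
        have "0 < x $ i - a $ i" "0 < b $ i - x $ i" using True by (auto simp: mem_box_cart)
        then show "\<forall>\<^sub>F n in sequentially. inverse (real (Suc n)) < x $ i - a $ i \<and> inverse (real (Suc n)) < b $ i - x $ i"
          by (intro eventually_conj order_tendstoD(2)[OF LIMSEQ_inverse_real_of_nat])
      qed
      then have "\<forall>\<^sub>F n in sequentially. indicator (K n) x * G x = indicator (box a b) x * G x"
      proof eventually_elim
        case (elim n)
        have "a $ i + inverse (real (Suc n)) \<le> x $ i \<and> x $ i \<le> b $ i - inverse (real (Suc n))" for i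
          using elim[rule_format, of i] by linarith
        then have "x \<in> K n" by (simp add: K_def mem_box_cart)
        then show ?case using True by simp
      qed
      then show ?thesis by (rule tendsto_eventually)
    next
      case False
      then have "x \<notin> K n" for n using K[of n] by blast
      then show ?thesis using False by simp
    qed
  qed
  then have "(\<lambda>x. if x \<in> cbox a b then G x else 0) \<in> borel_measurable lebesgue"
  proof (rule borel_measurable_lebesgue_AE_cong)
    show "AE x in lborel. (if x \<in> cbox a b then G x else 0) = indicat_real (box a b) x * G x"
      using AE_cbox_imp_box[of a b] by eventually_elim (use box_subset_cbox[of a b] in \<open>auto simp: indicator_def\<close>)
  qed
  then show ?thesis by (subst (asm) borel_measurable_if) auto
qed

lemma locally_integrable_rep:
  fixes G \<Gamma> :: "real^'d::finite \<Rightarrow> real"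
  assumes G: "locally_integrable (box a b) G" and [measurable]: "\<Gamma> \<in> borel_measurable borel"
    and ae: "AE x in lborel. x \<in> cbox a b \<longrightarrow> G x = \<Gamma> x" and K: "compact K" "K \<subseteq> box a b"
  shows "integrable lborel (\<lambda>x. indicator K x * \<Gamma> x)"
proof -
  have "integrable lebesgue (\<lambda>x. indicator K x *\<^sub>R G x)"
    using G K by (auto simp: locally_integrable_def set_integrable_def)
  moreover have ae': "AE x in lborel. indicator K x *\<^sub>R G x = indicator K x * \<Gamma> x"
    using ae by eventually_elim (use K(2) box_subset_cbox[of a b] in \<open>auto simp: indicator_def\<close>)
  moreover have [measurable]: "K \<in> sets borel" using compact_imp_closed[OF K(1)] by simp
  moreover have meas: "(\<lambda>x. indicator K x * \<Gamma> x) \<in> borel_measurable borel"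
    by measurable
  ultimately show ?thesis using integral_lebesgue_AE_eq(2)[OF meas ae'] by simp
qed

lemma has_weak_deriv_rep:
  fixes g F G \<Gamma> :: "real^'d::finite \<Rightarrow> real"
  assumes wd: "has_weak_deriv (box a b) k g G"
    and [measurable]: "F \<in> borel_measurable borel" "\<Gamma> \<in> borel_measurable borel"
    and F: "AE x in lborel. x \<in> cbox a b \<longrightarrow> g x = F x" and \<Gamma>: "AE x in lborel. x \<in> cbox a b \<longrightarrow> G x = \<Gamma> x"
    and \<phi>: "test_function (box a b) \<phi>" and ks: "\<And>i. count_list ks i = k $ i"
  shows "(\<integral>x. F x * iter_partial ks \<phi> x \<partial>lborel) = (-1) ^ (\<Sum>i\<in>UNIV. k $ i) * (\<integral>x. \<Gamma> x * \<phi> x \<partial>lborel)"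
proof -
  have [measurable]: "iter_partial ls \<phi> \<in> borel_measurable borel" for ls
    by (intro borel_measurable_continuous_onI test_function_continuous[OF \<phi>])
  obtain K where K: "compact K" "K \<subseteq> box a b" "\<And>x. x \<notin> K \<Longrightarrow> \<phi> x = 0"
    using \<phi> unfolding test_function_def by blast
  have z: "iter_partial ls \<phi> x = 0" if "x \<notin> box a b" for x ls
  proof (rule iter_partial_zero_outside[OF compact_imp_closed[OF K(1)] K(3)])
    show "x \<notin> K" using K(2) that by (rule contra_subsetD)
  qed
  have eq: "(LINT x:box a b|lebesgue. w x * iter_partial ls \<phi> x) = (\<integral>x. W x * iter_partial ls \<phi> x \<partial>lborel)"
    if [measurable]: "W \<in> borel_measurable borel" and "AE x in lborel. x \<in> cbox a b \<longrightarrow> w x = W x" for w W ls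
    unfolding set_lebesgue_integral_def
  proof (rule integral_lebesgue_AE_eq(1))
    show "AE x in lborel. indicat_real (box a b) x *\<^sub>R (w x * iter_partial ls \<phi> x) = W x * iter_partial ls \<phi> x"
      using that(2)
    proof eventually_elim
      case (elim x)
      then show ?case using z[of x ls] box_subset_cbox[of a b] by (cases "x \<in> box a b") auto
    qed
  qed measurable
  have "(LINT x:box a b|lebesgue. g x * iter_partial ks \<phi> x) =
      (-1) ^ (\<Sum>i\<in>UNIV. k $ i) * (LINT x:box a b|lebesgue. G x * \<phi> x)"
  proof -
    have "\<forall>\<phi> is. test_function (box a b) \<phi> \<longrightarrow> (\<forall>i. count_list is i = k $ i) \<longrightarrow>
      (LINT x:box a b|lebesgue. g x * iter_partial is \<phi> x) = (-1) ^ (\<Sum>i\<in>UNIV. k $ i) * (LINT x:box a b|lebesgue. G x * \<phi> x)"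
      using wd unfolding has_weak_deriv_def by (elim conjE)
    from this[THEN spec, THEN spec, of \<phi> ks] show ?thesis using \<phi> ks by simp
  qed
  then show ?thesis using eq[OF _ F, of ks] eq[OF _ \<Gamma>, of "[]"] by simp
qed

lemma integrable_mult_test_function:
  fixes \<Gamma> :: "real^'d::finite \<Rightarrow> real"
  assumes [measurable]: "\<Gamma> \<in> borel_measurable borel" and \<phi>: "test_function U \<phi>"
    and int: "\<And>K. compact K \<Longrightarrow> K \<subseteq> U \<Longrightarrow> integrable lborel (\<lambda>x. indicator K x * \<Gamma> x)"
  shows "integrable lborel (\<lambda>x. \<Gamma> x * \<phi> x)"
proof -
  obtain K where K: "compact K" "K \<subseteq> U" "\<And>x. x \<notin> K \<Longrightarrow> \<phi> x = 0"
    using \<phi> unfolding test_function_def by blast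
  have [measurable]: "\<phi> \<in> borel_measurable borel"
    using borel_measurable_continuous_onI[OF test_function_continuous[OF \<phi>, where ks="[]"]] by simp
  obtain B where B: "0 \<le> B" "\<And>x. \<bar>\<phi> x\<bar> \<le> B" using test_function_bounded[OF \<phi>, of "[]"] by auto
  show ?thesis
  proof (rule Bochner_Integration.integrable_bound)
    show "integrable lborel (\<lambda>x. B * (indicator K x * \<Gamma> x))" by (intro integrable_mult_right int K)
    have "norm (\<Gamma> x * \<phi> x) \<le> norm (B * (indicator K x * \<Gamma> x))" for x
      using B K(3)[of x] by (cases "x \<in> K") (auto simp: abs_mult mult.commute[of B] intro: mult_left_mono)
    then show "AE x in lborel. norm (\<Gamma> x * \<phi> x) \<le> norm (B * (indicator K x * \<Gamma> x))" by simp
  qed measurable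
qed

lemma has_weak_deriv_measurable:
  fixes g G :: "real^'d::finite \<Rightarrow> real"
  assumes "has_weak_deriv (box a b) k g G"
  shows "g \<in> borel_measurable (lebesgue_on (cbox a b))" "G \<in> borel_measurable (lebesgue_on (cbox a b))"
  using assms locally_integrable_imp_measurable unfolding has_weak_deriv_def by auto

text \<open>
  The difference of two weak derivatives is orthogonal to all test functions.
\<close>

lemma has_weak_deriv_unique:
  fixes g G1 G2 :: "real^'d::finite \<Rightarrow> real"
  assumes 1: "has_weak_deriv (box a b) k g G1" and 2: "has_weak_deriv (box a b) k g G2"
  shows "AE x in lborel. x \<in> cbox a b \<longrightarrow> G1 x = G2 x"
proof -
  obtain F where F: "F \<in> borel_measurable borel" "AE x in lborel. x \<in> cbox a b \<longrightarrow> g x = F x"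
    using Lp_space_ex_borel[OF has_weak_deriv_measurable(1)[OF 1]] by metis
  obtain \<Gamma>1 where \<Gamma>1[measurable]: "\<Gamma>1 \<in> borel_measurable borel" "AE x in lborel. x \<in> cbox a b \<longrightarrow> G1 x = \<Gamma>1 x"
    using Lp_space_ex_borel[OF has_weak_deriv_measurable(2)[OF 1]] by metis
  obtain \<Gamma>2 where \<Gamma>2[measurable]: "\<Gamma>2 \<in> borel_measurable borel" "AE x in lborel. x \<in> cbox a b \<longrightarrow> G2 x = \<Gamma>2 x"
    using Lp_space_ex_borel[OF has_weak_deriv_measurable(2)[OF 2]] by metis
  obtain ks where ks: "\<And>i. count_list ks i = k $ i" using mixed_diff_eq_foldr[of k] by blast
  have i1: "integrable lborel (\<lambda>x. indicator K x * \<Gamma>1 x)" if "compact K" "K \<subseteq> box a b" for K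
    by (rule locally_integrable_rep[OF _ \<Gamma>1 that]) (use 1 in \<open>simp add: has_weak_deriv_def\<close>)
  have i2: "integrable lborel (\<lambda>x. indicator K x * \<Gamma>2 x)" if "compact K" "K \<subseteq> box a b" for K
    by (rule locally_integrable_rep[OF _ \<Gamma>2 that]) (use 2 in \<open>simp add: has_weak_deriv_def\<close>)
  have "AE x in lborel. x \<in> box a b \<longrightarrow> \<Gamma>1 x - \<Gamma>2 x = 0"
  proof (rule AE_zero_if_orthogonal_to_test_functions)
    show "integrable lborel (\<lambda>x. indicator K x * (\<Gamma>1 x - \<Gamma>2 x))" if "compact K" "K \<subseteq> box a b" for K
      using i1[OF that] i2[OF that] by (simp add: right_diff_distrib)
    fix \<phi> assume \<phi>: "test_function (box a b) \<phi>"
    have "(\<integral>x. \<Gamma>1 x * \<phi> x \<partial>lborel) = (\<integral>x. \<Gamma>2 x * \<phi> x \<partial>lborel)"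
      using has_weak_deriv_rep[OF 1 F(1) \<Gamma>1(1) F(2) \<Gamma>1(2) \<phi> ks] has_weak_deriv_rep[OF 2 F(1) \<Gamma>2(1) F(2) \<Gamma>2(2) \<phi> ks]
      by simp
    then show "(\<integral>x. (\<Gamma>1 x - \<Gamma>2 x) * \<phi> x \<partial>lborel) = 0"
      unfolding left_diff_distrib
      by (subst Bochner_Integration.integral_diff) (auto intro!: integrable_mult_test_function[OF _ \<phi>] i1 i2)
  qed auto
  then show ?thesis using \<Gamma>1(2) \<Gamma>2(2) AE_cbox_imp_box[of a b] by eventually_elim auto
qed

lemma Lp_norm_cong_AE:
  fixes f g :: "real^'d::finite \<Rightarrow> real"
  assumes p: "1 \<le> p" and f: "f \<in> borel_measurable (lebesgue_on (cbox a b))"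
    and ae: "AE x in lborel. x \<in> cbox a b \<longrightarrow> f x = g x"
  shows "Lp_norm p (cbox a b) f = Lp_norm p (cbox a b) g"
proof -
  obtain F where F: "F \<in> borel_measurable borel" "\<And>x. x \<notin> cbox a b \<Longrightarrow> F x = 0"
    "AE x in lborel. x \<in> cbox a b \<longrightarrow> f x = F x"
    using Lp_space_ex_borel[OF f] by blast
  have "AE x in lborel. F x = indicator (cbox a b) x * f x"
    using F(3) by eventually_elim (use F(2) in \<open>auto simp: indicator_def\<close>)
  note 1 = Lp_norm_le_iff[OF p _ F(1) this]
  have "AE x in lborel. F x = indicator (cbox a b) x * g x"
    using F(3) ae by eventually_elim (use F(2) in \<open>auto simp: indicator_def\<close>)
  note 2 = Lp_norm_le_iff[OF p _ F(1) this]
  have iff: "Lp_norm p (cbox a b) f \<le> ennreal m \<longleftrightarrow> Lp_norm p (cbox a b) g \<le> ennreal m" if "0 \<le> m" for m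
    using 1 2 that by simp
  have le: "x \<le> y" if "\<And>m. 0 \<le> m \<Longrightarrow> y \<le> ennreal m \<Longrightarrow> x \<le> ennreal m" for x y :: ennreal
    using that by (cases y) auto
  show ?thesis
  proof (rule antisym)
    show "Lp_norm p (cbox a b) f \<le> Lp_norm p (cbox a b) g" by (rule le) (simp add: iff)
    show "Lp_norm p (cbox a b) g \<le> Lp_norm p (cbox a b) f" by (rule le) (simp add: iff)
  qed
qed

text \<open>
  The representative chosen by \<open>weak_deriv\<close> agrees almost everywhere with any known weak
  derivative, so its norm can be computed from the latter.
\<close>

lemma Lp_norm_weak_deriv:
  fixes g G :: "real^'d::finite \<Rightarrow> real"
  assumes p: "1 \<le> p" and wd: "has_weak_deriv (interior (cbox a b)) k g G"
  shows "Lp_norm p (cbox a b) (weak_deriv (interior (cbox a b)) k g) = Lp_norm p (cbox a b) G"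
proof -
  have 1: "has_weak_deriv (box a b) k g (weak_deriv (box a b) k g)"
    unfolding weak_deriv_def by (rule someI[of "has_weak_deriv (box a b) k g" G]) (use wd in simp)
  show ?thesis
    using Lp_norm_cong_AE[OF p has_weak_deriv_measurable(2)[OF 1] has_weak_deriv_unique[OF 1, of G]] wd by simp
qed

lemma shift_domain_eq_cbox:
  fixes a b y :: "real^'d::finite"
  obtains c d where "shift_domain (cbox a b) y = cbox c d"
proof -
  have "shift_domain (cbox a b) y = cbox (\<chi> i. max (a $ i) (a $ i - y $ i)) (\<chi> i. min (b $ i) (b $ i - y $ i))"
    by (simp add: set_eq_iff shift_domain_def mem_box_cart diff_le_eq le_diff_eq) blast
  then show ?thesis by (rule that)
qed

lemma Lp_norm_rep:
  fixes f F :: "real^'d::finite \<Rightarrow> real"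
  assumes "1 \<le> p" and "F \<in> borel_measurable borel" and F0: "\<And>x. x \<notin> cbox a b \<Longrightarrow> F x = 0"
    and ae: "AE x in lborel. x \<in> cbox a b \<longrightarrow> f x = F x" and "0 \<le> m"
  shows "Lp_norm p (cbox a b) f \<le> ennreal m \<longleftrightarrow> Lp_bounded p m F"
proof (rule Lp_norm_le_iff)
  show "AE x in lborel. F x = indicator (cbox a b) x * f x"
    using ae by eventually_elim (use F0 in \<open>auto simp: indicator_def\<close>)
qed (use assms in auto)

text \<open>
  The difference is \<open>h\<^sup>k\<close> times an average of translates of the derivative, almost everywhere on
  the domain of the difference, because the boundary of this box is a null set.
\<close>

lemma mixed_modulus_le_weak_deriv:
  fixes g G :: "real^'d::finite \<Rightarrow> real"
  assumes p: "1 \<le> p" and g: "g \<in> Lp_space p (cbox a b)"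
    and wd: "has_weak_deriv (box a b) k g G" and fin: "Lp_norm p (cbox a b) G < \<infinity>" and t: "\<And>i. 0 \<le> t $ i"
  shows "mixed_modulus k p (cbox a b) g t \<le> ennreal (\<Prod>i\<in>UNIV. t $ i ^ k $ i) * Lp_norm p (cbox a b) G"
proof -
  obtain m where m: "0 \<le> m" "Lp_norm p (cbox a b) G = ennreal m" using fin by (cases "Lp_norm p (cbox a b) G") auto
  obtain n where n: "0 \<le> n" "Lp_norm p (cbox a b) g = ennreal n"
    using g by (cases "Lp_norm p (cbox a b) g") (auto simp: Lp_space_def)
  obtain F where F: "F \<in> borel_measurable borel" "\<And>x. x \<notin> cbox a b \<Longrightarrow> F x = 0" "AE x in lborel. x \<in> cbox a b \<longrightarrow> g x = F x"
    using Lp_space_ex_borel[OF has_weak_deriv_measurable(1)[OF wd]] by blast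
  obtain \<Gamma> where \<Gamma>: "\<Gamma> \<in> borel_measurable borel" "\<And>x. x \<notin> cbox a b \<Longrightarrow> \<Gamma> x = 0" "AE x in lborel. x \<in> cbox a b \<longrightarrow> G x = \<Gamma> x"
    using Lp_space_ex_borel[OF has_weak_deriv_measurable(2)[OF wd]] by blast
  note [measurable] = F(1) \<Gamma>(1)
  have bF: "Lp_bounded p n F" using Lp_norm_rep[OF p F n(1)] n by simp
  have b\<Gamma>: "Lp_bounded p m \<Gamma>" using Lp_norm_rep[OF p \<Gamma> m(1)] m by simp
  have iF: "integrable lborel F" using F(1) F(2) bF by (rule Lp_bounded_integrable[OF p])
  have i\<Gamma>: "integrable lborel \<Gamma>" using \<Gamma>(1) \<Gamma>(2) b\<Gamma> by (rule Lp_bounded_integrable[OF p])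
  have weak: "(\<integral>x. F x * iter_partial ks \<phi> x \<partial>lborel) = (-1) ^ (\<Sum>i\<in>UNIV. k $ i) * (\<integral>x. \<Gamma> x * \<phi> x \<partial>lborel)"
    if "test_function (box a b) \<phi>" "\<And>i. count_list ks i = k $ i" for \<phi> ks
    by (rule has_weak_deriv_rep[OF wd F(1) \<Gamma>(1) F(3) \<Gamma>(3) that])
  define T where "T = (\<Prod>i\<in>UNIV. t $ i ^ k $ i)"
  have T0: "0 \<le> T" unfolding T_def using t by (intro prod_nonneg) auto
  have "mixed_modulus k p (cbox a b) g t \<le> ennreal (T * m)"
    unfolding mixed_modulus_le_iff[OF p F(1,3) mult_nonneg_nonneg[OF T0 m(1)]]
  proof (intro allI impI)
    fix h :: "real^'d" assume h: "\<forall>i. \<bar>h $ i\<bar> \<le> t $ i"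
    define D where "D = shift_domain (cbox a b) (step_vec k h)"
    have "\<exists>\<mu>. prob_space \<mu> \<and> sets \<mu> = sets borel \<and> (AE x in lborel. x \<in> interior D \<longrightarrow>
        mixed_diff k h F x = (\<Prod>i\<in>UNIV. h $ i ^ k $ i) * (\<integral>s. \<Gamma> (x - s) \<partial>\<mu>))"
      unfolding D_def by (rule mixed_diff_eq_average_of_weak_deriv[OF iF i\<Gamma>]) (rule weak)
    then obtain \<mu> where \<mu>: "prob_space \<mu>" and s\<mu>[measurable_cong]: "sets \<mu> = sets borel" and rep:
      "AE x in lborel. x \<in> interior D \<longrightarrow> mixed_diff k h F x = (\<Prod>i\<in>UNIV. h $ i ^ k $ i) * (\<integral>s. \<Gamma> (x - s) \<partial>\<mu>)"
      by (elim exE conjE)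
    have bd: "AE x in lborel. x \<in> D \<longrightarrow> x \<in> interior D"
    proof -
      obtain c d where "D = cbox c d" using shift_domain_eq_cbox[of a b "step_vec k h"] unfolding D_def by blast
      then show ?thesis using AE_cbox_imp_box[of c d] by simp
    qed
    have HT: "\<bar>\<Prod>i\<in>UNIV. h $ i ^ k $ i\<bar> \<le> T"
      unfolding T_def abs_prod power_abs using h by (intro prod_mono) (auto intro!: power_mono)
    show "Lp_bounded p (T * m) (\<lambda>x. indicator D x * mixed_diff k h F x)"
    proof (rule Lp_bounded_average[where \<Phi>="\<lambda>x s. \<bar>\<Gamma> (x - s)\<bar>", OF p \<mu> _ _ T0 m(1)])
      show "AE x in lborel. ennreal \<bar>indicator D x * mixed_diff k h F x\<bar> \<le> ennreal T * (\<integral>\<^sup>+ s. ennreal \<bar>\<Gamma> (x - s)\<bar> \<partial>\<mu>)"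
        using rep bd
      proof eventually_elim
        case (elim x)
        have le: "ennreal \<bar>\<integral>s. \<Gamma> (x - s) \<partial>\<mu>\<bar> \<le> (\<integral>\<^sup>+ s. ennreal \<bar>\<Gamma> (x - s)\<bar> \<partial>\<mu>)"
        proof (cases "integrable \<mu> (\<lambda>s. \<Gamma> (x - s))")
          case True
          then show ?thesis using integral_norm_bound_ennreal[OF True] by simp
        qed (simp add: not_integrable_integral_eq)
        show ?case
        proof (cases "x \<in> D")
          case True
          then have "ennreal \<bar>indicator D x * mixed_diff k h F x\<bar> = ennreal (\<bar>\<Prod>i\<in>UNIV. h $ i ^ k $ i\<bar>) * ennreal \<bar>\<integral>s. \<Gamma> (x - s) \<partial>\<mu>\<bar>"
            using elim by (simp add: abs_mult ennreal_mult)
          also have "\<dots> \<le> ennreal T * (\<integral>\<^sup>+ s. ennreal \<bar>\<Gamma> (x - s)\<bar> \<partial>\<mu>)"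
            using HT le by (intro mult_mono ennreal_leI) auto
          finally show ?thesis .
        qed simp
      qed
      have "Lp_bounded p m (\<lambda>x. \<bar>\<Gamma> (x - s)\<bar>)" for s
        by (rule Lp_bounded_mono_AE[OF p _ Lp_bounded_translate[OF b\<Gamma>, of "- s"]]) auto
      then show "AE s in \<mu>. Lp_bounded p m (\<lambda>x. \<bar>\<Gamma> (x - s)\<bar>)" by simp
    qed measurable
  qed
  then show ?thesis using m T0 by (simp add: T_def ennreal_mult)
qed

lemma mixed_modulus_triangle:
  fixes f g :: "real^'d::finite \<Rightarrow> real"
  assumes p: "1 \<le> p" and f: "f \<in> Lp_space p (cbox a b)" and g: "g \<in> Lp_space p (cbox a b)"
  shows "mixed_modulus k p (cbox a b) f t \<le>
    ennreal (\<Prod>i\<in>UNIV. 2 ^ k $ i) * Lp_norm p (cbox a b) (\<lambda>x. f x - g x) + mixed_modulus k p (cbox a b) g t"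
proof (cases "Lp_norm p (cbox a b) (\<lambda>x. f x - g x) = \<infinity> \<or> mixed_modulus k p (cbox a b) g t = \<infinity>")
  case True
  have "0 < (\<Prod>i\<in>UNIV. 2 ^ k $ i :: real)" by (intro prod_pos) auto
  then show ?thesis using True by (auto simp: ennreal_mult_top)
next
  case False
  obtain m where m: "0 \<le> m" "Lp_norm p (cbox a b) (\<lambda>x. f x - g x) = ennreal m"
    using False by (cases "Lp_norm p (cbox a b) (\<lambda>x. f x - g x)") auto
  obtain n where n: "0 \<le> n" "mixed_modulus k p (cbox a b) g t = ennreal n"
    using False by (cases "mixed_modulus k p (cbox a b) g t") auto
  obtain F where F: "F \<in> borel_measurable borel" "\<And>x. x \<notin> cbox a b \<Longrightarrow> F x = 0" "AE x in lborel. x \<in> cbox a b \<longrightarrow> f x = F x"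
    using Lp_space_ex_borel[of f a b] f unfolding Lp_space_def by blast
  obtain G where G: "G \<in> borel_measurable borel" "\<And>x. x \<notin> cbox a b \<Longrightarrow> G x = 0" "AE x in lborel. x \<in> cbox a b \<longrightarrow> g x = G x"
    using Lp_space_ex_borel[of g a b] g unfolding Lp_space_def by blast
  note [measurable] = F(1) G(1)
  have "Lp_norm p (cbox a b) (\<lambda>x. f x - g x) \<le> ennreal m \<longleftrightarrow> Lp_bounded p m (\<lambda>x. F x - G x)"
  proof (rule Lp_norm_rep[OF p _ _ _ m(1)])
    show "AE x in lborel. x \<in> cbox a b \<longrightarrow> f x - g x = F x - G x"
      using F(3) G(3) by eventually_elim auto
  qed (use F(2) G(2) in auto)
  then have b: "Lp_bounded p m (\<lambda>x. F x - G x)" using m by simp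
  define P where "P = (\<Prod>i\<in>UNIV. 2 ^ k $ i :: real)"
  have P: "0 \<le> P" unfolding P_def by (intro prod_nonneg) auto
  have Pm: "0 \<le> P * m" using P m by simp
  have "mixed_modulus k p (cbox a b) f t \<le> ennreal (P * m + n)"
    unfolding mixed_modulus_le_iff[OF p F(1,3) add_nonneg_nonneg[OF Pm n(1)]]
  proof (intro allI impI)
    fix h :: "real^'d" assume h: "\<forall>i. \<bar>h $ i\<bar> \<le> t $ i"
    let ?I = "indicator (shift_domain (cbox a b) (step_vec k h)) :: real^'d \<Rightarrow> real"
    have 1: "Lp_bounded p (P * m) (mixed_diff k h (\<lambda>x. F x - G x))"
      unfolding P_def by (rule Lp_bounded_mixed_diff[OF p m(1) b]) measurable
    have "Lp_bounded p (P * m) (\<lambda>x. ?I x * mixed_diff k h (\<lambda>x. F x - G x) x)"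
      by (rule Lp_bounded_mono_AE[OF p _ 1]) (auto simp: indicator_def)
    moreover have "Lp_bounded p n (\<lambda>x. ?I x * mixed_diff k h G x)"
      using mixed_modulus_le_iff[OF p G(1,3) n(1), of k t] n h by auto
    ultimately have "Lp_bounded p (P * m + n) (\<lambda>x. ?I x * mixed_diff k h (\<lambda>x. F x - G x) x + ?I x * mixed_diff k h G x)"
      using Pm n(1) by (intro Lp_bounded_add[OF p]) measurable
    then show "Lp_bounded p (P * m + n) (\<lambda>x. ?I x * mixed_diff k h F x)"
      by (simp add: mixed_diff_diff right_diff_distrib)
  qed
  then show ?thesis using m n P by (simp add: P_def ennreal_mult)
qed

lemma prod_restrict_index:
  fixes f :: "'d::finite \<Rightarrow> 'b::comm_semiring_1"
  shows "(\<Prod>i\<in>UNIV. f i ^ (restrict_index r e $ i)) = (\<Prod>i\<in>e. f i ^ r $ i)"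
proof -
  have "(\<Prod>i\<in>UNIV. f i ^ (restrict_index r e $ i)) = (\<Prod>i\<in>UNIV. if i \<in> e then f i ^ r $ i else 1)"
    by (intro prod.cong) (auto simp: restrict_index_def)
  also have "\<dots> = (\<Prod>i\<in>UNIV \<inter> e. f i ^ r $ i)"
    by (rule prod.inter_restrict[symmetric]) simp
  finally show ?thesis by simp
qed

text \<open>
  The constant arises by adding the triangle inequalities for all \<open>e\<close>: the coefficients of the
  norm of \<open>f - g\<close> are at most the sum of all \<open>\<Prod>i\<in>e. 2 ^ r\<^sub>i\<close>, and this sum is at least \<open>1\<close> because
  of \<open>e = {}\<close>.
\<close>

theorem total_modulus_le_K_functional:
  fixes f :: "real^'d::finite \<Rightarrow> real"
  assumes p: "1 \<le> p" and f: "f \<in> Lp_space p (cbox a b)" and t: "\<forall>i. 0 \<le> t $ i"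
  shows "ennreal (inverse (\<Sum>e\<in>UNIV. \<Prod>i\<in>e. 2 ^ (r $ i))) * total_modulus r p (cbox a b) f t
          \<le> K_functional r p (cbox a b) f (vec_pow t r)"
proof -
  define S where "S = (\<Sum>e\<in>(UNIV :: 'd set set). \<Prod>i\<in>e. 2 ^ (r $ i) :: real)"
  have S1: "1 \<le> S"
  proof -
    have "(\<Prod>i\<in>({}::'d set). 2 ^ (r $ i) :: real) \<le> S"
      unfolding S_def by (rule member_le_sum) (auto intro: prod_nonneg)
    then show ?thesis by simp
  qed
  have key: "total_modulus r p (cbox a b) f t \<le> ennreal S * (Lp_norm p (cbox a b) (\<lambda>x. f x - g x) +
       (\<Sum>e \<in> {e. e \<noteq> {}}. ennreal (\<Prod>i\<in>e. vec_pow t r $ i) *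
          Lp_norm p (cbox a b) (weak_deriv (interior (cbox a b)) (restrict_index r e) g)))"
    if g: "g \<in> Sobolev_space r p (cbox a b)" for g
  proof -
    define A where "A = Lp_norm p (cbox a b) (\<lambda>x. f x - g x)"
    define B where "B e = ennreal (\<Prod>i\<in>e. vec_pow t r $ i) *
          Lp_norm p (cbox a b) (weak_deriv (interior (cbox a b)) (restrict_index r e) g)" for e
    have gL: "g \<in> Lp_space p (cbox a b)" using g by (simp add: Sobolev_space_def)
    have each: "mixed_modulus (restrict_index r e) p (cbox a b) f t \<le> ennreal (\<Prod>i\<in>e. 2 ^ r $ i) * A + B e" for e
    proof -
      let ?G = "weak_deriv (box a b) (restrict_index r e) g"
      have wd: "has_weak_deriv (box a b) (restrict_index r e) g ?G"
      proof -
        have "\<forall>e. \<exists>G. has_weak_deriv (box a b) (restrict_index r e) g G"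
          using g by (simp add: Sobolev_space_def)
        then obtain G where "has_weak_deriv (box a b) (restrict_index r e) g G" by blast
        then show ?thesis
          unfolding weak_deriv_def by (rule someI[of "has_weak_deriv (box a b) (restrict_index r e) g"])
      qed
      have "Lp_norm p (cbox a b) ?G \<le> Sobolev_norm r p (cbox a b) g"
        unfolding Sobolev_norm_def interior_cbox by (subst sum.remove[of UNIV e]) auto
      then have fin: "Lp_norm p (cbox a b) ?G < \<infinity>"
        by (rule le_less_trans) (use g in \<open>simp add: Sobolev_space_def\<close>)
      have "mixed_modulus (restrict_index r e) p (cbox a b) g t \<le> B e"
        using mixed_modulus_le_weak_deriv[OF p gL wd fin, of t] t
        by (simp add: B_def prod_restrict_index vec_pow_def)
      then have "ennreal (\<Prod>i\<in>e. 2 ^ r $ i) * A + mixed_modulus (restrict_index r e) p (cbox a b) g t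
          \<le> ennreal (\<Prod>i\<in>e. 2 ^ r $ i) * A + B e"
        by (rule add_left_mono)
      then show ?thesis
        using mixed_modulus_triangle[OF p f gL, of "restrict_index r e" t]
        unfolding prod_restrict_index A_def[symmetric] by (rule order_trans[rotated])
    qed
    have "total_modulus r p (cbox a b) f t \<le> (\<Sum>e\<in>{e. e \<noteq> {}}. ennreal (\<Prod>i\<in>e. 2 ^ r $ i) * A + B e)"
      unfolding total_modulus_def by (intro sum_mono each)
    also have "\<dots> = (\<Sum>e\<in>{e. e \<noteq> {}}. ennreal (\<Prod>i\<in>e. 2 ^ r $ i)) * A + (\<Sum>e\<in>{e. e \<noteq> {}}. B e)"
      by (simp add: sum.distrib sum_distrib_right)
    also have "\<dots> \<le> ennreal S * A + ennreal S * (\<Sum>e\<in>{e. e \<noteq> {}}. B e)"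
    proof (intro add_mono mult_right_mono)
      have "(\<Sum>e\<in>{e. e \<noteq> {}}. ennreal (\<Prod>i\<in>e. 2 ^ r $ i)) \<le> (\<Sum>e\<in>(UNIV :: 'd set set). ennreal (\<Prod>i\<in>e. 2 ^ r $ i))"
        by (intro sum_mono2) auto
      also have "\<dots> = ennreal S" unfolding S_def by (intro sum_ennreal) (auto intro: prod_nonneg)
      finally show "(\<Sum>e\<in>{e. e \<noteq> {}}. ennreal (\<Prod>i\<in>e. 2 ^ r $ i)) \<le> ennreal S" .
      have "1 \<le> ennreal S" using S1 by simp
      then show "(\<Sum>e\<in>{e. e \<noteq> {}}. B e) \<le> ennreal S * (\<Sum>e\<in>{e. e \<noteq> {}}. B e)"
        using mult_right_mono[of 1 "ennreal S" "\<Sum>e\<in>{e. e \<noteq> {}}. B e"] by simp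
    qed simp
    finally show ?thesis by (simp add: A_def B_def distrib_left)
  qed
  show ?thesis unfolding K_functional_def S_def[symmetric]
  proof (rule INF_greatest)
    fix g assume g: "g \<in> Sobolev_space r p (cbox a b)"
    let ?R = "Lp_norm p (cbox a b) (\<lambda>x. f x - g x) +
       (\<Sum>e \<in> {e. e \<noteq> {}}. ennreal (\<Prod>i\<in>e. vec_pow t r $ i) *
          Lp_norm p (cbox a b) (weak_deriv (interior (cbox a b)) (restrict_index r e) g))"
    have "ennreal (inverse S) * total_modulus r p (cbox a b) f t \<le> ennreal (inverse S) * (ennreal S * ?R)"
      by (intro mult_left_mono key g) simp
    also have "\<dots> = ennreal (inverse S * S) * ?R" using S1 by (subst ennreal_mult) (auto simp: mult.assoc)
    also have "inverse S * S = 1" using S1 by simp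
    finally show "ennreal (inverse S) * total_modulus r p (cbox a b) f t \<le> ?R" by simp
  qed
qed

section \<open>Moving averages and refined steps\<close>

text \<open>
  \<open>A z\<close> is the mean of \<open>u\<close> over \<open>[z, z + \<eta>]\<close>.  That it equals some value of \<open>u\<close> in this interval
  is how nonnegativity and support are inherited.
\<close>

lemma ex_moving_average:
  fixes u :: "real \<Rightarrow> real"
  assumes \<eta>: "0 < \<eta>" and u: "continuous_on UNIV u"
  shows "\<exists>A. (\<forall>z. (A has_real_derivative (u (z + \<eta>) - u z) / \<eta>) (at z)) \<and>
    (\<forall>z. \<exists>\<xi>. z < \<xi> \<and> \<xi> < z + \<eta> \<and> A z = u \<xi>) \<and>
    ((\<forall>z. 0 \<le> u z) \<longrightarrow> (\<exists>z. 0 < u z) \<longrightarrow> (\<exists>z. 0 < A z))"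
proof -
  obtain U where U: "\<And>z. (U has_real_derivative u z) (at z)"
    using einterval_antiderivative[of "-\<infinity>" \<infinity> u] u
    by (auto simp: continuous_on_eq_continuous_at has_real_derivative_iff_has_vector_derivative)
  define A where "A z = (U (z + \<eta>) - U z) / \<eta>" for z
  have U': "((\<lambda>z. U (z + \<eta>)) has_real_derivative u (z + \<eta>)) (at z)" for z
    using DERIV_shift[of U "u (z + \<eta>)" z \<eta>] U by simp
  have 1: "(A has_real_derivative (u (z + \<eta>) - u z) / \<eta>) (at z)" for z
    unfolding A_def by (intro DERIV_cdivide DERIV_diff U U')
  have 2: "\<exists>\<xi>. z < \<xi> \<and> \<xi> < z + \<eta> \<and> A z = u \<xi>" for z
    using MVT2[of z "z + \<eta>" U u] U \<eta> by (auto simp: A_def)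
  have 3: "\<exists>z. 0 < A z" if nn: "\<And>z. 0 \<le> u z" and z0: "0 < u z0" for z0
  proof (rule ccontr)
    assume "\<not> (\<exists>z. 0 < A z)"
    then have "A (z0 - \<eta>/2) \<le> 0" by (simp add: not_less)
    moreover have "z0 - \<eta>/2 + \<eta> = z0 + \<eta>/2" by simp
    ultimately have "U (z0 + \<eta>/2) \<le> U (z0 - \<eta>/2)"
      using \<eta> by (simp add: A_def divide_le_0_iff)
    moreover have mono: "U x \<le> U y" if "x \<le> y" for x y
      by (rule DERIV_nonneg_imp_nondecreasing[OF that]) (use U nn in blast)
    ultimately have const: "U y = U (z0 - \<eta>/2)" if "z0 - \<eta>/2 \<le> y" "y \<le> z0 + \<eta>/2" for y
      using mono[OF that(1)] mono[OF that(2)] by linarith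
    have "\<forall>\<^sub>F y in nhds z0. U y = U (z0 - \<eta>/2)"
      using eventually_nhds_in_open[of "{z0 - \<eta>/2<..<z0 + \<eta>/2}" z0] \<eta>
      by (auto elim!: eventually_mono intro!: const)
    then have "(U has_real_derivative 0) (at z0)" by (subst DERIV_cong_ev[OF refl _ refl]) auto
    then show False using DERIV_unique[OF U[of z0]] z0 by auto
  qed
  show ?thesis using 1 2 3 by blast
qed

text \<open>
  Each moving average of length \<open>\<eta>\<close> turns one derivative into a first difference divided by \<open>\<eta>\<close>.
  After \<open>r\<close> averages the \<open>r\<close>-th derivative is therefore an \<open>r\<close>-th difference of the original
  function, while the support has grown by \<open>r \<eta>\<close> to the left.
\<close>

lemma ex_spline_profile:
  fixes v :: "real \<Rightarrow> real"
  assumes \<eta>: "0 < \<eta>" and v: "continuous_on UNIV v" "\<And>z. 0 \<le> v z" "0 < v z0"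
    and supp: "\<forall>z. z \<notin> {c..d} \<longrightarrow> v z = 0"
  shows "\<exists>w :: nat \<Rightarrow> real \<Rightarrow> real.
    (\<forall>m<r. \<forall>z. (w m has_real_derivative w (Suc m) z) (at z)) \<and>
    (\<forall>m\<le>r. continuous_on UNIV (w m)) \<and>
    (\<forall>z. w r z = fdiff r \<eta> v z / \<eta> ^ r) \<and> (\<forall>z. 0 \<le> w 0 z) \<and> (\<exists>z. 0 < w 0 z) \<and>
    (\<forall>m\<le>r. \<forall>z. z \<notin> {c - real r * \<eta>..d} \<longrightarrow> w m z = 0)"
proof (induction r)
  case 0
  show ?case using v supp by (intro exI[of _ "\<lambda>m. v"]) (auto simp: fdiff_def)
next
  case (Suc r)
  then obtain w :: "nat \<Rightarrow> real \<Rightarrow> real" where w: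
    "\<And>m z. m < r \<Longrightarrow> (w m has_real_derivative w (Suc m) z) (at z)"
    "\<And>m. m \<le> r \<Longrightarrow> continuous_on UNIV (w m)"
    "\<And>z. w r z = fdiff r \<eta> v z / \<eta> ^ r" "\<And>z. 0 \<le> w 0 z" "\<exists>z. 0 < w 0 z"
    "\<And>m z. m \<le> r \<Longrightarrow> z \<notin> {c - real r * \<eta>..d} \<Longrightarrow> w m z = 0"
    by (elim exE conjE) blast
  obtain A where A: "\<And>z. (A has_real_derivative (w 0 (z + \<eta>) - w 0 z) / \<eta>) (at z)"
    "\<And>z. \<exists>\<xi>. z < \<xi> \<and> \<xi> < z + \<eta> \<and> A z = w 0 \<xi>" "\<exists>z. 0 < A z"
    using ex_moving_average[OF \<eta> w(2)[of 0]] w(4,5) by auto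
  \<comment> \<open>Averaging once more: the new profile is \<open>A\<close>, and its derivatives are difference quotients of
    the old ones.\<close>
  define w' where "w' m = (case m of 0 \<Rightarrow> A | Suc n \<Rightarrow> (\<lambda>z. (w n (z + \<eta>) - w n z) / \<eta>))" for m
  have w'0: "w' 0 = A" and w'S: "w' (Suc n) = (\<lambda>z. (w n (z + \<eta>) - w n z) / \<eta>)" for n
    by (simp_all add: w'_def)
  have shift: "continuous_on UNIV (\<lambda>z. w m (z + \<eta>))" if "m \<le> r" for m
    by (rule continuous_on_compose2[OF w(2)[OF that]]) (auto intro!: continuous_intros)
  show ?case
  proof (intro exI[of _ w'] conjI allI impI)
    show "(w' m has_real_derivative w' (Suc m) z) (at z)" if "m < Suc r" for m z
    proof (cases m)
      case 0
      then show ?thesis using A(1) by (simp add: w'0 w'S)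
    next
      case (Suc n)
      then have "(w n has_real_derivative w (Suc n) z) (at z)" for z using w(1)[of n] that by simp
      then have "((\<lambda>z. (w n (z + \<eta>) - w n z) / \<eta>) has_real_derivative (w (Suc n) (z + \<eta>) - w (Suc n) z) / \<eta>) (at z)"
        using DERIV_shift[of "w n" _ z \<eta>] by (intro DERIV_cdivide DERIV_diff) auto
      then show ?thesis using Suc by (simp add: w'S)
    qed
    show "continuous_on UNIV (w' m)" if "m \<le> Suc r" for m
    proof (cases m)
      case 0
      have "continuous_on UNIV A" by (rule DERIV_continuous_on) (rule A(1))
      then show ?thesis using 0 by (simp add: w'0)
    next
      case (Suc n)
      then have n: "n \<le> r" using that by simp
      then show ?thesis unfolding Suc w'S using \<eta> by (intro continuous_intros shift w(2)[OF n]) auto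
    qed
    show "w' (Suc r) z = fdiff (Suc r) \<eta> v z / \<eta> ^ Suc r" for z
      using \<eta> by (simp add: w'S w(3) fdiff_Suc diff_divide_distrib[symmetric])
    show "0 \<le> w' 0 z" for z using A(2)[of z] w(4) by (auto simp: w'0)
    show "\<exists>z. 0 < w' 0 z" using A(3) by (simp add: w'0)
    show "w' m z = 0" if m: "m \<le> Suc r" and z: "z \<notin> {c - real (Suc r) * \<eta>..d}" for m z
    proof (cases m)
      case 0
      obtain \<xi> where \<xi>: "z < \<xi>" "\<xi> < z + \<eta>" "A z = w 0 \<xi>" using A(2) by blast
      have "\<xi> \<notin> {c - real r * \<eta>..d}" using z \<xi>(1,2) by (auto simp: algebra_simps)
      then show ?thesis using w(6)[of 0 \<xi>] \<xi>(3) 0 by (simp add: w'0)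
    next
      case (Suc n)
      then have n: "n \<le> r" using m by simp
      have "z + \<eta> \<notin> {c - real r * \<eta>..d}" "z \<notin> {c - real r * \<eta>..d}"
        using z \<eta> by (auto simp: algebra_simps)
      then show ?thesis using w(6)[OF n] by (simp add: Suc w'S)
    qed
  qed
qed

lemma fdiff_sum: "fdiff m h (\<lambda>x. \<Sum>l\<in>L. u l x) x = (\<Sum>l\<in>L. fdiff m h (u l) x)"
  unfolding fdiff_def sum_distrib_left by (rule sum.swap)

lemma fdiff_cmult: "fdiff m h (\<lambda>x. c * u x) x = c * fdiff m h u x"
  unfolding fdiff_def sum_distrib_left by (simp add: mult_ac)

lemma fdiff_affine:
  assumes "a \<noteq> 0"
  shows "fdiff m h (\<lambda>x. u ((x - b) / a)) x = fdiff m (h / a) u ((x - b) / a)"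
  unfolding fdiff_def by (intro sum.cong) (auto simp: diff_divide_distrib add_divide_distrib algebra_simps)

lemma fdiff_translate: "fdiff m h (\<lambda>x. u (x + c)) x = fdiff m h u (x + c)"
  unfolding fdiff_def by (intro sum.cong) (auto simp: algebra_simps)

text \<open>
  The \<open>m\<close>-th iterate of the operator \<open>u \<mapsto> (\<Sum>l<j. u (\<cdot> + l h))\<close>, through which differences with
  step \<open>j h\<close> factor into differences with step \<open>h\<close>.
\<close>

fun step_sum :: "nat \<Rightarrow> real \<Rightarrow> nat \<Rightarrow> (real \<Rightarrow> real) \<Rightarrow> real \<Rightarrow> real" where
  "step_sum j h 0 u = u"
| "step_sum j h (Suc m) u = (\<lambda>z. \<Sum>l<j. step_sum j h m u (z + real l * h))"

text \<open>
  A first difference with step \<open>j h\<close> telescopes into \<open>j\<close> first differences with step \<open>h\<close>.  In this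
  way the terms of a Steklov kernel, which use different steps, become differences with one common
  step.
\<close>

lemma fdiff_step_sum: "fdiff m (real j * h) u z = fdiff m h (step_sum j h m u) z"
proof (induction m arbitrary: z)
  case 0
  show ?case by (simp add: fdiff_def)
next
  case (Suc m)
  define g where "g = fdiff m h (step_sum j h m u)"
  have "fdiff (Suc m) (real j * h) u z = g (z + real j * h) - g (z + real 0 * h)"
    by (simp add: fdiff_Suc Suc g_def)
  also have "\<dots> = (\<Sum>l<j. g (z + real (Suc l) * h) - g (z + real l * h))"
    by (subst sum_lessThan_telescope) simp
  also have "\<dots> = (\<Sum>l<j. fdiff (Suc m) h (step_sum j h m u) (z + real l * h))"
    by (intro sum.cong) (auto simp: fdiff_Suc g_def algebra_simps)
  also have "\<dots> = fdiff (Suc m) h (step_sum j h (Suc m) u) z"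
    by (simp add: fdiff_sum fdiff_translate)
  finally show ?case .
qed

lemma step_sum_bound:
  assumes "\<And>z. \<bar>u z\<bar> \<le> B"
  shows "\<bar>step_sum j h m u z\<bar> \<le> real j ^ m * B"
proof (induction m arbitrary: z)
  case (Suc m)
  have "\<bar>step_sum j h (Suc m) u z\<bar> \<le> (\<Sum>l<j. \<bar>step_sum j h m u (z + real l * h)\<bar>)"
    by simp
  also have "\<dots> \<le> (\<Sum>l<j. real j ^ m * B)" by (intro sum_mono Suc)
  finally show ?case by simp
qed (use assms in simp)

lemma step_sum_zero:
  assumes "0 \<le> h" and "\<And>z. z \<notin> {c..d} \<Longrightarrow> u z = 0"
  shows "z \<notin> {c - real m * (real j - 1) * h..d} \<Longrightarrow> step_sum j h m u z = 0"
proof (induction m arbitrary: z)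
  case (Suc m)
  show ?case unfolding step_sum.simps
  proof (rule sum.neutral, rule ballI)
    fix l assume "l \<in> {..<j}"
    then have l: "real l \<le> real j - 1" by (simp add: of_nat_diff[symmetric] Suc_leI less_imp_Suc_add flip: of_nat_Suc) linarith?
    have "0 \<le> real l * h" "real l * h \<le> (real j - 1) * h" using assms(1) l by (auto intro: mult_right_mono)
    then have "z + real l * h \<notin> {c - real m * (real j - 1) * h..d}"
      using Suc.prems by (auto simp: algebra_simps)
    then show "step_sum j h m u (z + real l * h) = 0" by (rule Suc.IH)
  qed
qed (use assms in simp)

lemma continuous_on_step_sum:
  assumes "continuous_on UNIV u" shows "continuous_on UNIV (step_sum j h m u)"
proof (induction m)
  case (Suc m)
  have "continuous_on UNIV (\<lambda>z. step_sum j h m u (z + real l * h))" for l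
    by (rule continuous_on_compose2[OF Suc]) (auto intro!: continuous_intros)
  then show ?case by (auto intro!: continuous_intros)
qed (use assms in simp)

section \<open>Univariate Steklov kernels\<close>

text \<open>
  Supported in \<open>[1/2, 1]\<close>: the free half of \<open>[0, 1]\<close> is used up by \<open>r\<close> moving averages of length
  \<open>1 / (2 r)\<close>.
\<close>

definition tent :: "real \<Rightarrow> real" where
  "tent z = max 0 (1 - \<bar>4 * z - 3\<bar>)"

text \<open>
  The coefficients for which \<open>\<Sum>j=1..r. c\<^sub>j F (x + j h)\<close> differs from \<open>F x\<close> by \<open>\<plusminus>\<close> the \<open>r\<close>-th
  difference.
\<close>

definition reproduction_coeff :: "nat \<Rightarrow> nat \<Rightarrow> real" where
  "reproduction_coeff r j = - ((-1) ^ j * real (r choose j))"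

text \<open>
  After the substitution \<open>y = x + j h\<close> in each term, integration against this kernel is the map
  \<open>f \<mapsto> \<integral> (\<Sum>j=1..r. c\<^sub>j f (x + j h)) w ((h + \<delta> (x - a) / (b - a)) / \<delta>) dh / \<delta>\<close>.  For a profile \<open>w\<close>
  supported in \<open>[0, 1]\<close> the steps fill an interval of length \<open>\<delta>\<close> that slides with \<open>x\<close> from
  \<open>[0, \<delta>]\<close> at the left end of \<open>[a, b]\<close> to \<open>[-\<delta>, 0]\<close> at the right end, so that all nodes stay in
  \<open>[a, b]\<close>.
\<close>

definition steklov_kernel :: "nat \<Rightarrow> (real \<Rightarrow> real) \<Rightarrow> real \<Rightarrow> real \<Rightarrow> real \<Rightarrow> real \<Rightarrow> real \<Rightarrow> real" where
  "steklov_kernel r w a b \<delta> x y = (\<Sum>j\<in>{1..r}. reproduction_coeff r j / (real j * \<delta>) *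
      w ((y - (x - real j * (\<delta> / (b - a)) * (x - a))) / (real j * \<delta>)))"

text \<open>
  Integrating \<open>F\<close> against such a \<open>u\<close> amounts to integrating the \<open>m\<close>-th difference of \<open>F\<close> with step
  \<open>- h\<close> against \<open>V\<close>.  The condition on the support of \<open>V\<close> keeps all nodes of this difference in
  \<open>[a, b]\<close>.
\<close>

definition difference_kernel :: "nat \<Rightarrow> real \<Rightarrow> real \<Rightarrow> real \<Rightarrow> real \<Rightarrow> real \<Rightarrow> real \<Rightarrow> (real \<Rightarrow> real) \<Rightarrow> bool" where
  "difference_kernel m h a b \<rho> M x u \<longleftrightarrow> (\<exists>V\<in>borel_measurable borel. \<forall>y.
     u y = fdiff m h V y \<and> \<bar>V y\<bar> \<le> M \<and>
     (V y \<noteq> 0 \<longrightarrow> y \<in> {a..b} \<and> y - real m * h \<in> {a..b} \<and> \<bar>y - x\<bar> \<le> \<rho>))"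

text \<open>
  The point is the convex combination \<open>(1 - \<tau>) x + \<tau> (a + (b - a) \<theta>)\<close>.
\<close>

lemma contraction_mem:
  fixes a b x \<theta> \<tau> :: real
  assumes "x \<in> {a..b}" "0 \<le> \<theta>" "\<theta> \<le> 1" "0 \<le> \<tau>" "\<tau> \<le> 1"
  shows "x - \<tau> * (x - a) + \<tau> * (b - a) * \<theta> \<in> {a..b}" "\<bar>x - \<tau> * (x - a) + \<tau> * (b - a) * \<theta> - x\<bar> \<le> \<tau> * (b - a)"
proof -
  define z where "z = a + (b - a) * \<theta>"
  have ab: "0 \<le> b - a" using assms by auto
  have "0 \<le> (b - a) * \<theta>" "(b - a) * \<theta> \<le> b - a" using assms ab by (auto intro: mult_left_le)
  then have z: "a \<le> z" "z \<le> b" by (auto simp: z_def)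
  have eq: "x - \<tau> * (x - a) + \<tau> * (b - a) * \<theta> = x + \<tau> * (z - x)" by (simp add: z_def algebra_simps)
  have "x + \<tau> * (z - x) = (1 - \<tau>) * x + \<tau> * z" by (simp add: algebra_simps)
  moreover have "(1 - \<tau>) * a \<le> (1 - \<tau>) * x" "(1 - \<tau>) * x \<le> (1 - \<tau>) * b" "\<tau> * a \<le> \<tau> * z" "\<tau> * z \<le> \<tau> * b"
    using assms z by (auto intro: mult_left_mono)
  moreover have "(1 - \<tau>) * a + \<tau> * a = a" "(1 - \<tau>) * b + \<tau> * b = b" by (simp_all add: algebra_simps)
  ultimately show "x - \<tau> * (x - a) + \<tau> * (b - a) * \<theta> \<in> {a..b}" unfolding eq atLeastAtMost_iff by linarith
  have "\<bar>z - x\<bar> \<le> b - a" using z assms(1) by auto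
  then have "\<tau> * \<bar>z - x\<bar> \<le> \<tau> * (b - a)" using assms by (intro mult_left_mono)
  then show "\<bar>x - \<tau> * (x - a) + \<tau> * (b - a) * \<theta> - x\<bar> \<le> \<tau> * (b - a)"
    unfolding eq using assms by (simp add: abs_mult)
qed

locale steklov =
  fixes r :: nat and w :: "nat \<Rightarrow> real \<Rightarrow> real" and B a b \<delta> :: real
  assumes r: "1 \<le> r"
    and w_deriv: "\<And>m z. m < r \<Longrightarrow> (w m has_real_derivative w (Suc m) z) (at z)"
    and w_cont: "\<And>m. m \<le> r \<Longrightarrow> continuous_on UNIV (w m)"
    and w_top: "\<And>z. w r z = fdiff r (1 / (2 * real r)) tent z * (2 * real r) ^ r"
    and w_supp: "\<And>m z. m \<le> r \<Longrightarrow> z \<notin> {0..1} \<Longrightarrow> w m z = 0"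
    and w_bound: "\<And>m z. m \<le> r \<Longrightarrow> \<bar>w m z\<bar> \<le> B" and B: "0 \<le> B"
    and \<delta>: "0 < \<delta>" "2 * real r * \<delta> \<le> b - a"
begin

text \<open>
  With \<open>w m\<close> as the \<open>m\<close>-th derivative of the profile \<open>w 0\<close>, \<open>\<kappa> m\<close> is the \<open>m\<close>-th derivative in \<open>x\<close>
  of the Steklov kernel: by the chain rule each differentiation contributes the factor
  \<open>- (1 - j s) / (j \<delta>)\<close>.  The function \<open>V x\<close> is the one of which \<open>\<kappa> r x\<close> is the \<open>r\<close>-th difference,
  with the common step \<open>h\<close> for all terms \<open>j\<close>.
\<close>

definition s where "s = \<delta> / (b - a)"
definition \<zeta> where "\<zeta> j x y = (y - (x - real j * s * (x - a))) / (real j * \<delta>)"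
definition \<kappa> where "\<kappa> m x y = (\<Sum>j\<in>{1..r}. reproduction_coeff r j / (real j * \<delta>) *
    (- (1 - real j * s) / (real j * \<delta>)) ^ m * w m (\<zeta> j x y))"
definition h where "h = \<delta> / (2 * real r)"
definition \<gamma> where "\<gamma> j = reproduction_coeff r j / (real j * \<delta>) *
    (- (1 - real j * s) / (real j * \<delta>)) ^ r * (2 * real r) ^ r"
definition \<nu> where "\<nu> j = step_sum j (1 / (2 * real r) / real j) r tent"
definition V where "V x y = (\<Sum>j\<in>{1..r}. \<gamma> j * \<nu> j (\<zeta> j x y))"

lemma ab: "0 < b - a"
proof -
  have "0 < 2 * real r * \<delta>" using r \<delta> by auto
  then show ?thesis using \<delta> by linarith
qed

lemma node_scale:
  assumes "j \<in> {1..r}" shows "0 \<le> real j * s" "real j * s \<le> 1" "real j * s * (b - a) = real j * \<delta>" "0 < real j * \<delta>"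
    "real j * \<delta> \<le> real r * \<delta>"
proof -
  show "0 \<le> real j * s" using ab \<delta> by (simp add: s_def)
  show "real j * s * (b - a) = real j * \<delta>" using ab by (simp add: s_def)
  show "0 < real j * \<delta>" using assms \<delta> by simp
  show "real j * \<delta> \<le> real r * \<delta>" using assms \<delta> by (intro mult_right_mono) auto
  moreover have "real r * \<delta> \<le> b - a" using \<delta> ab by linarith
  ultimately show "real j * s \<le> 1" using ab by (simp add: s_def divide_le_eq)
qed

lemma \<kappa>_0: "\<kappa> 0 x y = steklov_kernel r (w 0) a b \<delta> x y"
  by (simp add: \<kappa>_def steklov_kernel_def \<zeta>_def s_def)

text \<open>
  The substitution \<open>\<zeta> = \<zeta> j x y\<close> writes \<open>y\<close> as a contraction of a point of \<open>[a, b]\<close> towards \<open>x\<close>.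
  The offset \<open>c\<close> treats the far node of a difference in the same way.
\<close>

lemma \<zeta>_support:
  assumes j: "j \<in> {1..r}" and x: "x \<in> {a..b}" and z: "0 \<le> \<zeta> j x y - c" "\<zeta> j x y - c \<le> 1"
  shows "y - real j * \<delta> * c \<in> {a..b}" "\<bar>y - real j * \<delta> * c - x\<bar> \<le> real r * \<delta>"
proof -
  have "y - real j * \<delta> * c = x - (real j * s) * (x - a) + (real j * s) * (b - a) * (\<zeta> j x y - c)"
  proof -
    have "real j * \<delta> \<noteq> 0" using node_scale(4)[OF j] by linarith
    then have "real j * \<delta> * \<zeta> j x y = y - (x - real j * s * (x - a))"
      unfolding \<zeta>_def times_divide_eq_right by (rule nonzero_mult_div_cancel_left)
    then show ?thesis unfolding node_scale(3)[OF j] right_diff_distrib[of _ "\<zeta> j x y"] by simp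
  qed
  then show "y - real j * \<delta> * c \<in> {a..b}" "\<bar>y - real j * \<delta> * c - x\<bar> \<le> real r * \<delta>"
    using contraction_mem[OF x z node_scale(1,2)[OF j]] node_scale(3,5)[OF j] by auto
qed

lemma \<kappa>_deriv:
  assumes "m < r" shows "((\<lambda>x. \<kappa> m x y) has_real_derivative \<kappa> (Suc m) x y) (at x)"
proof -
  have "((\<lambda>x. w m (\<zeta> j x y)) has_real_derivative w (Suc m) (\<zeta> j x y) * (- (1 - real j * s) / (real j * \<delta>))) (at x)"
    if "j \<in> {1..r}" for j
  proof (rule DERIV_chain2[OF w_deriv[OF assms]])
    have "(\<zeta> j x y) = (y - real j * s * a) / (real j * \<delta>) + (- (1 - real j * s) / (real j * \<delta>)) * x" for x
    proof -
      have "y - (x - real j * s * (x - a)) = (y - real j * s * a) + (- (1 - real j * s)) * x" by (simp add: algebra_simps)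
      then show ?thesis unfolding \<zeta>_def by (simp only: add_divide_distrib times_divide_eq_left)
    qed
    note eq = this
    have lin: "((\<lambda>x. c1 + c2 * x) has_real_derivative c2) (at x)" for c1 c2 :: real
      by (auto intro!: derivative_eq_intros)
    show "((\<lambda>x. \<zeta> j x y) has_real_derivative - (1 - real j * s) / (real j * \<delta>)) (at x)"
      unfolding eq by (rule lin)
  qed
  then have "((\<lambda>x. reproduction_coeff r j / (real j * \<delta>) * (- (1 - real j * s) / (real j * \<delta>)) ^ m * w m (\<zeta> j x y))
     has_real_derivative reproduction_coeff r j / (real j * \<delta>) * (- (1 - real j * s) / (real j * \<delta>)) ^ Suc m * w (Suc m) (\<zeta> j x y)) (at x)"
    if "j \<in> {1..r}" for j
    by (rule DERIV_cong[OF DERIV_cmult]) (use that in \<open>simp_all only: power_Suc mult_ac\<close>)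
  then show ?thesis unfolding \<kappa>_def by (intro DERIV_sum) auto
qed

lemma continuous_\<zeta>:
  assumes "j \<in> {1..r}" and u: "continuous_on UNIV u"
  shows "continuous_on UNIV (\<lambda>z. u (\<zeta> j (fst z) (snd z)))"
  unfolding \<zeta>_def using node_scale(4)[OF assms(1)]
  by (intro continuous_on_compose2[OF u]) (auto intro!: continuous_intros)

lemma \<kappa>_cont: "m \<le> r \<Longrightarrow> continuous_on UNIV (\<lambda>z. \<kappa> m (fst z) (snd z))"
  unfolding \<kappa>_def by (intro continuous_on_sum continuous_on_mult continuous_on_const continuous_\<zeta> w_cont) auto

lemma coeff_bound:
  assumes j: "j \<in> {1..r}"
  shows "\<bar>reproduction_coeff r j / (real j * \<delta>) * (- (1 - real j * s) / (real j * \<delta>)) ^ m\<bar> \<le> 2 ^ r / \<delta> ^ Suc m"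
proof -
  have "\<bar>reproduction_coeff r j\<bar> \<le> 2 ^ r"
  proof -
    have "real (r choose j) \<le> real (2 ^ r)" by (subst of_nat_le_iff) (rule binomial_le_pow2)
    then show ?thesis by (simp add: reproduction_coeff_def abs_mult power_abs)
  qed
  moreover have jd: "\<delta> \<le> real j * \<delta>" using j \<delta> by simp
  ultimately have 1: "\<bar>reproduction_coeff r j / (real j * \<delta>)\<bar> \<le> 2 ^ r / \<delta>"
    unfolding abs_divide using \<delta> node_scale(4)[OF j] by (intro frac_le) auto
  have "\<bar>- (1 - real j * s) / (real j * \<delta>)\<bar> \<le> 1 / \<delta>"
    using jd \<delta> node_scale(1,2)[OF j] by (simp only: abs_divide abs_minus) (intro frac_le; auto)
  then have "\<bar>- (1 - real j * s) / (real j * \<delta>)\<bar> ^ m \<le> (1 / \<delta>) ^ m" by (intro power_mono) auto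
  with 1 have "\<bar>reproduction_coeff r j / (real j * \<delta>)\<bar> * \<bar>- (1 - real j * s) / (real j * \<delta>)\<bar> ^ m \<le> 2 ^ r / \<delta> * (1 / \<delta>) ^ m"
    using \<delta> by (intro mult_mono) auto
  then show ?thesis unfolding abs_mult power_abs by (simp add: power_divide)
qed

lemma \<kappa>_support:
  assumes "m \<le> r" "x \<in> {a..b}" "\<kappa> m x y \<noteq> 0"
  shows "y \<in> {a..b}" "\<bar>y - x\<bar> \<le> real r * \<delta>"
proof -
  obtain j where j: "j \<in> {1..r}" "w m (\<zeta> j x y) \<noteq> 0"
    using assms(3) unfolding \<kappa>_def by (auto elim!: sum.not_neutral_contains_not_neutral)
  then have "\<zeta> j x y \<in> {0..1}" using w_supp[OF assms(1)] by blast
  then show "y \<in> {a..b}" "\<bar>y - x\<bar> \<le> real r * \<delta>"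
    using \<zeta>_support[OF j(1) assms(2), of y 0] by auto
qed

lemma \<kappa>_bound:
  assumes "m \<le> r" shows "\<bar>\<kappa> m x y\<bar> \<le> real r * 2 ^ r * B / \<delta> ^ Suc m"
proof -
  have "\<bar>\<kappa> m x y\<bar> \<le> (\<Sum>j\<in>{1..r}. \<bar>reproduction_coeff r j / (real j * \<delta>) *
    (- (1 - real j * s) / (real j * \<delta>)) ^ m * w m (\<zeta> j x y)\<bar>)" unfolding \<kappa>_def by (rule sum_abs)
  also have "\<dots> \<le> (\<Sum>j\<in>{1..r}. 2 ^ r / \<delta> ^ Suc m * B)"
    unfolding abs_mult[of "_ * _" "w m _"] using w_bound[OF assms] \<delta>
    by (intro sum_mono mult_mono coeff_bound) auto
  finally show ?thesis by simp
qed

lemma tent_props: "continuous_on UNIV tent" "0 \<le> tent z" "\<bar>tent z\<bar> \<le> 1" "z \<notin> {1/2..1} \<Longrightarrow> tent z = 0"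
  unfolding tent_def by (auto intro!: continuous_intros)

lemma \<nu>_bound:
  assumes "j \<in> {1..r}" shows "\<bar>\<nu> j z\<bar> \<le> real r ^ r"
proof -
  from assms
  have "real j ^ r \<le> real r ^ r" by (intro power_mono) auto
  moreover have "\<bar>\<nu> j z\<bar> \<le> real j ^ r" unfolding \<nu>_def
    using step_sum_bound[OF tent_props(3), where j=j and h="1 / (2 * real r) / real j" and m=r and z=z] by simp
  ultimately show ?thesis by linarith
qed

text \<open>
  The sums of translates move the left end of the support from \<open>1/2\<close> to \<open>1 / (2 j)\<close>.  This is
  exactly the length, in the variable \<open>\<zeta>\<close>, of \<open>r\<close> steps of size \<open>h\<close>.
\<close>

lemma \<nu>_supp:
  assumes j: "j \<in> {1..r}" and "\<nu> j z \<noteq> 0"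
  shows "0 \<le> z - 1 / (2 * real j)" "z \<le> 1"
proof -
  have "1 / 2 - real r * (real j - 1) * (1 / (2 * real r) / real j) = 1 / (2 * real j)"
    using j by (simp add: field_simps)
  moreover have "z \<in> {1 / 2 - real r * (real j - 1) * (1 / (2 * real r) / real j)..1}"
    by (rule ccontr) (use step_sum_zero[of "1 / (2 * real r) / real j" "1/2" 1 tent z r j, OF _ tent_props(4)] assms(2)
      in \<open>simp add: \<nu>_def\<close>)
  ultimately show "0 \<le> z - 1 / (2 * real j)" "z \<le> 1" by simp_all
qed

text \<open>
  In the variable \<open>\<zeta> j x y\<close> the step \<open>h\<close> in \<open>y\<close> has length \<open>1 / (2 r j)\<close>, and \<open>j\<close> of these make up
  one step \<open>1 / (2 r)\<close> of the profile.
\<close>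

lemma \<kappa>_diff: "\<kappa> r x y = fdiff r h (V x) y"
proof -
  have "fdiff r h (V x) y = (\<Sum>j\<in>{1..r}. \<gamma> j * fdiff r (h / (real j * \<delta>)) (\<nu> j) (\<zeta> j x y))"
    unfolding V_def \<zeta>_def fdiff_sum fdiff_cmult using node_scale(4) \<delta>(1)
    by (intro sum.cong refl arg_cong2[where f="(*)"] fdiff_affine) auto
  also have "\<dots> = (\<Sum>j\<in>{1..r}. \<gamma> j * fdiff r (1 / (2 * real r)) tent (\<zeta> j x y))"
  proof (intro sum.cong refl arg_cong2[where f="(*)"])
    fix j assume j: "j \<in> {1..r}"
    have 1: "h / (real j * \<delta>) = 1 / (2 * real r) / real j" using \<delta> by (simp add: h_def)
    have 2: "real j * (1 / (2 * real r) / real j) = 1 / (2 * real r)" using j by simp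
    show "fdiff r (h / (real j * \<delta>)) (\<nu> j) (\<zeta> j x y) = fdiff r (1 / (2 * real r)) tent (\<zeta> j x y)"
      unfolding \<nu>_def 1 fdiff_step_sum[symmetric] 2 ..
  qed
  also have "\<dots> = \<kappa> r x y" unfolding \<kappa>_def w_top \<gamma>_def by (simp add: mult_ac)
  finally show ?thesis ..
qed

lemma V_cont: "continuous_on UNIV (\<lambda>z. V (fst z) (snd z))"
  unfolding V_def \<nu>_def
  by (intro continuous_on_sum continuous_on_mult continuous_on_const continuous_\<zeta> continuous_on_step_sum tent_props) auto

lemma V_bound: "\<bar>V x y\<bar> \<le> real r * 2 ^ r * (2 * real r) ^ r * real r ^ r / \<delta> ^ Suc r"
proof -
  have "\<bar>V x y\<bar> \<le> (\<Sum>j\<in>{1..r}. \<bar>\<gamma> j * \<nu> j (\<zeta> j x y)\<bar>)" unfolding V_def by (rule sum_abs)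
  also have "\<dots> \<le> (\<Sum>j\<in>{1..r}. 2 ^ r / \<delta> ^ Suc r * (2 * real r) ^ r * real r ^ r)"
  proof (rule sum_mono)
    fix j assume j: "j \<in> {1..r}"
    have "\<bar>\<gamma> j\<bar> \<le> 2 ^ r / \<delta> ^ Suc r * (2 * real r) ^ r"
      unfolding \<gamma>_def abs_mult[of "_ * _" "(2 * real r) ^ r"]
      using coeff_bound[OF j, of r] \<delta>(1) by (intro mult_mono) auto
    then show "\<bar>\<gamma> j * \<nu> j (\<zeta> j x y)\<bar> \<le> 2 ^ r / \<delta> ^ Suc r * (2 * real r) ^ r * real r ^ r"
      unfolding abs_mult[of "\<gamma> j"] using \<nu>_bound[OF j] \<delta> by (intro mult_mono) auto
  qed
  finally show ?thesis by (simp add: mult_ac)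
qed

lemma V_support:
  assumes "x \<in> {a..b}" "V x y \<noteq> 0"
  shows "y \<in> {a..b}" "y - real r * h \<in> {a..b}" "\<bar>y - x\<bar> \<le> real r * \<delta>"
proof -
  obtain j where j: "j \<in> {1..r}" "\<nu> j (\<zeta> j x y) \<noteq> 0"
    using assms(2) unfolding V_def by (auto elim!: sum.not_neutral_contains_not_neutral)
  note z = \<nu>_supp[OF j]
  have pos: "0 < 1 / (2 * real j)" using j by simp
  have "real j * \<delta> * (1 / (2 * real j)) = real r * h" using j by (simp add: h_def)
  then show "y \<in> {a..b}" "y - real r * h \<in> {a..b}" "\<bar>y - x\<bar> \<le> real r * \<delta>"
    using \<zeta>_support[OF j(1) assms(1), of y 0] \<zeta>_support[OF j(1) assms(1), of y "1 / (2 * real j)"] z pos by auto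
qed

end

section \<open>Taylor polynomials of Steklov kernels\<close>

text \<open>
  What the multivariate argument uses of a kernel, where \<open>k m\<close> is the \<open>m\<close>-th derivative in \<open>x\<close>:
  the kernel is bounded, and both \<open>t ^ r\<close> times its \<open>r\<close>-th derivative and its deviation from the
  Steklov kernel are \<open>r\<close>-th differences.  Since \<open>C\<close> is an argument, its independence of the
  interval and of \<open>t\<close> can be expressed.
\<close>

definition smoothing_kernel ::
    "nat \<Rightarrow> (real \<Rightarrow> real) \<Rightarrow> real \<Rightarrow> real \<Rightarrow> real \<Rightarrow> real \<Rightarrow> real \<Rightarrow> (nat \<Rightarrow> real \<Rightarrow> real \<Rightarrow> real) \<Rightarrow> bool" where
  "smoothing_kernel r w C a b t \<delta> k \<longleftrightarrow>
    0 < \<delta> \<and> \<delta> \<le> t \<and> 2 * real r * \<delta> \<le> b - a \<and>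
    (\<forall>m<r. \<forall>x y. ((\<lambda>x. k m x y) has_real_derivative k (Suc m) x y) (at x)) \<and>
    (\<forall>m\<le>r. continuous_on UNIV (\<lambda>z. k m (fst z) (snd z))) \<and>
    (\<forall>x\<in>{a..b}.
      difference_kernel 0 (\<delta> / (2 * real r)) a b (2 * real r * \<delta>) (C / \<delta>) x (k 0 x) \<and>
      difference_kernel r (\<delta> / (2 * real r)) a b (2 * real r * \<delta>) (C / \<delta>) x (\<lambda>y. t ^ r * k r x y) \<and>
      difference_kernel r (\<delta> / (2 * real r)) a b (2 * real r * \<delta>) (C / \<delta>) x (\<lambda>y. steklov_kernel r w a b \<delta> x y - k 0 x y))"

lemma difference_kernel_zero: "0 \<le> M \<Longrightarrow> difference_kernel m h a b \<rho> M x (\<lambda>y. 0)"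
  unfolding difference_kernel_def by (intro bexI[of _ "\<lambda>y. 0"]) (auto simp: fdiff_def)

lemma difference_kernel_mono:
  assumes "difference_kernel m h a b \<rho> M x u" "\<rho> \<le> \<rho>'" "M \<le> M'"
  shows "difference_kernel m h a b \<rho>' M' x u"
proof -
  obtain V where V: "V \<in> borel_measurable borel" "\<And>y. u y = fdiff m h V y" "\<And>y. \<bar>V y\<bar> \<le> M"
     "\<And>y. V y \<noteq> 0 \<Longrightarrow> y \<in> {a..b} \<and> y - real m * h \<in> {a..b} \<and> \<bar>y - x\<bar> \<le> \<rho>"
    using assms(1) unfolding difference_kernel_def by blast
  have "\<bar>V y\<bar> \<le> M'" for y using V(3)[of y] assms(3) by linarith
  moreover have "V y \<noteq> 0 \<longrightarrow> y \<in> {a..b} \<and> y - real m * h \<in> {a..b} \<and> \<bar>y - x\<bar> \<le> \<rho>'" for y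
    using V(4)[of y] assms(2) by auto
  ultimately show ?thesis unfolding difference_kernel_def using V(1,2) by (intro bexI[of _ V]) auto
qed

lemma continuous_slice:
  fixes f :: "real \<Rightarrow> real \<Rightarrow> real"
  assumes "continuous_on UNIV (\<lambda>z. f (fst z) (snd z))"
  shows "continuous_on UNIV (f x)" "continuous_on UNIV (\<lambda>x. f x y)"
proof -
  have "continuous_on UNIV (\<lambda>y. (\<lambda>z. f (fst z) (snd z)) (x, y))"
    by (rule continuous_on_compose2[OF assms]) (auto intro!: continuous_intros)
  then show "continuous_on UNIV (f x)" by simp
  have "continuous_on UNIV (\<lambda>x. (\<lambda>z. f (fst z) (snd z)) (x, y))"
    by (rule continuous_on_compose2[OF assms]) (auto intro!: continuous_intros)
  then show "continuous_on UNIV (\<lambda>x. f x y)" by simp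
qed

context steklov
begin

lemma difference_kernel_\<kappa>_0:
  assumes x: "x \<in> {a..b}"
  shows "difference_kernel 0 h a b (real r * \<delta>) (real r * 2 ^ r * B / \<delta>) x (\<kappa> 0 x)"
  unfolding difference_kernel_def
proof (intro bexI[of _ "\<kappa> 0 x"] allI conjI impI)
  show "\<kappa> 0 x y = fdiff 0 h (\<kappa> 0 x) y" for y by (simp add: fdiff_def)
  show "\<bar>\<kappa> 0 x y\<bar> \<le> real r * 2 ^ r * B / \<delta>" for y using \<kappa>_bound[of 0 x y] by simp
  show "\<kappa> 0 x \<in> borel_measurable borel"
    by (intro borel_measurable_continuous_onI continuous_slice(1) \<kappa>_cont) simp
  fix y assume "\<kappa> 0 x y \<noteq> 0"
  then show "y \<in> {a..b}" "y - real 0 * h \<in> {a..b}" "\<bar>y - x\<bar> \<le> real r * \<delta>"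
    using \<kappa>_support[of 0 x y] x by auto
qed

lemma difference_kernel_\<kappa>_r:
  assumes x: "x \<in> {a..b}" and T: "0 \<le> T" "T \<le> \<delta> ^ r"
  shows "difference_kernel r h a b (real r * \<delta>) (real r * 2 ^ r * (2 * real r) ^ r * real r ^ r / \<delta>) x (\<lambda>y. T * \<kappa> r x y)"
  unfolding difference_kernel_def
proof (intro bexI[of _ "\<lambda>y. T * V x y"] allI conjI impI)
  show "T * \<kappa> r x y = fdiff r h (\<lambda>y. T * V x y) y" for y by (simp add: \<kappa>_diff fdiff_cmult)
  show "\<bar>T * V x y\<bar> \<le> real r * 2 ^ r * (2 * real r) ^ r * real r ^ r / \<delta>" for y
  proof -
    have "\<bar>T * V x y\<bar> \<le> \<delta> ^ r * (real r * 2 ^ r * (2 * real r) ^ r * real r ^ r / \<delta> ^ Suc r)"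
      unfolding abs_mult using T V_bound[of x y] by (intro mult_mono) auto
    then show ?thesis using \<delta>(1) by simp
  qed
  show "(\<lambda>y. T * V x y) \<in> borel_measurable borel"
    by (intro borel_measurable_continuous_onI continuous_on_mult continuous_on_const continuous_slice(1) V_cont)
  fix y assume "T * V x y \<noteq> 0"
  then have "V x y \<noteq> 0" by simp
  then show "y \<in> {a..b}" "y - real r * h \<in> {a..b}" "\<bar>y - x\<bar> \<le> real r * \<delta>"
    by (rule V_support[OF x])+
qed

text \<open>
  The \<open>m\<close>-th derivative of the Taylor polynomial of degree less than \<open>r\<close> of \<open>\<kappa> 0\<close> in \<open>x\<close>, expanded
  at the left end point.
\<close>

definition \<tau> where "\<tau> m x y = (\<Sum>l<r - m. \<kappa> (m + l) a y * ((x - a) ^ l / fact l))"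

lemma \<tau>_r: "\<tau> r x y = 0" by (simp add: \<tau>_def)

lemma \<tau>_deriv:
  assumes "m < r" shows "((\<lambda>x. \<tau> m x y) has_real_derivative \<tau> (Suc m) x y) (at x)"
proof -
  define n where "n = r - Suc m"
  have n: "r - m = Suc n" using assms by (simp add: n_def)
  have eq: "\<tau> m x y = \<kappa> m a y + (\<Sum>l<n. \<kappa> (Suc m + l) a y * ((x - a) ^ Suc l / fact (Suc l)))" for x
    unfolding \<tau>_def n by (subst sum.lessThan_Suc_shift) simp
  have "((\<lambda>x. (x - a) ^ Suc l / fact (Suc l)) has_real_derivative (x - a) ^ l / fact l) (at x)" for l
  proof -
    have "((\<lambda>x. (x - a) ^ Suc l) has_real_derivative real (Suc l) * (x - a) ^ l) (at x)"
      by (rule DERIV_cong[OF DERIV_power[where D=1]]) (auto intro!: derivative_eq_intros)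
    then have "((\<lambda>x. (x - a) ^ Suc l / fact (Suc l)) has_real_derivative real (Suc l) * (x - a) ^ l / fact (Suc l)) (at x)"
      by (rule DERIV_cdivide)
    moreover have "real (Suc l) * (x - a) ^ l / fact (Suc l) = (x - a) ^ l / fact l"
      by (simp add: field_simps del: of_nat_Suc)
    ultimately show ?thesis by simp
  qed
  then have "((\<lambda>x. \<kappa> m a y + (\<Sum>l<n. \<kappa> (Suc m + l) a y * ((x - a) ^ Suc l / fact (Suc l)))) has_real_derivative
     0 + (\<Sum>l<n. \<kappa> (Suc m + l) a y * ((x - a) ^ l / fact l))) (at x)"
    by (intro DERIV_add DERIV_const DERIV_sum DERIV_cmult)
  then show ?thesis unfolding eq by (simp add: \<tau>_def n_def)
qed

lemma \<tau>_cont: "continuous_on UNIV (\<lambda>z. \<tau> m (fst z) (snd z))"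
proof -
  have "continuous_on UNIV (\<lambda>z::real\<times>real. \<kappa> (m + l) a (snd z))" if "l < r - m" for l
    by (rule continuous_on_compose2[OF continuous_slice(1)[OF \<kappa>_cont]]) (use that in \<open>auto intro!: continuous_intros\<close>)
  then show ?thesis unfolding \<tau>_def by (intro continuous_on_sum continuous_on_mult) (auto intro!: continuous_intros)
qed

lemma difference_kernel_\<tau>_0:
  assumes x: "x \<in> {a..b}" and full: "2 * real r * \<delta> = b - a"
  shows "difference_kernel 0 h a b (2 * real r * \<delta>) (real r * (real r * 2 ^ r * B * (2 * real r) ^ r) / \<delta>) x (\<tau> 0 x)"
  unfolding difference_kernel_def
proof (intro bexI[of _ "\<tau> 0 x"] allI conjI impI)
  show "\<tau> 0 x y = fdiff 0 h (\<tau> 0 x) y" for y by (simp add: fdiff_def)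
  show "\<tau> 0 x \<in> borel_measurable borel"
    by (intro borel_measurable_continuous_onI continuous_slice(1) \<tau>_cont)
  show "\<bar>\<tau> 0 x y\<bar> \<le> real r * (real r * 2 ^ r * B * (2 * real r) ^ r) / \<delta>" for y
  proof -
    have "\<bar>\<tau> 0 x y\<bar> \<le> (\<Sum>l<r. \<bar>\<kappa> l a y * ((x - a) ^ l / fact l)\<bar>)"
      unfolding \<tau>_def by (rule order_trans[OF sum_abs]) simp
    also have "\<dots> \<le> (\<Sum>l<r. real r * 2 ^ r * B * (2 * real r) ^ r / \<delta>)"
    proof (rule sum_mono)
      fix l assume "l \<in> {..<r}"
      then have l: "l \<le> r" by simp
      have xa: "0 \<le> x - a" "x - a \<le> 2 * real r * \<delta>" using x full by auto
      have "\<bar>(x - a) ^ l / fact l\<bar> = (x - a) ^ l / fact l" using xa by simp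
      also have "\<dots> \<le> (x - a) ^ l / 1" using xa by (intro divide_left_mono) (auto simp: fact_ge_1)
      also have "\<dots> \<le> (2 * real r * \<delta>) ^ l" using xa by (simp add: power_mono)
      finally have 1: "\<bar>(x - a) ^ l / fact l\<bar> \<le> (2 * real r * \<delta>) ^ l" .
      have "\<bar>\<kappa> l a y * ((x - a) ^ l / fact l)\<bar> \<le> real r * 2 ^ r * B / \<delta> ^ Suc l * (2 * real r * \<delta>) ^ l"
        unfolding abs_mult[of "\<kappa> l a y"] using \<kappa>_bound[OF l, of a y] 1 B \<delta>(1) by (intro mult_mono) auto
      also have "\<dots> = real r * 2 ^ r * B * (2 * real r) ^ l / \<delta>" using \<delta>(1) by (simp add: power_mult_distrib)
      also have "\<dots> \<le> real r * 2 ^ r * B * (2 * real r) ^ r / \<delta>"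
        using \<delta>(1) B r l by (intro divide_right_mono mult_left_mono power_increasing) auto
      finally show "\<bar>\<kappa> l a y * ((x - a) ^ l / fact l)\<bar> \<le> real r * 2 ^ r * B * (2 * real r) ^ r / \<delta>" .
    qed
    finally show ?thesis by simp
  qed
  fix y assume "\<tau> 0 x y \<noteq> 0"
  then obtain l where l: "l < r" "\<kappa> l a y \<noteq> 0"
    unfolding \<tau>_def by (auto elim!: sum.not_neutral_contains_not_neutral)
  have "y \<in> {a..b}" using \<kappa>_support(1)[of l a y] l ab by auto
  then show "y \<in> {a..b}" "y - real 0 * h \<in> {a..b}" "\<bar>y - x\<bar> \<le> 2 * real r * \<delta>"
    using x full by auto
qed

text \<open>
  The remainder is an integral of \<open>\<kappa> r u\<close> over \<open>u\<close>.  Differences in \<open>y\<close> commute with this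
  integral.
\<close>

lemma taylor_remainder:
  assumes x: "x \<in> {a..b}"
  shows "\<kappa> 0 x y - \<tau> 0 x y = fdiff r h (\<lambda>y. integral {a..x} (\<lambda>u. (x - u) ^ (r - 1) / fact (r - 1) * V u y)) y"
proof -
  define p where "p u = (x - u) ^ (r - 1) / fact (r - 1)" for u
  have int: "(\<lambda>u. p u * V u z) integrable_on {a..x}" for z
    unfolding p_def
    by (intro integrable_continuous_interval continuous_intros continuous_on_subset[OF continuous_slice(2)[OF V_cont]]) auto
  have "\<kappa> 0 x y = (\<Sum>i<r. ((x - a) ^ i / fact i) *\<^sub>R \<kappa> i a y) + integral {a..x} (\<lambda>u. p u *\<^sub>R \<kappa> r u y)"
    unfolding p_def
  proof (rule Taylor_integral[where f="\<lambda>u. \<kappa> 0 u y" and Df="\<lambda>m u. \<kappa> m u y"])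
    show "((\<lambda>u. \<kappa> m u y) has_vector_derivative \<kappa> (Suc m) t y) (at t within {a..x})" if "m < r" for m t
      using \<kappa>_deriv[OF that, of y t]
      by (auto simp: has_real_derivative_iff_has_vector_derivative intro: has_vector_derivative_at_within)
  qed (use r x in auto)
  also have "(\<Sum>i<r. ((x - a) ^ i / fact i) *\<^sub>R \<kappa> i a y) = \<tau> 0 x y"
    by (simp add: \<tau>_def mult.commute)
  finally have "\<kappa> 0 x y - \<tau> 0 x y = integral {a..x} (\<lambda>u. p u * \<kappa> r u y)" by simp
  also have "\<dots> = integral {a..x} (\<lambda>u. \<Sum>j\<le>r. (-1) ^ (r - j) * real (r choose j) * (p u * V u (y + real j * h)))"
    unfolding \<kappa>_diff fdiff_def sum_distrib_left by (simp add: mult_ac)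
  also have "\<dots> = (\<Sum>j\<le>r. (-1) ^ (r - j) * real (r choose j) * integral {a..x} (\<lambda>u. p u * V u (y + real j * h)))"
    by (subst integral_sum) (auto intro: integrable_on_cmult_left int)
  finally show ?thesis by (simp add: fdiff_def p_def)
qed

lemma difference_kernel_remainder:
  assumes x: "x \<in> {a..b}" and full: "2 * real r * \<delta> = b - a"
  shows "difference_kernel r h a b (2 * real r * \<delta>) ((2 * real r) ^ r * (real r * 2 ^ r * (2 * real r) ^ r * real r ^ r) / \<delta>)
     x (\<lambda>y. \<kappa> 0 x y - \<tau> 0 x y)"
proof -
  define E where "E y = integral {a..x} (\<lambda>u. (x - u) ^ (r - 1) / fact (r - 1) * V u y)" for y
  define M where "M = real r * 2 ^ r * (2 * real r) ^ r * real r ^ r"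
  have M: "0 \<le> M" by (simp add: M_def)
  have Vb: "\<bar>V u y\<bar> \<le> M / \<delta> ^ Suc r" for u y using V_bound[of u y] by (simp add: M_def)
  have int: "(\<lambda>u. (x - u) ^ (r - 1) / fact (r - 1) * V u y) integrable_on {a..x}" for y
    by (intro integrable_continuous_interval continuous_intros continuous_on_subset[OF continuous_slice(2)[OF V_cont]]) auto
  show ?thesis unfolding difference_kernel_def M_def[symmetric]
  proof (intro bexI[of _ E] allI conjI impI)
    show "\<kappa> 0 x y - \<tau> 0 x y = fdiff r h E y" for y
      unfolding E_def by (rule taylor_remainder[OF x])
    have "continuous_on UNIV (\<lambda>y. integral (cbox a x) (\<lambda>u. (x - u) ^ (r - 1) / fact (r - 1) * V u y))"
    proof (rule integral_continuous_on_param)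
      have "continuous_on (UNIV \<times> cbox a x) (\<lambda>z. V (fst (snd z, fst z)) (snd (snd z, fst z)))"
        by (rule continuous_on_compose2[OF V_cont]) (auto intro!: continuous_intros)
      then show "continuous_on (UNIV \<times> cbox a x) (\<lambda>(y, u). (x - u) ^ (r - 1) / fact (r - 1) * V u y)"
        by (auto simp: split_beta intro!: continuous_intros)
    qed
    then show "E \<in> borel_measurable borel" unfolding E_def by (intro borel_measurable_continuous_onI) simp
    show "\<bar>E y\<bar> \<le> (2 * real r) ^ r * M / \<delta>" for y
    proof -
      have xa: "0 \<le> x - a" "x - a \<le> 2 * real r * \<delta>" using x full by auto
      have "norm (E y) \<le> (2 * real r * \<delta>) ^ (r - 1) * (M / \<delta> ^ Suc r) * measure lborel (cbox a x)"
        unfolding E_def cbox_interval[symmetric]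
      proof (rule Henstock_Kurzweil_Integration.integrable_bound)
        show "0 \<le> (2 * real r * \<delta>) ^ (r - 1) * (M / \<delta> ^ Suc r)" using M \<delta>(1) by simp
        show "(\<lambda>u. (x - u) ^ (r - 1) / fact (r - 1) * V u y) integrable_on cbox a x" using int by simp
        fix u assume u: "u \<in> cbox a x"
        then have xu: "0 \<le> x - u" "x - u \<le> 2 * real r * \<delta>" using xa by auto
        have "\<bar>(x - u) ^ (r - 1) / fact (r - 1)\<bar> = (x - u) ^ (r - 1) / fact (r - 1)" using xu by simp
        also have "\<dots> \<le> (x - u) ^ (r - 1) / 1" using xu by (intro divide_left_mono) (auto simp: fact_ge_1)
        also have "\<dots> \<le> (2 * real r * \<delta>) ^ (r - 1)" using xu by (simp add: power_mono)
        finally show "norm ((x - u) ^ (r - 1) / fact (r - 1) * V u y) \<le> (2 * real r * \<delta>) ^ (r - 1) * (M / \<delta> ^ Suc r)"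
          unfolding real_norm_def abs_mult[of _ "V u y"] using Vb[of u y] xu \<delta>(1) by (intro mult_mono) auto
      qed
      also have "\<dots> \<le> (2 * real r * \<delta>) ^ (r - 1) * (M / \<delta> ^ Suc r) * (2 * real r * \<delta>)"
        using xa M \<delta>(1) by (intro mult_left_mono) auto
      also have "\<dots> = (2 * real r * \<delta>) ^ r * (M / \<delta> ^ Suc r)"
        using r by (cases r) auto
      also have "\<dots> = (2 * real r) ^ r * M / \<delta>" using \<delta>(1) by (simp add: power_mult_distrib)
      finally show ?thesis by simp
    qed
    fix y assume "E y \<noteq> 0"
    then obtain u where u: "u \<in> {a..x}" "V u y \<noteq> 0"
    proof -
      have "E y = 0" if "\<And>u. u \<in> {a..x} \<Longrightarrow> V u y = 0"
        unfolding E_def using that by (subst integral_cong[where g="\<lambda>u. 0"]) auto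
      then show ?thesis using \<open>E y \<noteq> 0\<close> that by blast
    qed
    then have u': "u \<in> {a..b}" using x by auto
    show "y \<in> {a..b}" "y - real r * h \<in> {a..b}" using V_support[OF u' u(2)] by auto
    then show "\<bar>y - x\<bar> \<le> 2 * real r * \<delta>" using x full by auto
  qed
qed

end

text \<open>
  For \<open>t \<le> (b - a) / (2 r)\<close> the Steklov kernel with \<open>\<delta> = t\<close> serves.  For larger \<open>t\<close> the step is
  \<open>\<delta> = (b - a) / (2 r)\<close>, and \<open>t ^ r\<close> times the \<open>r\<close>-th derivative of the Steklov kernel would not
  be bounded uniformly in \<open>t\<close>; its Taylor polynomial has \<open>r\<close>-th derivative zero, and the remainder
  over the whole interval is of the same order as the kernel because \<open>b - a = 2 r \<delta>\<close>.
\<close>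

lemma ex_smoothing_kernel:
  assumes r: "1 \<le> r"
  shows "\<exists>C w. 0 < C \<and> continuous_on UNIV w \<and> (\<forall>z. 0 \<le> w z \<and> w z \<le> C) \<and> (\<exists>z. 0 < w z) \<and>
    (\<forall>z. z \<notin> {0..1} \<longrightarrow> w z = 0) \<and>
    (\<forall>a b t. a < b \<longrightarrow> 0 < t \<longrightarrow> (\<exists>\<delta> k. smoothing_kernel r w C a b t \<delta> k))"
proof -
  have \<eta>: "0 < 1 / (2 * real r)" using r by simp
  have tent: "continuous_on UNIV tent" "0 \<le> tent z" "0 < tent (3/4)" "\<forall>z. z \<notin> {1/2..1} \<longrightarrow> tent z = 0" for z
    unfolding tent_def by (auto intro!: continuous_intros)
  have half: "1/2 - real r * (1 / (2 * real r)) = 0" using r by simp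
  obtain w z0 where w:
    "\<forall>m<r. \<forall>z. (w m has_real_derivative w (Suc m) z) (at z)"
    "\<forall>m\<le>r. continuous_on UNIV (w m)"
    "\<forall>z. w r z = fdiff r (1 / (2 * real r)) tent z / (1 / (2 * real r)) ^ r" "\<forall>z. 0 \<le> w 0 z" "0 < w 0 z0"
    "\<forall>m\<le>r. \<forall>z. z \<notin> {0..1} \<longrightarrow> w m z = 0"
    using ex_spline_profile[OF \<eta> tent, of r] unfolding half by (elim exE conjE)
  have "\<exists>B. 0 \<le> B \<and> (\<forall>m\<le>r. \<forall>z. \<bar>w m z\<bar> \<le> B)"
  proof -
    have "\<exists>B. \<forall>z. \<bar>w m z\<bar> \<le> B" if m: "m \<le> r" for m
    proof -
      have "bounded (w m ` {0..1})"
        using w(2) m by (intro compact_imp_bounded compact_continuous_image) (auto intro: continuous_on_subset)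
      then obtain B where B: "\<forall>y\<in>w m ` {0..1}. \<bar>y\<bar> \<le> B" by (auto simp: bounded_iff)
      have "\<bar>w m z\<bar> \<le> max B 0" for z
      proof (cases "z \<in> {0..1}")
        case True
        then have "\<bar>w m z\<bar> \<le> B" using B by blast
        then show ?thesis by linarith
      next
        case False
        then have "w m z = 0" using w(6) m by blast
        then show ?thesis by simp
      qed
      then show ?thesis by blast
    qed
    then obtain B where B: "\<And>m z. m \<le> r \<Longrightarrow> \<bar>w m z\<bar> \<le> B m" by metis
    have "\<bar>w m z\<bar> \<le> (\<Sum>m\<le>r. \<bar>B m\<bar>)" if "m \<le> r" for m z
    proof -
      have "\<bar>B m\<bar> \<le> (\<Sum>m\<le>r. \<bar>B m\<bar>)" using that by (intro member_le_sum) auto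
      then show ?thesis using B[OF that, of z] by linarith
    qed
    then show ?thesis by (intro exI[of _ "\<Sum>m\<le>r. \<bar>B m\<bar>"]) (auto intro: sum_nonneg)
  qed
  then obtain B where B: "0 \<le> B" "\<And>m z. m \<le> r \<Longrightarrow> \<bar>w m z\<bar> \<le> B" by blast
  define C1 where "C1 = real r * 2 ^ r * B"
  define C2 where "C2 = real r * 2 ^ r * (2 * real r) ^ r * real r ^ r"
  define C3 where "C3 = real r * (real r * 2 ^ r * B * (2 * real r) ^ r)"
  define C4 where "C4 = (2 * real r) ^ r * C2"
  define C where "C = 1 + B + C1 + C2 + C3 + C4"
  have nn: "0 \<le> C1" "0 \<le> C2" "0 \<le> C3" "0 \<le> C4" using B by (auto simp: C1_def C2_def C3_def C4_def)
  have C: "0 < C" "B \<le> C" "C1 \<le> C" "C2 \<le> C" "C3 \<le> C" "C4 \<le> C" using nn B(1) by (auto simp: C_def)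
  have "\<exists>\<delta> k. smoothing_kernel r (w 0) C a b t \<delta> k" if ab: "a < b" and t: "0 < t" for a b t
  proof -
    define \<delta> where "\<delta> = min t ((b - a) / (2 * real r))"
    have \<delta>: "0 < \<delta>" "\<delta> \<le> t" "2 * real r * \<delta> \<le> b - a"
      using ab t r by (auto simp: \<delta>_def min_def field_simps)
    interpret steklov r w B a b \<delta>
    proof
      show "1 \<le> r" by fact
      show "(w m has_real_derivative w (Suc m) z) (at z)" if "m < r" for m z using w(1) that by blast
      show "continuous_on UNIV (w m)" if "m \<le> r" for m using w(2) that by blast
      show "w r z = fdiff r (1 / (2 * real r)) tent z * (2 * real r) ^ r" for z
        using w(3) by (simp add: power_divide)
      show "w m z = 0" if "m \<le> r" "z \<notin> {0..1}" for m z using w(6) that by blast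
      show "\<bar>w m z\<bar> \<le> B" if "m \<le> r" for m z using that by (rule B(2))
      show "0 \<le> B" by fact
      show "0 < \<delta>" "2 * real r * \<delta> \<le> b - a" by fact+
    qed
    have Cd: "C' / \<delta> \<le> C / \<delta>" if "C' \<le> C" for C' using that \<delta>(1) by (intro divide_right_mono) auto
    have rad: "real r * \<delta> \<le> 2 * real r * \<delta>" using \<delta>(1) by simp
    show ?thesis
    proof (cases "t \<le> (b - a) / (2 * real r)")
      case True
      then have t\<delta>: "t = \<delta>" by (simp add: \<delta>_def)
      have "smoothing_kernel r (w 0) C a b t \<delta> \<kappa>"
        unfolding smoothing_kernel_def h_def[symmetric] \<kappa>_0[symmetric]
      proof (intro conjI allI impI ballI)
        fix x assume x: "x \<in> {a..b}"
        show "difference_kernel 0 h a b (2 * real r * \<delta>) (C / \<delta>) x (\<kappa> 0 x)"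
          by (rule difference_kernel_mono[OF difference_kernel_\<kappa>_0[OF x] rad]) (rule Cd, use C in \<open>simp add: C1_def\<close>)
        show "difference_kernel r h a b (2 * real r * \<delta>) (C / \<delta>) x (\<lambda>y. t ^ r * \<kappa> r x y)"
          by (rule difference_kernel_mono[OF difference_kernel_\<kappa>_r[OF x] rad])
             (use t t\<delta> Cd[OF C(4)] in \<open>auto simp: C2_def\<close>)
        show "difference_kernel r h a b (2 * real r * \<delta>) (C / \<delta>) x (\<lambda>y. \<kappa> 0 x y - \<kappa> 0 x y)"
          using C \<delta> by (simp add: difference_kernel_zero)
      next
        show "0 < \<delta>" "\<delta> \<le> t" "2 * real r * \<delta> \<le> b - a" by fact+
        show "((\<lambda>x. \<kappa> m x y) has_real_derivative \<kappa> (Suc m) x y) (at x)" if "m < r" for m x y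
          using that by (rule \<kappa>_deriv)
        show "continuous_on UNIV (\<lambda>z. \<kappa> m (fst z) (snd z))" if "m \<le> r" for m
          using that by (rule \<kappa>_cont)
      qed
      then show ?thesis by blast
    next
      case False
      then have full: "2 * real r * \<delta> = b - a" using r by (simp add: \<delta>_def)
      have "smoothing_kernel r (w 0) C a b t \<delta> \<tau>"
        unfolding smoothing_kernel_def h_def[symmetric] \<kappa>_0[symmetric]
      proof (intro conjI allI impI ballI)
        fix x assume x: "x \<in> {a..b}"
        show "difference_kernel 0 h a b (2 * real r * \<delta>) (C / \<delta>) x (\<tau> 0 x)"
          by (rule difference_kernel_mono[OF difference_kernel_\<tau>_0[OF x full] order_refl]) (rule Cd, use C in \<open>simp add: C3_def\<close>)
        show "difference_kernel r h a b (2 * real r * \<delta>) (C / \<delta>) x (\<lambda>y. t ^ r * \<tau> r x y)"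
          using C \<delta> by (simp add: difference_kernel_zero \<tau>_r)
        show "difference_kernel r h a b (2 * real r * \<delta>) (C / \<delta>) x (\<lambda>y. \<kappa> 0 x y - \<tau> 0 x y)"
          by (rule difference_kernel_mono[OF difference_kernel_remainder[OF x full] order_refl])
             (rule Cd, use C in \<open>simp add: C4_def C2_def\<close>)
      next
        show "0 < \<delta>" "\<delta> \<le> t" "2 * real r * \<delta> \<le> b - a" by fact+
        show "((\<lambda>x. \<tau> m x y) has_real_derivative \<tau> (Suc m) x y) (at x)" if "m < r" for m x y
          using that by (rule \<tau>_deriv)
        show "continuous_on UNIV (\<lambda>z. \<tau> m (fst z) (snd z))" if "m \<le> r" for m
          by (rule \<tau>_cont)
      qed
      then show ?thesis by blast
    qed
  qed
  moreover have "0 \<le> w 0 z \<and> w 0 z \<le> C" for z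
  proof -
    have "\<bar>w 0 z\<bar> \<le> B" by (rule B(2)) simp
    then show ?thesis using w(4) C(2) by (metis abs_le_D1 order_trans)
  qed
  moreover have "continuous_on UNIV (w 0)" "\<forall>z. z \<notin> {0..1} \<longrightarrow> w 0 z = 0" using w(2,6) by blast+
  ultimately show ?thesis using C(1) w(5) by blast
qed

section \<open>Integrals against difference kernels\<close>

text \<open>
  The case of the uniform distribution on the box \<open>[-\<rho>, \<rho>]\<close>, whose volume is the factor
  \<open>\<Prod>i. 2 \<rho>\<^sub>i\<close>.
\<close>

lemma Lp_bounded_box_average:
  fixes G :: "real^'d::finite \<Rightarrow> real" and \<Phi> :: "real^'d \<Rightarrow> real^'d \<Rightarrow> real"
  assumes p: "1 \<le> p" and [measurable]: "(\<lambda>(x, v). \<Phi> x v) \<in> borel_measurable (borel \<Otimes>\<^sub>M borel)"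
    and pos: "\<And>x v. 0 \<le> \<Phi> x v" and M: "0 \<le> M" and m: "0 \<le> m" and \<rho>: "\<And>i. 0 < \<rho> $ i"
    and G: "\<And>x. ennreal \<bar>G x\<bar> \<le> ennreal M * (\<integral>\<^sup>+v. ennreal (\<Phi> x v) * indicator (cbox (- \<rho>) \<rho>) v \<partial>lborel)"
    and le: "\<And>v. v \<in> cbox (- \<rho>) \<rho> \<Longrightarrow> Lp_bounded p m (\<lambda>x. \<Phi> x v)"
  shows "Lp_bounded p (M * (\<Prod>i\<in>UNIV. 2 * \<rho> $ i) * m) G"
proof -
  define P where "P = (\<Prod>i\<in>UNIV. 2 * \<rho> $ i)"
  have P: "0 < P" unfolding P_def using \<rho> by (intro prod_pos) auto
  define \<mu> where "\<mu> = uniform_measure lborel (cbox (- \<rho>) \<rho>)"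
  have em: "emeasure lborel (cbox (- \<rho>) \<rho>) = ennreal P"
  proof -
    have "emeasure lborel (cbox (- \<rho>) \<rho>) = ennreal (\<Prod>b\<in>Basis. (\<rho> - (- \<rho>)) \<bullet> b)"
      using \<rho> by (subst emeasure_lborel_cbox) (auto simp: Basis_vec_def inner_axis less_imp_le)
    also have "(\<Prod>b\<in>Basis. (\<rho> - (- \<rho>)) \<bullet> b) = P"
      unfolding P_def Basis_vec_def
      by (simp add: prod.UNION_disjoint axis_eq_axis inner_axis)
    finally show ?thesis .
  qed
  have sets\<mu>[measurable_cong]: "sets \<mu> = sets borel" by (simp add: \<mu>_def)
  show ?thesis unfolding P_def[symmetric]
  proof (rule Lp_bounded_average[where \<mu>=\<mu> and \<Phi>=\<Phi>, OF p])
    show "prob_space \<mu>" unfolding \<mu>_def by (rule prob_space_uniform_measure) (use em P in auto)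
    show "(\<lambda>(x, v). \<Phi> x v) \<in> borel_measurable (lborel \<Otimes>\<^sub>M \<mu>)" by measurable
    show "0 \<le> M * P" using M P by simp
    show "AE x in lborel. ennreal \<bar>G x\<bar> \<le> ennreal (M * P) * (\<integral>\<^sup>+ v. ennreal (\<Phi> x v) \<partial>\<mu>)"
    proof (rule AE_I2)
      fix x
      have "(\<integral>\<^sup>+ v. ennreal (\<Phi> x v) \<partial>\<mu>) = (\<integral>\<^sup>+v. ennreal (\<Phi> x v) * indicator (cbox (- \<rho>) \<rho>) v \<partial>lborel) / ennreal P"
        unfolding \<mu>_def by (subst nn_integral_uniform_measure) (auto simp: em)
      then have "ennreal P * (\<integral>\<^sup>+ v. ennreal (\<Phi> x v) \<partial>\<mu>) = (\<integral>\<^sup>+v. ennreal (\<Phi> x v) * indicator (cbox (- \<rho>) \<rho>) v \<partial>lborel)"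
        using P by (simp add: ennreal_times_divide ennreal_mult_divide_eq mult.commute[of "ennreal P"])
      then show "ennreal \<bar>G x\<bar> \<le> ennreal (M * P) * (\<integral>\<^sup>+ v. ennreal (\<Phi> x v) \<partial>\<mu>)"
        using G[of x] M P by (simp add: ennreal_mult mult.assoc)
    qed
    show "AE v in \<mu>. Lp_bounded p m (\<lambda>x. \<Phi> x v)"
      unfolding \<mu>_def by (subst AE_uniform_measure) (use em P le in auto)
  qed (use pos m in auto)
qed

lemma mixed_diff_prod:
  fixes V :: "'d::finite \<Rightarrow> real \<Rightarrow> real"
  shows "mixed_diff k h (\<lambda>y. \<Prod>i\<in>UNIV. V i (y $ i)) y = (\<Prod>i\<in>UNIV. fdiff (k $ i) (h $ i) (V i) (y $ i))"
proof -
  have "(\<Prod>i\<in>UNIV. fdiff (k $ i) (h $ i) (V i) (y $ i)) =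
    (\<Sum>j\<in>multi_indices k. \<Prod>i\<in>UNIV. (-1) ^ (k $ i - j i) * real (k $ i choose j i) * V i (y $ i + real (j i) * h $ i))"
    unfolding fdiff_def by (rule prod_sum_PiE) auto
  also have "\<dots> = mixed_diff k h (\<lambda>y. \<Prod>i\<in>UNIV. V i (y $ i)) y"
    unfolding mixed_diff_expand diff_coeff_def index_scale_def prod.distrib[symmetric] by simp
  finally show ?thesis ..
qed

text \<open>
  The product of the kernels is the mixed difference of the product of their functions \<open>V\<^sub>i\<close>;
  summation by parts moves it onto \<open>F\<close>, and the supports of the \<open>V\<^sub>i\<close> restrict the integral.
\<close>

lemma integral_difference_kernel_le:
  fixes F :: "real^'d::finite \<Rightarrow> real"
  assumes F: "integrable lborel F"
    and u: "\<And>i. difference_kernel (k $ i) (h $ i) (a $ i) (b $ i) (\<rho> $ i) (M i) (x $ i) (u i)"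
  shows "ennreal \<bar>\<integral>y. F y * (\<Prod>i\<in>UNIV. u i (y $ i)) \<partial>lborel\<bar> \<le> ennreal (\<Prod>i\<in>UNIV. M i) *
    (\<integral>\<^sup>+v. ennreal \<bar>indicator (shift_domain (cbox a b) (step_vec k (- h))) (x + v) * mixed_diff k (- h) F (x + v)\<bar> *
       indicator (cbox (- \<rho>) \<rho>) v \<partial>lborel)"
proof -
  have [measurable]: "F \<in> borel_measurable borel" using F by auto
  have "\<forall>i. \<exists>V. V \<in> borel_measurable borel \<and> (\<forall>y. u i y = fdiff (k $ i) (h $ i) V y \<and> \<bar>V y\<bar> \<le> M i \<and>
     (V y \<noteq> 0 \<longrightarrow> y \<in> {a $ i..b $ i} \<and> y - real (k $ i) * h $ i \<in> {a $ i..b $ i} \<and> \<bar>y - x $ i\<bar> \<le> \<rho> $ i))"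
    using u unfolding difference_kernel_def by blast
  from choice[OF this] obtain V where V: "\<forall>i. V i \<in> borel_measurable borel \<and> (\<forall>y. u i y = fdiff (k $ i) (h $ i) (V i) y \<and> \<bar>V i y\<bar> \<le> M i \<and>
     (V i y \<noteq> 0 \<longrightarrow> y \<in> {a $ i..b $ i} \<and> y - real (k $ i) * h $ i \<in> {a $ i..b $ i} \<and> \<bar>y - x $ i\<bar> \<le> \<rho> $ i))"
    by blast
  have [measurable]: "V i \<in> borel_measurable borel" for i using V by blast
  have Veq: "u i y = fdiff (k $ i) (h $ i) (V i) y" and Vb: "\<bar>V i y\<bar> \<le> M i" for i y using V by blast+
  have Vs: "y \<in> {a $ i..b $ i} \<and> y - real (k $ i) * h $ i \<in> {a $ i..b $ i} \<and> \<bar>y - x $ i\<bar> \<le> \<rho> $ i" if "V i y \<noteq> 0" for i y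
    using V that by blast
  define \<psi> where "\<psi> y = (\<Prod>i\<in>UNIV. V i (y $ i))" for y :: "real^'d"
  define D where "D = shift_domain (cbox a b) (step_vec k (- h))"
  have [measurable]: "D \<in> sets borel" by (simp add: D_def shift_domain_borel)
  have [measurable]: "\<psi> \<in> borel_measurable borel" unfolding \<psi>_def by measurable
  have \<psi>b: "\<bar>\<psi> y\<bar> \<le> (\<Prod>i\<in>UNIV. M i)" for y
    unfolding \<psi>_def abs_prod using Vb by (intro prod_mono) auto
  have \<psi>s: "y \<in> D \<and> y - x \<in> cbox (- \<rho>) \<rho>" if "\<psi> y \<noteq> 0" for y
  proof -
    have nz: "V i (y $ i) \<noteq> 0" for i using that unfolding \<psi>_def by (metis UNIV_I finite prod_zero)
    have *: "a $ i \<le> y $ i \<and> y $ i \<le> b $ i \<and> a $ i \<le> y $ i - real (k $ i) * h $ i \<and> y $ i - real (k $ i) * h $ i \<le> b $ i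
       \<and> - \<rho> $ i \<le> y $ i - x $ i \<and> y $ i - x $ i \<le> \<rho> $ i" for i
      using Vs[OF nz, of i] by auto
    show ?thesis using * by (simp add: D_def shift_domain_def mem_box_cart)
  qed
  have neg: "- (- h) = h" by simp
  have "(\<integral>y. F y * (\<Prod>i\<in>UNIV. u i (y $ i)) \<partial>lborel) = (\<integral>y. F y * mixed_diff k (- (- h)) \<psi> y \<partial>lborel)"
    unfolding Veq neg \<psi>_def mixed_diff_prod ..
  also have "\<dots> = (\<integral>y. mixed_diff k (- h) F y * \<psi> y \<partial>lborel)"
    by (rule integral_mixed_diff_mult(2)[OF _ F \<psi>b, symmetric]) simp
  finally have eq: "(\<integral>y. F y * (\<Prod>i\<in>UNIV. u i (y $ i)) \<partial>lborel) = (\<integral>y. mixed_diff k (- h) F y * \<psi> y \<partial>lborel)" .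
  have int: "integrable lborel (\<lambda>y. mixed_diff k (- h) F y * \<psi> y)"
    by (rule integral_mixed_diff_mult(1)[OF _ F \<psi>b]) simp
  have "ennreal \<bar>\<integral>y. F y * (\<Prod>i\<in>UNIV. u i (y $ i)) \<partial>lborel\<bar> \<le> (\<integral>\<^sup>+y. ennreal \<bar>mixed_diff k (- h) F y * \<psi> y\<bar> \<partial>lborel)"
    unfolding eq using integral_norm_bound_ennreal[OF int] by simp
  also have "\<dots> \<le> (\<integral>\<^sup>+y. ennreal (\<Prod>i\<in>UNIV. M i) * (ennreal \<bar>indicator D y * mixed_diff k (- h) F y\<bar> * indicator (cbox (- \<rho>) \<rho>) (y - x)) \<partial>lborel)"
  proof (rule nn_integral_mono)
    fix y
    show "ennreal \<bar>mixed_diff k (- h) F y * \<psi> y\<bar> \<le> ennreal (\<Prod>i\<in>UNIV. M i) * (ennreal \<bar>indicator D y * mixed_diff k (- h) F y\<bar> * indicator (cbox (- \<rho>) \<rho>) (y - x))"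
    proof (cases "\<psi> y = 0")
      case False
      have "\<bar>mixed_diff k (- h) F y * \<psi> y\<bar> \<le> (\<Prod>i\<in>UNIV. M i) * \<bar>mixed_diff k (- h) F y\<bar>"
        unfolding abs_mult using \<psi>b[of y] by (subst mult.commute) (intro mult_right_mono; simp)
      moreover have "0 \<le> (\<Prod>i\<in>UNIV. M i)" using \<psi>b[of y] by linarith
      ultimately show ?thesis using \<psi>s[OF False] by (simp add: ennreal_mult[symmetric] ennreal_leI)
    qed simp
  qed
  also have "\<dots> = ennreal (\<Prod>i\<in>UNIV. M i) * (\<integral>\<^sup>+y. ennreal \<bar>indicator D y * mixed_diff k (- h) F y\<bar> * indicator (cbox (- \<rho>) \<rho>) (y - x) \<partial>lborel)"
    by (rule nn_integral_cmult) measurable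
  also have "(\<integral>\<^sup>+y. ennreal \<bar>indicator D y * mixed_diff k (- h) F y\<bar> * indicator (cbox (- \<rho>) \<rho>) (y - x) \<partial>lborel)
     = (\<integral>\<^sup>+v. ennreal \<bar>indicator D (v + x) * mixed_diff k (- h) F (v + x)\<bar> * indicator (cbox (- \<rho>) \<rho>) (v + x - x) \<partial>lborel)"
    by (rule nn_integral_lborel_translate[symmetric]) measurable
  finally show ?thesis by (simp add: D_def add.commute)
qed

text \<open>
  The preceding bound is an average of translates of the difference of \<open>F\<close>.
\<close>

lemma Lp_bounded_difference_kernel:
  fixes F :: "real^'d::finite \<Rightarrow> real"
  assumes p: "1 \<le> p" and F: "integrable lborel F" and \<rho>: "\<And>i. 0 < \<rho> $ i" and M: "\<And>i. 0 \<le> M i" and m: "0 \<le> m"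
    and u: "\<And>x i. x \<in> cbox a b \<Longrightarrow> difference_kernel (k $ i) (h $ i) (a $ i) (b $ i) (\<rho> $ i) (M i) (x $ i) (u x i)"
    and mm: "Lp_bounded p m (\<lambda>x. indicator (shift_domain (cbox a b) (step_vec k (- h))) x * mixed_diff k (- h) F x)"
  shows "Lp_bounded p ((\<Prod>i\<in>UNIV. M i * (2 * \<rho> $ i)) * m)
     (\<lambda>x. indicator (cbox a b) x * (\<integral>y. F y * (\<Prod>i\<in>UNIV. u x i (y $ i)) \<partial>lborel))"
proof -
  have [measurable]: "F \<in> borel_measurable borel" using F by auto
  define D where "D = shift_domain (cbox a b) (step_vec k (- h))"
  have [measurable]: "D \<in> sets borel" by (simp add: D_def shift_domain_borel)
  have "Lp_bounded p ((\<Prod>i\<in>UNIV. M i) * (\<Prod>i\<in>UNIV. 2 * \<rho> $ i) * m)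
     (\<lambda>x. indicator (cbox a b) x * (\<integral>y. F y * (\<Prod>i\<in>UNIV. u x i (y $ i)) \<partial>lborel))"
  proof (rule Lp_bounded_box_average[where \<Phi>="\<lambda>x v. \<bar>indicator D (x + v) * mixed_diff k (- h) F (x + v)\<bar>", OF p _ _ _ m \<rho>])
    show "(\<lambda>(x, v). \<bar>indicator D (x + v) * mixed_diff k (- h) F (x + v)\<bar>) \<in> borel_measurable (borel \<Otimes>\<^sub>M borel)"
      by measurable
    show "0 \<le> (\<Prod>i\<in>UNIV. M i)" using M by (intro prod_nonneg) auto
    fix x
    show "ennreal \<bar>indicator (cbox a b) x * (\<integral>y. F y * (\<Prod>i\<in>UNIV. u x i (y $ i)) \<partial>lborel)\<bar> \<le> ennreal (\<Prod>i\<in>UNIV. M i) *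
       (\<integral>\<^sup>+v. ennreal \<bar>indicator D (x + v) * mixed_diff k (- h) F (x + v)\<bar> * indicator (cbox (- \<rho>) \<rho>) v \<partial>lborel)"
    proof (cases "x \<in> cbox a b")
      case True
      then show ?thesis using integral_difference_kernel_le[OF F u[OF True]] by (simp add: D_def)
    qed simp
  next
    fix v
    have "Lp_bounded p m (\<lambda>x. indicator D (x + v) * mixed_diff k (- h) F (x + v))"
      by (rule Lp_bounded_translate[OF mm[folded D_def]]) measurable
    then show "Lp_bounded p m (\<lambda>x. \<bar>indicator D (x + v) * mixed_diff k (- h) F (x + v)\<bar>)"
      by (rule Lp_bounded_mono_AE[OF p, rotated]) auto
  qed auto
  then show ?thesis by (simp add: prod.distrib)
qed

lemma integral_diag_affine:
  fixes f :: "real^'d::finite \<Rightarrow> real"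
  assumes [measurable]: "f \<in> borel_measurable borel" and c: "\<And>i. c i \<noteq> 0"
  shows "(\<integral>x. f x \<partial>lborel) = (\<Prod>i\<in>UNIV. \<bar>c i\<bar>) * (\<integral>x. f (t + (\<chi> i. c i * x $ i)) \<partial>lborel)"
    and "integrable lborel f \<longleftrightarrow> integrable lborel (\<lambda>x. f (t + (\<chi> i. c i * x $ i)))"
proof -
  define c' where "c' b = (\<Sum>i\<in>UNIV. c i * (b $ i))" for b :: "real^'d"
  have c'_axis: "c' (axis i 1) = c i" for i
    unfolding c'_def axis_def by (simp add: if_distrib cong: if_cong)
  define T where "T x = t + (\<chi> i. c i * x $ i)" for x
  have T: "T = (\<lambda>x. t + (\<Sum>j\<in>Basis. (c' j * (x \<bullet> j)) *\<^sub>R j))"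
  proof
    fix x
    have "(\<Sum>j\<in>Basis. (c' j * (x \<bullet> j)) *\<^sub>R j) = (\<Sum>i\<in>UNIV. (c i * x $ i) *\<^sub>R axis i 1)"
      unfolding Basis_vec_def by (simp add: sum.UNION_disjoint axis_eq_axis inner_axis c'_axis)
    also have "\<dots> = (\<chi> i. c i * x $ i)"
      by (simp add: vec_eq_iff axis_def if_distrib cong: if_cong)
    finally show "T x = t + (\<Sum>j\<in>Basis. (c' j * (x \<bullet> j)) *\<^sub>R j)" by (simp add: T_def)
  qed
  have P: "(\<Prod>j\<in>Basis. \<bar>c' j\<bar>) = (\<Prod>i\<in>UNIV. \<bar>c i\<bar>)"
    unfolding Basis_vec_def by (simp add: prod.UNION_disjoint axis_eq_axis c'_axis)
  have "(lborel :: (real^'d) measure) = density (distr lborel borel (\<lambda>x. t + (\<Sum>j\<in>Basis. (c' j * (x \<bullet> j)) *\<^sub>R j))) (\<lambda>_. (\<Prod>j\<in>Basis. \<bar>c' j\<bar>))"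
    by (rule lborel_affine_euclidean) (auto simp: Basis_vec_def c'_axis c)
  then have L: "(lborel :: (real^'d) measure) = density (distr lborel borel T) (\<lambda>_. ennreal (\<Prod>i\<in>UNIV. \<bar>c i\<bar>))"
    unfolding T[symmetric] P .
  have [measurable]: "T \<in> borel_measurable borel" unfolding T by measurable
  have pos: "0 < (\<Prod>i\<in>UNIV. \<bar>c i\<bar>)" using c by (intro prod_pos) auto
  have "(\<integral>x. f x \<partial>lborel) = (\<integral>x. f x \<partial>density (distr lborel borel T) (\<lambda>_. ennreal (\<Prod>i\<in>UNIV. \<bar>c i\<bar>)))"
    using L by simp
  also have "\<dots> = (\<Prod>i\<in>UNIV. \<bar>c i\<bar>) * (\<integral>x. f (T x) \<partial>lborel)"
    using pos by (subst integral_density) (auto simp: integral_distr)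
  finally show "(\<integral>x. f x \<partial>lborel) = (\<Prod>i\<in>UNIV. \<bar>c i\<bar>) * (\<integral>x. f (t + (\<chi> i. c i * x $ i)) \<partial>lborel)" by (simp add: T_def)
  have "integrable lborel f \<longleftrightarrow> integrable (density (distr lborel borel T) (\<lambda>_. ennreal (\<Prod>i\<in>UNIV. \<bar>c i\<bar>))) f"
    using L by simp
  also have "\<dots> \<longleftrightarrow> integrable lborel (\<lambda>x. f (T x))"
    using pos c by (subst integrable_density) (auto simp: integrable_distr_eq)
  finally show "integrable lborel f \<longleftrightarrow> integrable lborel (\<lambda>x. f (t + (\<chi> i. c i * x $ i)))" by (simp add: T_def)
qed

text \<open>
  In one variable the sum is the identity plus \<open>- (-1) ^ r\<close> times the \<open>r\<close>-th difference.  The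
  product of these operators over the coordinates expands over the sets \<open>e\<close> of coordinates in
  which the difference is chosen.
\<close>

lemma sum_reproduction_coeff:
  fixes F :: "real^'d::finite \<Rightarrow> real"
  shows "(\<Sum>j\<in>PiE UNIV (\<lambda>i. {1..r $ i}). (\<Prod>i\<in>UNIV. reproduction_coeff (r $ i) (j i)) * F (x + index_scale j h))
    = F x + (\<Sum>e\<in>{e. e \<noteq> {}}. (\<Prod>i\<in>e. - ((-1) ^ (r $ i))) * mixed_diff (restrict_index r e) h F x)"
proof -
  define A where "A i j = (-1) ^ (r $ i - j) * real (r $ i choose j)" for i j
  define z where "z j = (if j = 0 then 1 else 0 :: real)" for j :: nat
  define \<beta> where "\<beta> i j = - ((-1) ^ (r $ i)) * A i j + z j" for i j
  have sg: "(-1) ^ n * (-1) ^ (n - j) = ((-1) ^ j :: real)" if "j \<le> n" for n j :: nat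
  proof -
    define d where "d = n - j"
    have n: "n = j + d" using that by (simp add: d_def)
    have "(-1) ^ d * (-1) ^ d = (1 :: real)" unfolding power_mult_distrib[symmetric] by simp
    then show ?thesis unfolding n power_add by (simp only: mult.assoc diff_add_inverse mult_1_right)
  qed
  have \<beta>: "\<beta> i j = (if j = 0 then 0 else reproduction_coeff (r $ i) j)" if "j \<le> r $ i" for i j
    using sg[OF that] by (auto simp: \<beta>_def A_def z_def reproduction_coeff_def simp flip: mult.assoc)
  have md: "mixed_diff (restrict_index r e) h F x =
     (\<Sum>j\<in>multi_indices r. ((\<Prod>i\<in>e. A i (j i)) * (\<Prod>i\<in>-e. z (j i))) * F (x + index_scale j h))" for e
  proof -
    have dc: "diff_coeff (restrict_index r e) j = (\<Prod>i\<in>e. A i (j i)) * (\<Prod>i\<in>-e. z (j i))" for j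
    proof -
      have "diff_coeff (restrict_index r e) j = (\<Prod>i\<in>e \<union> - e. if i \<in> e then A i (j i) else z (j i))"
        unfolding diff_coeff_def by (intro prod.cong) (auto simp: restrict_index_def A_def z_def)
      also have "\<dots> = (\<Prod>i\<in>e. A i (j i)) * (\<Prod>i\<in>-e. z (j i))"
        by (subst prod.union_disjoint) auto
      finally show ?thesis .
    qed
    have sub: "multi_indices (restrict_index r e) \<subseteq> multi_indices r"
      by (intro PiE_mono) (auto simp: restrict_index_def)
    have "diff_coeff (restrict_index r e) j = 0" if "j \<in> multi_indices r - multi_indices (restrict_index r e)" for j
    proof -
      from that obtain i where "restrict_index r e $ i < j i" by (auto simp: PiE_iff not_le)
      then have "(-1) ^ (restrict_index r e $ i - j i) * real (restrict_index r e $ i choose j i) = 0"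
        by (simp add: binomial_eq_0)
      then show ?thesis unfolding diff_coeff_def by (intro prod_zero) auto
    qed
    then show ?thesis unfolding mixed_diff_expand dc[symmetric]
      by (intro sum.mono_neutral_left sub) auto
  qed
  have "(\<Sum>j\<in>PiE UNIV (\<lambda>i. {1..r $ i}). (\<Prod>i\<in>UNIV. reproduction_coeff (r $ i) (j i)) * F (x + index_scale j h))
    = (\<Sum>j\<in>PiE UNIV (\<lambda>i. {1..r $ i}). (\<Prod>i\<in>UNIV. \<beta> i (j i)) * F (x + index_scale j h))"
  proof (intro sum.cong refl arg_cong2[where f="(*)"] prod.cong)
    fix j i assume "j \<in> PiE UNIV (\<lambda>i. {1..r $ i})"
    then have "1 \<le> j i" "j i \<le> r $ i" by (auto simp: PiE_iff)
    then show "reproduction_coeff (r $ i) (j i) = \<beta> i (j i)" by (simp add: \<beta>)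
  qed
  also have "\<dots> = (\<Sum>j\<in>multi_indices r. (\<Prod>i\<in>UNIV. \<beta> i (j i)) * F (x + index_scale j h))"
  proof (rule sum.mono_neutral_left)
    show "PiE UNIV (\<lambda>i. {1..r $ i}) \<subseteq> multi_indices r" by (intro PiE_mono) auto
    show "\<forall>j\<in>multi_indices r - PiE UNIV (\<lambda>i. {1..r $ i}). (\<Prod>i\<in>UNIV. \<beta> i (j i)) * F (x + index_scale j h) = 0"
    proof
      fix j assume j: "j \<in> multi_indices r - PiE UNIV (\<lambda>i. {1..r $ i})"
      then have le: "\<And>i. j i \<le> r $ i" and "\<exists>i. \<not> (1 \<le> j i \<and> j i \<le> r $ i)" by (auto simp: PiE_iff)
      then obtain i where "\<not> 1 \<le> j i" by blast
      then have "j i = 0" by simp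
      then have "\<beta> i (j i) = 0" using \<beta>[of "j i" i] by simp
      then have "(\<Prod>i\<in>UNIV. \<beta> i (j i)) = 0" by (intro prod_zero) auto
      then show "(\<Prod>i\<in>UNIV. \<beta> i (j i)) * F (x + index_scale j h) = 0" by simp
    qed
  qed simp
  also have "\<dots> = (\<Sum>j\<in>multi_indices r. \<Sum>e\<in>UNIV. (\<Prod>i\<in>e. - ((-1) ^ (r $ i))) * (((\<Prod>i\<in>e. A i (j i)) * (\<Prod>i\<in>-e. z (j i))) * F (x + index_scale j h)))"
  proof (intro sum.cong refl)
    fix j
    have "(\<Prod>i\<in>UNIV. \<beta> i (j i)) = (\<Sum>e\<in>Pow UNIV. (\<Prod>i\<in>e. - ((-1) ^ (r $ i)) * A i (j i)) * (\<Prod>i\<in>UNIV - e. z (j i)))"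
      unfolding \<beta>_def by (rule prod_add) simp
    then show "(\<Prod>i\<in>UNIV. \<beta> i (j i)) * F (x + index_scale j h) =
       (\<Sum>e\<in>UNIV. (\<Prod>i\<in>e. - ((-1) ^ (r $ i))) * (((\<Prod>i\<in>e. A i (j i)) * (\<Prod>i\<in>-e. z (j i))) * F (x + index_scale j h)))"
      by (simp only: sum_distrib_right Pow_UNIV prod.distrib Compl_eq_Diff_UNIV mult.assoc)
  qed
  also have "\<dots> = (\<Sum>e\<in>UNIV. (\<Prod>i\<in>e. - ((-1) ^ (r $ i))) * mixed_diff (restrict_index r e) h F x)"
    unfolding md sum_distrib_left by (rule sum.swap)
  also have "\<dots> = mixed_diff (restrict_index r {}) h F x + (\<Sum>e\<in>UNIV - {{}}. (\<Prod>i\<in>e. - ((-1) ^ (r $ i))) * mixed_diff (restrict_index r e) h F x)"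
    by (subst sum.remove[of _ "{}"]) auto
  also have "mixed_diff (restrict_index r {}) h F x = F x"
  proof -
    have r0: "restrict_index r {} $ i = 0" for i by (simp add: restrict_index_def)
    have "multi_indices (restrict_index r {}) = {\<lambda>i. 0}" by (auto simp: r0 PiE_iff)
    moreover have "index_scale (\<lambda>i. 0) h = 0" by (simp add: index_scale_def vec_eq_iff)
    ultimately show ?thesis by (simp add: mixed_diff_expand diff_coeff_def r0)
  qed
  also have "UNIV - {{}} = {e :: 'd set. e \<noteq> {}}" by auto
  finally show ?thesis .
qed

section \<open>The error of the Steklov mean\<close>

text \<open>
  Up to normalisation the Steklov mean is \<open>\<integral> W(x, h) \<Sum>j. \<beta> j F(x + j h) dh\<close> with a nonnegative
  weight \<open>W\<close> of constant mass.  Hence \<open>F x\<close> minus this mean is an average of the combinations of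
  mixed differences in \<open>sum_reproduction_coeff\<close>.  On the support of \<open>W(x, \<cdot>)\<close> the steps are at
  most \<open>\<delta>\<close> and \<open>x\<close> lies in the domains of all these differences.
\<close>

lemma Lp_bounded_steklov_error:
  fixes F :: "real^'d::finite \<Rightarrow> real" and a b \<delta> :: "real^'d" and w :: "'d \<Rightarrow> real \<Rightarrow> real"
  assumes p: "1 \<le> p" and F: "integrable lborel F" and ab: "\<And>i. a $ i < b $ i"
    and \<delta>: "\<And>i. 0 < \<delta> $ i" "\<And>i. 2 * real (r $ i) * \<delta> $ i \<le> b $ i - a $ i"
    and w: "\<And>i. continuous_on UNIV (w i)" "\<And>i z. 0 \<le> w i z" "\<And>i z. w i z \<le> C i" "\<And>i z. z \<notin> {0..1} \<Longrightarrow> w i z = 0"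
    and I0: "I0 = (\<integral>\<zeta>. (\<Prod>i\<in>UNIV. w i (\<zeta> $ i)) \<partial>(lborel :: (real^'d) measure))" "0 < I0"
    and me: "\<And>e. 0 \<le> me e" "\<And>e h. (\<And>i. \<bar>h $ i\<bar> \<le> \<delta> $ i) \<Longrightarrow> e \<noteq> {} \<Longrightarrow>
      Lp_bounded p (me e) (\<lambda>x. indicator (shift_domain (cbox a b) (step_vec (restrict_index r e) h)) x * mixed_diff (restrict_index r e) h F x)"
  shows "Lp_bounded p (((\<Prod>i\<in>UNIV. 2 * C i) / I0) * (\<Sum>e\<in>{e. e \<noteq> {}}. me e)) (\<lambda>x. indicator (cbox a b) x *
    (F x - (\<integral>y. F y * (\<Prod>i\<in>UNIV. steklov_kernel (r $ i) (w i) (a $ i) (b $ i) (\<delta> $ i) (x $ i) (y $ i)) \<partial>lborel) / I0))"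
proof -
  have [measurable]: "F \<in> borel_measurable borel" using F by auto
  have [measurable]: "w i \<in> borel_measurable borel" for i by (rule borel_measurable_continuous_onI[OF w(1)])
  define s where "s i = \<delta> $ i / (b $ i - a $ i)" for i
  have sl: "s i * (b $ i - a $ i) = \<delta> $ i" "0 < s i" for i using ab[of i] \<delta>(1)[of i] by (auto simp: s_def)
  have C: "0 \<le> C i" for i using w(2)[of i 0] w(3)[of i 0] by linarith
  \<comment> \<open>The weight on the steps; the shift by \<open>s\<^sub>i (x\<^sub>i - a\<^sub>i)\<close> makes the steps point into the box.\<close>
  define W where "W x h = (\<Prod>i\<in>UNIV. w i ((h $ i + s i * (x $ i - a $ i)) / \<delta> $ i))" for x h :: "real^'d"
  have [measurable]: "(\<lambda>h. W x h) \<in> borel_measurable borel" for x unfolding W_def by measurable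
  have W_le: "0 \<le> W x h" "W x h \<le> (\<Prod>i\<in>UNIV. C i)" for x h
    unfolding W_def using w(2,3) by (auto intro!: prod_nonneg prod_mono)
  define P where "P = (\<Prod>i\<in>UNIV. \<delta> $ i)"
  have P: "0 < P" unfolding P_def using \<delta>(1) by (intro prod_pos) auto
  define kern where "kern x y = (\<Prod>i\<in>UNIV. steklov_kernel (r $ i) (w i) (a $ i) (b $ i) (\<delta> $ i) (x $ i) (y $ i))" for x y :: "real^'d"
  define g where "g x = (\<integral>y. F y * kern x y \<partial>lborel) / I0" for x
  define E where "E = {e :: 'd set. e \<noteq> {}}"
  define \<sigma> where "\<sigma> e = (\<Prod>i\<in>e. - ((-1 :: real) ^ (r $ i)))" for e
  have \<sigma>: "\<bar>\<sigma> e\<bar> = 1" for e by (simp add: \<sigma>_def abs_prod power_abs)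
  define J where "J = PiE UNIV (\<lambda>i. {1..r $ i})"
  have finJ: "finite J" unfolding J_def by (intro finite_PiE) auto
  define \<beta> where "\<beta> j = (\<Prod>i\<in>UNIV. reproduction_coeff (r $ i) (j i))" for j
  define \<Phi> where "\<Phi> x h = (\<Sum>e\<in>E. \<bar>indicator (shift_domain (cbox a b) (step_vec (restrict_index r e) h)) x * mixed_diff (restrict_index r e) h F x\<bar>)" for x h
  have W_supp: "h \<in> cbox (- \<delta>) \<delta> \<and> (\<forall>e. x \<in> shift_domain (cbox a b) (step_vec (restrict_index r e) h))"
    if x: "x \<in> cbox a b" and nz: "W x h \<noteq> 0" for x h
  proof -
    define \<zeta> where "\<zeta> i = (h $ i + s i * (x $ i - a $ i)) / \<delta> $ i" for i
    have \<zeta>: "0 \<le> \<zeta> i" "\<zeta> i \<le> 1" for i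
    proof -
      have "w i (\<zeta> i) \<noteq> 0" using nz unfolding W_def \<zeta>_def by simp
      then have "\<zeta> i \<in> {0..1}" using w(4) by blast
      then show "0 \<le> \<zeta> i" "\<zeta> i \<le> 1" by auto
    qed
    have h: "h $ i = \<delta> $ i * \<zeta> i - s i * (x $ i - a $ i)" for i
      using \<delta>(1)[of i] by (simp add: \<zeta>_def)
    have xi: "x $ i \<in> {a $ i..b $ i}" for i using x by (auto simp: mem_box_cart)
    have "- \<delta> $ i \<le> h $ i \<and> h $ i \<le> \<delta> $ i" for i
    proof -
      have "0 \<le> s i * (x $ i - a $ i)" using xi[of i] sl(2)[of i] by simp
      moreover have "s i * (x $ i - a $ i) \<le> s i * (b $ i - a $ i)" using xi[of i] sl(2)[of i] by (intro mult_left_mono) auto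
      moreover have "0 \<le> \<delta> $ i * \<zeta> i" "\<delta> $ i * \<zeta> i \<le> \<delta> $ i" using \<zeta>[of i] \<delta>(1)[of i] by (auto intro: mult_left_le)
      ultimately show ?thesis unfolding h sl(1) by linarith
    qed
    then have 1: "h \<in> cbox (- \<delta>) \<delta>" by (simp add: mem_box_cart)
    have "x + step_vec (restrict_index r e) h \<in> cbox a b" for e
    proof -
      have "x $ i + real n * h $ i \<in> {a $ i..b $ i}" if n: "n \<le> r $ i" for i n
      proof -
        have "real n * s i \<le> real (r $ i) * s i" using n sl(2)[of i] by (intro mult_right_mono) auto
        moreover have "2 * real (r $ i) * s i \<le> 1" using \<delta>(2)[of i] ab[of i] by (simp add: s_def divide_le_eq)
        moreover have "0 \<le> real (r $ i) * s i" using sl(2)[of i] by simp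
        ultimately have t: "0 \<le> real n * s i" "real n * s i \<le> 1" using sl(2)[of i] by (simp, linarith)
        have eqn: "x $ i + real n * h $ i = x $ i - real n * s i * (x $ i - a $ i) + real n * s i * (b $ i - a $ i) * \<zeta> i"
          unfolding h using sl(1)[of i] by (simp add: algebra_simps)
        show ?thesis unfolding eqn by (rule contraction_mem(1)[OF xi \<zeta> t])
      qed
      from this[of "restrict_index r e $ i" i for i] show ?thesis
        by (auto simp: mem_box_cart restrict_index_def)
    qed
    then show ?thesis using 1 x by (auto simp: shift_domain_def)
  qed
  have W_int: "(\<integral>h. W x h \<partial>lborel) = P * I0" "integrable lborel (W x)" for x
  proof -
    define t where "t = (\<chi> i. - s i * (x $ i - a $ i))"
    have \<delta>0: "\<delta> $ i \<noteq> 0" for i using \<delta>(1)[of i] by simp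
    have eq: "W x (t + (\<chi> i. \<delta> $ i * \<zeta> $ i)) = (\<Prod>i\<in>UNIV. w i (\<zeta> $ i))" for \<zeta>
      unfolding W_def t_def by (intro prod.cong) (use \<delta>0 in auto)
    have abs: "(\<Prod>i\<in>UNIV. \<bar>\<delta> $ i\<bar>) = P" unfolding P_def using \<delta>(1) by (intro prod.cong) (auto simp: less_imp_le)
    show "(\<integral>h. W x h \<partial>lborel) = P * I0"
      using integral_diag_affine(1)[of "W x" "\<lambda>i. \<delta> $ i" t, OF _ \<delta>0] unfolding eq abs I0(1) by simp
    have "integrable lborel (\<lambda>\<zeta> :: real^'d. \<Prod>i\<in>UNIV. w i (\<zeta> $ i))"
      by (rule ccontr) (use I0 in \<open>simp add: not_integrable_integral_eq\<close>)
    then show "integrable lborel (W x)"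
      using integral_diag_affine(2)[of "W x" "\<lambda>i. \<delta> $ i" t, OF _ \<delta>0] unfolding eq by simp
  qed
  have piece: "integrable lborel (\<lambda>h. W x h * F (x + index_scale j h))"
    "integrable lborel (\<lambda>y. F y * (\<Prod>i\<in>UNIV. w i ((y $ i - (x $ i - real (j i) * (\<delta> $ i / (b $ i - a $ i)) * (x $ i - a $ i))) / (real (j i) * \<delta> $ i))))"
    "(\<integral>h. W x h * F (x + index_scale j h) \<partial>lborel) = P * (\<integral>y. F y * (\<Prod>i\<in>UNIV. 1 / (real (j i) * \<delta> $ i) *
        w i ((y $ i - (x $ i - real (j i) * (\<delta> $ i / (b $ i - a $ i)) * (x $ i - a $ i))) / (real (j i) * \<delta> $ i))) \<partial>lborel)"
    if "j \<in> J" for j x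
  proof -
    have "\<forall>i. 1 \<le> j i" using that by (simp add: J_def PiE_iff)
    then have j0: "real (j i) \<noteq> 0" for i by (metis not_one_le_zero of_nat_eq_0_iff)
    define Z where "Z = (\<Prod>i\<in>UNIV. real (j i))"
    have Z: "Z \<noteq> 0" using j0 by (simp add: Z_def)
    define f where "f y = F y * (\<Prod>i\<in>UNIV. w i ((y $ i - (x $ i - real (j i) * s i * (x $ i - a $ i))) / (real (j i) * \<delta> $ i)))" for y
    have [measurable]: "f \<in> borel_measurable borel" unfolding f_def by measurable
    have eq: "f (x + (\<chi> i. real (j i) * h $ i)) = W x h * F (x + index_scale j h)" for h
    proof -
      have "((x + (\<chi> i. real (j i) * h $ i)) $ i - (x $ i - real (j i) * s i * (x $ i - a $ i))) / (real (j i) * \<delta> $ i)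
         = (h $ i + s i * (x $ i - a $ i)) / \<delta> $ i" for i
      proof -
        have "(x + (\<chi> i. real (j i) * h $ i)) $ i - (x $ i - real (j i) * s i * (x $ i - a $ i)) = real (j i) * (h $ i + s i * (x $ i - a $ i))"
          by (simp add: algebra_simps)
        then show ?thesis using j0[of i] by simp
      qed
      then show ?thesis unfolding f_def W_def index_scale_def by simp
    qed
    have intf: "integrable lborel f"
    proof (rule Bochner_Integration.integrable_bound)
      show "integrable lborel (\<lambda>y. (\<Prod>i\<in>UNIV. C i) * F y)" using F by simp
      have "\<bar>\<Prod>i\<in>UNIV. w i (z i)\<bar> \<le> \<bar>\<Prod>i\<in>UNIV. C i\<bar>" for z
        unfolding abs_prod using w(2,3) C by (intro prod_mono) auto
      then show "AE y in lborel. norm (f y) \<le> norm ((\<Prod>i\<in>UNIV. C i) * F y)"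
        unfolding f_def by (simp add: abs_mult mult.commute[of "\<bar>F _\<bar>"] mult_right_mono)
    qed measurable
    then show "integrable lborel (\<lambda>y. F y * (\<Prod>i\<in>UNIV. w i ((y $ i - (x $ i - real (j i) * (\<delta> $ i / (b $ i - a $ i)) * (x $ i - a $ i))) / (real (j i) * \<delta> $ i))))"
      unfolding f_def s_def .
    show "integrable lborel (\<lambda>h. W x h * F (x + index_scale j h))"
      using integral_diag_affine(2)[of f "\<lambda>i. real (j i)" x, OF _ j0] intf unfolding eq by simp
    have "(\<integral>y. F y * (\<Prod>i\<in>UNIV. 1 / (real (j i) * \<delta> $ i) * w i ((y $ i - (x $ i - real (j i) * (\<delta> $ i / (b $ i - a $ i)) * (x $ i - a $ i))) / (real (j i) * \<delta> $ i))) \<partial>lborel)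
      = (\<integral>y. (\<Prod>i\<in>UNIV. 1 / (real (j i) * \<delta> $ i)) * f y \<partial>lborel)"
      unfolding f_def s_def by (simp only: prod.distrib mult_ac)
    also have "\<dots> = (\<Prod>i\<in>UNIV. 1 / (real (j i) * \<delta> $ i)) * ((\<Prod>i\<in>UNIV. real (j i)) * (\<integral>h. W x h * F (x + index_scale j h) \<partial>lborel))"
      using integral_diag_affine(1)[of f "\<lambda>i. real (j i)" x, OF _ j0] unfolding eq by simp
    also have "(\<Prod>i\<in>UNIV. 1 / (real (j i) * \<delta> $ i)) = 1 / ((\<Prod>i\<in>UNIV. real (j i)) * P)"
      by (simp add: prod_dividef prod.distrib P_def)
    finally have fin: "(\<integral>y. F y * (\<Prod>i\<in>UNIV. 1 / (real (j i) * \<delta> $ i) * w i ((y $ i - (x $ i - real (j i) * (\<delta> $ i / (b $ i - a $ i)) * (x $ i - a $ i))) / (real (j i) * \<delta> $ i))) \<partial>lborel)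
      = 1 / (Z * P) * (Z * (\<integral>h. W x h * F (x + index_scale j h) \<partial>lborel))" unfolding Z_def .
    show "(\<integral>h. W x h * F (x + index_scale j h) \<partial>lborel) = P * (\<integral>y. F y * (\<Prod>i\<in>UNIV. 1 / (real (j i) * \<delta> $ i) *
        w i ((y $ i - (x $ i - real (j i) * (\<delta> $ i / (b $ i - a $ i)) * (x $ i - a $ i))) / (real (j i) * \<delta> $ i))) \<partial>lborel)"
      unfolding fin using P Z by simp
  qed
  have g_eq: "P * I0 * g x = (\<integral>h. W x h * (\<Sum>j\<in>J. \<beta> j * F (x + index_scale j h)) \<partial>lborel)" for x
  proof -
    let ?q = "\<lambda>j y. \<Prod>i\<in>UNIV. 1 / (real (j i) * \<delta> $ i) *
        w i ((y $ i - (x $ i - real (j i) * (\<delta> $ i / (b $ i - a $ i)) * (x $ i - a $ i))) / (real (j i) * \<delta> $ i))"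
    have "kern x y = (\<Sum>j\<in>J. \<beta> j * ?q j y)" for y
    proof -
      have "kern x y = (\<Sum>j\<in>J. \<Prod>i\<in>UNIV. reproduction_coeff (r $ i) (j i) / (real (j i) * \<delta> $ i) *
        w i ((y $ i - (x $ i - real (j i) * (\<delta> $ i / (b $ i - a $ i)) * (x $ i - a $ i))) / (real (j i) * \<delta> $ i)))"
        unfolding kern_def steklov_kernel_def J_def by (rule prod_sum_PiE) auto
      also have "\<dots> = (\<Sum>j\<in>J. \<beta> j * ?q j y)"
        unfolding \<beta>_def prod.distrib[symmetric] by (intro sum.cong prod.cong) auto
      finally show ?thesis .
    qed
    then have "(\<integral>y. F y * kern x y \<partial>lborel) = (\<integral>y. (\<Sum>j\<in>J. \<beta> j * (F y * ?q j y)) \<partial>lborel)"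
      by (simp add: sum_distrib_left mult.left_commute)
    also have "\<dots> = (\<Sum>j\<in>J. \<beta> j * (\<integral>y. F y * ?q j y \<partial>lborel))"
    proof -
      have "integrable lborel (\<lambda>y. F y * ?q j y)" if "j \<in> J" for j
        using integrable_mult_right[OF piece(2)[OF that, of x], of "\<Prod>i\<in>UNIV. 1 / (real (j i) * \<delta> $ i)"]
        by (simp only: prod.distrib mult.left_commute)
      then show ?thesis by (subst Bochner_Integration.integral_sum) auto
    qed
    finally have kern_int: "(\<integral>y. F y * kern x y \<partial>lborel) = (\<Sum>j\<in>J. \<beta> j * (\<integral>y. F y * ?q j y \<partial>lborel))" .
    have "P * I0 * g x = P * (\<integral>y. F y * kern x y \<partial>lborel)" using I0(2) by (simp add: g_def)
    also have "\<dots> = (\<Sum>j\<in>J. \<beta> j * (P * (\<integral>y. F y * ?q j y \<partial>lborel)))"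
      unfolding kern_int sum_distrib_left by (simp only: mult.left_commute)
    also have "\<dots> = (\<Sum>j\<in>J. \<beta> j * (\<integral>h. W x h * F (x + index_scale j h) \<partial>lborel))"
      by (intro sum.cong refl arg_cong2[where f="(*)"] piece(3)[symmetric])
    also have "\<dots> = (\<integral>h. (\<Sum>j\<in>J. \<beta> j * (W x h * F (x + index_scale j h))) \<partial>lborel)"
      using piece(1) by (subst Bochner_Integration.integral_sum) auto
    finally show ?thesis by (simp add: sum_distrib_left mult.left_commute)
  qed
  have [measurable]: "(\<lambda>z. indicator (shift_domain (cbox a b) (step_vec k (snd z))) (fst z) :: real) \<in> borel_measurable (borel \<Otimes>\<^sub>M borel)" for k
  proof -
    have "(\<lambda>z. step_vec k (snd z)) \<in> borel_measurable (borel \<Otimes>\<^sub>M (borel :: (real^'d) measure))"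
    proof -
      have "(\<lambda>h. step_vec k h) \<in> borel_measurable borel"
        by (intro borel_measurable_continuous_onI continuous_intros)
      then show ?thesis by measurable
    qed
    then have [measurable]: "(\<lambda>z. fst z + step_vec k (snd z)) \<in> borel_measurable (borel \<Otimes>\<^sub>M borel)" by measurable
    have "(\<lambda>z. indicator (shift_domain (cbox a b) (step_vec k (snd z))) (fst z) :: real)
       = (\<lambda>z. indicator (cbox a b) (fst z) * indicator (cbox a b) (fst z + step_vec k (snd z)))"
      by (auto simp: fun_eq_iff shift_domain_def indicator_def)
    then show ?thesis by simp
  qed
  have \<Phi>_meas: "(\<lambda>(x, h). \<Phi> x h) \<in> borel_measurable (borel \<Otimes>\<^sub>M borel)"
    unfolding \<Phi>_def split_beta by measurable
  have [measurable]: "\<Phi> x \<in> borel_measurable borel" for x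
    using measurable_Pair2[OF \<Phi>_meas, of x] by simp
  have main: "Lp_bounded p ((\<Prod>i\<in>UNIV. C i) / (P * I0) * (\<Prod>i\<in>UNIV. 2 * \<delta> $ i) * (\<Sum>e\<in>E. me e)) (\<lambda>x. indicator (cbox a b) x * (F x - g x))"
  proof (rule Lp_bounded_box_average[where \<Phi>=\<Phi>, OF p])
    show "(\<lambda>(x, h). \<Phi> x h) \<in> borel_measurable (borel \<Otimes>\<^sub>M borel)"
      by (rule \<Phi>_meas)
    show "0 \<le> \<Phi> x h" for x h unfolding \<Phi>_def by (intro sum_nonneg) auto
    show "0 \<le> (\<Prod>i\<in>UNIV. C i) / (P * I0)" using C P I0 by (intro divide_nonneg_pos prod_nonneg) auto
    show "0 \<le> (\<Sum>e\<in>E. me e)" using me(1) by (intro sum_nonneg) auto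
    show "0 < \<delta> $ i" for i by (rule \<delta>(1))
  next
    fix x
    show "ennreal \<bar>indicator (cbox a b) x * (F x - g x)\<bar> \<le> ennreal ((\<Prod>i\<in>UNIV. C i) / (P * I0)) *
       (\<integral>\<^sup>+h. ennreal (\<Phi> x h) * indicator (cbox (- \<delta>) \<delta>) h \<partial>lborel)"
    proof (cases "x \<in> cbox a b")
      case True
      have int2: "integrable lborel (\<lambda>h. W x h * (\<Sum>j\<in>J. \<beta> j * F (x + index_scale j h)))"
      proof -
        have "integrable lborel (\<lambda>h. \<Sum>j\<in>J. \<beta> j * (W x h * F (x + index_scale j h)))"
          using piece(1) by (intro Bochner_Integration.integrable_sum integrable_mult_right) auto
        then show ?thesis by (simp add: sum_distrib_left mult.left_commute)
      qed
      have int1: "integrable lborel (\<lambda>h. W x h * F x)" using W_int(2) by simp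
      have "P * I0 * (F x - g x) = (\<integral>h. W x h * F x - W x h * (\<Sum>j\<in>J. \<beta> j * F (x + index_scale j h)) \<partial>lborel)"
        unfolding right_diff_distrib g_eq using int1 int2 W_int(1)[of x]
        by (subst Bochner_Integration.integral_diff) auto
      then have "ennreal \<bar>P * I0 * (F x - g x)\<bar> \<le> (\<integral>\<^sup>+h. ennreal \<bar>W x h * F x - W x h * (\<Sum>j\<in>J. \<beta> j * F (x + index_scale j h))\<bar> \<partial>lborel)"
        using integral_norm_bound_ennreal[OF Bochner_Integration.integrable_diff[OF int1 int2]] by simp
      also have "\<dots> \<le> (\<integral>\<^sup>+h. ennreal (\<Prod>i\<in>UNIV. C i) * (ennreal (\<Phi> x h) * indicator (cbox (- \<delta>) \<delta>) h) \<partial>lborel)"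
      proof (rule nn_integral_mono)
        fix h
        show "ennreal \<bar>W x h * F x - W x h * (\<Sum>j\<in>J. \<beta> j * F (x + index_scale j h))\<bar>
           \<le> ennreal (\<Prod>i\<in>UNIV. C i) * (ennreal (\<Phi> x h) * indicator (cbox (- \<delta>) \<delta>) h)"
        proof (cases "W x h = 0")
          case False
          note ws = W_supp[OF True False]
          have "(\<Sum>j\<in>J. \<beta> j * F (x + index_scale j h)) = F x + (\<Sum>e\<in>E. \<sigma> e * mixed_diff (restrict_index r e) h F x)"
            unfolding J_def \<beta>_def E_def \<sigma>_def by (rule sum_reproduction_coeff)
          then have "W x h * F x - W x h * (\<Sum>j\<in>J. \<beta> j * F (x + index_scale j h)) = - (W x h * (\<Sum>e\<in>E. \<sigma> e * mixed_diff (restrict_index r e) h F x))"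
            by (simp add: algebra_simps)
          then have "\<bar>W x h * F x - W x h * (\<Sum>j\<in>J. \<beta> j * F (x + index_scale j h))\<bar> = W x h * \<bar>\<Sum>e\<in>E. \<sigma> e * mixed_diff (restrict_index r e) h F x\<bar>"
            using W_le(1)[of x h] by (simp add: abs_mult)
          also have "\<dots> \<le> (\<Prod>i\<in>UNIV. C i) * \<Phi> x h"
          proof (intro mult_mono W_le)
            have "\<bar>\<Sum>e\<in>E. \<sigma> e * mixed_diff (restrict_index r e) h F x\<bar> \<le> (\<Sum>e\<in>E. \<bar>\<sigma> e * mixed_diff (restrict_index r e) h F x\<bar>)"
              by (rule sum_abs)
            also have "\<dots> = \<Phi> x h" unfolding \<Phi>_def using ws by (intro sum.cong) (auto simp: abs_mult \<sigma>)
            finally show "\<bar>\<Sum>e\<in>E. \<sigma> e * mixed_diff (restrict_index r e) h F x\<bar> \<le> \<Phi> x h" .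
          qed (use C in \<open>auto intro!: prod_nonneg\<close>)
          finally show ?thesis using ws C by (simp add: ennreal_mult''[symmetric] ennreal_mult'[symmetric] prod_nonneg ennreal_leI)
        qed simp
      qed
      also have "\<dots> = ennreal (\<Prod>i\<in>UNIV. C i) * (\<integral>\<^sup>+h. ennreal (\<Phi> x h) * indicator (cbox (- \<delta>) \<delta>) h \<partial>lborel)"
        by (rule nn_integral_cmult) measurable
      finally have "ennreal (1 / (P * I0)) * ennreal \<bar>P * I0 * (F x - g x)\<bar> \<le> ennreal (1 / (P * I0)) * (ennreal (\<Prod>i\<in>UNIV. C i) * (\<integral>\<^sup>+h. ennreal (\<Phi> x h) * indicator (cbox (- \<delta>) \<delta>) h \<partial>lborel))"
        by (rule mult_left_mono) simp
      moreover have "ennreal (1 / (P * I0)) * ennreal \<bar>P * I0 * (F x - g x)\<bar> = ennreal \<bar>F x - g x\<bar>"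
        using P I0(2) by (simp add: ennreal_mult[symmetric] abs_mult)
      moreover have "ennreal (1 / (P * I0)) * ennreal (\<Prod>i\<in>UNIV. C i) = ennreal ((\<Prod>i\<in>UNIV. C i) / (P * I0))"
        using P I0(2) C by (simp add: ennreal_mult[symmetric] prod_nonneg)
      ultimately show ?thesis using True by (simp add: mult.assoc[symmetric])
    qed simp
  next
    fix h assume h: "h \<in> cbox (- \<delta>) \<delta>"
    then have h': "\<bar>h $ i\<bar> \<le> \<delta> $ i" for i by (simp add: mem_box_cart abs_le_iff minus_le_iff)
    show "Lp_bounded p (\<Sum>e\<in>E. me e) (\<lambda>x. \<Phi> x h)"
      unfolding \<Phi>_def
    proof (rule Lp_bounded_sum[OF p])
      fix e assume e: "e \<in> E"
      have "Lp_bounded p (me e) (\<lambda>x. \<bar>indicator (shift_domain (cbox a b) (step_vec (restrict_index r e) h)) x * mixed_diff (restrict_index r e) h F x\<bar>)"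
        by (rule Lp_bounded_mono_AE[OF p _ me(2)[OF h']]) (use e in \<open>auto simp: E_def\<close>)
      then show "(\<lambda>x. \<bar>indicator (shift_domain (cbox a b) (step_vec (restrict_index r e) h)) x * mixed_diff (restrict_index r e) h F x\<bar>) \<in> borel_measurable borel \<and>
         0 \<le> me e \<and> Lp_bounded p (me e) (\<lambda>x. \<bar>indicator (shift_domain (cbox a b) (step_vec (restrict_index r e) h)) x * mixed_diff (restrict_index r e) h F x\<bar>)"
        using me(1) by auto
    qed simp
  qed
  have ceq: "(\<Prod>i\<in>UNIV. C i) / (P * I0) * (\<Prod>i\<in>UNIV. 2 * \<delta> $ i) = (\<Prod>i\<in>UNIV. 2 * C i) / I0"
    unfolding prod.distrib P_def[symmetric] using P by simp
  show ?thesis using main unfolding ceq g_def kern_def E_def .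
qed

section \<open>Weak derivatives of kernel operators\<close>

lemma integrable_continuous_compact_support:
  fixes f :: "'a::euclidean_space \<Rightarrow> real"
  assumes "continuous_on UNIV f" "compact K" "\<And>x. x \<notin> K \<Longrightarrow> f x = 0"
  shows "integrable lborel f"
proof -
  have "integrable lborel (\<lambda>x. indicator K x *\<^sub>R f x)"
    using assms by (intro borel_integrable_compact) (auto intro: continuous_on_subset)
  moreover have "(\<lambda>x. indicator K x *\<^sub>R f x) = f" using assms(3) by (auto simp: fun_eq_iff indicator_def)
  ultimately show ?thesis by simp
qed

text \<open>
  Integrate \<open>f (x + e\<^sub>k) - f x = \<integral>\<^sub>0\<^sup>1 f' (x + \<theta> e\<^sub>k) d\<theta>\<close> over \<open>x\<close>: by translation invariance the
  left side gives zero, and the right side gives the integral of \<open>f'\<close>.  This is integration by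
  parts without boundary terms.
\<close>

lemma integral_line_derivative_eq_0:
  fixes f f' :: "real^'d::finite \<Rightarrow> real"
  assumes d: "\<And>x. ((\<lambda>s. f (x + s *\<^sub>R axis k 1)) has_real_derivative f' x) (at 0)"
    and c: "continuous_on UNIV f" "continuous_on UNIV f'"
    and K: "compact K" "\<And>x. x \<notin> K \<Longrightarrow> f x = 0" "\<And>x. x \<notin> K \<Longrightarrow> f' x = 0"
  shows "(\<integral>x. f' x \<partial>lborel) = 0"
proof -
  let ?e = "axis k 1 :: real^'d"
  interpret u: prob_space uniform01 by (rule prob_space_uniform01)
  interpret pair: pair_sigma_finite "lborel :: (real^'d) measure" uniform01 ..
  have f: "integrable lborel f" by (rule integrable_continuous_compact_support[OF c(1) K(1,2)])
  have f': "integrable lborel f'" by (rule integrable_continuous_compact_support[OF c(2) K(1,3)])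
  have [measurable]: "f \<in> borel_measurable borel" "f' \<in> borel_measurable borel" using c by (auto intro: borel_measurable_continuous_onI)
  have d': "((\<lambda>s. f (x + s *\<^sub>R ?e)) has_real_derivative f' (x + s *\<^sub>R ?e)) (at s)" for x s
  proof -
    have "((\<lambda>t. t - s) has_real_derivative 1) (at s)" by (auto intro!: derivative_eq_intros)
    from DERIV_chain2[OF _ this, of "\<lambda>v. f (x + s *\<^sub>R ?e + v *\<^sub>R ?e)"] d[of "x + s *\<^sub>R ?e"]
    have "((\<lambda>t. f (x + s *\<^sub>R ?e + (t - s) *\<^sub>R ?e)) has_real_derivative f' (x + s *\<^sub>R ?e) * 1) (at s)"
      by simp
    moreover have "x + s *\<^sub>R ?e + (t - s) *\<^sub>R ?e = x + t *\<^sub>R ?e" for t by (simp add: algebra_simps)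
    ultimately show ?thesis by (simp only: mult_1_right)
  qed
  have ftc: "f (x + ?e) - f x = (\<integral>\<theta>. f' (x + \<theta> *\<^sub>R ?e) \<partial>uniform01)" for x
  proof -
    have "(\<integral>\<theta>. f' (x + \<theta> *\<^sub>R ?e) * indicator {0..1} \<theta> \<partial>lborel) = f (x + 1 *\<^sub>R ?e) - f (x + 0 *\<^sub>R ?e)"
    proof (rule integral_FTC_Icc_real)
      fix s :: real
      show "((\<lambda>s. f (x + s *\<^sub>R ?e)) has_real_derivative f' (x + s *\<^sub>R ?e)) (at s)" by (rule d')
      have "continuous_on UNIV (\<lambda>s. f' (x + s *\<^sub>R ?e))"
        by (intro continuous_on_compose2[OF c(2)] continuous_intros) auto
      then show "isCont (\<lambda>s. f' (x + s *\<^sub>R ?e)) s" by (simp add: continuous_on_eq_continuous_at)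
    qed simp
    moreover have "(\<integral>\<theta>. f' (x + \<theta> *\<^sub>R ?e) \<partial>uniform01) = (\<integral>\<theta>. indicator {0..1} \<theta> *\<^sub>R f' (x + \<theta> *\<^sub>R ?e) \<partial>lborel)"
      unfolding uniform01_def by (subst integral_density) auto
    ultimately show ?thesis by (simp add: mult_ac)
  qed
  have int: "integrable (lborel \<Otimes>\<^sub>M uniform01) (\<lambda>(x, \<theta>). f' (x + \<theta> *\<^sub>R ?e))"
  proof (rule integrableI_bounded)
    have "(\<integral>\<^sup>+ z. ennreal (norm (case z of (x, \<theta>) \<Rightarrow> f' (x + \<theta> *\<^sub>R ?e))) \<partial>(lborel \<Otimes>\<^sub>M uniform01))
      = (\<integral>\<^sup>+ \<theta>. \<integral>\<^sup>+ x. ennreal (norm (f' (x + \<theta> *\<^sub>R ?e))) \<partial>lborel \<partial>uniform01)"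
      by (subst pair.nn_integral_snd[symmetric]) auto
    also have "\<dots> = (\<integral>\<^sup>+ \<theta>. \<integral>\<^sup>+ x. ennreal (norm (f' x)) \<partial>lborel \<partial>uniform01)"
      by (intro nn_integral_cong nn_integral_lborel_translate) measurable
    also have "\<dots> = (\<integral>\<^sup>+ x. ennreal (norm (f' x)) \<partial>lborel)" by (simp add: u.emeasure_space_1)
    also have "\<dots> < \<infinity>" using f' by (subst (asm) integrable_iff_bounded) simp
    finally show "(\<integral>\<^sup>+ z. ennreal (norm (case z of (x, \<theta>) \<Rightarrow> f' (x + \<theta> *\<^sub>R ?e))) \<partial>(lborel \<Otimes>\<^sub>M uniform01)) < \<infinity>" .
  qed measurable
  have "(\<integral>x. f (x + ?e) - f x \<partial>lborel) = (\<integral>x. f (x + ?e) \<partial>lborel) - (\<integral>x. f x \<partial>lborel)"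
    by (rule Bochner_Integration.integral_diff) (use f integrable_lborel_translate[of f ?e] in auto)
  also have "\<dots> = 0" by (simp add: integral_lborel_translate)
  finally have "0 = (\<integral>x. (\<integral>\<theta>. f' (x + \<theta> *\<^sub>R ?e) \<partial>uniform01) \<partial>lborel)" unfolding ftc by simp
  also have "\<dots> = (\<integral>\<theta>. (\<integral>x. f' (x + \<theta> *\<^sub>R ?e) \<partial>lborel) \<partial>uniform01)"
    using pair.Fubini_integral[OF int] by simp
  also have "\<dots> = (\<integral>\<theta>. (\<integral>x. f' x \<partial>lborel) \<partial>uniform01)" by (subst integral_lborel_translate) auto
  also have "\<dots> = (\<integral>x. f' x \<partial>lborel)" by (simp add: u.prob_space)
  finally show ?thesis by simp
qed

definition kernel_product ::
    "('d \<Rightarrow> nat \<Rightarrow> real \<Rightarrow> real \<Rightarrow> real) \<Rightarrow> ('d \<Rightarrow> nat) \<Rightarrow> real^'d \<Rightarrow> real^'d \<Rightarrow> real" where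
  "kernel_product k m x y = (\<Prod>i\<in>UNIV. k i (m i) (x $ i) (y $ i))"

locale smooth_kernels =
  fixes k :: "'d::finite \<Rightarrow> nat \<Rightarrow> real \<Rightarrow> real \<Rightarrow> real" and r :: "nat^'d"
  assumes k_deriv: "\<And>i m x y. m < r $ i \<Longrightarrow> ((\<lambda>x. k i m x y) has_real_derivative k i (Suc m) x y) (at x)"
    and k_cont: "\<And>i m. m \<le> r $ i \<Longrightarrow> continuous_on UNIV (\<lambda>z. k i m (fst z) (snd z))"
begin

lemma kernel_product_cont:
  assumes "\<And>i. m i \<le> r $ i"
  shows "continuous_on UNIV (\<lambda>z. kernel_product k m (fst z) (snd z))"
proof -
  have "continuous_on UNIV (\<lambda>z :: (real^'d) \<times> (real^'d). k i (m i) (fst z $ i) (snd z $ i))" for i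
  proof -
    have "continuous_on UNIV (\<lambda>z :: (real^'d) \<times> (real^'d). (\<lambda>z. k i (m i) (fst z) (snd z)) (fst z $ i, snd z $ i))"
      by (rule continuous_on_compose2[OF k_cont[OF assms]]) (auto intro!: continuous_intros)
    then show ?thesis by simp
  qed
  then show ?thesis unfolding kernel_product_def by (intro continuous_on_prod)
qed

lemma kernel_product_cont1:
  assumes "\<And>i. m i \<le> r $ i"
  shows "continuous_on UNIV (\<lambda>x. kernel_product k m x y)"
proof -
  have "continuous_on UNIV (\<lambda>x. (\<lambda>z. kernel_product k m (fst z) (snd z)) (x, y))"
    by (rule continuous_on_compose2[OF kernel_product_cont[OF assms]]) (auto intro!: continuous_intros)
  then show ?thesis by simp
qed

lemma kernel_product_borel [measurable]:
  assumes "\<And>i. m i \<le> r $ i"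
  shows "(\<lambda>z. kernel_product k m (fst z) (snd z)) \<in> borel_measurable (borel \<Otimes>\<^sub>M borel)"
  unfolding borel_prod by (rule borel_measurable_continuous_onI[OF kernel_product_cont[OF assms]])

lemma kernel_product_deriv:
  assumes m: "m l < r $ l"
  shows "((\<lambda>s. kernel_product k m (x + s *\<^sub>R axis l 1) y) has_real_derivative kernel_product k (m(l := Suc (m l))) x y) (at 0)"
proof -
  have "((\<lambda>s. \<Prod>i\<in>UNIV. (\<lambda>x. k i (m i) x (y $ i)) ((x + s *\<^sub>R axis l 1) $ i)) has_real_derivative
    (\<Prod>i\<in>UNIV. ((\<lambda>i x. k i (m i) x (y $ i))(l := (\<lambda>x. k l (Suc (m l)) x (y $ l)))) i (x $ i))) (at 0)"
    by (rule partial_prod[where u="\<lambda>i x. k i (m i) x (y $ i)"]) (rule k_deriv[OF m])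
  moreover have "((\<lambda>i x. k i (m i) x (y $ i))(l := (\<lambda>x. k l (Suc (m l)) x (y $ l)))) i (x $ i) = k i ((m(l := Suc (m l))) i) (x $ i) (y $ i)" for i
    by simp
  ultimately show ?thesis unfolding kernel_product_def by simp
qed

text \<open>
  One integration by parts for each entry of the list, applied to the product of the kernel and a
  derivative of the test function.
\<close>

lemma integral_kernel_product_iter_partial:
  assumes \<phi>: "test_function U \<phi>"
  shows "(\<And>i. m i + count_list ks i \<le> r $ i) \<Longrightarrow>
    (\<integral>x. kernel_product k m x y * iter_partial ks \<phi> x \<partial>lborel) =
    (-1) ^ length ks * (\<integral>x. kernel_product k (\<lambda>i. m i + count_list ks i) x y * \<phi> x \<partial>lborel)"
proof (induction ks arbitrary: m)
  case (Cons l ks)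
  obtain K where K: "compact K" "\<And>x. x \<notin> K \<Longrightarrow> \<phi> x = 0"
    using \<phi> unfolding test_function_def by blast
  have z: "iter_partial ls \<phi> x = 0" if "x \<notin> K" for ls x
    by (rule iter_partial_zero_outside[OF compact_imp_closed[OF K(1)] K(2) that])
  define m' where "m' = m(l := Suc (m l))"
  have ml: "m l < r $ l" using Cons.prems[of l] by simp
  have mi: "m i \<le> r $ i" for i using Cons.prems[of i] by (auto split: if_splits)
  have m'i: "m' i + count_list ks i \<le> r $ i" for i using Cons.prems[of i] by (auto simp: m'_def split: if_splits)
  have m'le: "m' i \<le> r $ i" for i using m'i[of i] by simp
  let ?\<psi> = "iter_partial ks \<phi>" and ?\<psi>' = "iter_partial (l # ks) \<phi>"
  note cont = kernel_product_cont1[OF mi] kernel_product_cont1[OF m'le] test_function_continuous[OF \<phi>]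
  have "(\<integral>x. kernel_product k m' x y * ?\<psi> x + ?\<psi>' x * kernel_product k m x y \<partial>lborel) = 0"
  proof (rule integral_line_derivative_eq_0[where f="\<lambda>x. kernel_product k m x y * ?\<psi> x" and k=l and K=K])
    fix x
    have "?\<psi> differentiable_on UNIV" using \<phi> by (simp add: test_function_def)
    from has_derivative_along_axis[OF this, of x 1 l 0]
    have "((\<lambda>s. ?\<psi> (x + s *\<^sub>R axis l 1)) has_real_derivative ?\<psi>' x) (at 0)"
      by (simp add: iter_partial_Cons)
    then show "((\<lambda>s. kernel_product k m (x + s *\<^sub>R axis l 1) y * ?\<psi> (x + s *\<^sub>R axis l 1)) has_real_derivative
       kernel_product k m' x y * ?\<psi> x + ?\<psi>' x * kernel_product k m x y) (at 0)"
      using DERIV_mult[OF kernel_product_deriv[where m=m and l=l and x=x and y=y, OF ml]] unfolding m'_def by fastforce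
    show "kernel_product k m x y * ?\<psi> x = 0" if "x \<notin> K" using z[OF that] by simp
    show "kernel_product k m' x y * ?\<psi> x + ?\<psi>' x * kernel_product k m x y = 0" if "x \<notin> K" using z[OF that] by simp
  qed (use K(1) in \<open>auto intro!: continuous_on_add continuous_on_mult cont\<close>)
  moreover have "integrable lborel (\<lambda>x. kernel_product k m' x y * ?\<psi> x)"
    by (rule integrable_continuous_compact_support[OF continuous_on_mult[OF cont(2,3)] K(1)]) (simp add: z)
  moreover have "integrable lborel (\<lambda>x. ?\<psi>' x * kernel_product k m x y)"
    by (rule integrable_continuous_compact_support[OF continuous_on_mult[OF cont(3,1)] K(1)]) (simp add: z)
  ultimately have "(\<integral>x. ?\<psi>' x * kernel_product k m x y \<partial>lborel) = - (\<integral>x. kernel_product k m' x y * ?\<psi> x \<partial>lborel)"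
    by (simp add: Bochner_Integration.integral_add)
  also have "\<dots> = - ((-1) ^ length ks * (\<integral>x. kernel_product k (\<lambda>i. m' i + count_list ks i) x y * \<phi> x \<partial>lborel))"
    by (subst Cons.IH[OF m'i]) simp
  also have "(\<lambda>i. m' i + count_list ks i) = (\<lambda>i. m i + count_list (l # ks) i)"
    by (auto simp: m'_def fun_eq_iff)
  finally show ?case by (simp add: mult.commute)
qed simp

end

lemma bounded_on_compact_continuous:
  fixes f :: "'a::topological_space \<Rightarrow> real"
  assumes "continuous_on UNIV f" "compact S"
  obtains B where "0 \<le> B" "\<And>x. x \<in> S \<Longrightarrow> \<bar>f x\<bar> \<le> B"
proof -
  have "bounded (f ` S)" using assms by (intro compact_imp_bounded compact_continuous_image) (auto intro: continuous_on_subset)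
  then obtain B where "\<forall>y\<in>f ` S. \<bar>y\<bar> \<le> B" by (auto simp: bounded_iff)
  then have "\<bar>f x\<bar> \<le> max B 0" if "x \<in> S" for x using that by (auto simp: le_max_iff_disj)
  then show ?thesis by (intro that[of "max B 0"]) auto
qed

context smooth_kernels
begin

definition kernel_operator :: "(real^'d \<Rightarrow> real) \<Rightarrow> ('d \<Rightarrow> nat) \<Rightarrow> real^'d \<Rightarrow> real" where
  "kernel_operator F m x = (\<integral>y. F y * kernel_product k m x y \<partial>lborel)"

lemma kernel_operator_borel:
  assumes F[measurable]: "F \<in> borel_measurable borel" and m: "\<And>i. m i \<le> r $ i"
  shows "kernel_operator F m \<in> borel_measurable borel"
proof -
  note [measurable] = kernel_product_borel[OF m]
  have "(\<lambda>x. \<integral>y. F y * kernel_product k m x y \<partial>lborel) \<in> borel_measurable lborel"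
    by measurable
  then show ?thesis unfolding kernel_operator_def[abs_def] by simp
qed

lemma kernel_operator_bounded:
  assumes F: "integrable lborel F" "\<And>y. y \<notin> cbox a b \<Longrightarrow> F y = 0" and m: "\<And>i. m i \<le> r $ i" and K: "compact K"
  obtains B where "0 \<le> B" "\<And>x. x \<in> K \<Longrightarrow> \<bar>kernel_operator F m x\<bar> \<le> B"
proof -
  obtain B where B: "0 \<le> B" "\<And>z. z \<in> K \<times> cbox a b \<Longrightarrow> \<bar>kernel_product k m (fst z) (snd z)\<bar> \<le> B"
    using bounded_on_compact_continuous[OF kernel_product_cont[OF m] compact_Times[OF K compact_cbox]] by blast
  have "\<bar>kernel_operator F m x\<bar> \<le> (\<integral>y. \<bar>F y\<bar> * B \<partial>lborel)" if x: "x \<in> K" for x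
  proof -
    have "norm (kernel_operator F m x) \<le> (\<integral>y. norm (F y * kernel_product k m x y) \<partial>lborel)"
      unfolding kernel_operator_def by (rule integral_norm_bound)
    also have "\<dots> \<le> (\<integral>y. \<bar>F y\<bar> * B \<partial>lborel)"
    proof (rule integral_mono')
      show "integrable lborel (\<lambda>y. \<bar>F y\<bar> * B)" using F(1) by simp
      show "norm (F y * kernel_product k m x y) \<le> \<bar>F y\<bar> * B" for y
        using B(2)[of "(x, y)"] x F(2)[of y] by (cases "y \<in> cbox a b") (auto simp: abs_mult intro: mult_left_mono)
    qed (use B in auto)
    finally show ?thesis by simp
  qed
  then show ?thesis using B(1) by (intro that[of "\<integral>y. \<bar>F y\<bar> * B \<partial>lborel"]) auto
qed

lemma locally_integrable_kernel_operator:
  assumes F: "integrable lborel F" "\<And>y. y \<notin> cbox a b \<Longrightarrow> F y = 0" and m: "\<And>i. m i \<le> r $ i"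
  shows "locally_integrable U (kernel_operator F m)"
  unfolding locally_integrable_def
proof (intro allI impI)
  fix K :: "(real^'d) set" assume "compact K \<and> K \<subseteq> U"
  then have K: "compact K" by simp
  have [measurable]: "F \<in> borel_measurable borel" using F(1) by auto
  note [measurable] = kernel_operator_borel[OF _ m, of F]
  have [measurable]: "K \<in> sets borel" using compact_imp_closed[OF K] by simp
  obtain B where B: "0 \<le> B" "\<And>x. x \<in> K \<Longrightarrow> \<bar>kernel_operator F m x\<bar> \<le> B"
    using kernel_operator_bounded[OF F m K] by blast
  have "integrable lborel (\<lambda>x. indicator K x * kernel_operator F m x)"
  proof (rule Bochner_Integration.integrable_bound)
    have "integrable lborel (indicator K :: real^'d \<Rightarrow> real)"
      using emeasure_bounded_finite[OF compact_imp_bounded[OF K]] by (intro integrable_real_indicator) auto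
    then show "integrable lborel (\<lambda>x. B * indicator K x :: real)" by simp
    show "AE x in lborel. norm (indicator K x * kernel_operator F m x) \<le> norm (B * indicator K x :: real)"
      using B by (intro AE_I2) (auto simp: indicator_def abs_mult)
  qed measurable
  then have "integrable lebesgue (\<lambda>x. indicator K x * kernel_operator F m x)"
    by (subst integrable_completion) auto
  then show "set_integrable lebesgue K (kernel_operator F m)" by (simp add: set_integrable_def)
qed

lemma integral_kernel_operator_mult:
  assumes F: "integrable lborel F" "\<And>y. y \<notin> cbox a b \<Longrightarrow> F y = 0" and m: "\<And>i. m i \<le> r $ i"
    and \<psi>: "continuous_on UNIV \<psi>" and K: "compact K" "\<And>x. x \<notin> K \<Longrightarrow> \<psi> x = 0"
  shows "(\<integral>x. kernel_operator F m x * \<psi> x \<partial>lborel) = (\<integral>y. F y * (\<integral>x. kernel_product k m x y * \<psi> x \<partial>lborel) \<partial>lborel)"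
proof -
  have [measurable]: "F \<in> borel_measurable borel" using F(1) by auto
  have [measurable]: "\<psi> \<in> borel_measurable borel" by (rule borel_measurable_continuous_onI[OF \<psi>])
  note [measurable] = kernel_product_borel[OF m]
  have int\<psi>: "integrable lborel \<psi>" by (rule integrable_continuous_compact_support[OF \<psi> K])
  obtain B where B: "0 \<le> B" "\<And>z. z \<in> K \<times> cbox a b \<Longrightarrow> \<bar>kernel_product k m (fst z) (snd z)\<bar> \<le> B"
    using bounded_on_compact_continuous[OF kernel_product_cont[OF m] compact_Times[OF K(1) compact_cbox]] by blast
  have int: "integrable (lborel \<Otimes>\<^sub>M lborel) (\<lambda>(x, y). F y * kernel_product k m x y * \<psi> x)"
  proof (rule integrableI_bounded)
    have "(\<integral>\<^sup>+ z. ennreal (norm (case z of (x, y) \<Rightarrow> F y * kernel_product k m x y * \<psi> x)) \<partial>(lborel \<Otimes>\<^sub>M lborel))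
      = (\<integral>\<^sup>+ x. \<integral>\<^sup>+ y. ennreal (norm (F y * kernel_product k m x y * \<psi> x)) \<partial>lborel \<partial>lborel)"
      by (subst lborel.nn_integral_fst[symmetric]) (auto simp: split_beta)
    also have "\<dots> \<le> (\<integral>\<^sup>+ x. \<integral>\<^sup>+ y. ennreal (B * \<bar>\<psi> x\<bar>) * ennreal \<bar>F y\<bar> \<partial>lborel \<partial>lborel)"
    proof (intro nn_integral_mono)
      fix x y
      have "\<bar>F y * kernel_product k m x y * \<psi> x\<bar> \<le> B * \<bar>\<psi> x\<bar> * \<bar>F y\<bar>"
      proof (cases "x \<in> K \<and> y \<in> cbox a b")
        case True
        then have "\<bar>kernel_product k m x y\<bar> \<le> B" using B(2)[of "(x, y)"] by simp
        then have "\<bar>kernel_product k m x y\<bar> * (\<bar>\<psi> x\<bar> * \<bar>F y\<bar>) \<le> B * (\<bar>\<psi> x\<bar> * \<bar>F y\<bar>)"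
          by (rule mult_right_mono) simp
        then show ?thesis by (simp add: abs_mult mult_ac)
      next
        case False
        then show ?thesis using K(2)[of x] F(2)[of y] by auto
      qed
      then show "ennreal (norm (F y * kernel_product k m x y * \<psi> x)) \<le> ennreal (B * \<bar>\<psi> x\<bar>) * ennreal \<bar>F y\<bar>"
        using B(1) by (simp add: ennreal_mult[symmetric] ennreal_leI)
    qed
    also have "\<dots> = (\<integral>\<^sup>+ x. ennreal (B * \<bar>\<psi> x\<bar>) * (\<integral>\<^sup>+ y. ennreal \<bar>F y\<bar> \<partial>lborel) \<partial>lborel)"
      by (intro nn_integral_cong nn_integral_cmult) measurable
    also have "\<dots> = (\<integral>\<^sup>+ x. ennreal (B * \<bar>\<psi> x\<bar>) \<partial>lborel) * (\<integral>\<^sup>+ y. ennreal \<bar>F y\<bar> \<partial>lborel)"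
      by (intro nn_integral_multc) measurable
    also have "\<dots> < \<infinity>"
    proof -
      have "integrable lborel (\<lambda>x. B * \<bar>\<psi> x\<bar>)" using int\<psi> by simp
      then have "(\<integral>\<^sup>+ x. ennreal (B * \<bar>\<psi> x\<bar>) \<partial>lborel) < \<infinity>"
        using B(1) by (subst (asm) integrable_iff_bounded) (simp add: abs_mult)
      moreover have "(\<integral>\<^sup>+ y. ennreal \<bar>F y\<bar> \<partial>lborel) < \<infinity>" using F(1) by (subst (asm) integrable_iff_bounded) simp
      ultimately show ?thesis by (simp add: ennreal_mult_less_top)
    qed
    finally show "(\<integral>\<^sup>+ z. ennreal (norm (case z of (x, y) \<Rightarrow> F y * kernel_product k m x y * \<psi> x)) \<partial>(lborel \<Otimes>\<^sub>M lborel)) < \<infinity>" .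
  qed measurable
  have "(\<integral>x. kernel_operator F m x * \<psi> x \<partial>lborel) = (\<integral>x. (\<integral>y. F y * kernel_product k m x y * \<psi> x \<partial>lborel) \<partial>lborel)"
    unfolding kernel_operator_def by simp
  also have "\<dots> = (\<integral>y. (\<integral>x. F y * kernel_product k m x y * \<psi> x \<partial>lborel) \<partial>lborel)"
    using lborel_pair.Fubini_integral[OF int] by simp
  also have "\<dots> = (\<integral>y. F y * (\<integral>x. kernel_product k m x y * \<psi> x \<partial>lborel) \<partial>lborel)"
    by (simp add: mult.assoc)
  finally show ?thesis .
qed

text \<open>
  By Fubini the derivatives act on the kernel alone, so that integrability of \<open>F\<close> suffices.
\<close>

lemma has_weak_deriv_kernel_operator:
  assumes F: "integrable lborel F" "\<And>y. y \<notin> cbox a b \<Longrightarrow> F y = 0"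
  shows "has_weak_deriv (box a b) (restrict_index r e) (kernel_operator F (\<lambda>i. 0)) (kernel_operator F (\<lambda>i. restrict_index r e $ i))"
  unfolding has_weak_deriv_def
proof (intro conjI allI impI)
  have [measurable]: "F \<in> borel_measurable borel" using F(1) by auto
  have le: "restrict_index r e $ i \<le> r $ i" for i by (simp add: restrict_index_def)
  have zero: "0 \<le> r $ i" for i by simp
  show "locally_integrable (box a b) (kernel_operator F (\<lambda>i. 0))" by (rule locally_integrable_kernel_operator[OF F zero])
  show "locally_integrable (box a b) (kernel_operator F (\<lambda>i. restrict_index r e $ i))"
    by (rule locally_integrable_kernel_operator[OF F le])
  fix \<phi> ks assume \<phi>: "test_function (box a b) \<phi>" and ks: "\<forall>i. count_list ks i = restrict_index r e $ i"
  obtain K where K: "compact K" "K \<subseteq> box a b" "\<And>x. x \<notin> K \<Longrightarrow> \<phi> x = 0"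
    using \<phi> unfolding test_function_def by blast
  have z: "iter_partial ls \<phi> x = 0" if "x \<notin> K" for ls x
    by (rule iter_partial_zero_outside[OF compact_imp_closed[OF K(1)] K(3) that])
  have [measurable]: "iter_partial ls \<phi> \<in> borel_measurable borel" for ls
    by (intro borel_measurable_continuous_onI test_function_continuous[OF \<phi>])
  have len: "length ks = (\<Sum>i\<in>UNIV. restrict_index r e $ i)"
    using ks sum_count_set[of ks UNIV] by simp
  have set_int: "(LINT x:box a b|lebesgue. kernel_operator F m x * iter_partial ls \<phi> x) = (\<integral>x. kernel_operator F m x * iter_partial ls \<phi> x \<partial>lborel)"
    if m: "\<And>i. m i \<le> r $ i" for m ls
    unfolding set_lebesgue_integral_def
  proof (rule integral_lebesgue_AE_eq(1))
    have [measurable]: "kernel_operator F m \<in> borel_measurable borel" by (rule kernel_operator_borel[OF _ m]) measurable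
    show "(\<lambda>x. kernel_operator F m x * iter_partial ls \<phi> x) \<in> borel_measurable borel" by measurable
    show "AE x in lborel. indicat_real (box a b) x *\<^sub>R (kernel_operator F m x * iter_partial ls \<phi> x) = kernel_operator F m x * iter_partial ls \<phi> x"
    proof (rule AE_I2)
      fix x
      show "indicat_real (box a b) x *\<^sub>R (kernel_operator F m x * iter_partial ls \<phi> x) = kernel_operator F m x * iter_partial ls \<phi> x"
        using z[of x ls] K(2) by (cases "x \<in> box a b") auto
    qed
  qed
  have "(\<integral>x. kernel_operator F (\<lambda>i. 0) x * iter_partial ks \<phi> x \<partial>lborel)
     = (\<integral>y. F y * (\<integral>x. kernel_product k (\<lambda>i. 0) x y * iter_partial ks \<phi> x \<partial>lborel) \<partial>lborel)"
    by (rule integral_kernel_operator_mult[OF F zero test_function_continuous[OF \<phi>] K(1) z])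
  also have "\<dots> = (\<integral>y. F y * ((-1) ^ length ks * (\<integral>x. kernel_product k (\<lambda>i. restrict_index r e $ i) x y * \<phi> x \<partial>lborel)) \<partial>lborel)"
    using integral_kernel_product_iter_partial[OF \<phi>, of "\<lambda>i. 0" ks] ks le by simp
  also have "\<dots> = (-1) ^ length ks * (\<integral>y. F y * (\<integral>x. kernel_product k (\<lambda>i. restrict_index r e $ i) x y * \<phi> x \<partial>lborel) \<partial>lborel)"
    by (simp only: mult.left_commute[of "F _"] integral_mult_right_zero)
  also have "(\<integral>y. F y * (\<integral>x. kernel_product k (\<lambda>i. restrict_index r e $ i) x y * \<phi> x \<partial>lborel) \<partial>lborel)
     = (\<integral>x. kernel_operator F (\<lambda>i. restrict_index r e $ i) x * iter_partial [] \<phi> x \<partial>lborel)"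
    using integral_kernel_operator_mult[OF F le test_function_continuous[OF \<phi>, where ks="[]"] K(1)] K(3) by simp
  finally show "(LINT x:box a b|lebesgue. kernel_operator F (\<lambda>i. 0) x * iter_partial ks \<phi> x) =
      (-1) ^ (\<Sum>i\<in>UNIV. restrict_index r e $ i) * (LINT x:box a b|lebesgue. kernel_operator F (\<lambda>i. restrict_index r e $ i) x * \<phi> x)"
    using set_int[OF zero, of ks] set_int[OF le, of "[]"] by (simp add: len)
qed

end

section \<open>The upper estimate for positive steps\<close>

lemma difference_kernel_bounded:
  assumes "difference_kernel m h a b \<rho> M x u"
  shows "u \<in> borel_measurable borel" "\<bar>u y\<bar> \<le> 2 ^ m * M"
proof -
  obtain V where V: "V \<in> borel_measurable borel" "\<And>y. u y = fdiff m h V y" "\<And>y. \<bar>V y\<bar> \<le> M"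
    using assms unfolding difference_kernel_def by (elim bexE) auto
  note [measurable] = V(1)
  have u: "u = (\<lambda>y. \<Sum>j\<le>m. (-1) ^ (m - j) * real (m choose j) * V (y + real j * h))"
    using V(2) by (simp add: fun_eq_iff fdiff_def)
  show "u \<in> borel_measurable borel" unfolding u by measurable
  have "\<bar>u y\<bar> \<le> (\<Sum>j\<le>m. real (m choose j) * M)"
    unfolding u
  proof (rule order_trans[OF sum_abs] , rule sum_mono)
    fix j
    show "\<bar>(-1) ^ (m - j) * real (m choose j) * V (y + real j * h)\<bar> \<le> real (m choose j) * M"
      using mult_left_mono[OF V(3)[of "y + real j * h"], of "real (m choose j)"] by (simp add: abs_mult power_abs)
  qed
  also have "\<dots> = real (\<Sum>j\<le>m. m choose j) * M" by (simp add: sum_distrib_right)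
  also have "\<dots> = 2 ^ m * M" by (simp only: choose_row_sum) simp
  finally show "\<bar>u y\<bar> \<le> 2 ^ m * M" .
qed

lemma integral_prod_add_expand:
  fixes F :: "real^'d::finite \<Rightarrow> real" and u v :: "'d \<Rightarrow> real \<Rightarrow> real"
  assumes F: "integrable lborel F"
    and u: "\<And>i. u i \<in> borel_measurable borel" "\<And>i y. \<bar>u i y\<bar> \<le> M i"
    and v: "\<And>i. v i \<in> borel_measurable borel" "\<And>i y. \<bar>v i y\<bar> \<le> N i"
  shows "(\<integral>y. F y * (\<Prod>i\<in>UNIV. u i (y $ i) + v i (y $ i)) \<partial>lborel)
    = (\<Sum>e\<in>UNIV. \<integral>y. F y * (\<Prod>i\<in>UNIV. (if i \<in> e then u i else v i) (y $ i)) \<partial>lborel)"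
proof -
  note [measurable] = u(1) v(1)
  have [measurable]: "F \<in> borel_measurable borel" using F by auto
  have MN: "0 \<le> M i" "0 \<le> N i" for i using u(2)[of i 0] v(2)[of i 0] by (auto intro: order_trans[OF abs_ge_zero])
  have int: "integrable lborel (\<lambda>y. F y * (\<Prod>i\<in>UNIV. (if i \<in> e then u i else v i) (y $ i)))" for e
  proof (rule Bochner_Integration.integrable_bound)
    show "integrable lborel (\<lambda>y. (\<Prod>i\<in>UNIV. M i + N i) * F y)" using F by simp
    show "(\<lambda>y. F y * (\<Prod>i\<in>UNIV. (if i \<in> e then u i else v i) (y $ i))) \<in> borel_measurable lborel"
    proof -
      have [measurable]: "(if i \<in> e then u i else v i) \<in> borel_measurable borel" for i by simp
      show ?thesis by measurable
    qed
    show "AE y in lborel. norm (F y * (\<Prod>i\<in>UNIV. (if i \<in> e then u i else v i) (y $ i))) \<le> norm ((\<Prod>i\<in>UNIV. M i + N i) * F y)"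
    proof (rule AE_I2)
      fix y :: "real^'d"
      have "\<bar>\<Prod>i\<in>UNIV. (if i \<in> e then u i else v i) (y $ i)\<bar> \<le> (\<Prod>i\<in>UNIV. M i + N i)"
        unfolding abs_prod
      proof (rule prod_mono)
        fix i show "0 \<le> \<bar>(if i \<in> e then u i else v i) (y $ i)\<bar> \<and> \<bar>(if i \<in> e then u i else v i) (y $ i)\<bar> \<le> M i + N i"
          using u(2)[of i "y $ i"] v(2)[of i "y $ i"] MN[of i] by auto
      qed
      moreover have "0 \<le> (\<Prod>i\<in>UNIV. M i + N i)" using MN by (intro prod_nonneg) auto
      ultimately show "norm (F y * (\<Prod>i\<in>UNIV. (if i \<in> e then u i else v i) (y $ i))) \<le> norm ((\<Prod>i\<in>UNIV. M i + N i) * F y)"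
        using mult_left_mono[of "\<bar>\<Prod>i\<in>UNIV. (if i \<in> e then u i else v i) (y $ i)\<bar>" "\<Prod>i\<in>UNIV. M i + N i" "\<bar>F y\<bar>"]
        by (simp add: abs_mult mult.commute)
    qed
  qed
  have "(\<Prod>i\<in>UNIV. u i (y $ i) + v i (y $ i)) = (\<Sum>e\<in>UNIV. \<Prod>i\<in>UNIV. (if i \<in> e then u i else v i) (y $ i))" for y :: "real^'d"
  proof -
    have "(\<Prod>i\<in>UNIV. u i (y $ i) + v i (y $ i)) = (\<Sum>e\<in>Pow UNIV. (\<Prod>i\<in>e. u i (y $ i)) * (\<Prod>i\<in>UNIV - e. v i (y $ i)))"
      by (rule prod_add) simp
    also have "\<dots> = (\<Sum>e\<in>UNIV. \<Prod>i\<in>UNIV. (if i \<in> e then u i else v i) (y $ i))"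
    proof (simp only: Pow_UNIV, rule sum.cong[OF refl])
      fix e :: "'d set"
      have "(\<Prod>i\<in>UNIV. (if i \<in> e then u i else v i) (y $ i)) = (\<Prod>i\<in>UNIV. if i \<in> e then u i (y $ i) else v i (y $ i))"
        by (intro prod.cong) auto
      also have "\<dots> = (\<Prod>i\<in>e. u i (y $ i)) * (\<Prod>i\<in>UNIV - e. v i (y $ i))"
        by (subst prod.If_cases) (auto simp: Compl_eq_Diff_UNIV)
      finally show "(\<Prod>i\<in>e. u i (y $ i)) * (\<Prod>i\<in>UNIV - e. v i (y $ i)) = (\<Prod>i\<in>UNIV. (if i \<in> e then u i else v i) (y $ i))" by simp
    qed
    finally show ?thesis .
  qed
  then have "(\<integral>y. F y * (\<Prod>i\<in>UNIV. u i (y $ i) + v i (y $ i)) \<partial>lborel)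
    = (\<integral>y. (\<Sum>e\<in>UNIV. F y * (\<Prod>i\<in>UNIV. (if i \<in> e then u i else v i) (y $ i))) \<partial>lborel)"
    by (simp only: sum_distrib_left)
  also have "\<dots> = (\<Sum>e\<in>UNIV. \<integral>y. F y * (\<Prod>i\<in>UNIV. (if i \<in> e then u i else v i) (y $ i)) \<partial>lborel)"
    by (rule Bochner_Integration.integral_sum) (rule int)
  finally show ?thesis .
qed

lemma borel_measurable_integral_prod_kernel:
  fixes F :: "real^'d::finite \<Rightarrow> real" and u :: "'d \<Rightarrow> real \<Rightarrow> real \<Rightarrow> real"
  assumes [measurable]: "F \<in> borel_measurable borel" and u: "\<And>i. continuous_on UNIV (\<lambda>z. u i (fst z) (snd z))"
  shows "(\<lambda>x :: real^'d. \<integral>y. F y * (\<Prod>i\<in>UNIV. u i (x $ i) (y $ i)) \<partial>lborel) \<in> borel_measurable borel"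
proof -
  have "continuous_on UNIV (\<lambda>z :: (real^'d) \<times> (real^'d). u i (fst z $ i) (snd z $ i))" for i
  proof -
    have "continuous_on UNIV (\<lambda>z :: (real^'d) \<times> (real^'d). (\<lambda>z. u i (fst z) (snd z)) (fst z $ i, snd z $ i))"
      by (rule continuous_on_compose2[OF u]) (auto intro!: continuous_intros)
    then show ?thesis by simp
  qed
  then have "continuous_on UNIV (\<lambda>z :: (real^'d) \<times> (real^'d). \<Prod>i\<in>UNIV. u i (fst z $ i) (snd z $ i))"
    by (intro continuous_on_prod)
  then have [measurable]: "(\<lambda>z :: (real^'d) \<times> (real^'d). \<Prod>i\<in>UNIV. u i (fst z $ i) (snd z $ i)) \<in> borel_measurable (borel \<Otimes>\<^sub>M borel)"
    unfolding borel_prod by (rule borel_measurable_continuous_onI)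
  have "(\<lambda>x :: real^'d. \<integral>y. F y * (\<Prod>i\<in>UNIV. u i (x $ i) (y $ i)) \<partial>lborel) \<in> borel_measurable lborel"
    by measurable
  then show ?thesis by simp
qed

lemma continuous_steklov_kernel:
  assumes "continuous_on UNIV w" and "0 < \<delta>" "a < b"
  shows "continuous_on UNIV (\<lambda>z. steklov_kernel r w a b \<delta> (fst z) (snd z))"
  unfolding steklov_kernel_def
proof (intro continuous_on_sum continuous_on_mult continuous_on_const)
  fix j assume "j \<in> {1..r}"
  then show "continuous_on UNIV (\<lambda>z. w ((snd z - (fst z - real j * (\<delta> / (b - a)) * (fst z - a))) / (real j * \<delta>)))"
    using assms by (intro continuous_on_compose2[OF assms(1)] continuous_intros) auto
qed

lemma Lp_space_ex_bounded:
  fixes f :: "real^'d::finite \<Rightarrow> real"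
  assumes p: "1 \<le> p" and f: "f \<in> Lp_space p (cbox a b)"
  obtains F n where "F \<in> borel_measurable borel" "\<And>x. x \<notin> cbox a b \<Longrightarrow> F x = 0"
    "AE x in lborel. x \<in> cbox a b \<longrightarrow> f x = F x" "0 \<le> n" "Lp_bounded p n F"
proof -
  have fm: "f \<in> borel_measurable (lebesgue_on (cbox a b))" and fn: "Lp_norm p (cbox a b) f < \<infinity>"
    using f by (auto simp: Lp_space_def)
  obtain F where F: "F \<in> borel_measurable borel" "\<And>x. x \<notin> cbox a b \<Longrightarrow> F x = 0"
    "AE x in lborel. x \<in> cbox a b \<longrightarrow> f x = F x"
    using Lp_space_ex_borel[OF fm] by blast
  define n where "n = enn2real (Lp_norm p (cbox a b) f)"
  have n: "0 \<le> n" "Lp_norm p (cbox a b) f \<le> ennreal n" using fn by (auto simp: n_def)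
  have Fn: "Lp_bounded p n F" by (rule Lp_norm_rep[THEN iffD1, OF p F n(1) n(2)])
  show thesis by (rule that[OF F n(1) Fn])
qed

text \<open>
  The competitor is \<open>g(x) = (\<integral> F(y) \<Prod>i. k\<^sub>i(x\<^sub>i, y\<^sub>i) dy) / I0\<close>.  Its distance from \<open>f\<close> is the
  error of the Steklov mean plus the difference of the two kernel integrals.  With
  \<open>st\<^sub>i = (st\<^sub>i - k\<^sub>i) + k\<^sub>i\<close> the product of the Steklov kernels expands into the product of the
  \<open>k\<^sub>i\<close> and terms indexed by \<open>e \<noteq> {}\<close>, in which the coordinates in \<open>e\<close> carry \<open>r\<^sub>i\<close>-th differences;
  such a term is bounded by the modulus of order \<open>r(e)\<close>.
\<close>

lemma K_functional_le_smoothing: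
  fixes f :: "real^'d::finite \<Rightarrow> real" and a b t \<delta> :: "real^'d" and w :: "'d \<Rightarrow> real \<Rightarrow> real"
    and k :: "'d \<Rightarrow> nat \<Rightarrow> real \<Rightarrow> real \<Rightarrow> real"
  assumes p: "1 \<le> p" and r: "\<And>i. 1 \<le> r $ i" and ab: "\<And>i. a $ i < b $ i" and t: "\<And>i. 0 < t $ i"
    and sk: "\<And>i. smoothing_kernel (r $ i) (w i) (C i) (a $ i) (b $ i) (t $ i) (\<delta> $ i) (k i)" and C: "\<And>i. 0 < C i"
    and w: "\<And>i. continuous_on UNIV (w i)" "\<And>i z. 0 \<le> w i z" "\<And>i z. w i z \<le> C i" "\<And>i z. z \<notin> {0..1} \<Longrightarrow> w i z = 0"
    and I0: "I0 = (\<integral>\<zeta>. (\<Prod>i\<in>UNIV. w i (\<zeta> $ i)) \<partial>(lborel :: (real^'d) measure))" "0 < I0"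
    and f: "f \<in> Lp_space p (cbox a b)"
    and me: "\<And>e. 0 \<le> me e" "\<And>e. e \<noteq> {} \<Longrightarrow> mixed_modulus (restrict_index r e) p (cbox a b) f t \<le> ennreal (me e)"
  shows "K_functional r p (cbox a b) f (vec_pow t r) \<le>
    ennreal (((\<Prod>i\<in>UNIV. 2 * C i) / I0 + 2 * (\<Prod>i\<in>UNIV. 4 * real (r $ i) * C i) / I0) * (\<Sum>e\<in>{e. e \<noteq> {}}. me e))"
proof -
  obtain F n where F[measurable]: "F \<in> borel_measurable borel" and F0: "\<And>x. x \<notin> cbox a b \<Longrightarrow> F x = 0"
    and ae: "AE x in lborel. x \<in> cbox a b \<longrightarrow> f x = F x" and n: "0 \<le> n" and Fn: "Lp_bounded p n F"
    using Lp_space_ex_bounded[OF p f] by blast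
  have Fi: "integrable lborel F" by (rule Lp_bounded_integrable[OF p F F0 Fn])
  have \<delta>: "0 < \<delta> $ i" "\<delta> $ i \<le> t $ i" "2 * real (r $ i) * \<delta> $ i \<le> b $ i - a $ i" for i
    using sk[of i] by (auto simp: smoothing_kernel_def)
  have rpos: "0 < real (r $ i)" for i using r[of i] by simp
  interpret K: smooth_kernels k r
    by unfold_locales (use sk in \<open>auto simp: smoothing_kernel_def\<close>)
  define F' where "F' y = F y / I0" for y
  have F': "integrable lborel F'" "\<And>y. y \<notin> cbox a b \<Longrightarrow> F' y = 0" using Fi F0 by (auto simp: F'_def[abs_def])
  define G where "G e = K.kernel_operator F' (\<lambda>i. restrict_index r e $ i)" for e
  define g where "g = G {}"
  have g_eq: "g = K.kernel_operator F' (\<lambda>i. 0)" by (simp add: g_def G_def restrict_index_def)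
  have wd: "has_weak_deriv (box a b) (restrict_index r e) g (G e)" for e
    unfolding g_eq G_def by (rule K.has_weak_deriv_kernel_operator[OF F'])
  have [measurable]: "G e \<in> borel_measurable borel" for e
    unfolding G_def using F'(1) by (intro K.kernel_operator_borel) (auto simp: restrict_index_def)
  \<comment> \<open>For \<open>e = {}\<close> the norm of \<open>f\<close> itself is the bound; it is needed to see that \<open>g\<close> lies in
    \<open>L\<^sub>p\<close>.\<close>
  define m where "m e = (if e = {} then n else me e)" for e
  have m0: "0 \<le> m e" for e using me n by (simp add: m_def)
  have mm: "Lp_bounded p (m e) (\<lambda>x. indicator (shift_domain (cbox a b) (step_vec (restrict_index r e) h)) x * mixed_diff (restrict_index r e) h F x)"
    if h: "\<And>i. \<bar>h $ i\<bar> \<le> t $ i" for e h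
  proof (cases "e = {}")
    case True
    have "Lp_bounded p ((\<Prod>i\<in>UNIV. 2 ^ (restrict_index r e $ i)) * n) (mixed_diff (restrict_index r e) h F)"
      by (rule Lp_bounded_mixed_diff[OF p n Fn F])
    moreover have "(\<Prod>i\<in>UNIV. 2 ^ (restrict_index r e $ i)) = (1::real)" using True by (simp add: restrict_index_def)
    ultimately have "Lp_bounded p (m e) (mixed_diff (restrict_index r e) h F)" using True by (simp add: m_def)
    then show ?thesis by (rule Lp_bounded_mono_AE[OF p, rotated]) (auto simp: indicator_def)
  next
    case False
    then show ?thesis
      using me(2)[OF False] mixed_modulus_le_iff[where r="restrict_index r e" and t=t, OF p F ae me(1)[of e]] h by (simp add: m_def)
  qed
  define B where "B = (\<Prod>i\<in>UNIV. 4 * real (r $ i) * C i)"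
  have B: "0 \<le> B" unfolding B_def using C rpos by (intro prod_nonneg) (auto intro: less_imp_le)
  \<comment> \<open>The factors \<open>C\<^sub>i / \<delta>\<^sub>i\<close> and \<open>2 (2 r\<^sub>i \<delta>\<^sub>i)\<close> from the kernels and their supports multiply to a
    constant free of \<open>\<delta>\<close>.\<close>
  have gen: "Lp_bounded p (B * m e) (\<lambda>x. indicator (cbox a b) x * (\<integral>y. F y * (\<Prod>i\<in>UNIV. u i (x $ i) (y $ i)) \<partial>lborel))"
    if u: "\<And>i x. x \<in> {a $ i..b $ i} \<Longrightarrow> difference_kernel (restrict_index r e $ i) (\<delta> $ i / (2 * real (r $ i))) (a $ i) (b $ i)
       (2 * real (r $ i) * \<delta> $ i) (C i / \<delta> $ i) x (u i x)" for e u
  proof -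
    let ?h = "\<chi> i. \<delta> $ i / (2 * real (r $ i))" and ?\<rho> = "\<chi> i. 2 * real (r $ i) * \<delta> $ i"
    have "(\<Prod>i\<in>UNIV. C i / \<delta> $ i * (2 * ?\<rho> $ i)) = B"
      unfolding B_def using \<delta>(1) by (intro prod.cong) (auto simp: less_imp_neq[symmetric])
    moreover have "Lp_bounded p ((\<Prod>i\<in>UNIV. C i / \<delta> $ i * (2 * ?\<rho> $ i)) * m e)
      (\<lambda>x. indicator (cbox a b) x * (\<integral>y. F y * (\<Prod>i\<in>UNIV. (\<lambda>x i. u i (x $ i)) x i (y $ i)) \<partial>lborel))"
    proof (rule Lp_bounded_difference_kernel[where k="restrict_index r e" and h="?h", OF p Fi _ _ m0])
      show "0 < ?\<rho> $ i" for i using rpos[of i] \<delta>(1)[of i] by simp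
      show "0 \<le> C i / \<delta> $ i" for i using C[of i] \<delta>(1)[of i] by simp
      show "difference_kernel (restrict_index r e $ i) (?h $ i) (a $ i) (b $ i) (?\<rho> $ i) (C i / \<delta> $ i) (x $ i) (u i (x $ i))"
        if "x \<in> cbox a b" for x i
        using u[of "x $ i" i] that by (simp add: mem_box_cart)
      have "\<bar>(- ?h) $ i\<bar> \<le> t $ i" for i
      proof -
        have "\<delta> $ i / (2 * real (r $ i)) \<le> \<delta> $ i / 1" using r[of i] \<delta>(1)[of i] by (intro divide_left_mono) auto
        then show ?thesis using \<delta>(1,2)[of i] by simp
      qed
      from mm[OF this, of e]
      show "Lp_bounded p (m e) (\<lambda>x. indicator (shift_domain (cbox a b) (step_vec (restrict_index r e) (- ?h))) x * mixed_diff (restrict_index r e) (- ?h) F x)" .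
    qed
    ultimately show ?thesis by simp
  qed
  have kc: "continuous_on UNIV (\<lambda>z. k i l (fst z) (snd z))" if "l \<le> r $ i" for i l
    using sk[of i] that by (simp add: smoothing_kernel_def)
  define T where "T e = (\<Prod>i\<in>e. t $ i ^ r $ i)" for e
  have T: "0 < T e" for e unfolding T_def using t by (intro prod_pos) auto
  have nG: "Lp_bounded p (B / I0 * m e / T e) (\<lambda>x. indicator (cbox a b) x * G e x)" for e
  proof -
    define u where "u i = (if i \<in> e then (\<lambda>x y. t $ i ^ r $ i * k i (r $ i) x y) else k i 0)" for i
    have uu: "difference_kernel (restrict_index r e $ i) (\<delta> $ i / (2 * real (r $ i))) (a $ i) (b $ i)
       (2 * real (r $ i) * \<delta> $ i) (C i / \<delta> $ i) x (u i x)" if "x \<in> {a $ i..b $ i}" for i x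
      using sk[of i] that by (auto simp: u_def restrict_index_def smoothing_kernel_def)
    have uc: "continuous_on UNIV (\<lambda>z. u i (fst z) (snd z))" for i
      unfolding u_def using kc[of "r $ i" i] kc[of 0 i] by (auto intro!: continuous_intros)
    have prd: "(\<Prod>i\<in>UNIV. u i (x $ i) (y $ i)) = T e * kernel_product k (\<lambda>i. restrict_index r e $ i) x y" for x y :: "real^'d"
    proof -
      have "(\<Prod>i\<in>UNIV. u i (x $ i) (y $ i)) = (\<Prod>i\<in>UNIV. t $ i ^ (restrict_index r e $ i) * k i (restrict_index r e $ i) (x $ i) (y $ i))"
        by (intro prod.cong) (auto simp: u_def restrict_index_def)
      also have "\<dots> = T e * kernel_product k (\<lambda>i. restrict_index r e $ i) x y"
        unfolding prod.distrib prod_restrict_index T_def kernel_product_def ..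
      finally show ?thesis .
    qed
    have G: "G e x = (1 / (T e * I0)) * (\<integral>y. F y * (\<Prod>i\<in>UNIV. u i (x $ i) (y $ i)) \<partial>lborel)" for x
    proof -
      have "G e x = (\<integral>y. (1 / (T e * I0)) * (F y * (\<Prod>i\<in>UNIV. u i (x $ i) (y $ i))) \<partial>lborel)"
        unfolding G_def K.kernel_operator_def F'_def prd using T[of e] by (intro Bochner_Integration.integral_cong) auto
      then show ?thesis by simp
    qed
    note [measurable] = borel_measurable_integral_prod_kernel[OF F uc]
    have "Lp_bounded p (\<bar>1 / (T e * I0)\<bar> * (B * m e)) (\<lambda>x. (1 / (T e * I0)) * (indicator (cbox a b) x * (\<integral>y. F y * (\<Prod>i\<in>UNIV. u i (x $ i) (y $ i)) \<partial>lborel)))"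
      using B m0 by (intro Lp_bounded_cmult[OF p _ gen[OF uu]]) (auto intro: mult_nonneg_nonneg)
    then show ?thesis using T[of e] I0(2) by (simp add: G mult_ac)
  qed
  have LG: "Lp_norm p (cbox a b) (G e) \<le> ennreal (B / I0 * m e / T e)" for e
  proof (subst Lp_norm_rep[OF p])
    show "AE x in lborel. x \<in> cbox a b \<longrightarrow> G e x = indicator (cbox a b) x * G e x" by simp
    show "0 \<le> B / I0 * m e / T e" using B I0(2) m0[of e] T[of e] by simp
  qed (use nG in auto)
  have Lwd: "Lp_norm p (cbox a b) (weak_deriv (interior (cbox a b)) (restrict_index r e) g) = Lp_norm p (cbox a b) (G e)" for e
    by (rule Lp_norm_weak_deriv[OF p]) (use wd in \<open>simp add: interior_cbox\<close>)
  have Gfin: "Lp_norm p (cbox a b) (G e) < \<infinity>" for e using LG[of e] by (rule order_le_less_trans) simp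
  have gS: "g \<in> Sobolev_space r p (cbox a b)"
    unfolding Sobolev_space_def Lp_space_def Sobolev_norm_def
  proof (intro CollectI conjI allI)
    show "g \<in> borel_measurable (lebesgue_on (cbox a b))" by (rule has_weak_deriv_measurable(1)[OF wd])
    show "Lp_norm p (cbox a b) g < \<infinity>" unfolding g_def by (rule Gfin)
    show "\<exists>G. has_weak_deriv (interior (cbox a b)) (restrict_index r e) g G" for e using wd[of e] by (auto simp: interior_cbox)
    show "(\<Sum>e\<in>UNIV. Lp_norm p (cbox a b) (weak_deriv (interior (cbox a b)) (restrict_index r e) g)) < \<infinity>"
      unfolding Lwd using Gfin by (auto simp: less_top)
  qed
  define S where "S = (\<Sum>e\<in>{e :: 'd set. e \<noteq> {}}. me e)"
  have S: "0 \<le> S" unfolding S_def by (intro sum_nonneg me)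
  define A where "A = (\<Prod>i\<in>UNIV. 2 * C i) / I0"
  have A: "0 \<le> A" unfolding A_def using C I0(2) by (intro divide_nonneg_nonneg prod_nonneg) (auto intro: less_imp_le)
  define st where "st i = steklov_kernel (r $ i) (w i) (a $ i) (b $ i) (\<delta> $ i)" for i
  define E where "E x = F x - (\<integral>y. F y * (\<Prod>i\<in>UNIV. st i (x $ i) (y $ i)) \<partial>lborel) / I0" for x
  have stc: "continuous_on UNIV (\<lambda>z. st i (fst z) (snd z))" for i
    unfolding st_def by (rule continuous_steklov_kernel[OF w(1) \<delta>(1) ab])
  have E: "Lp_bounded p (A * S) (\<lambda>x. indicator (cbox a b) x * E x)"
    unfolding A_def S_def E_def st_def
  proof (rule Lp_bounded_steklov_error[OF p Fi ab \<delta>(1,3) w I0 me(1)])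
    show "Lp_bounded p (me e) (\<lambda>x. indicator (shift_domain (cbox a b) (step_vec (restrict_index r e) h)) x * mixed_diff (restrict_index r e) h F x)"
      if "\<And>i. \<bar>h $ i\<bar> \<le> \<delta> $ i" "e \<noteq> {}" for e h
      using mm[of h e] that(1) \<delta>(2) that(2) by (auto simp: m_def intro: order_trans)
  qed
  define u where "u e i = (if i \<in> e then (\<lambda>x y. st i x y - k i 0 x y) else k i 0)" for e i
  define R where "R e x = (\<integral>y. F y * (\<Prod>i\<in>UNIV. u e i (x $ i) (y $ i)) \<partial>lborel)" for e and x :: "real^'d"
  have uc: "continuous_on UNIV (\<lambda>z. u e i (fst z) (snd z))" for e i
    unfolding u_def using stc[of i] kc[of 0 i] by (auto intro!: continuous_intros)
  have R_borel[measurable]: "R e \<in> borel_measurable borel" for e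
    unfolding R_def[abs_def] by (rule borel_measurable_integral_prod_kernel[OF F uc])
  have nR: "Lp_bounded p (B * m e) (\<lambda>x. indicator (cbox a b) x * R e x)" for e
    unfolding R_def
  proof (rule gen)
    fix i x assume "x \<in> {a $ i..b $ i}"
    then show "difference_kernel (restrict_index r e $ i) (\<delta> $ i / (2 * real (r $ i))) (a $ i) (b $ i)
       (2 * real (r $ i) * \<delta> $ i) (C i / \<delta> $ i) x (u e i x)"
      using sk[of i] by (auto simp: u_def st_def restrict_index_def smoothing_kernel_def)
  qed
  have dec: "F x - g x = E x + (1 / I0) * (\<Sum>e\<in>{e. e \<noteq> {}}. R e x)" if x: "x \<in> cbox a b" for x
  proof -
    have xi: "x $ i \<in> {a $ i..b $ i}" for i using x by (simp add: mem_box_cart)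
    have d1: "difference_kernel (r $ i) (\<delta> $ i / (2 * real (r $ i))) (a $ i) (b $ i)
       (2 * real (r $ i) * \<delta> $ i) (C i / \<delta> $ i) (x $ i) (\<lambda>y. st i (x $ i) y - k i 0 (x $ i) y)"
      and d2: "difference_kernel 0 (\<delta> $ i / (2 * real (r $ i))) (a $ i) (b $ i)
       (2 * real (r $ i) * \<delta> $ i) (C i / \<delta> $ i) (x $ i) (k i 0 (x $ i))" for i
      using sk[of i] xi[of i] by (auto simp: smoothing_kernel_def st_def)
    have "(\<integral>y. F y * (\<Prod>i\<in>UNIV. st i (x $ i) (y $ i)) \<partial>lborel)
      = (\<integral>y. F y * (\<Prod>i\<in>UNIV. (st i (x $ i) (y $ i) - k i 0 (x $ i) (y $ i)) + k i 0 (x $ i) (y $ i)) \<partial>lborel)" by simp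
    also have "\<dots> = (\<Sum>e\<in>UNIV. \<integral>y. F y * (\<Prod>i\<in>UNIV. (if i \<in> e then (\<lambda>y. st i (x $ i) y - k i 0 (x $ i) y) else k i 0 (x $ i)) (y $ i)) \<partial>lborel)"
      by (rule integral_prod_add_expand[OF Fi difference_kernel_bounded[OF d1] difference_kernel_bounded[OF d2]])
    also have "\<dots> = (\<Sum>e\<in>UNIV. R e x)"
      unfolding R_def u_def by (intro sum.cong Bochner_Integration.integral_cong arg_cong2[where f="(*)"] prod.cong) auto
    also have "\<dots> = R {} x + (\<Sum>e\<in>{e. e \<noteq> {}}. R e x)"
    proof -
      have "(UNIV :: 'd set set) = insert {} {e. e \<noteq> {}}" by auto
      from arg_cong[where f="\<lambda>A. \<Sum>e\<in>A. R e x", OF this] show ?thesis by simp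
    qed
    also have "R {} x = I0 * g x"
    proof -
      have "R {} x = (\<integral>y. I0 * (F' y * kernel_product k (\<lambda>i. 0) x y) \<partial>lborel)"
        unfolding R_def u_def kernel_product_def F'_def using I0(2) by (intro Bochner_Integration.integral_cong) auto
      then show ?thesis by (simp add: g_eq K.kernel_operator_def)
    qed
    finally show ?thesis unfolding E_def using I0(2) by (simp add: field_simps)
  qed
  have "Lp_bounded p (A * S + \<bar>1 / I0\<bar> * (\<Sum>e\<in>{e. e \<noteq> {}}. B * m e))
     (\<lambda>x. indicator (cbox a b) x * E x + (1 / I0) * (\<Sum>e\<in>{e. e \<noteq> {}}. indicator (cbox a b) x * R e x))"
  proof (intro Lp_bounded_add Lp_bounded_cmult Lp_bounded_sum p E)
    show "(\<lambda>x. indicator (cbox a b) x * E x) \<in> borel_measurable borel"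
      unfolding E_def using borel_measurable_integral_prod_kernel[OF F stc] by measurable
    show "0 \<le> \<bar>1 / I0\<bar> * (\<Sum>e\<in>{e :: 'd set. e \<noteq> {}}. B * m e)" "0 \<le> (\<Sum>e\<in>{e :: 'd set. e \<noteq> {}}. B * m e)"
      using B m0 by (auto intro!: sum_nonneg mult_nonneg_nonneg)
    show "0 \<le> A * S" using A S by simp
  qed (use B m0 nR in \<open>auto intro!: mult_nonneg_nonneg\<close>)
  moreover have "A * S + \<bar>1 / I0\<bar> * (\<Sum>e\<in>{e. e \<noteq> {}}. B * m e) = (A + B / I0) * S"
    using I0(2) by (simp add: S_def m_def sum_distrib_left[symmetric] algebra_simps)
  moreover have "(\<lambda>x. indicator (cbox a b) x * E x + (1 / I0) * (\<Sum>e\<in>{e. e \<noteq> {}}. indicator (cbox a b) x * R e x))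
    = (\<lambda>x. indicator (cbox a b) x * (F x - g x))"
    by (auto simp: fun_eq_iff indicator_def dec)
  ultimately have err: "Lp_bounded p ((A + B / I0) * S) (\<lambda>x. indicator (cbox a b) x * (F x - g x))" by simp
  have AB: "0 \<le> A + B / I0" using A B I0(2) by simp
  have "Lp_norm p (cbox a b) (\<lambda>x. f x - g x) \<le> ennreal ((A + B / I0) * S)"
  proof (subst Lp_norm_rep[OF p])
    show "AE x in lborel. x \<in> cbox a b \<longrightarrow> f x - g x = indicator (cbox a b) x * (F x - g x)"
      using ae by eventually_elim (auto simp: indicator_def)
    show "(\<lambda>x. indicator (cbox a b) x * (F x - g x)) \<in> borel_measurable borel" unfolding g_def by measurable
    show "0 \<le> (A + B / I0) * S" using AB S by simp
  qed (use err in auto)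
  moreover have "(\<Sum>e\<in>{e. e \<noteq> {}}. ennreal (\<Prod>i\<in>e. vec_pow t r $ i) * Lp_norm p (cbox a b) (weak_deriv (interior (cbox a b)) (restrict_index r e) g))
    \<le> (\<Sum>e\<in>{e. e \<noteq> {}}. ennreal (B / I0 * me e))"
  proof (rule sum_mono)
    fix e :: "'d set" assume "e \<in> {e. e \<noteq> {}}"
    then have e: "m e = me e" by (simp add: m_def)
    have "ennreal (\<Prod>i\<in>e. vec_pow t r $ i) * Lp_norm p (cbox a b) (weak_deriv (interior (cbox a b)) (restrict_index r e) g)
      \<le> ennreal (T e) * ennreal (B / I0 * m e / T e)"
      unfolding Lwd using LG[of e] by (intro mult_mono) (auto simp: T_def vec_pow_def)
    also have "\<dots> = ennreal (B / I0 * me e)"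
      using T[of e] B I0(2) me(1)[of e] by (subst ennreal_mult[symmetric]) (auto simp: e)
    finally show "ennreal (\<Prod>i\<in>e. vec_pow t r $ i) * Lp_norm p (cbox a b) (weak_deriv (interior (cbox a b)) (restrict_index r e) g) \<le> ennreal (B / I0 * me e)" .
  qed
  moreover have "(\<Sum>e\<in>{e :: 'd set. e \<noteq> {}}. ennreal (B / I0 * me e)) = ennreal (B / I0 * S)"
    using B I0(2) me(1) by (subst sum_ennreal) (auto simp: S_def sum_distrib_left)
  ultimately have "Lp_norm p (cbox a b) (\<lambda>x. f x - g x) + (\<Sum>e\<in>{e. e \<noteq> {}}. ennreal (\<Prod>i\<in>e. vec_pow t r $ i) *
      Lp_norm p (cbox a b) (weak_deriv (interior (cbox a b)) (restrict_index r e) g)) \<le> ennreal ((A + B / I0) * S) + ennreal (B / I0 * S)"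
    by (simp add: add_mono)
  also have "\<dots> = ennreal ((A + B / I0) * S + B / I0 * S)"
    using AB B S I0(2) by (subst ennreal_plus) auto
  also have "(A + B / I0) * S + B / I0 * S = (A + 2 * B / I0) * S" by (simp add: algebra_simps)
  finally show ?thesis
    unfolding K_functional_def A_def[symmetric] B_def[symmetric] S_def[symmetric]
    by (rule INF_lower2[OF gS])
qed

lemma integral_prod_pos:
  fixes w :: "'d::finite \<Rightarrow> real \<Rightarrow> real"
  assumes w: "\<And>i. continuous_on UNIV (w i)" "\<And>i z. 0 \<le> w i z" "\<And>i z. z \<notin> {0..1} \<Longrightarrow> w i z = 0"
    and z: "\<And>i. 0 < w i (z i)"
  shows "0 < (\<integral>\<zeta>. (\<Prod>i\<in>UNIV. w i (\<zeta> $ i)) \<partial>(lborel :: (real^'d) measure))"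
proof -
  let ?W = "\<lambda>\<zeta> :: real^'d. \<Prod>i\<in>UNIV. w i (\<zeta> $ i)"
  have c: "continuous_on UNIV ?W"
    by (intro continuous_on_prod continuous_on_compose2[OF w(1)] continuous_intros) auto
  have supp: "?W \<zeta> = 0" if "\<zeta> \<notin> cbox 0 1" for \<zeta>
  proof -
    obtain i where "\<zeta> $ i \<notin> {0..1}" using \<open>\<zeta> \<notin> cbox 0 1\<close> by (auto simp: mem_box_cart)
    then show ?thesis using w(3)[of "\<zeta> $ i" i] by (intro prod_zero) auto
  qed
  have int: "integrable lborel ?W" by (rule integrable_continuous_compact_support[OF c compact_cbox supp])
  have nn: "0 \<le> ?W \<zeta>" for \<zeta> by (intro prod_nonneg) (simp add: w)
  have "(\<integral>\<zeta>. ?W \<zeta> \<partial>lborel) \<noteq> 0"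
  proof
    assume "(\<integral>\<zeta>. ?W \<zeta> \<partial>lborel) = 0"
    then have ae: "AE \<zeta> in lborel. ?W \<zeta> = 0" using integral_nonneg_eq_0_iff_AE[OF int] nn by simp
    define U where "U = {\<zeta>. 0 < ?W \<zeta>}"
    have U: "open U" unfolding U_def using c by (intro open_Collect_less) (auto intro: continuous_intros)
    have "(\<chi> i. z i) \<in> U" using z by (auto simp: U_def intro!: prod_pos)
    then have "\<not> negligible U" using open_not_negligible[OF U] by blast
    moreover have "U \<in> null_sets lborel"
      proof (subst AE_iff_null_sets)
      show "AE x in lborel. x \<notin> U"
        using ae
      proof eventually_elim
        case (elim x)
        then show ?case unfolding U_def mem_Collect_eq by linarith
      qed
    qed (use U in simp)
    then have "negligible U" by (simp add: negligible_iff_null_sets null_sets_completionI)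
    ultimately show False by simp
  qed
  moreover have "0 \<le> (\<integral>\<zeta>. ?W \<zeta> \<partial>lborel)" using nn by (intro integral_nonneg_AE) auto
  ultimately show ?thesis by linarith
qed

lemma mixed_modulus_finite:
  fixes f :: "real^'d::finite \<Rightarrow> real"
  assumes p: "1 \<le> p" and f: "f \<in> Lp_space p (cbox a b)"
  shows "mixed_modulus k p (cbox a b) f t < \<infinity>"
proof -
  obtain F n where F[measurable]: "F \<in> borel_measurable borel" and F0: "\<And>x. x \<notin> cbox a b \<Longrightarrow> F x = 0"
    and ae: "AE x in lborel. x \<in> cbox a b \<longrightarrow> f x = F x" and n: "0 \<le> n" and Fn: "Lp_bounded p n F"
    using Lp_space_ex_bounded[OF p f] by blast
  have "mixed_modulus k p (cbox a b) f t \<le> ennreal ((\<Prod>i\<in>UNIV. 2 ^ (k $ i)) * n)"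
  proof (subst mixed_modulus_le_iff[OF p F ae])
    show "0 \<le> (\<Prod>i\<in>UNIV. 2 ^ (k $ i)) * n" using n by (intro mult_nonneg_nonneg prod_nonneg) auto
    show "\<forall>h. (\<forall>i. \<bar>h $ i\<bar> \<le> t $ i) \<longrightarrow> Lp_bounded p ((\<Prod>i\<in>UNIV. 2 ^ (k $ i)) * n)
      (\<lambda>x. indicator (shift_domain (cbox a b) (step_vec k h)) x * mixed_diff k h F x)"
      by (intro allI impI Lp_bounded_mono_AE[OF p _ Lp_bounded_mixed_diff[OF p n Fn F]]) (auto simp: indicator_def)
  qed
  then show ?thesis by (rule order_le_less_trans) simp
qed

text \<open>
  The profiles are chosen from \<open>r\<close> alone, before \<open>p\<close>, the box, \<open>f\<close> and \<open>t\<close>; hence so is the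
  constant.
\<close>

lemma K_functional_le_total_modulus_pos:
  fixes r :: "nat^'d::finite"
  assumes r: "\<And>i. 1 \<le> r $ i"
  obtains D where "0 < D" "\<And>p (a :: real^'d) b f t. 1 \<le> p \<Longrightarrow> (\<And>i. a $ i < b $ i) \<Longrightarrow> f \<in> Lp_space p (cbox a b) \<Longrightarrow>
    (\<And>i. 0 < t $ i) \<Longrightarrow> K_functional r p (cbox a b) f (vec_pow t r) \<le> ennreal D * total_modulus r p (cbox a b) f t"
proof -
  have "\<forall>i. \<exists>C w. 0 < C \<and> continuous_on UNIV w \<and> (\<forall>z. 0 \<le> w z \<and> w z \<le> C) \<and> (\<exists>z. 0 < w z) \<and>
    (\<forall>z. z \<notin> {0..1} \<longrightarrow> w z = 0) \<and>
    (\<forall>a b t. a < b \<longrightarrow> 0 < t \<longrightarrow> (\<exists>\<delta> k. smoothing_kernel (r $ i) w C a b t \<delta> k))"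
    by (intro allI ex_smoothing_kernel r)
  from choice[OF this] obtain C where "\<forall>i. \<exists>w. 0 < C i \<and> continuous_on UNIV w \<and> (\<forall>z. 0 \<le> w z \<and> w z \<le> C i) \<and> (\<exists>z. 0 < w z) \<and>
    (\<forall>z. z \<notin> {0..1} \<longrightarrow> w z = 0) \<and>
    (\<forall>a b t. a < b \<longrightarrow> 0 < t \<longrightarrow> (\<exists>\<delta> k. smoothing_kernel (r $ i) w (C i) a b t \<delta> k))"
    by (elim exE)
  from choice[OF this] obtain w where Cw: "\<forall>i. 0 < C i \<and> continuous_on UNIV (w i) \<and> (\<forall>z. 0 \<le> w i z \<and> w i z \<le> C i) \<and> (\<exists>z. 0 < w i z) \<and>
    (\<forall>z. z \<notin> {0..1} \<longrightarrow> w i z = 0) \<and>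
    (\<forall>a b t. a < b \<longrightarrow> 0 < t \<longrightarrow> (\<exists>\<delta> k. smoothing_kernel (r $ i) (w i) (C i) a b t \<delta> k))"
    by (elim exE)
  have C: "0 < C i" and w: "continuous_on UNIV (w i)" "0 \<le> w i z" "w i z \<le> C i" "z \<notin> {0..1} \<Longrightarrow> w i z = 0" for i z
    using Cw[rule_format, of i] by auto
  have "\<forall>i. \<exists>z. 0 < w i z" using Cw by blast
  from choice[OF this] obtain z where z: "\<forall>i. 0 < w i (z i)" by (elim exE)
  define I0 where "I0 = (\<integral>\<zeta>. (\<Prod>i\<in>UNIV. w i (\<zeta> $ i)) \<partial>(lborel :: (real^'d) measure))"
  have I0: "0 < I0" unfolding I0_def by (rule integral_prod_pos[where z=z, OF w(1,2,4)]) (use z in auto)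
  define D where "D = (\<Prod>i\<in>UNIV. 2 * C i) / I0 + 2 * (\<Prod>i\<in>UNIV. 4 * real (r $ i) * C i) / I0"
  have rpos: "0 < real (r $ i)" for i using r[of i] by simp
  have "0 < (\<Prod>i\<in>UNIV. 2 * C i)" "0 < (\<Prod>i\<in>UNIV. 4 * real (r $ i) * C i)"
    using C rpos by (auto intro!: prod_pos mult_pos_pos)
  then have D: "0 < D" unfolding D_def using I0 by (intro add_pos_pos divide_pos_pos) auto
  moreover have "K_functional r p (cbox a b) f (vec_pow t r) \<le> ennreal D * total_modulus r p (cbox a b) f t"
    if p: "1 \<le> p" and ab: "\<And>i. a $ i < b $ i" and f: "f \<in> Lp_space p (cbox a b)" and t: "\<And>i. 0 < t $ i"
    for p and a b t :: "real^'d" and f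
  proof -
    have "\<forall>i. \<exists>\<delta> k. smoothing_kernel (r $ i) (w i) (C i) (a $ i) (b $ i) (t $ i) \<delta> k"
      using Cw ab t by blast
    from choice[OF this] obtain \<delta> where "\<forall>i. \<exists>k. smoothing_kernel (r $ i) (w i) (C i) (a $ i) (b $ i) (t $ i) (\<delta> i) k"
      by (elim exE)
    from choice[OF this] obtain k where sk: "\<forall>i. smoothing_kernel (r $ i) (w i) (C i) (a $ i) (b $ i) (t $ i) (\<delta> i) (k i)"
      by (elim exE)
    define me where "me e = enn2real (mixed_modulus (restrict_index r e) p (cbox a b) f t)" for e
    have me: "mixed_modulus (restrict_index r e) p (cbox a b) f t = ennreal (me e)" "0 \<le> me e" for e
      unfolding me_def using mixed_modulus_finite[OF p f, of "restrict_index r e" t] by auto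
    have "K_functional r p (cbox a b) f (vec_pow t r) \<le> ennreal (D * (\<Sum>e\<in>{e. e \<noteq> {}}. me e))"
      unfolding D_def
      by (rule K_functional_le_smoothing[where \<delta>="\<chi> i. \<delta> i" and k=k and w=w and t=t, OF p r ab t _ C w I0_def I0 f me(2)])
        (use sk me in auto)
    also have "\<dots> = ennreal D * total_modulus r p (cbox a b) f t"
      unfolding total_modulus_def me(1) using D me(2) by (subst sum_ennreal) (auto simp: ennreal_mult sum_nonneg)
    finally show ?thesis .
  qed
  ultimately show thesis by (rule that)
qed

section \<open>Vanishing steps\<close>

lemma clamp_real_abs:
  fixes M z :: real assumes "0 \<le> M"
  shows "\<bar>max (- M) (min M z)\<bar> \<le> M" "\<bar>z - max (- M) (min M z)\<bar> \<le> \<bar>z\<bar>" "\<bar>z\<bar> \<le> M \<Longrightarrow> max (- M) (min M z) = z"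
  using assms by (auto simp: max_def min_def)

lemma Lp_bounded_dominated:
  fixes u :: "nat \<Rightarrow> 'a::euclidean_space \<Rightarrow> real"
  assumes p: "1 \<le> p" "p \<noteq> \<infinity>" and [measurable]: "\<And>n. u n \<in> borel_measurable borel" "v \<in> borel_measurable borel"
    and uv: "\<And>n x. \<bar>u n x\<bar> \<le> \<bar>v x\<bar>" and v: "Lp_bounded p m v" and lim: "AE x in lborel. (\<lambda>n. u n x) \<longlonglongrightarrow> 0" and \<eta>: "0 < \<eta>"
  shows "\<exists>n. Lp_bounded p \<eta> (u n)"
proof -
  define q where "q = enn2real p"
  have q: "1 \<le> q" using enn2real_ge_1[OF p] by (simp add: q_def)
  have "(\<lambda>n. \<integral>\<^sup>+x. ennreal (\<bar>u n x\<bar> powr q) \<partial>lborel) \<longlonglongrightarrow> (\<integral>\<^sup>+x. (0 :: ennreal) \<partial>(lborel :: 'a measure))"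
  proof (rule nn_integral_dominated_convergence[where w="\<lambda>x. ennreal (\<bar>v x\<bar> powr q)"])
    show "AE x in lborel. ennreal (\<bar>u n x\<bar> powr q) \<le> ennreal (\<bar>v x\<bar> powr q)" for n
      using uv q by (intro AE_I2 ennreal_leI powr_mono2) auto
    show "(\<integral>\<^sup>+x. ennreal (\<bar>v x\<bar> powr q) \<partial>lborel) < \<infinity>"
      using v p(2) unfolding Lp_bounded_def q_def[symmetric] by (auto intro: order_le_less_trans)
    show "AE x in lborel. (\<lambda>n. ennreal (\<bar>u n x\<bar> powr q)) \<longlonglongrightarrow> 0"
      using lim
    proof eventually_elim
      case (elim x)
      have "(\<lambda>n. \<bar>u n x\<bar>) \<longlonglongrightarrow> 0" using elim by (rule tendsto_rabs_zero)
      then have "(\<lambda>n. \<bar>u n x\<bar> powr q) \<longlonglongrightarrow> 0 powr q"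
        using q by (intro tendsto_powr') auto
      then have "(\<lambda>n. ennreal (\<bar>u n x\<bar> powr q)) \<longlonglongrightarrow> ennreal (0 powr q)" by (rule tendsto_ennrealI)
      then show ?case by simp
    qed
  qed measurable
  then have "(\<lambda>n. \<integral>\<^sup>+x. ennreal (\<bar>u n x\<bar> powr q) \<partial>lborel) \<longlonglongrightarrow> 0" by simp
  moreover have "0 < ennreal (\<eta> powr q)" using \<eta> by simp
  ultimately have "eventually (\<lambda>n. (\<integral>\<^sup>+x. ennreal (\<bar>u n x\<bar> powr q) \<partial>lborel) < ennreal (\<eta> powr q)) sequentially"
    by (rule order_tendstoD(2))
  then obtain n where "(\<integral>\<^sup>+x. ennreal (\<bar>u n x\<bar> powr q) \<partial>lborel) < ennreal (\<eta> powr q)"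
    by (auto simp: eventually_sequentially)
  then show ?thesis unfolding Lp_bounded_def q_def[symmetric] using p(2) by (auto intro!: exI[of _ n])
qed

lemma Lp_bounded_on_ball:
  fixes u :: "'a::euclidean_space \<Rightarrow> real"
  assumes p: "1 \<le> p" "p \<noteq> \<infinity>" and \<eta>: "0 < \<eta>"
  obtains \<epsilon> where "0 < \<epsilon>" "Lp_bounded p \<eta> (\<lambda>x :: 'a::euclidean_space. \<epsilon> * indicator (cball 0 R) x)"
proof -
  define q where "q = enn2real p"
  have q: "1 \<le> q" using enn2real_ge_1[OF p] by (simp add: q_def)
  let ?B = "cball (0 :: 'a) R"
  define \<mu> where "\<mu> = measure lborel ?B"
  have \<mu>: "0 \<le> \<mu>" "emeasure lborel ?B = ennreal \<mu>"
    unfolding \<mu>_def using emeasure_bounded_finite[OF bounded_cball, of "0 :: 'a" R]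
    by (auto simp: emeasure_eq_ennreal_measure less_top)
  \<comment> \<open>Then \<open>\<epsilon>\<^sup>q \<mu> \<le> \<eta>\<^sup>q\<close>, because \<open>\<mu> \<le> (\<mu> + 1)\<^sup>q\<close> for \<open>q \<ge> 1\<close>.\<close>
  define \<epsilon> where "\<epsilon> = \<eta> / (\<mu> + 1)"
  have \<epsilon>: "0 < \<epsilon>" unfolding \<epsilon>_def using \<eta> \<mu>(1) by simp
  have "(\<integral>\<^sup>+x. ennreal (\<bar>\<epsilon> * indicator ?B x\<bar> powr q) \<partial>lborel) = (\<integral>\<^sup>+x. ennreal (\<epsilon> powr q) * indicator ?B x \<partial>(lborel :: 'a measure))"
    using \<epsilon> q by (intro nn_integral_cong) (auto simp: indicator_def)
  also have "\<dots> = ennreal (\<epsilon> powr q) * ennreal \<mu>" by (subst nn_integral_cmult_indicator) (auto simp: \<mu>(2))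
  also have "\<dots> = ennreal (\<epsilon> powr q * \<mu>)" using \<mu>(1) by (subst ennreal_mult[symmetric]) auto
  also have "\<dots> \<le> ennreal (\<eta> powr q)"
  proof (rule ennreal_leI)
    have "\<mu> + 1 \<le> (\<mu> + 1) powr q" using powr_mono[of 1 q "\<mu> + 1"] q \<mu>(1) by simp
    then have "\<epsilon> powr q * \<mu> \<le> \<epsilon> powr q * (\<mu> + 1) powr q" by (intro mult_left_mono) auto
    also have "\<dots> = (\<epsilon> * (\<mu> + 1)) powr q" using \<epsilon> \<mu>(1) by (simp add: powr_mult)
    also have "\<epsilon> * (\<mu> + 1) = \<eta>" using \<mu>(1) by (simp add: \<epsilon>_def)
    finally show "\<epsilon> powr q * \<mu> \<le> \<eta> powr q" .
  qed
  finally have "Lp_bounded p \<eta> (\<lambda>x :: 'a. \<epsilon> * indicator ?B x)"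
    unfolding Lp_bounded_def q_def[symmetric] using p(2) by simp
  then show thesis using \<epsilon> that by blast
qed

lemma Lp_bounded_indicator_ball:
  assumes p: "1 \<le> p" "p \<noteq> \<infinity>" and M: "0 \<le> M"
  shows "\<exists>m. Lp_bounded p m (\<lambda>x :: 'a::euclidean_space. M * indicator (cball 0 R) x)"
proof -
  obtain \<epsilon> where \<epsilon>: "0 < \<epsilon>" "Lp_bounded p 1 (\<lambda>x :: 'a. \<epsilon> * indicator (cball 0 R) x)"
    using Lp_bounded_on_ball[OF p, of 1] by auto
  have [measurable]: "(\<lambda>x :: 'a. \<epsilon> * indicator (cball 0 R) x :: real) \<in> borel_measurable borel"
    by (intro borel_measurable_times borel_measurable_indicator) auto
  have "Lp_bounded p (\<bar>M / \<epsilon>\<bar> * 1) (\<lambda>x :: 'a. M / \<epsilon> * (\<epsilon> * indicator (cball 0 R) x))"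
    by (rule Lp_bounded_cmult[OF p(1) _ \<epsilon>(2)]) auto
  then show ?thesis using \<epsilon>(1) by auto
qed

text \<open>
  First \<open>F\<close> is truncated to bounded values.  A Lebesgue measurable function is an almost
  everywhere limit of continuous functions; after clamping their values and multiplying by a
  continuous cut-off function they are dominated by a constant on a ball.
\<close>

lemma Lp_approx_continuous:
  fixes F :: "real^'d::finite \<Rightarrow> real"
  assumes p: "1 \<le> p" "p \<noteq> \<infinity>" and F[measurable]: "F \<in> borel_measurable borel"
    and F0: "\<And>x. x \<notin> cbox a b \<Longrightarrow> F x = 0" and Fn: "Lp_bounded p n F" and \<eta>: "0 < \<eta>"
  obtains G R where "continuous_on UNIV G" "\<And>x. x \<notin> cball 0 R \<Longrightarrow> G x = 0" "Lp_bounded p \<eta> (\<lambda>x. F x - G x)"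
proof -
  define cl where "cl M z = max (- M) (min M z)" for M z :: real
  have "\<exists>N. Lp_bounded p (\<eta> / 2) (\<lambda>x. F x - cl (real N) (F x))"
  proof (rule Lp_bounded_dominated[OF p _ F _ Fn])
    show "(\<lambda>x. F x - cl (real N) (F x)) \<in> borel_measurable borel" for N unfolding cl_def by measurable
    show "\<bar>F x - cl (real N) (F x)\<bar> \<le> \<bar>F x\<bar>" for N x unfolding cl_def by (rule clamp_real_abs) simp
    show "AE x in lborel. (\<lambda>N. F x - cl (real N) (F x)) \<longlonglongrightarrow> 0"
    proof (rule AE_I2, rule tendsto_eventually)
      fix x
      obtain N0 where N0: "\<bar>F x\<bar> \<le> real N0" using real_arch_simple by blast
      show "eventually (\<lambda>N. F x - cl (real N) (F x) = 0) sequentially"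
        using eventually_ge_at_top[of N0]
      proof eventually_elim
        case (elim N)
        then show ?case using N0 clamp_real_abs(3)[of "real N" "F x"] by (simp add: cl_def)
      qed
    qed
  qed (use \<eta> in simp)
  then obtain N where N: "Lp_bounded p (\<eta> / 2) (\<lambda>x. F x - cl (real N) (F x))" by blast
  define F1 where "F1 x = cl (real N) (F x)" for x
  have [measurable]: "F1 \<in> borel_measurable borel" unfolding F1_def cl_def by measurable
  have F10: "F1 x = 0" if "x \<notin> cbox a b" for x using F0[OF that] by (simp add: F1_def cl_def)
  have "F \<in> borel_measurable lebesgue" by (rule measurable_completion) simp
  then have "F measurable_on UNIV" by (intro lebesgue_measurable_imp_measurable_on) simp_all
  then obtain Z g where Z: "negligible Z" and g: "\<And>n. continuous_on UNIV (g n)" "\<And>x. x \<notin> Z \<Longrightarrow> (\<lambda>n. g n x) \<longlonglongrightarrow> F x"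
    unfolding measurable_on_def by (elim exE conjE) auto
  obtain R where "\<forall>x\<in>cbox a b. norm x \<le> R"
    using bounded_cbox[of a b] unfolding bounded_iff by blast
  then have R: "cbox a b \<subseteq> cball 0 R" by auto
  define \<psi> where "\<psi> x = max 0 (min 1 (R + 1 - norm x))" for x :: "real^'d"
  have \<psi>: "0 \<le> \<psi> x" "\<psi> x \<le> 1" "x \<in> cbox a b \<Longrightarrow> \<psi> x = 1" "x \<notin> cball 0 (R + 1) \<Longrightarrow> \<psi> x = 0" for x
    using R by (auto simp: \<psi>_def subset_iff)
  have \<psi>c: "continuous_on UNIV \<psi>" unfolding \<psi>_def by (intro continuous_intros)
  define G where "G n x = cl (real N) (g n x) * \<psi> x" for n x
  have Gc: "continuous_on UNIV (G n)" for n unfolding G_def cl_def using \<psi>c g(1) by (intro continuous_intros)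
  have [measurable]: "G n \<in> borel_measurable borel" for n by (rule borel_measurable_continuous_onI[OF Gc])
  obtain m where m: "Lp_bounded p m (\<lambda>x :: real^'d. (2 * real N) * indicator (cball 0 (R + 1)) x)"
    using Lp_bounded_indicator_ball[OF p, of "2 * real N" "R + 1"] by auto
  have [measurable]: "(\<lambda>x :: real^'d. 2 * real N * indicator (cball 0 (R + 1)) x :: real) \<in> borel_measurable borel"
    by (intro borel_measurable_times borel_measurable_indicator) auto
  have "\<exists>n. Lp_bounded p (\<eta> / 2) (\<lambda>x. F1 x - G n x)"
  proof (rule Lp_bounded_dominated[OF p _ _ _ m])
    show "\<bar>F1 x - G n x\<bar> \<le> \<bar>2 * real N * indicator (cball 0 (R + 1)) x\<bar>" for n x
    proof (cases "x \<in> cball 0 (R + 1)")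
      case True
      have "\<bar>G n x\<bar> \<le> real N * 1"
        unfolding G_def abs_mult using \<psi>[of x] clamp_real_abs(1)[of "real N" "g n x"] by (intro mult_mono) (auto simp: cl_def)
      moreover have "\<bar>F1 x\<bar> \<le> real N" unfolding F1_def cl_def by (rule clamp_real_abs) simp
      ultimately show ?thesis using True by simp
    next
      case False
      moreover have "x \<notin> cbox a b" using False R by (auto simp: subset_iff)
      ultimately show ?thesis using F10[of x] \<psi>(4)[of x] by (simp add: G_def)
    qed
    have "AE x in lborel. x \<notin> Z"
    proof -
      have "AE x in lebesgue. x \<notin> Z" using Z by (intro AE_not_in) (simp add: negligible_iff_null_sets)
      then show ?thesis by (simp add: AE_completion_iff)
    qed
    then show "AE x in lborel. (\<lambda>n. F1 x - G n x) \<longlonglongrightarrow> 0"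
    proof eventually_elim
      case (elim x)
      have lim: "(\<lambda>n. F1 x - G n x) \<longlonglongrightarrow> F1 x - cl (real N) (F x) * \<psi> x"
        unfolding G_def cl_def by (intro tendsto_intros g(2)[OF elim])
      have "F1 x - cl (real N) (F x) * \<psi> x = 0"
      proof (cases "x \<in> cbox a b")
        case True
        then show ?thesis using \<psi>(3)[OF True] by (simp add: F1_def)
      next
        case False
        then show ?thesis using F10[OF False] by (simp add: F1_def)
      qed
      with lim show ?case by (simp only:)
    qed
  qed (use \<eta> in auto)
  then obtain n where n: "Lp_bounded p (\<eta> / 2) (\<lambda>x. F1 x - G n x)" by blast
  have "Lp_bounded p (\<eta> / 2 + \<eta> / 2) (\<lambda>x. (F x - F1 x) + (F1 x - G n x))"
    using \<eta> N[folded F1_def] n by (intro Lp_bounded_add[OF p(1)]) auto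
  then have "Lp_bounded p \<eta> (\<lambda>x. F x - G n x)" by simp
  moreover have "G n x = 0" if "x \<notin> cball 0 (R + 1)" for x using \<psi>(4)[OF that] by (simp add: G_def)
  ultimately show thesis using that[OF Gc] by blast
qed

text \<open>
  This holds for continuous functions of compact support by uniform continuity, and in general by
  approximation, because translations preserve the norm.
\<close>

lemma Lp_translation_continuous:
  fixes F :: "real^'d::finite \<Rightarrow> real"
  assumes p: "1 \<le> p" "p \<noteq> \<infinity>" and F[measurable]: "F \<in> borel_measurable borel"
    and F0: "\<And>x. x \<notin> cbox a b \<Longrightarrow> F x = 0" and Fn: "Lp_bounded p n F" and \<eta>: "0 < \<eta>"
  obtains \<epsilon> where "0 < \<epsilon>" "\<And>s. norm s \<le> \<epsilon> \<Longrightarrow> Lp_bounded p \<eta> (\<lambda>x. F (x + s) - F x)"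
proof -
  have \<eta>3: "0 < \<eta> / 3" using \<eta> by simp
  obtain G R where G: "continuous_on UNIV G" "\<And>x. x \<notin> cball 0 R \<Longrightarrow> G x = 0" "Lp_bounded p (\<eta> / 3) (\<lambda>x. F x - G x)"
    using Lp_approx_continuous[OF p F F0 Fn \<eta>3] by blast
  have [measurable]: "G \<in> borel_measurable borel" by (rule borel_measurable_continuous_onI[OF G(1)])
  obtain c where c: "0 < c" "Lp_bounded p (\<eta> / 3) (\<lambda>x :: real^'d. c * indicator (cball 0 (R + 1)) x)"
    using Lp_bounded_on_ball[OF p \<eta>3] by blast
  have "uniformly_continuous_on (cball 0 (R + 2)) G"
    by (rule compact_uniformly_continuous[OF continuous_on_subset[OF G(1)]]) auto
  then obtain d where d: "0 < d" "\<And>x y. x \<in> cball 0 (R + 2) \<Longrightarrow> y \<in> cball 0 (R + 2) \<Longrightarrow> dist y x < d \<Longrightarrow> dist (G y) (G x) < c"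
    unfolding uniformly_continuous_on_def using c(1) by meson
  define \<epsilon> where "\<epsilon> = min 1 (d / 2)"
  have \<epsilon>: "0 < \<epsilon>" "\<epsilon> \<le> 1" "\<epsilon> < d" using d(1) by (auto simp: \<epsilon>_def min_def)
  have "Lp_bounded p \<eta> (\<lambda>x. F (x + s) - F x)" if s: "norm s \<le> \<epsilon>" for s
  proof -
    have "\<bar>G (x + s) - G x\<bar> \<le> \<bar>c * indicator (cball 0 (R + 1)) x\<bar>" for x
    proof (cases "x \<in> cball 0 (R + 1)")
      case True
      have "norm (x + s) \<le> R + 2" using True s \<epsilon>(2) norm_triangle_ineq[of x s] by simp
      then have "dist (G (x + s)) (G x) < c" using True s \<epsilon>(3) by (intro d(2)) (auto simp: dist_norm[of "x + s" x])
      then show ?thesis using True c(1) by (simp add: dist_real_def)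
    next
      case False
      have "norm x \<le> norm (x + s) + norm s" using norm_triangle_ineq4[of "x + s" s] by simp
      then have "R < norm (x + s)" "R < norm x" using False s \<epsilon>(2) by auto
      then show ?thesis using G(2)[of x] G(2)[of "x + s"] by simp
    qed
    then have 1: "Lp_bounded p (\<eta> / 3) (\<lambda>x. G (x + s) - G x)"
      by (intro Lp_bounded_mono_AE[OF p(1) _ c(2)] AE_I2)
    have 2: "Lp_bounded p (\<eta> / 3) (\<lambda>x. F (x + s) - G (x + s))"
      using Lp_bounded_translate[OF G(3), of s] by simp
    have 3: "Lp_bounded p (\<eta> / 3) (\<lambda>x. - 1 * (F x - G x))"
      using Lp_bounded_cmult[OF p(1) _ G(3), of "- 1"] \<eta> by simp
    have "Lp_bounded p (\<eta> / 3 + \<eta> / 3 + \<eta> / 3) (\<lambda>x. (G (x + s) - G x) + (F (x + s) - G (x + s)) + - 1 * (F x - G x))"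
      using \<eta> by (intro Lp_bounded_add[OF p(1)] 1 2 3) auto
    then show ?thesis by simp
  qed
  then show thesis using \<epsilon>(1) that by blast
qed

lemma mixed_diff_zero_step:
  fixes F :: "real^'d::finite \<Rightarrow> real"
  assumes "k $ l \<noteq> 0" "h $ l = 0"
  shows "mixed_diff k h F x = 0"
proof -
  interpret comp_fun_commute "\<lambda>i. coord_diff i (k $ i) (h $ i)" by (rule coord_diff_comp_fun_commute)
  let ?f = "\<lambda>i. coord_diff i (k $ i) (h $ i)"
  have "mixed_diff k h F = coord_diff l (k $ l) (h $ l) (Finite_Set.fold ?f F (UNIV - {l}))"
    unfolding mixed_diff_def by (rule fold_rec) auto
  moreover have "fdiff m 0 \<psi> s = 0" if "m \<noteq> 0" for m \<psi> s
  proof -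
    from not0_implies_Suc[OF that] obtain m' where "m = Suc m'" by blast
    then show ?thesis by (simp add: fdiff_Suc)
  qed
  ultimately show ?thesis using assms by (simp add: coord_diff_def)
qed

lemma norm_axis_real: "norm (axis l c :: real^'d::finite) = \<bar>c\<bar>"
proof -
  have "axis l c = c *\<^sub>R (axis l 1 :: real^'d)" by (auto simp: axis_def vec_eq_iff)
  then show ?thesis by simp
qed

text \<open>
  The same difference with the \<open>l\<close>-th step set to zero vanishes.  Subtracting it moves every node
  by at most \<open>k\<^sub>l \<bar>h\<^sub>l\<bar>\<close>.
\<close>

lemma Lp_bounded_mixed_diff_small_step:
  fixes F :: "real^'d::finite \<Rightarrow> real"
  assumes p: "1 \<le> p" and F[measurable]: "F \<in> borel_measurable borel" and kl: "k $ l \<noteq> 0" and \<eta>: "0 \<le> \<eta>"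
    and \<epsilon>: "\<And>s. norm s \<le> \<epsilon> \<Longrightarrow> Lp_bounded p \<eta> (\<lambda>x. F (x + s) - F x)" and h: "real (k $ l) * \<bar>h $ l\<bar> \<le> \<epsilon>"
  shows "Lp_bounded p ((\<Prod>i\<in>UNIV. 2 ^ (k $ i)) * \<eta>) (mixed_diff k h F)"
proof -
  define h' where "h' = (\<chi> i. if i = l then 0 else h $ i)"
  have "Lp_bounded p (\<Sum>j\<in>multi_indices k. \<bar>diff_coeff k j\<bar> * \<eta>)
    (\<lambda>x. \<Sum>j\<in>multi_indices k. diff_coeff k j * (F (x + index_scale j h) - F (x + index_scale j h')))"
  proof (intro Lp_bounded_sum p finite_multi_indices conjI Lp_bounded_cmult \<eta>)
    fix j assume j: "j \<in> multi_indices k"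
    show "(\<lambda>x. diff_coeff k j * (F (x + index_scale j h) - F (x + index_scale j h'))) \<in> borel_measurable borel"
      "(\<lambda>x. F (x + index_scale j h) - F (x + index_scale j h')) \<in> borel_measurable borel" by measurable
    show "0 \<le> \<bar>diff_coeff k j\<bar> * \<eta>" using \<eta> by simp
    let ?s = "axis l (real (j l) * h $ l)"
    have s: "index_scale j h = index_scale j h' + ?s" by (auto simp: index_scale_def h'_def vec_eq_iff axis_def)
    have "real (j l) * \<bar>h $ l\<bar> \<le> real (k $ l) * \<bar>h $ l\<bar>" using j by (intro mult_right_mono) (auto simp: PiE_iff)
    then have "norm ?s \<le> \<epsilon>" using h by (simp add: norm_axis_real abs_mult)
    from Lp_bounded_translate[OF \<epsilon>[OF this], of "index_scale j h'"]
    show "Lp_bounded p \<eta> (\<lambda>x. F (x + index_scale j h) - F (x + index_scale j h'))"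
      unfolding s by (simp add: add.assoc)
  qed
  moreover have "(\<Sum>j\<in>multi_indices k. diff_coeff k j * (F (x + index_scale j h) - F (x + index_scale j h'))) = mixed_diff k h F x" for x
  proof -
    have "(\<Sum>j\<in>multi_indices k. diff_coeff k j * (F (x + index_scale j h) - F (x + index_scale j h'))) = mixed_diff k h F x - mixed_diff k h' F x"
      by (simp add: mixed_diff_expand sum_subtractf right_diff_distrib)
    moreover have "mixed_diff k h' F x = 0" by (rule mixed_diff_zero_step[OF kl]) (simp add: h'_def)
    ultimately show ?thesis by simp
  qed
  ultimately show ?thesis by (simp only: sum_distrib_right[symmetric] sum_abs_diff_coeff)
qed

lemma mixed_modulus_small_step:
  fixes f :: "real^'d::finite \<Rightarrow> real"
  assumes p: "1 \<le> p" "p \<noteq> \<infinity>" and f: "f \<in> Lp_space p (cbox a b)" and kl: "k $ l \<noteq> 0" and \<eta>: "0 < \<eta>"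
  shows "\<exists>\<epsilon>>0. \<forall>t. t $ l \<le> \<epsilon> \<longrightarrow> mixed_modulus k p (cbox a b) f t \<le> ennreal \<eta>"
proof -
  obtain F n where F[measurable]: "F \<in> borel_measurable borel" and F0: "\<And>x. x \<notin> cbox a b \<Longrightarrow> F x = 0"
    and ae: "AE x in lborel. x \<in> cbox a b \<longrightarrow> f x = F x" and n: "0 \<le> n" and Fn: "Lp_bounded p n F"
    using Lp_space_ex_bounded[OF p(1) f] by blast
  define P where "P = (\<Prod>i\<in>UNIV. 2 ^ (k $ i) :: real)"
  have P: "0 < P" unfolding P_def by (intro prod_pos) auto
  have \<eta>P: "0 < \<eta> / P" using \<eta> P by simp
  obtain \<epsilon> where \<epsilon>: "0 < \<epsilon>" "\<And>s. norm s \<le> \<epsilon> \<Longrightarrow> Lp_bounded p (\<eta> / P) (\<lambda>x. F (x + s) - F x)"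
    using Lp_translation_continuous[OF p F F0 Fn \<eta>P] by blast
  have "mixed_modulus k p (cbox a b) f t \<le> ennreal \<eta>" if t: "t $ l \<le> \<epsilon> / real (k $ l)" for t
  proof (subst mixed_modulus_le_iff[OF p(1) F ae])
    show "\<forall>h. (\<forall>i. \<bar>h $ i\<bar> \<le> t $ i) \<longrightarrow> Lp_bounded p \<eta>
      (\<lambda>x. indicator (shift_domain (cbox a b) (step_vec k h)) x * mixed_diff k h F x)"
    proof (intro allI impI)
      fix h assume h: "\<forall>i. \<bar>h $ i\<bar> \<le> t $ i"
      have "\<bar>h $ l\<bar> \<le> \<epsilon> / real (k $ l)" using h t by (meson order_trans)
      then have "real (k $ l) * \<bar>h $ l\<bar> \<le> \<epsilon>" using kl by (simp add: field_simps)
      from Lp_bounded_mixed_diff_small_step[where \<eta>="\<eta> / P", OF p(1) F kl _ \<epsilon>(2) this]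
      have "Lp_bounded p (P * (\<eta> / P)) (mixed_diff k h F)" using \<eta>P by (simp add: P_def)
      then have "Lp_bounded p \<eta> (mixed_diff k h F)" using P by simp
      then show "Lp_bounded p \<eta> (\<lambda>x. indicator (shift_domain (cbox a b) (step_vec k h)) x * mixed_diff k h F x)"
        by (rule Lp_bounded_mono_AE[OF p(1), rotated]) (auto simp: indicator_def)
    qed
  qed (use \<eta> in simp)
  then show ?thesis using \<epsilon>(1) kl by (intro exI[of _ "\<epsilon> / real (k $ l)"]) auto
qed

lemma mixed_modulus_mono:
  fixes t s :: "real^'d::finite"
  assumes "\<And>i. 0 \<le> s $ i" and "\<And>i. k $ i \<noteq> 0 \<Longrightarrow> t $ i \<le> s $ i"
  shows "mixed_modulus k p Q f t \<le> mixed_modulus k p Q f s"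
  unfolding mixed_modulus_def
proof (rule SUP_mono)
  fix h assume h: "h \<in> {h :: real^'d. \<forall>i. \<bar>h $ i\<bar> \<le> t $ i}"
  define h' where "h' = (\<chi> i. if k $ i = 0 then 0 else h $ i)"
  have "\<bar>h' $ i\<bar> \<le> s $ i" for i
  proof (cases "k $ i = 0")
    case False
    have "\<bar>h $ i\<bar> \<le> t $ i" using h by simp
    then show ?thesis using False assms(2)[of i] by (simp add: h'_def)
  qed (use assms(1) in \<open>simp add: h'_def\<close>)
  moreover have "mixed_diff k h f = mixed_diff k h' f" by (rule mixed_diff_cong_step) (simp add: h'_def)
  moreover have "step_vec k h = step_vec k h'" by (auto simp: h'_def vec_eq_iff)
  ultimately show "\<exists>m\<in>{h. \<forall>i. \<bar>h $ i\<bar> \<le> s $ i}. Lp_norm p (shift_domain Q (step_vec k h)) (mixed_diff k h f)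
    \<le> Lp_norm p (shift_domain Q (step_vec k m)) (mixed_diff k m f)"
    by (intro bexI[of _ h']) auto
qed

lemma K_functional_mono:
  assumes "\<And>i. 0 \<le> t $ i" "\<And>i. t $ i \<le> s $ i"
  shows "K_functional r p Q f t \<le> K_functional r p Q f s"
  unfolding K_functional_def
  using assms by (intro INF_mono' add_left_mono sum_mono mult_right_mono ennreal_leI prod_mono) auto

section \<open>The equivalence\<close>

text \<open>
  The zero entries of \<open>t\<close> are replaced by one small \<open>\<epsilon>\<close>.  The modulus of order \<open>r(e)\<close> is
  unaffected if \<open>t\<^sub>i \<noteq> 0\<close> for all \<open>i \<in> e\<close>, and otherwise it tends to zero with \<open>\<epsilon>\<close>.
\<close>

lemma total_modulus_perturb:
  fixes f :: "real^'d::finite \<Rightarrow> real" and t :: "real^'d"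
  assumes p: "1 \<le> p" "p \<noteq> \<infinity>" and r: "\<And>i. 1 \<le> r $ i" and f: "f \<in> Lp_space p (cbox a b)"
    and t: "\<And>i. 0 \<le> t $ i" and \<eta>: "0 < \<eta>"
  obtains s where "\<And>i. 0 < s $ i" "\<And>i. t $ i \<le> s $ i"
    "total_modulus r p (cbox a b) f s \<le> total_modulus r p (cbox a b) f t + ennreal \<eta>"
proof -
  define N where "N = card {e :: 'd set. e \<noteq> {}}"
  have N: "0 < N" unfolding N_def by (subst card_gt_0_iff) auto
  define te where "te \<epsilon> = (\<chi> i. if t $ i = 0 then \<epsilon> else t $ i)" for \<epsilon>
  have \<eta>N: "0 < \<eta> / real N" using \<eta> N by simp
  have "\<exists>\<epsilon>>0. \<forall>\<epsilon>'. 0 < \<epsilon>' \<and> \<epsilon>' \<le> \<epsilon> \<longrightarrow> mixed_modulus (restrict_index r e) p (cbox a b) f (te \<epsilon>')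
      \<le> mixed_modulus (restrict_index r e) p (cbox a b) f t + ennreal (\<eta> / real N)" for e
  proof (cases "\<exists>l\<in>e. t $ l = 0")
    case True
    then obtain l where l: "l \<in> e" "t $ l = 0" by blast
    have "restrict_index r e $ l \<noteq> 0" using l r[of l] by (simp add: restrict_index_def)
    from mixed_modulus_small_step[OF p f this \<eta>N]
    obtain \<epsilon> where \<epsilon>: "0 < \<epsilon>" "\<forall>t. t $ l \<le> \<epsilon> \<longrightarrow> mixed_modulus (restrict_index r e) p (cbox a b) f t \<le> ennreal (\<eta> / real N)"
      by blast
    have "mixed_modulus (restrict_index r e) p (cbox a b) f (te \<epsilon>')
      \<le> mixed_modulus (restrict_index r e) p (cbox a b) f t + ennreal (\<eta> / real N)" if "\<epsilon>' \<le> \<epsilon>" for \<epsilon>'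
    proof -
      have "mixed_modulus (restrict_index r e) p (cbox a b) f (te \<epsilon>') \<le> ennreal (\<eta> / real N)"
        using \<epsilon>(2) that l(2) by (simp add: te_def)
      then show ?thesis by (rule order_trans) simp
    qed
    then show ?thesis using \<epsilon>(1) by blast
  next
    case False
    have "mixed_modulus (restrict_index r e) p (cbox a b) f (te \<epsilon>')
      \<le> mixed_modulus (restrict_index r e) p (cbox a b) f t + ennreal (\<eta> / real N)" for \<epsilon>'
    proof -
      have "mixed_modulus (restrict_index r e) p (cbox a b) f (te \<epsilon>') \<le> mixed_modulus (restrict_index r e) p (cbox a b) f t"
        using False t by (intro mixed_modulus_mono) (auto simp: te_def restrict_index_def split: if_splits)
      then show ?thesis by (rule order_trans) simp
    qed
    then show ?thesis by (intro exI[of _ 1]) auto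
  qed
  then have "\<forall>e. \<exists>\<epsilon>>0. \<forall>\<epsilon>'. 0 < \<epsilon>' \<and> \<epsilon>' \<le> \<epsilon> \<longrightarrow> mixed_modulus (restrict_index r e) p (cbox a b) f (te \<epsilon>')
      \<le> mixed_modulus (restrict_index r e) p (cbox a b) f t + ennreal (\<eta> / real N)" by blast
  from choice[OF this] obtain \<epsilon> where \<epsilon>: "\<And>e. 0 < \<epsilon> e"
    "\<And>e \<epsilon>'. 0 < \<epsilon>' \<Longrightarrow> \<epsilon>' \<le> \<epsilon> e \<Longrightarrow> mixed_modulus (restrict_index r e) p (cbox a b) f (te \<epsilon>')
      \<le> mixed_modulus (restrict_index r e) p (cbox a b) f t + ennreal (\<eta> / real N)" by blast
  define m where "m = Min (range \<epsilon>)"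
  have "m \<in> range \<epsilon>" unfolding m_def by (rule Min_in) auto
  then have m: "0 < m" using \<epsilon>(1) by auto
  have me: "m \<le> \<epsilon> e" for e unfolding m_def by (rule Min_le) auto
  have "total_modulus r p (cbox a b) f (te m) \<le> (\<Sum>e\<in>{e. e \<noteq> {}}. mixed_modulus (restrict_index r e) p (cbox a b) f t + ennreal (\<eta> / real N))"
    unfolding total_modulus_def by (intro sum_mono \<epsilon>(2)[OF m me])
  also have "\<dots> = total_modulus r p (cbox a b) f t + of_nat N * ennreal (\<eta> / real N)"
    by (simp add: sum.distrib total_modulus_def N_def)
  also have "of_nat N * ennreal (\<eta> / real N) = ennreal \<eta>"
    using N \<eta>N by (simp add: ennreal_of_nat_eq_real_of_nat ennreal_mult[symmetric])
  finally have *: "total_modulus r p (cbox a b) f (te m) \<le> total_modulus r p (cbox a b) f t + ennreal \<eta>" .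
  show thesis
  proof (rule that[OF _ _ *])
    show "0 < te m $ i" for i using m t[of i] by (auto simp: te_def less_le)
    show "t $ i \<le> te m $ i" for i using m by (simp add: te_def)
  qed
qed

theorem theorem1p2:
  fixes p :: ennreal and r :: "nat^'d::finite"
  assumes "1 \<le> p" and "\<forall>i. 1 \<le> r $ i"
  shows "\<exists>C::real. 0 < C \<and>
    (\<forall>(a::real^'d) (b::real^'d) (f::real^'d \<Rightarrow> real) (t::real^'d).
      (\<forall>i. a $ i < b $ i) \<longrightarrow> f \<in> Lp_space p (cbox a b) \<longrightarrow> (\<forall>i. 0 \<le> t $ i) \<longrightarrow>
        ennreal (inverse (\<Sum>e\<in>UNIV. \<Prod>i\<in>e. 2 ^ (r $ i))) * total_modulus r p (cbox a b) f t
          \<le> K_functional r p (cbox a b) f (vec_pow t r) \<and>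
        (p < \<infinity> \<or> (\<forall>i. 0 < t $ i) \<longrightarrow>
          K_functional r p (cbox a b) f (vec_pow t r)
            \<le> ennreal C * total_modulus r p (cbox a b) f t))"
proof -
  have r: "\<And>i. 1 \<le> r $ i" using assms(2) by simp
  obtain D where D: "0 < D" and pos: "\<And>p (a :: real^'d) b f (t :: real^'d). 1 \<le> p \<Longrightarrow> (\<And>i. a $ i < b $ i) \<Longrightarrow> f \<in> Lp_space p (cbox a b) \<Longrightarrow>
    (\<And>i. 0 < t $ i) \<Longrightarrow> K_functional r p (cbox a b) f (vec_pow t r) \<le> ennreal D * total_modulus r p (cbox a b) f t"
    using K_functional_le_total_modulus_pos[OF r] by blast
  have upper: "K_functional r p (cbox a b) f (vec_pow t r) \<le> ennreal D * total_modulus r p (cbox a b) f t"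
    if p: "p \<noteq> \<infinity>" and ab: "\<And>i. a $ i < b $ i" and f: "f \<in> Lp_space p (cbox a b)" and t: "\<And>i. 0 \<le> t $ i"
    for a b t :: "real^'d" and f
  proof (rule ennreal_le_epsilon)
    \<comment> \<open>The K-functional does not decrease when \<open>t\<close> is enlarged to the positive vector \<open>s\<close>.\<close>
    fix \<eta> :: real assume \<eta>: "0 < \<eta>"
    then have \<eta>D: "0 < \<eta> / D" using D by simp
    obtain s where s: "\<And>i. 0 < s $ i" "\<And>i. t $ i \<le> s $ i"
      "total_modulus r p (cbox a b) f s \<le> total_modulus r p (cbox a b) f t + ennreal (\<eta> / D)"
      using total_modulus_perturb[OF assms(1) p r f t \<eta>D] by blast
    have "K_functional r p (cbox a b) f (vec_pow t r) \<le> K_functional r p (cbox a b) f (vec_pow s r)"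
      using t s(2) by (intro K_functional_mono) (auto simp: vec_pow_def intro: power_mono)
    also have "\<dots> \<le> ennreal D * total_modulus r p (cbox a b) f s" by (rule pos[OF assms(1) ab f s(1)])
    also have "\<dots> \<le> ennreal D * (total_modulus r p (cbox a b) f t + ennreal (\<eta> / D))" by (rule mult_left_mono[OF s(3)]) simp
    also have "\<dots> = ennreal D * total_modulus r p (cbox a b) f t + ennreal D * ennreal (\<eta> / D)" by (rule distrib_left)
    also have "ennreal D * ennreal (\<eta> / D) = ennreal \<eta>" using D \<eta> by (subst ennreal_mult[symmetric]) auto
    finally show "K_functional r p (cbox a b) f (vec_pow t r) \<le> ennreal D * total_modulus r p (cbox a b) f t + ennreal \<eta>" .
  qed
  show ?thesis
  proof (intro exI[of _ D] conjI D allI impI)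
    fix a b t :: "real^'d" and f
    assume ab: "\<forall>i. a $ i < b $ i" and f: "f \<in> Lp_space p (cbox a b)" and t: "\<forall>i. 0 \<le> t $ i"
    show "ennreal (inverse (\<Sum>e\<in>UNIV. \<Prod>i\<in>e. 2 ^ (r $ i))) * total_modulus r p (cbox a b) f t
          \<le> K_functional r p (cbox a b) f (vec_pow t r)"
      by (rule total_modulus_le_K_functional[OF assms(1) f t])
    assume "p < \<infinity> \<or> (\<forall>i. 0 < t $ i)"
    then show "K_functional r p (cbox a b) f (vec_pow t r) \<le> ennreal D * total_modulus r p (cbox a b) f t"
      using upper[OF _ _ f] pos[OF assms(1) _ f] ab t by auto
  qed
qed

end
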